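(* Let $\mathcal{M}$ be a $\sigma$-finite, semifinite infinite factor, let $A,B\in\mathcal{M}^+$, and let $B\ne0$. Each of the following conditions is sufficient for the existence of $C_j\in\mathcal{M}^+$ with $C_j\sim B$ and $N_{C_j}$ infinite for all $j$ such that $A=\sum_{j=1}^\infty C_j$: (i) $\tau((A-\|B\|I)_+)=\infty$; (ii) $\|A\|_e=\|B\|$ and $\chi_{\{\|B\|\}}(B)=0$; (iii) $\|A\|_e=\|B\|$, $\chi_{\{\|B\|\}}(B)\ne0$, $B\ne\|B\|\chi_{\{\|B\|\}}(B)$, and $\chi_{\{\|A\|_e\}}(A)$ is infinite; (iv) $\|A\|_e=\|B\|$, $B=\|B\|\chi_{\{\|B\|\}}(B)$, $A=\|A\|_e\chi_{\{\|A\|_e\}}(A)$, and $\chi_{\{\|A\|_e\}}(A)$ is infinite.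
   Context: $\mathcal{M}$ acts on a Hilbert space; $\mathcal{M}^+$ is its set of positive elements. A semifinite infinite factor is of type I$_\infty$ or II$_\infty$; $\tau$ is its faithful normal semifinite trace (on type I$_\infty$ normalized to be $1$ on rank-one projections), $\mathcal{J}$ is the norm-closed two-sided ideal generated by the finite projections of $\mathcal{M}$, $\pi:\mathcal{M}\to\mathcal{M}/\mathcal{J}$ is the quotient map and $\|A\|_e=\|\pi(A)\|$. For $B,C\in\mathcal{M}^+$, $B\sim C$ means $B=XX^*$ and $C=X^*X$ for some $X\in\mathcal{M}$. $N_C$ is the projection on the null space of $C$. $\chi_S(B)$ is the spectral projection of $B$ for the Borel set $S$, and $X_+$ is the positive part of a selfadjoint $X$. "Infinite" for a projection is meant relative to $\mathcal{M}$ (Murray-von Neumann). Infinite sums of operators converge in the strong operator topology. *)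

theory Defs
  imports "HOL-Analysis.Analysis"
begin

text \<open>Complex Hilbert spaces. The underlying real Hilbert space structure is the canonical one,
  with inner product the real part of the complex inner product, which is linear in its first
  argument.\<close>

class complex_hilbert_space = real_inner + complete_space +
  fixes scaleC :: "complex \<Rightarrow> 'a \<Rightarrow> 'a"
    and cinner :: "'a \<Rightarrow> 'a \<Rightarrow> complex"
  assumes scaleC_add_right: "scaleC c (x + y) = scaleC c x + scaleC c y"
    and scaleC_add_left: "scaleC (c + d) x = scaleC c x + scaleC d x"
    and scaleC_scaleC: "scaleC c (scaleC d x) = scaleC (c * d) x"
    and scaleC_of_real: "scaleC (complex_of_real r) x = scaleR r x"
    and cinner_commute: "cinner x y = cnj (cinner y x)"
    and cinner_add_left: "cinner (x + y) z = cinner x z + cinner y z"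
    and cinner_scaleC_left: "cinner (scaleC c x) y = c * cinner x y"
    and inner_eq_Re_cinner: "inner x y = Re (cinner x y)"

text \<open>Operators are elements of the library type of bounded real-linear maps, which carries the
  operator norm. The algebra of bounded operators of the Hilbert space is the subset of
  complex-linear maps.\<close>

type_synonym 'h operator = "'h \<Rightarrow>\<^sub>L 'h"

definition bounded_ops :: "'h::complex_hilbert_space operator set" where
  "bounded_ops = {A. \<forall>c x. blinfun_apply A (scaleC c x) = scaleC c (blinfun_apply A x)}"

definition adj :: "'h::complex_hilbert_space operator \<Rightarrow> 'h operator" where
  "adj A = (THE B. \<forall>x y. cinner (blinfun_apply A x) y = cinner x (blinfun_apply B y))"

definition positive_op :: "'h::complex_hilbert_space operator \<Rightarrow> bool" where
  "positive_op A \<longleftrightarrow> A \<in> bounded_ops \<and> (\<forall>x. cinner (blinfun_apply A x) x \<in> \<real>\<^sub>\<ge>\<^sub>0)"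

definition le_op :: "'h::complex_hilbert_space operator \<Rightarrow> 'h operator \<Rightarrow> bool" where
  "le_op A B \<longleftrightarrow> positive_op (B - A)"

definition projection :: "'h::complex_hilbert_space operator \<Rightarrow> bool" where
  "projection P \<longleftrightarrow> P \<in> bounded_ops \<and> P o\<^sub>L P = P \<and> adj P = P"

definition null_proj :: "'h::complex_hilbert_space operator \<Rightarrow> 'h operator" where
  "null_proj C = (THE P. projection P \<and> range (blinfun_apply P) = {x. blinfun_apply C x = 0})"

text \<open>The positive part of a selfadjoint operator, through its unique decomposition as a
  difference of two positive operators with product zero.\<close>

definition pos_part :: "'h::complex_hilbert_space operator \<Rightarrow> 'h operator" where
  "pos_part X = (THE P. \<exists>N. positive_op P \<and> positive_op N \<and> X = P - N \<and> P o\<^sub>L N = 0)"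

text \<open>A projection-valued measure \<open>E\<close> on the Borel sets of the real line, the scalar measure
  \<open>S \<mapsto> \<langle>E(S)x, x\<rangle>\<close>, and the assertion that \<open>B\<close> is the integral of the identity function
  with respect to \<open>E\<close>, read weakly on the diagonal (which determines \<open>B\<close> by polarization).\<close>

definition projection_valued_measure ::
    "(real set \<Rightarrow> 'h::complex_hilbert_space operator) \<Rightarrow> bool" where
  "projection_valued_measure E \<longleftrightarrow>
     (\<forall>S \<in> sets borel. projection (E S)) \<and>
     E UNIV = id_blinfun \<and>
     (\<forall>F :: nat \<Rightarrow> real set. range F \<subseteq> sets borel \<longrightarrow> disjoint_family F \<longrightarrow>
        (\<forall>x. (\<lambda>n. blinfun_apply (E (F n)) x) sums blinfun_apply (E (\<Union>n. F n)) x))"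

definition scalar_spectral_measure ::
    "(real set \<Rightarrow> 'h::complex_hilbert_space operator) \<Rightarrow> 'h \<Rightarrow> real measure" where
  "scalar_spectral_measure E x =
     measure_of UNIV (sets borel) (\<lambda>S. ennreal (Re (cinner (blinfun_apply (E S) x) x)))"

definition spectral_measure_of ::
    "'h::complex_hilbert_space operator \<Rightarrow> (real set \<Rightarrow> 'h operator) \<Rightarrow> bool" where
  "spectral_measure_of B E \<longleftrightarrow> projection_valued_measure E \<and>
     (\<forall>x. integrable (scalar_spectral_measure E x) (\<lambda>t. t) \<and>
          cinner (blinfun_apply B x) x =
            complex_of_real (integral\<^sup>L (scalar_spectral_measure E x) (\<lambda>t. t)))"

text \<open>The spectral projection of the selfadjoint operator \<open>B\<close> for the Borel set \<open>S\<close>. The spectral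
  measure is unique on Borel sets only, hence the description of its value rather than of \<open>E\<close>.\<close>

definition spectral_proj :: "real set \<Rightarrow> 'h::complex_hilbert_space operator \<Rightarrow> 'h operator" where
  "spectral_proj S B = (THE P. \<exists>E. spectral_measure_of B E \<and> P = E S)"

definition commutant :: "'h::complex_hilbert_space operator set \<Rightarrow> 'h operator set" where
  "commutant S = {T \<in> bounded_ops. \<forall>A \<in> S. T o\<^sub>L A = A o\<^sub>L T}"

definition von_neumann_algebra :: "'h::complex_hilbert_space operator set \<Rightarrow> bool" where
  "von_neumann_algebra M \<longleftrightarrow>
     M \<subseteq> bounded_ops \<and> (\<forall>A \<in> M. adj A \<in> M) \<and> commutant (commutant M) = M"

definition factor :: "'h::complex_hilbert_space operator set \<Rightarrow> bool" where
  "factor M \<longleftrightarrow> von_neumann_algebra M \<and>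
     (\<forall>Z \<in> M \<inter> commutant M. \<exists>c. \<forall>x. blinfun_apply Z x = scaleC c x)"

definition positives :: "'h::complex_hilbert_space operator set \<Rightarrow> 'h operator set" where
  "positives M = {A \<in> M. positive_op A}"

definition projections :: "'h::complex_hilbert_space operator set \<Rightarrow> 'h operator set" where
  "projections M = {P \<in> M. projection P}"

text \<open>On projections this relation is Murray--von Neumann equivalence.\<close>

definition equiv_op ::
    "'h::complex_hilbert_space operator set \<Rightarrow> 'h operator \<Rightarrow> 'h operator \<Rightarrow> bool" where
  "equiv_op M B C \<longleftrightarrow> (\<exists>X \<in> M. B = X o\<^sub>L adj X \<and> C = adj X o\<^sub>L X)"

definition finite_projection ::
    "'h::complex_hilbert_space operator set \<Rightarrow> 'h operator \<Rightarrow> bool" where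
  "finite_projection M P \<longleftrightarrow> P \<in> projections M \<and>
     (\<forall>Q \<in> projections M. le_op Q P \<and> equiv_op M P Q \<longrightarrow> Q = P)"

definition infinite_projection ::
    "'h::complex_hilbert_space operator set \<Rightarrow> 'h operator \<Rightarrow> bool" where
  "infinite_projection M P \<longleftrightarrow> P \<in> projections M \<and> \<not> finite_projection M P"

definition minimal_projection ::
    "'h::complex_hilbert_space operator set \<Rightarrow> 'h operator \<Rightarrow> bool" where
  "minimal_projection M P \<longleftrightarrow> P \<in> projections M \<and> P \<noteq> 0 \<and>
     (\<forall>Q \<in> projections M. le_op Q P \<longrightarrow> Q = 0 \<or> Q = P)"

definition sigma_finite_algebra :: "'h::complex_hilbert_space operator set \<Rightarrow> bool" where
  "sigma_finite_algebra M \<longleftrightarrow>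
     (\<forall>F. F \<subseteq> projections M - {0} \<longrightarrow> pairwise (\<lambda>P Q. P o\<^sub>L Q = 0) F \<longrightarrow> countable F)"

definition semifinite_algebra :: "'h::complex_hilbert_space operator set \<Rightarrow> bool" where
  "semifinite_algebra M \<longleftrightarrow>
     (\<forall>P \<in> projections M. P \<noteq> 0 \<longrightarrow> (\<exists>Q. finite_projection M Q \<and> Q \<noteq> 0 \<and> le_op Q P))"

definition infinite_algebra :: "'h::complex_hilbert_space operator set \<Rightarrow> bool" where
  "infinite_algebra M \<longleftrightarrow> infinite_projection M id_blinfun"

text \<open>Traces are functions on the positive cone; their values elsewhere are irrelevant.\<close>

definition trace_on ::
    "'h::complex_hilbert_space operator set \<Rightarrow> ('h operator \<Rightarrow> ennreal) \<Rightarrow> bool" where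
  "trace_on M \<tau> \<longleftrightarrow>
     (\<forall>A \<in> positives M. \<forall>B \<in> positives M. \<tau> (A + B) = \<tau> A + \<tau> B) \<and>
     (\<forall>A \<in> positives M. \<forall>r \<ge> 0. \<tau> (r *\<^sub>R A) = ennreal r * \<tau> A) \<and>
     (\<forall>X \<in> M. \<tau> (adj X o\<^sub>L X) = \<tau> (X o\<^sub>L adj X))"

definition faithful_trace ::
    "'h::complex_hilbert_space operator set \<Rightarrow> ('h operator \<Rightarrow> ennreal) \<Rightarrow> bool" where
  "faithful_trace M \<tau> \<longleftrightarrow> (\<forall>A \<in> positives M. \<tau> A = 0 \<longrightarrow> A = 0)"

text \<open>Normality: \<open>\<tau>\<close> preserves suprema of bounded upward directed sets.\<close>

definition normal_trace ::
    "'h::complex_hilbert_space operator set \<Rightarrow> ('h operator \<Rightarrow> ennreal) \<Rightarrow> bool" where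
  "normal_trace M \<tau> \<longleftrightarrow>
     (\<forall>D S. D \<noteq> {} \<longrightarrow> D \<subseteq> positives M \<longrightarrow>
        (\<forall>A \<in> D. \<forall>B \<in> D. \<exists>C \<in> D. le_op A C \<and> le_op B C) \<longrightarrow>
        S \<in> positives M \<longrightarrow> (\<forall>A \<in> D. le_op A S) \<longrightarrow>
        (\<forall>T \<in> positives M. (\<forall>A \<in> D. le_op A T) \<longrightarrow> le_op S T) \<longrightarrow>
        \<tau> S = (SUP A\<in>D. \<tau> A))"

definition semifinite_trace ::
    "'h::complex_hilbert_space operator set \<Rightarrow> ('h operator \<Rightarrow> ennreal) \<Rightarrow> bool" where
  "semifinite_trace M \<tau> \<longleftrightarrow>
     (\<forall>A \<in> positives M. A \<noteq> 0 \<longrightarrow> (\<exists>B \<in> positives M. B \<noteq> 0 \<and> le_op B A \<and> \<tau> B < \<infinity>))"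

text \<open>The last clause is the normalization on type I factors, whose minimal projections are the
  rank-one projections under the identification with all bounded operators on a Hilbert space;
  it is void on type II factors.\<close>

definition factor_trace ::
    "'h::complex_hilbert_space operator set \<Rightarrow> ('h operator \<Rightarrow> ennreal) \<Rightarrow> bool" where
  "factor_trace M \<tau> \<longleftrightarrow>
     trace_on M \<tau> \<and> faithful_trace M \<tau> \<and> normal_trace M \<tau> \<and> semifinite_trace M \<tau> \<and>
     (\<forall>P. minimal_projection M P \<longrightarrow> \<tau> P = 1)"

definition two_sided_ideal ::
    "'h::complex_hilbert_space operator set \<Rightarrow> 'h operator set \<Rightarrow> bool" where
  "two_sided_ideal M I \<longleftrightarrow> I \<subseteq> M \<and> 0 \<in> I \<and> (\<forall>K \<in> I. \<forall>L \<in> I. K + L \<in> I) \<and>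
     (\<forall>K \<in> I. \<forall>X \<in> M. X o\<^sub>L K \<in> I \<and> K o\<^sub>L X \<in> I)"

definition finite_ideal :: "'h::complex_hilbert_space operator set \<Rightarrow> 'h operator set" where
  "finite_ideal M = (\<lambda>I. two_sided_ideal M I \<and> closed I) hull {P. finite_projection M P}"

text \<open>The quotient map sends an operator to its coset, and the norm of a coset is the quotient
  norm.\<close>

definition quotient_map ::
    "'h::complex_hilbert_space operator set \<Rightarrow> 'h operator \<Rightarrow> 'h operator set" where
  "quotient_map M A = {A + K | K. K \<in> finite_ideal M}"

definition quotient_norm :: "'h::complex_hilbert_space operator set \<Rightarrow> real" where
  "quotient_norm U = (INF X\<in>U. norm X)"

definition ess_norm :: "'h::complex_hilbert_space operator set \<Rightarrow> 'h operator \<Rightarrow> real" where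
  "ess_norm M A = quotient_norm (quotient_map M A)"

end

theory Submission
  imports Defs
begin

text \<open>
  Only the real Hilbert space structure matters: \<open>M\<close> is the commutant of a selfadjoint set of operators
  which contains the complex scalars, and adjoints, positivity, positive parts and spectral
  projections can be computed in the underlying real Hilbert space.

  Let \<open>\<parallel>B\<parallel> = 1\<close>, and call \<open>A\<close> a \<open>B\<close>-sum if \<open>A = \<Sum>\<^sub>j X\<^sub>j X\<^sub>j\<^sup>*\<close> with \<open>X\<^sub>j\<^sup>* X\<^sub>j = B\<close>. Writing \<open>B\<close> as a dyadic
  series of projections and mixing partial isometries with the Haar basis of \<open>\<ell>\<^sup>2\<close> shows that infinite
  projections are \<open>B\<close>-sums, so it suffices to write \<open>A\<close> as a sum of infinite projections. If
  \<open>\<tau>((A - 1)\<^sub>+) = \<infinity>\<close>, cut \<open>A\<close> into two commuting halves with the same property. Each half dominates a sum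
  \<open>\<Sum>\<^sub>i (1 + \<lambda>\<^sub>i) v\<^sub>i v\<^sub>i\<^sup>*\<close> of copies of a finite projection \<open>q\<close> with \<open>\<Sum>\<^sub>i \<lambda>\<^sub>i = \<infinity>\<close>, and what remains is
  \<open>\<Sum>\<^sub>k a\<^sub>k P\<^sub>k\<close> with projections \<open>P\<^sub>k\<close> and \<open>0 < a\<^sub>k < 1\<close>. Adding infinitely many copies of \<open>q\<close> from the other half
  makes \<open>P\<^sub>k\<close> infinite, hence a sum of copies of \<open>q\<close>; rotations by suitable angles then move the
  excesses \<open>\<lambda>\<^sub>i\<close> over to the deficient coefficients \<open>a\<^sub>k\<close>.

  The other conditions are reduced to this case by cutting \<open>B\<close> into spectral pieces of norm less
  than \<open>1\<close> and \<open>A\<close> into orthogonal pieces, the \<open>n\<close>-th of which exceeds the norm of the \<open>n\<close>-th piece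
  of \<open>B\<close> on an infinite projection; part of an eigenspace of \<open>A\<close> takes care of the eigenspace of \<open>B\<close>.
  The null projections are infinite since \<open>A\<close> can always be cut into two orthogonal pieces with
  infinite supports to which the same argument applies.
\<close>

section \<open>Adjoints and positivity in real Hilbert spaces\<close>

text \<open>Infinite is handled throughout as infinite trace: finite trace forces Murray-von Neumann
  finiteness, while a projection of infinite trace is filled by countably many copies of one fixed
  projection \<open>q\<close> of finite trace, and shifting these copies shows that it is infinite.
  This treats types I and II at once. Three obstacles shape the proof. A copy of \<open>q\<close> in
  the deficient part must be orthogonal to the copies whose excess it receives; this is why
  \<open>A\<close> is cut in two and each half feeds the other. An eigenspace of infinite
  multiplicity cannot be cut by functions of \<open>A\<close>, so the halving draws on all
  projections of the factor that commute with \<open>A\<close>. Finally, the sums need not converge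
  in norm; they are recorded by their quadratic forms, whose terms are nonnegative and can be
  regrouped freely, and strong convergence is recovered only at the end.\<close>

class hilbert_space = real_inner + complete_space
begin
subclass banach ..
end

subclass (in complex_hilbert_space) hilbert_space ..

abbreviation op_times :: "'a::real_normed_vector operator \<Rightarrow> 'a operator \<Rightarrow> 'a operator" (infixl "\<odot>" 70)
  where "A \<odot> B \<equiv> A o\<^sub>L B"

abbreviation ap :: "('a::real_normed_vector \<Rightarrow>\<^sub>L 'b::real_normed_vector) \<Rightarrow> 'a \<Rightarrow> 'b" where "ap \<equiv> blinfun_apply"

abbreviation qf :: "'a::real_inner operator \<Rightarrow> 'a \<Rightarrow> real" where "qf A x \<equiv> inner (ap A x) x"

abbreviation nsq :: "'a::real_inner operator \<Rightarrow> 'a \<Rightarrow> real" where "nsq A x \<equiv> (norm (ap A x))\<^sup>2"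

abbreviation op_one :: "'a::real_normed_vector operator" ("\<one>") where "\<one> \<equiv> id_blinfun"

lemma op_assoc: "(A \<odot> B) \<odot> C = A \<odot> (B \<odot> C)"
  by (rule blinfun_eqI) simp

lemma op_one_left [simp]: "\<one> \<odot> A = A" and op_one_right [simp]: "A \<odot> \<one> = A"
  by (auto intro: blinfun_eqI)

lemmas op_distrib =
  bounded_bilinear.add_left[OF bounded_bilinear_blinfun_compose]
  bounded_bilinear.add_right[OF bounded_bilinear_blinfun_compose]
  bounded_bilinear.diff_left[OF bounded_bilinear_blinfun_compose]
  bounded_bilinear.diff_right[OF bounded_bilinear_blinfun_compose]
  bounded_bilinear.minus_left[OF bounded_bilinear_blinfun_compose]
  bounded_bilinear.minus_right[OF bounded_bilinear_blinfun_compose]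
lemmas op_scale =
  bounded_bilinear.scaleR_left[OF bounded_bilinear_blinfun_compose]
  bounded_bilinear.scaleR_right[OF bounded_bilinear_blinfun_compose]
lemmas apply_simps = blinfun.add_left blinfun.diff_left blinfun.scaleR_left blinfun.minus_left
  blinfun.add_right blinfun.diff_right blinfun.scaleR_right blinfun.minus_right
lemmas inner_expand = inner_add_left inner_add_right inner_diff_left inner_diff_right

section \<open>Nearest points and the Riesz representation\<close>

lemma eq_of_inner_eq: "(\<And>z. inner x z = inner y z) \<Longrightarrow> x = (y::'a::real_inner)"
  by (metis inner_eq_zero_iff inner_diff_left eq_iff_diff_eq_0)

text \<open>A minimizing sequence is Cauchy: the midpoint of two of its points lies in
  \<open>K\<close>, hence at distance at least \<open>d\<close> from \<open>x\<close>, and the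
  parallelogram identity turns this into \<open>key\<close>.\<close>

lemma nearest_point_exists:
  fixes K :: "'a::hilbert_space set"
  assumes K: "closed K" "convex K" "K \<noteq> {}"
  shows "\<exists>y\<in>K. \<forall>z\<in>K. norm (x - y) \<le> norm (x - z)"
proof -
  define d where "d = infdist x K"
  have dle: "d \<le> norm (x - z)" if "z \<in> K" for z
    using infdist_le[OF that, of x] by (simp add: d_def dist_norm)
  have d0: "d \<ge> 0" by (simp add: d_def infdist_nonneg)
  have "\<exists>z\<in>K. norm (x - z) < d + 1 / Suc n" for n
  proof (rule ccontr)
    assume "\<not> ?thesis"
    then have "\<forall>z\<in>K. d + 1 / Suc n \<le> dist x z" by (auto simp: dist_norm not_less)
    then have "d + 1 / Suc n \<le> infdist x K"
      using K(3) by (auto simp: infdist_def intro: cINF_greatest)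
    then show False by (simp add: d_def)
  qed
  then obtain f where f: "\<And>n. f n \<in> K" "\<And>n. norm (x - f n) < d + 1 / Suc n" by metis
  have key: "(norm (f m - f n))\<^sup>2 \<le> 2 * (norm (x - f m))\<^sup>2 + 2 * (norm (x - f n))\<^sup>2 - 4 * d\<^sup>2" for m n
  proof -
    have "(1/2) *\<^sub>R f m + (1/2) *\<^sub>R f n \<in> K"
      using K(2) f(1) by (intro convexD) auto
    from dle[OF this] have "d\<^sup>2 \<le> (norm (x - ((1/2) *\<^sub>R f m + (1/2) *\<^sub>R f n)))\<^sup>2"
      using d0 by (intro power_mono)
    moreover have "2 * (norm (x - f m))\<^sup>2 + 2 * (norm (x - f n))\<^sup>2 =
       4 * (norm (x - ((1/2) *\<^sub>R f m + (1/2) *\<^sub>R f n)))\<^sup>2 + (norm (f m - f n))\<^sup>2"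
      by (simp add: power2_norm_eq_inner inner_expand inner_commute algebra_simps)
    ultimately show ?thesis by linarith
  qed
  have "Cauchy f"
  proof (rule metric_CauchyI)
    fix e :: real assume "e > 0"
    have "(\<lambda>n. (d + 1 / Suc n)\<^sup>2) \<longlonglongrightarrow> (d + 0)\<^sup>2"
      using LIMSEQ_inverse_real_of_nat by (intro tendsto_intros) (simp add: inverse_eq_divide)
    then have "\<forall>\<^sub>F n in sequentially. (d + 1 / Suc n)\<^sup>2 < d\<^sup>2 + e\<^sup>2 / 4"
      using \<open>e > 0\<close> by (intro order_tendstoD(2)) auto
    then obtain N where N: "\<And>n. n \<ge> N \<Longrightarrow> (d + 1 / Suc n)\<^sup>2 < d\<^sup>2 + e\<^sup>2 / 4"
      by (auto simp: eventually_sequentially)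
    have "dist (f m) (f n) < e" if "m \<ge> N" "n \<ge> N" for m n
    proof -
      have "(norm (x - f k))\<^sup>2 < d\<^sup>2 + e\<^sup>2 / 4" if "k \<ge> N" for k
        using N[OF that] f(2)[of k] by (smt (verit) norm_ge_zero power_mono)
      from this[OF \<open>m \<ge> N\<close>] this[OF \<open>n \<ge> N\<close>] key[of m n]
      have "(norm (f m - f n))\<^sup>2 < e\<^sup>2" by linarith
      then show ?thesis using \<open>e > 0\<close> by (simp add: dist_norm power2_less_imp_less)
    qed
    then show "\<exists>N. \<forall>m\<ge>N. \<forall>n\<ge>N. dist (f m) (f n) < e" by blast
  qed
  then obtain y where y: "f \<longlonglongrightarrow> y" using Cauchy_convergent convergent_def by blast
  have "y \<in> K" using K(1) f(1) y closed_sequentially by blast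
  have "(\<lambda>n. norm (x - f n)) \<longlonglongrightarrow> norm (x - y)" by (intro tendsto_intros y)
  moreover have "(\<lambda>n. d + 1 / Suc n) \<longlonglongrightarrow> d + 0"
    using LIMSEQ_inverse_real_of_nat by (intro tendsto_intros) (simp add: inverse_eq_divide)
  ultimately have "norm (x - y) \<le> d + 0"
    by (rule LIMSEQ_le) (use f(2) less_imp_le in blast)
  then show ?thesis using \<open>y \<in> K\<close> dle by (metis add_0_right order_trans)
qed

text \<open>The nearest point works: moving it along \<open>z\<close> cannot shorten the distance,
  and the optimal displacement \<open>t\<close> would shorten it unless the inner product
  vanishes.\<close>

lemma orthogonal_split:
  fixes K :: "'a::hilbert_space set"
  assumes "closed K" "subspace K"
  shows "\<exists>y\<in>K. \<forall>z\<in>K. inner (x - y) z = 0"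
proof -
  obtain y where y: "y \<in> K" "\<And>z. z \<in> K \<Longrightarrow> norm (x - y) \<le> norm (x - z)"
    using nearest_point_exists[of K x] assms subspace_imp_convex subspace_0 by (metis empty_iff)
  have "inner (x - y) z = 0" if "z \<in> K" for z
  proof -
    define t where "t = inner (x - y) z / inner z z"
    show ?thesis
    proof (cases "z = 0")
      case False
      have "y + t *\<^sub>R z \<in> K" using y(1) that assms(2) by (simp add: subspace_add subspace_scale)
      from y(2)[OF this] have "(norm (x - y))\<^sup>2 \<le> (norm (x - (y + t *\<^sub>R z)))\<^sup>2"
        by (intro power_mono) auto
      also have "\<dots> = (norm (x - y))\<^sup>2 - 2 * t * inner (x - y) z + t * t * inner z z"
        by (simp add: power2_norm_eq_inner inner_expand inner_commute algebra_simps)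
      finally have "2 * t * inner (x - y) z \<le> t * t * inner z z" by linarith
      moreover have "t * inner z z = inner (x - y) z" using False by (simp add: t_def)
      ultimately have "t * inner (x - y) z \<le> 0"
        by (metis (no_types, lifting) add_le_same_cancel1 mult.assoc mult_2)
      then have "(inner (x - y) z)\<^sup>2 \<le> 0" 
        using False by (auto simp: t_def power2_eq_square divide_le_0_iff) (metis inner_gt_zero_iff not_le)
      then show ?thesis by simp
    qed simp
  qed
  then show ?thesis using y(1) by blast
qed

text \<open>A vector \<open>u\<close> orthogonal to the kernel with \<open>f u\<close> nonzero
  represents \<open>f\<close> up to a factor, since \<open>f u *\<^sub>R z - f z *\<^sub>R u\<close>
  lies in the kernel.\<close>

lemma riesz_representation:
  fixes f :: "'a::hilbert_space \<Rightarrow> real"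
  assumes "bounded_linear f"
  shows "\<exists>w. \<forall>x. f x = inner x w"
proof -
  interpret f: bounded_linear f by fact
  define K where "K = {x. f x = 0}"
  have K: "closed K" "subspace K"
    unfolding K_def
    by (auto intro!: closed_Collect_eq continuous_intros f.continuous_on simp: subspace_def f.add f.scale f.zero)
  show ?thesis
  proof (cases "\<forall>x. f x = 0")
    case True then show ?thesis by (intro exI[of _ 0]) simp
  next
    case False
    then obtain x where x: "f x \<noteq> 0" by blast
    obtain y where y: "y \<in> K" "\<And>z. z \<in> K \<Longrightarrow> inner (x - y) z = 0"
      using orthogonal_split[OF K] by blast
    define u where "u = x - y"
    have fu: "f u \<noteq> 0" using x y(1) by (simp add: u_def K_def f.diff)
    then have "u \<noteq> 0" using f.zero by auto
    have "f z = inner z ((f u / inner u u) *\<^sub>R u)" for z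
    proof -
      have "f u *\<^sub>R z - f z *\<^sub>R u \<in> K" by (simp add: K_def f.diff f.scale)
      from y(2)[OF this] have "f u * inner u z = f z * inner u u"
        by (simp add: u_def[symmetric] inner_expand)
      then show ?thesis using \<open>u \<noteq> 0\<close> by (simp add: inner_commute field_simps)
    qed
    then show ?thesis by blast
  qed
qed

section \<open>Adjoints for the real inner product\<close>

definition radj :: "'a::hilbert_space operator \<Rightarrow> 'a operator" ("_\<^sup>\<star>" [1000] 999) where
  "radj A = (THE B. \<forall>x y. inner (ap A x) y = inner x (ap B y))"

lemma radj_unique:
  assumes "\<And>x y. inner (ap A x) y = inner x (ap B y)"
  shows "A\<^sup>\<star> = B"
  unfolding radj_def
proof (rule the_equality)
  fix C assume "\<forall>x y. inner (ap A x) y = inner x (ap C y)"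
  then have *: "inner (ap C x) z = inner (ap B x) z" for x z
    using assms by (metis inner_commute)
  show "C = B"
    by (rule blinfun_eqI, rule eq_of_inner_eq) (rule *)
qed (use assms in blast)

lemma inner_radj: "inner (ap A x) y = inner x (ap (A\<^sup>\<star>) y)"
proof -
  have "\<exists>w. \<forall>x. inner (ap A x) y = inner x w" for y
  proof (rule riesz_representation)
    have "bounded_linear (\<lambda>u. inner u y)" by (rule bounded_linear_inner_left)
    moreover have "bounded_linear (ap A)" by (rule blinfun.bounded_linear_right)
    ultimately show "bounded_linear (\<lambda>x. inner (ap A x) y)" by (rule bounded_linear_compose)
  qed
  then obtain g where g: "\<And>x y. inner (ap A x) y = inner x (g y)" by metis
  have g': "inner (g y) x = inner (ap A x) y" for x y by (simp only: g inner_commute[of "g y" x])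
  have "bounded_linear g"
  proof (rule bounded_linear_intro)
    show "g (y + z) = g y + g z" for y z
      by (rule eq_of_inner_eq) (simp add: inner_add_left inner_add_right g')
    show "g (r *\<^sub>R y) = r *\<^sub>R g y" for r y
      by (rule eq_of_inner_eq) (simp add: g')
    show "norm (g y) \<le> norm y * norm A" for y
    proof (cases "g y = 0")
      case False
      have "norm (g y) * norm (g y) = inner (ap A (g y)) y"
        by (simp add: g power2_norm_eq_inner[symmetric] power2_eq_square)
      also have "\<dots> \<le> norm (ap A (g y)) * norm y" by (rule norm_cauchy_schwarz)
      also have "\<dots> \<le> (norm A * norm (g y)) * norm y" by (intro mult_right_mono norm_blinfun) auto
      finally show ?thesis using False by (simp add: mult.commute)
    qed simp
  qed
  then have "ap (Blinfun g) = g" by (rule bounded_linear_Blinfun_apply)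
  then have "A\<^sup>\<star> = Blinfun g" by (intro radj_unique) (simp add: g)
  then show ?thesis using \<open>ap (Blinfun g) = g\<close> g by metis
qed

lemma inner_radj': "inner x (ap A y) = inner (ap (A\<^sup>\<star>) x) y"
  by (metis inner_commute inner_radj)

lemma radj_radj [simp]: "(A\<^sup>\<star>)\<^sup>\<star> = A"
  by (rule radj_unique) (simp add: inner_radj')
lemma radj_comp [simp]: "(A \<odot> B)\<^sup>\<star> = B\<^sup>\<star> \<odot> A\<^sup>\<star>"
  by (rule radj_unique) (simp add: inner_radj)
lemma radj_add [simp]: "(A + B)\<^sup>\<star> = A\<^sup>\<star> + B\<^sup>\<star>"
  by (rule radj_unique) (simp add: inner_radj apply_simps inner_expand)
lemma radj_diff [simp]: "(A - B)\<^sup>\<star> = A\<^sup>\<star> - B\<^sup>\<star>"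
  by (rule radj_unique) (simp add: inner_radj apply_simps inner_expand)
lemma radj_minus [simp]: "(- A)\<^sup>\<star> = - A\<^sup>\<star>"
  by (rule radj_unique) (simp add: inner_radj apply_simps)
lemma radj_scaleR [simp]: "(c *\<^sub>R A)\<^sup>\<star> = c *\<^sub>R A\<^sup>\<star>"
  by (rule radj_unique) (simp add: inner_radj apply_simps)
lemma radj_one [simp]: "\<one>\<^sup>\<star> = \<one>"
  by (rule radj_unique) simp
lemma radj_zero [simp]: "0\<^sup>\<star> = 0"
  by (rule radj_unique) (simp add: blinfun.zero_left)

lemma norm_radj_le: "norm (A\<^sup>\<star>) \<le> norm A"
proof (rule norm_blinfun_bound)
  fix y
  let ?g = "ap (A\<^sup>\<star>)"
  show "norm (?g y) \<le> norm A * norm y"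
  proof (cases "?g y = 0")
    case False
    have "norm (?g y) * norm (?g y) = inner (ap A (?g y)) y"
      by (simp add: inner_radj power2_norm_eq_inner[symmetric] power2_eq_square)
    also have "\<dots> \<le> norm (ap A (?g y)) * norm y" by (rule norm_cauchy_schwarz)
    also have "\<dots> \<le> (norm A * norm (?g y)) * norm y" by (intro mult_right_mono norm_blinfun) auto
    finally show ?thesis using False by (simp add: mult.commute)
  qed simp
qed simp

lemma norm_radj [simp]: "norm (A\<^sup>\<star>) = norm A"
  using norm_radj_le[of A] norm_radj_le[of "A\<^sup>\<star>"] by simp

lemma bounded_linear_radj: "bounded_linear radj"
  by (rule bounded_linear_intro[where K=1]) auto

lemma tendsto_radj: "(f \<longlongrightarrow> a) F \<Longrightarrow> ((\<lambda>x. (f x)\<^sup>\<star>) \<longlongrightarrow> a\<^sup>\<star>) F"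
  by (rule bounded_linear.tendsto[OF bounded_linear_radj])

lemma norm_apply_sq: "nsq A x = qf (A\<^sup>\<star> \<odot> A) x"
  by (simp add: power2_norm_eq_inner inner_radj')

section \<open>Positive operators and projections through quadratic forms\<close>

definition pos :: "'a::hilbert_space operator \<Rightarrow> bool" where
  "pos A \<longleftrightarrow> A\<^sup>\<star> = A \<and> (\<forall>x. 0 \<le> qf A x)"

definition prj :: "'a::hilbert_space operator \<Rightarrow> bool" where
  "prj P \<longleftrightarrow> P\<^sup>\<star> = P \<and> P \<odot> P = P"

lemma pos_sa: "pos A \<Longrightarrow> A\<^sup>\<star> = A" and pos_ge: "pos A \<Longrightarrow> 0 \<le> qf A x"
  by (auto simp: pos_def)

lemma prj_sa: "prj P \<Longrightarrow> P\<^sup>\<star> = P" and prj_idem: "prj P \<Longrightarrow> P \<odot> P = P"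
  by (auto simp: prj_def)

lemma prj_idem_apply: "prj P \<Longrightarrow> ap P (ap P x) = ap P x"
  by (metis prj_idem blinfun_apply_blinfun_compose)

lemma prj_inner: "prj P \<Longrightarrow> qf P x = nsq P x"
  by (simp add: norm_apply_sq prj_def)

lemma prj_pos: "prj P \<Longrightarrow> pos P"
  unfolding pos_def using prj_inner prj_sa by (metis zero_le_power2)

lemma pos_radj_comp [simp]: "pos (A\<^sup>\<star> \<odot> A)"
  unfolding pos_def by (auto simp: norm_apply_sq[symmetric] simp del: blinfun_apply_blinfun_compose)

lemma pos_comp_radj [simp]: "pos (A \<odot> A\<^sup>\<star>)"
  using pos_radj_comp[of "A\<^sup>\<star>"] by simp

lemma pos_add: "pos A \<Longrightarrow> pos B \<Longrightarrow> pos (A + B)"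
  by (auto simp: pos_def apply_simps inner_expand)
lemma pos_scaleR: "pos A \<Longrightarrow> 0 \<le> c \<Longrightarrow> pos (c *\<^sub>R A)"
  by (auto simp: pos_def apply_simps)
lemma pos_zero [simp]: "pos 0" by (simp add: pos_def blinfun.zero_left)
lemma pos_one [simp]: "pos \<one>" by (simp add: pos_def)
lemma prj_zero [simp]: "prj 0" by (simp add: prj_def)
lemma prj_one [simp]: "prj \<one>" by (simp add: prj_def)
lemma prj_compl: "prj P \<Longrightarrow> prj (\<one> - P)"
  by (simp add: prj_def op_distrib)

lemma pos_conj: "pos A \<Longrightarrow> pos (X\<^sup>\<star> \<odot> A \<odot> X)"
  by (simp add: pos_def op_assoc inner_radj[of "X\<^sup>\<star>"])

text \<open>Polarization. Selfadjointness matters because over the reals a skew map has zero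
  quadratic form; for selfadjoint operators the form is a faithful substitute.\<close>

lemma sa_eqI:
  assumes "A\<^sup>\<star> = A" "B\<^sup>\<star> = B"
    and "\<And>x. qf A x = qf B x"
  shows "A = B"
proof (rule blinfun_eqI)
  fix x
  have "inner (ap (A - B) x) y = 0" for y
  proof -
    let ?D = "A - B"
    have D: "?D\<^sup>\<star> = ?D" using assms by simp
    have q: "qf ?D z = 0" for z by (simp add: assms(3) apply_simps inner_expand)
    have s: "inner (ap ?D y) x = inner (ap ?D x) y"
      by (metis D inner_radj inner_commute)
    show ?thesis
      using q[of "x + y"] q[of x] q[of y] s
      by (simp only: blinfun.add_right inner_add_left inner_add_right)
  qed
  then have "ap (A - B) x = 0" by (metis inner_eq_zero_iff)
  then show "ap A x = ap B x" by (simp add: apply_simps)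
qed

text \<open>A quadratic polynomial in \<open>t\<close> that is nowhere negative has nonpositive
  discriminant; if its leading coefficient is zero, the linear one must vanish too.\<close>

lemma pos_cauchy_schwarz:
  assumes "pos A"
  shows "(inner (ap A x) y)\<^sup>2 \<le> qf A x * qf A y"
proof -
  let ?a = "qf A x" and ?b = "inner (ap A x) y"
    and ?c = "qf A y"
  have s: "inner (ap A y) x = ?b" by (metis assms pos_sa inner_radj inner_commute)
  have q: "0 \<le> ?c * t\<^sup>2 + 2 * ?b * t + ?a" for t
  proof -
    have "0 \<le> qf A (x + t *\<^sub>R y)" using assms by (rule pos_ge)
    also have "\<dots> = ?c * t\<^sup>2 + 2 * ?b * t + ?a"
      by (simp add: apply_simps inner_expand s power2_eq_square algebra_simps)
    finally show ?thesis .
  qed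
  show ?thesis
  proof (cases "?c = 0")
    case True
    have "?b = 0"
    proof (rule ccontr)
      assume "?b \<noteq> 0"
      then show False using q[of "- (?a + 1) / (2 * ?b)"] True by simp
    qed
    then show ?thesis using True by simp
  next
    case False
    then have c: "?c > 0" using pos_ge[OF assms, of y] by linarith
    have "?c * (- ?b / ?c)\<^sup>2 + 2 * ?b * (- ?b / ?c) + ?a = ?a - ?b\<^sup>2 / ?c"
      using c by (simp add: power2_eq_square field_simps)
    with q[of "- ?b / ?c"] have "?b\<^sup>2 / ?c \<le> ?a" by linarith
    then show ?thesis using c by (simp add: field_simps)
  qed
qed

lemma inner_le_norm_op: "qf A x \<le> norm A * (norm x)\<^sup>2"
proof -
  have "qf A x \<le> norm (ap A x) * norm x" by (rule norm_cauchy_schwarz)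
  also have "\<dots> \<le> (norm A * norm x) * norm x" by (intro mult_right_mono norm_blinfun) auto
  finally show ?thesis by (simp add: power2_eq_square)
qed

text \<open>Cauchy-Schwarz for the form of \<open>A\<close> with \<open>y = A x\<close>. This is how
  smallness of a form becomes smallness in norm, up to the strong convergence of the final
  series.\<close>

lemma pos_apply_norm_le:
  assumes "pos A" "\<And>x. qf A x \<le> c * (norm x)\<^sup>2"
  shows "nsq A x \<le> c * qf A x"
proof (cases "ap A x = 0")
  case False
  let ?n = "nsq A x"
  have "?n\<^sup>2 = (inner (ap A x) (ap A x))\<^sup>2" by (simp add: power2_norm_eq_inner)
  also have "\<dots> \<le> qf A x * qf A (ap A x)"
    by (rule pos_cauchy_schwarz[OF assms(1)])
  also have "\<dots> \<le> qf A x * (c * ?n)"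
    by (intro mult_left_mono assms(2) pos_ge[OF assms(1)])
  finally have "?n * ?n \<le> (c * qf A x) * ?n" by (simp add: power2_eq_square mult_ac)
  moreover have "?n > 0" using False by simp
  ultimately show ?thesis by (rule mult_right_le_imp_le)
qed (simp)

lemma pos_norm_bound:
  assumes "pos A" "0 \<le> c" "\<And>x. qf A x \<le> c * (norm x)\<^sup>2"
  shows "norm A \<le> c"
proof (rule norm_blinfun_bound[OF assms(2)])
  fix x
  have "nsq A x \<le> c * (c * (norm x)\<^sup>2)"
    by (rule order_trans[OF pos_apply_norm_le[OF assms(1,3)] mult_left_mono[OF assms(3,2)]])
  also have "\<dots> = (c * norm x)\<^sup>2" by (simp add: power2_eq_square)
  finally show "norm (ap A x) \<le> c * norm x"
    by (rule power2_le_imp_le) (use assms(2) in simp)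
qed

lemma pos_le_norm: "pos A \<Longrightarrow> pos (norm A *\<^sub>R \<one> - A)"
  by (simp add: pos_def apply_simps inner_expand power2_norm_eq_inner[symmetric] inner_le_norm_op)

lemma pos_inner_zero: "pos A \<Longrightarrow> qf A x = 0 \<Longrightarrow> ap A x = 0"
  using pos_apply_norm_le[of A "norm A" x] inner_le_norm_op[of A] by auto

lemma pos_antisym: "pos A \<Longrightarrow> pos (- A) \<Longrightarrow> A = 0"
  by (rule sa_eqI) (auto simp: pos_def apply_simps blinfun.zero_left intro: antisym)

section \<open>Kernel projections, square roots and positive parts\<close>

definition proj_on :: "'a::hilbert_space set \<Rightarrow> 'a operator" where
  "proj_on K = (SOME P. prj P \<and> (\<forall>x. P x \<in> K) \<and> (\<forall>x\<in>K. P x = x))"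

lemma proj_on_ex:
  assumes "closed K" "subspace K"
  shows "\<exists>P :: 'a::hilbert_space operator. prj P \<and> (\<forall>x. P x \<in> K) \<and> (\<forall>x\<in>K. P x = x)"
proof -
  obtain g where g: "\<And>x. g x \<in> K" "\<And>x z. z \<in> K \<Longrightarrow> inner (x - g x) z = 0"
    using orthogonal_split[OF assms] by metis
  have uniq: "y = g x" if "y \<in> K" "\<And>z. z \<in> K \<Longrightarrow> inner (x - y) z = 0" for x y
  proof -
    have "y - g x \<in> K" using that g assms(2) by (simp add: subspace_diff)
    then have "inner (x - g x) (y - g x) - inner (x - y) (y - g x) = 0" using that g by simp
    then have "inner (y - g x) (y - g x) = 0" by (simp add: inner_expand)
    then show ?thesis by simp
  qed
  have nb: "norm (g x) \<le> norm x * 1" for x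
  proof -
    have "inner (g x) (g x) = inner x (g x)" using g(2)[OF g(1), of x x] by (simp add: inner_expand)
    then have "norm (g x) * norm (g x) \<le> norm x * norm (g x)"
      by (metis norm_cauchy_schwarz power2_eq_square power2_norm_eq_inner)
    then show ?thesis by (cases "g x = 0") auto
  qed
  have "bounded_linear g"
  proof (rule bounded_linear_intro)
    show "g (x + y) = g x + g y" for x y
    proof (rule uniq[symmetric])
      show "g x + g y \<in> K" using g(1) assms(2) by (simp add: subspace_add)
      show "inner (x + y - (g x + g y)) z = 0" if "z \<in> K" for z
        using g(2)[OF that, of x] g(2)[OF that, of y] by (simp add: inner_expand)
    qed
    show "g (r *\<^sub>R x) = r *\<^sub>R g x" for r x
    proof (rule uniq[symmetric])
      show "r *\<^sub>R g x \<in> K" using g(1) assms(2) by (simp add: subspace_scale)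
      show "inner (r *\<^sub>R x - r *\<^sub>R g x) z = 0" if "z \<in> K" for z
        using g(2)[OF that, of x] by (simp add: inner_expand)
    qed
  qed (rule nb)
  then have G: "ap (Blinfun g) = g" by (rule bounded_linear_Blinfun_apply)
  have fx: "g x = x" if "x \<in> K" for x using uniq[of x x] that by simp
  have ig: "inner (g x) y = inner (g x) (g y)" for x y
    using g(2)[OF g(1), of y x] by (simp add: inner_expand inner_commute)
  have "(Blinfun g)\<^sup>\<star> = Blinfun g"
    by (rule radj_unique) (metis G ig inner_commute)
  moreover have "Blinfun g \<odot> Blinfun g = Blinfun g" by (rule blinfun_eqI) (simp add: G fx g(1))
  ultimately show ?thesis using G fx g(1) by (intro exI[of _ "Blinfun g"]) (auto simp: prj_def)
qed

lemma proj_on: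
  assumes "closed K" "subspace K"
  shows "prj (proj_on K)" "ap (proj_on K) x \<in> K" "x \<in> K \<Longrightarrow> ap (proj_on K) x = x"
  using someI_ex[OF proj_on_ex[OF assms]] by (auto simp: proj_on_def)

text \<open>With \<open>P\<close> the projection, invariance under \<open>S\<close> gives
  \<open>P S P = S P\<close>; invariance under the adjoint gives, after taking adjoints,
  \<open>P S P = P S\<close>.\<close>

lemma proj_on_commute:
  assumes K: "closed K" "subspace K"
    and S: "\<And>x. x \<in> K \<Longrightarrow> ap S x \<in> K" "\<And>x. x \<in> K \<Longrightarrow> ap (S\<^sup>\<star>) x \<in> K"
  shows "S \<odot> proj_on K = proj_on K \<odot> S"
proof -
  let ?P = "proj_on K"
  have sa: "?P\<^sup>\<star> = ?P" using proj_on(1)[OF K] by (rule prj_sa)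
  have inv: "?P \<odot> (T \<odot> ?P) = T \<odot> ?P" if "\<And>x. x \<in> K \<Longrightarrow> ap T x \<in> K" for T
    by (rule blinfun_eqI) (simp add: proj_on[OF K] that)
  have "(?P \<odot> (S\<^sup>\<star> \<odot> ?P))\<^sup>\<star> = (S\<^sup>\<star> \<odot> ?P)\<^sup>\<star>" using inv[OF S(2)] by simp
  then have "?P \<odot> (S \<odot> ?P) = ?P \<odot> S" by (simp add: sa op_assoc)
  then show ?thesis using inv[OF S(1)] by simp
qed

lemma closed_null: "closed {x. ap T x = 0}" and subspace_null: "subspace {x. ap T x = 0}"
  by (auto intro!: closed_Collect_eq continuous_intros simp: subspace_def apply_simps)

definition kerp :: "'a::hilbert_space operator \<Rightarrow> 'a operator" where
  "kerp T = proj_on {x. T x = 0}"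

lemma prj_kerp [simp]: "prj (kerp T)"
  unfolding kerp_def by (rule proj_on(1)[OF closed_null subspace_null])
lemma kerp_null: "ap T (ap (kerp T) x) = 0"
  unfolding kerp_def using proj_on(2)[OF closed_null subspace_null] by blast
lemma comp_kerp [simp]: "T \<odot> kerp T = 0"
  by (rule blinfun_eqI) (simp add: kerp_null)
lemma kerp_fix: "ap T x = 0 \<Longrightarrow> ap (kerp T) x = x"
  unfolding kerp_def by (rule proj_on(3)[OF closed_null subspace_null]) simp
lemma kerp_eq_iff: "ap (kerp T) x = x \<longleftrightarrow> ap T x = 0"
  by (metis kerp_fix kerp_null)
lemma kerp_sa [simp]: "(kerp T)\<^sup>\<star> = kerp T" by (rule prj_sa) simp

lemma kerp_comp: "T \<odot> S = 0 \<Longrightarrow> kerp T \<odot> S = S"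
  by (rule blinfun_eqI) (metis blinfun.zero_left blinfun_apply_blinfun_compose kerp_fix)

lemma kerp_commute:
  assumes "S \<odot> T = T \<odot> S" "S \<odot> T\<^sup>\<star> = T\<^sup>\<star> \<odot> S"
  shows "S \<odot> kerp T = kerp T \<odot> S"
proof -
  have "(S \<odot> T\<^sup>\<star>)\<^sup>\<star> = (T\<^sup>\<star> \<odot> S)\<^sup>\<star>" using assms(2) by simp
  then have *: "T \<odot> S\<^sup>\<star> = S\<^sup>\<star> \<odot> T" by simp
  show ?thesis
    unfolding kerp_def
    by (rule proj_on_commute[OF closed_null subspace_null]; simp)
      (metis assms(1) * blinfun_apply_blinfun_compose blinfun.zero_right)+
qed

lemma kerp_commute_sa: "T\<^sup>\<star> = T \<Longrightarrow> S \<odot> T = T \<odot> S \<Longrightarrow> S \<odot> kerp T = kerp T \<odot> S"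
  by (rule kerp_commute) auto

lemma subspace_closure:
  assumes "subspace (S :: 'a::real_normed_vector set)"
  shows "subspace (closure S)"
proof (rule subspaceI)
  show "0 \<in> closure S" using assms closure_subset subspace_0 by blast
next
  fix x y assume "x \<in> closure S" "y \<in> closure S"
  then obtain f g where f: "\<And>n. f n \<in> S" "f \<longlonglongrightarrow> x" and g: "\<And>n. g n \<in> S" "g \<longlonglongrightarrow> y"
    by (auto simp: closure_sequential)
  have "(\<lambda>n. f n + g n) \<longlonglongrightarrow> x + y" by (rule tendsto_add[OF f(2) g(2)])
  then show "x + y \<in> closure S"
    unfolding closure_sequential using subspace_add[OF assms f(1) g(1)] by (intro exI[of _ "\<lambda>n. f n + g n"]) auto
next
  fix c x assume "x \<in> closure S"
  then obtain f where f: "\<And>n. f n \<in> S" "f \<longlonglongrightarrow> x" by (auto simp: closure_sequential)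
  have "(\<lambda>n. c *\<^sub>R f n) \<longlonglongrightarrow> c *\<^sub>R x" by (intro tendsto_scaleR tendsto_const f(2))
  then show "c *\<^sub>R x \<in> closure S"
    unfolding closure_sequential using subspace_scale[OF assms f(1)] by (intro exI[of _ "\<lambda>n. c *\<^sub>R f n"]) auto
qed

lemma subspace_closure_range: "subspace (closure (range (ap T)))"
  by (intro subspace_closure linear_subspace_image subspace_UNIV blinfun.bounded_linear_right bounded_linear.linear)

text \<open>The component of \<open>x\<close> orthogonal to the range of the adjoint lies in the
  kernel of \<open>T\<close>, to which \<open>x\<close> is orthogonal.\<close>

lemma in_closure_range:
  assumes "ap (kerp T) x = 0"
  shows "x \<in> closure (range (ap (T\<^sup>\<star>)))"
proof -
  let ?K = "closure (range (ap (T\<^sup>\<star>)))"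
  obtain y where y: "y \<in> ?K" "\<And>z. z \<in> ?K \<Longrightarrow> inner (x - y) z = 0"
    using orthogonal_split[of ?K x] subspace_closure_range by auto
  have "inner (ap T (x - y)) z = 0" for z
    using y(2)[of "ap (T\<^sup>\<star>) z"] closure_subset[of "range (ap (T\<^sup>\<star>))"]
    by (auto simp: inner_radj)
  then have T: "ap T (x - y) = 0" by (metis inner_eq_zero_iff)
  have "?K \<subseteq> {z. inner (x - y) z = 0}"
    by (rule closure_minimal) (auto intro!: closed_Collect_eq continuous_intros simp: inner_radj[symmetric] T)
  then have "inner (x - y) y = 0" using y(1) by blast
  moreover have "inner (x - y) x = inner (ap (kerp T) (x - y)) x" by (simp add: kerp_fix[OF T])
  then have "inner (x - y) x = 0" using assms by (simp add: inner_radj)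
  ultimately have "inner (x - y) (x - y) = 0" by (simp add: inner_expand)
  then show ?thesis using y(1) by simp
qed

lemma nonneg_on_closure_range:
  assumes "\<And>z. 0 \<le> qf A (ap T z)"
    "y \<in> closure (range (ap T))"
  shows "0 \<le> qf A y"
proof -
  have "closure (range (ap T)) \<subseteq> {y. 0 \<le> qf A y}"
    by (rule closure_minimal) (auto intro!: closed_Collect_le continuous_intros assms(1))
  then show ?thesis using assms(2) by blast
qed

section \<open>Square roots by iterating \<open>Y = (T + Y^2) / 2\<close>, whose fixed points
  satisfy \<open>(1 - Y)^2 = 1 - T\<close>\<close>

primrec sqrt_iter :: "'a::hilbert_space operator \<Rightarrow> nat \<Rightarrow> 'a operator" where
  "sqrt_iter T 0 = 0"
| "sqrt_iter T (Suc n) = (1/2) *\<^sub>R (T + sqrt_iter T n \<odot> sqrt_iter T n)"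

text \<open>The same iteration for the number \<open>1\<close>. It majorizes the norms and the
  increments of \<open>sqrt_iter\<close> and so gives convergence even for
  \<open>norm T = 1\<close>, where the iteration is no strict contraction on the unit ball.\<close>

primrec sqrt_bound :: "nat \<Rightarrow> real" where
  "sqrt_bound 0 = 0"
| "sqrt_bound (Suc n) = (1 + sqrt_bound n * sqrt_bound n) / 2"

lemma sqrt_bound: "0 \<le> sqrt_bound n" "sqrt_bound n \<le> 1" "sqrt_bound n \<le> sqrt_bound (Suc n)"
proof -
  show *: "0 \<le> sqrt_bound n" for n by (induction n) auto
  show "sqrt_bound n \<le> 1"
    by (induction n) (auto simp: mult_le_one *)
  show "sqrt_bound n \<le> sqrt_bound (Suc n)"
    using sum_squares_ge_zero[of "sqrt_bound n - 1" 0] by (simp add: algebra_simps)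
qed

lemma sqrt_iter_limit:
  assumes "norm (T :: 'a::hilbert_space operator) \<le> 1"
  shows "\<exists>Y. sqrt_iter T \<longlonglongrightarrow> Y \<and> norm Y \<le> 1 \<and> 2 *\<^sub>R Y = T + Y \<odot> Y"
proof -
  let ?Y = "sqrt_iter T" and ?b = sqrt_bound
  have nb: "norm (?Y n) \<le> ?b n" for n
  proof (induction n)
    case (Suc n)
    have "norm (T + ?Y n \<odot> ?Y n) \<le> norm T + norm (?Y n) * norm (?Y n)"
      by (meson norm_blinfun_compose norm_triangle_ineq order_trans add_left_mono)
    also have "\<dots> \<le> 1 + ?b n * ?b n" using Suc assms by (intro add_mono mult_mono) (auto simp: sqrt_bound)
    finally show ?case by simp
  qed simp
  have step: "norm (?Y (Suc n) - ?Y n) \<le> ?b (Suc n) - ?b n" for n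
  proof (induction n)
    case 0 show ?case using assms by simp
  next
    case (Suc n)
    \<comment> \<open>A difference of two squares, expanded without commutativity.\<close>
    have "?Y (Suc (Suc n)) - ?Y (Suc n) =
       (1/2) *\<^sub>R ((?Y (Suc n) - ?Y n) \<odot> ?Y (Suc n) + ?Y n \<odot> (?Y (Suc n) - ?Y n))"
      by (simp only: sqrt_iter.simps(2)[of T "Suc n"] sqrt_iter.simps(2)[of T n]) 
        (simp only: op_distrib op_scale scaleR_diff_right[symmetric] algebra_simps)
    also have "norm \<dots> \<le> (1/2) * (norm (?Y (Suc n) - ?Y n) * norm (?Y (Suc n)) + norm (?Y n) * norm (?Y (Suc n) - ?Y n))"
      unfolding norm_scaleR
      by (intro mult_mono order_trans[OF norm_triangle_ineq] add_mono norm_blinfun_compose) auto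
    also have "\<dots> \<le> (1/2) * ((?b (Suc n) - ?b n) * ?b (Suc n) + ?b n * (?b (Suc n) - ?b n))"
      using Suc nb[of "Suc n"] nb[of n]
      by (intro mult_left_mono add_mono mult_mono) (auto simp: sqrt_bound simp del: sqrt_bound.simps sqrt_iter.simps)
    also have "\<dots> = ?b (Suc (Suc n)) - ?b (Suc n)"
      by (simp only: sqrt_bound.simps(2)[of "Suc n"] sqrt_bound.simps(2)[of n]) (simp add: algebra_simps)
    finally show ?case .
  qed
  have far: "norm (?Y (n + k) - ?Y n) \<le> ?b (n + k) - ?b n" for n k
  proof (induction k)
    case (Suc k)
    have "norm (?Y (n + Suc k) - ?Y n) \<le> norm (?Y (Suc (n + k)) - ?Y (n + k)) + norm (?Y (n + k) - ?Y n)"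
      using norm_triangle_ineq[of "?Y (Suc (n + k)) - ?Y (n + k)" "?Y (n + k) - ?Y n"]
      by (simp del: sqrt_iter.simps)
    then show ?case using Suc step[of "n + k"] by (simp del: sqrt_bound.simps sqrt_iter.simps)
  qed simp
  have inc: "incseq ?b" by (rule incseq_SucI) (rule sqrt_bound(3))
  have "convergent ?b"
    by (rule Bseq_mono_convergent[OF BseqI'[where K=1]]) 
      (use sqrt_bound inc in \<open>auto simp: incseq_def simp del: sqrt_bound.simps\<close>)
  then have cb: "Cauchy ?b" by (rule convergent_Cauchy)
  have "Cauchy ?Y"
  proof (rule CauchyI)
    fix e :: real assume "e > 0"
    then obtain N where N: "\<And>m n. m \<ge> N \<Longrightarrow> n \<ge> N \<Longrightarrow> norm (?b m - ?b n) < e"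
      using cb CauchyD by blast
    have *: "norm (?Y m - ?Y n) < e" if "m \<ge> n" "n \<ge> N" for m n
      using far[of n "m - n"] N[of m n] that by auto
    have "norm (?Y m - ?Y n) < e" if "m \<ge> N" "n \<ge> N" for m n
      using *[of n m] *[of m n] that by (cases "n \<le> m") (auto simp: norm_minus_commute)
    then show "\<exists>N. \<forall>m\<ge>N. \<forall>n\<ge>N. norm (?Y m - ?Y n) < e" by blast
  qed
  then obtain Y where Y: "?Y \<longlonglongrightarrow> Y" using Cauchy_convergent convergent_def by blast
  have "norm Y \<le> 1"
    by (rule Lim_bounded[OF tendsto_norm[OF Y], of 0]) (use nb sqrt_bound(2) order_trans in blast)
  moreover have "(\<lambda>n. ?Y (Suc n)) \<longlonglongrightarrow> (1/2) *\<^sub>R (T + Y \<odot> Y)"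
    unfolding sqrt_iter.simps
    by (intro tendsto_intros bounded_bilinear.tendsto[OF bounded_bilinear_blinfun_compose] Y)
  then have "Y = (1/2) *\<^sub>R (T + Y \<odot> Y)" using Y LIMSEQ_Suc LIMSEQ_unique by blast
  then have "2 *\<^sub>R Y = 2 *\<^sub>R ((1/2) *\<^sub>R (T + Y \<odot> Y))" by simp
  ultimately show ?thesis using Y by (intro exI[of _ Y]) simp
qed

lemma tendsto_commute:
  assumes "f \<longlonglongrightarrow> Y" "\<And>n. S \<odot> f n = f n \<odot> S"
  shows "S \<odot> Y = Y \<odot> (S :: 'a::hilbert_space operator)"
proof -
  have "(\<lambda>n. S \<odot> f n) \<longlonglongrightarrow> S \<odot> Y" "(\<lambda>n. f n \<odot> S) \<longlonglongrightarrow> Y \<odot> S"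
    by (intro tendsto_intros bounded_bilinear.tendsto[OF bounded_bilinear_blinfun_compose] assms(1))+
  then show ?thesis using assms(2) LIMSEQ_unique by simp
qed

text \<open>Divided by its norm \<open>c\<close>, the operator becomes \<open>1 - T\<close> with
  \<open>norm T \<le> 1\<close>, so the root is a multiple of \<open>1 - Y\<close>. Commutation with
  \<open>A\<close> passes to every iterate and then to the limit.\<close>

lemma op_sqrt_ex:
  assumes "pos (A :: 'a::hilbert_space operator)"
  shows "\<exists>S. pos S \<and> S \<odot> S = A \<and> (\<forall>U. U \<odot> A = A \<odot> U \<longrightarrow> U \<odot> S = S \<odot> U)"
proof (cases "norm A = 0")
  case True then show ?thesis by (intro exI[of _ 0]) auto
next
  case False
  define c where "c = norm A"
  have c: "c > 0" using False by (simp add: c_def)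
  define T where "T = \<one> - (1/c) *\<^sub>R A"
  have T: "T = (1/c) *\<^sub>R (c *\<^sub>R \<one> - A)" using c by (simp add: T_def scaleR_diff_right)
  have "pos T" unfolding T using pos_le_norm[OF assms] c by (auto simp: c_def intro!: pos_scaleR)
  moreover have "qf T x \<le> 1 * (norm x)\<^sup>2" for x
    using pos_ge[OF assms, of x] c by (simp add: T_def apply_simps inner_expand power2_norm_eq_inner)
  ultimately have "norm T \<le> 1" by (intro pos_norm_bound) auto
  then obtain Y where Y: "sqrt_iter T \<longlonglongrightarrow> Y" "norm Y \<le> 1" "2 *\<^sub>R Y = T + Y \<odot> Y"
    using sqrt_iter_limit by blast
  have it: "(sqrt_iter T n)\<^sup>\<star> = sqrt_iter T n" for n
    by (induction n) (auto simp: pos_sa[OF \<open>pos T\<close>])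
  have Ysa: "Y\<^sup>\<star> = Y" using LIMSEQ_unique[OF tendsto_radj[OF Y(1)]] Y(1) it by simp
  have "qf Y x \<le> (norm x)\<^sup>2" for x
    by (rule order_trans[OF inner_le_norm_op]) (use Y(2) in \<open>simp add: mult_left_le_one_le\<close>)
  then have pY: "pos (\<one> - Y)" by (simp add: pos_def Ysa apply_simps inner_expand power2_norm_eq_inner)
  have sq: "(\<one> - Y) \<odot> (\<one> - Y) = (1/c) *\<^sub>R A"
  proof -
    have "(\<one> - Y) \<odot> (\<one> - Y) = \<one> - 2 *\<^sub>R Y + Y \<odot> Y" by (simp add: op_distrib scaleR_2)
    also have "\<dots> = (1/c) *\<^sub>R A" unfolding Y(3) by (simp add: T_def)
    finally show ?thesis .
  qed
  have com: "U \<odot> Y = Y \<odot> U" if "U \<odot> A = A \<odot> U" for U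
  proof (rule tendsto_commute[OF Y(1)])
    have TU: "U \<odot> T = T \<odot> U" using that by (simp add: T_def op_distrib op_scale)
    fix n show "U \<odot> sqrt_iter T n = sqrt_iter T n \<odot> U"
      by (induction n) (simp_all add: op_distrib op_scale TU, metis op_assoc)
  qed
  show ?thesis
  proof (intro exI[of _ "sqrt c *\<^sub>R (\<one> - Y)"] conjI allI impI)
    show "pos (sqrt c *\<^sub>R (\<one> - Y))" using pY c by (intro pos_scaleR) auto
    show "sqrt c *\<^sub>R (\<one> - Y) \<odot> (sqrt c *\<^sub>R (\<one> - Y)) = A"
      using c by (simp add: op_scale sq)
    fix U assume "U \<odot> A = A \<odot> U"
    from com[OF this] show "U \<odot> (sqrt c *\<^sub>R (\<one> - Y)) = sqrt c *\<^sub>R (\<one> - Y) \<odot> U"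
      by (simp add: op_scale op_distrib)
  qed
qed

definition op_sqrt :: "'a::hilbert_space operator \<Rightarrow> 'a operator" where
  "op_sqrt A = (SOME S. pos S \<and> S \<odot> S = A \<and> (\<forall>U. U \<odot> A = A \<odot> U \<longrightarrow> U \<odot> S = S \<odot> U))"

lemma op_sqrt:
  assumes "pos A"
  shows "pos (op_sqrt A)" "op_sqrt A \<odot> op_sqrt A = A"
    "U \<odot> A = A \<odot> U \<Longrightarrow> U \<odot> op_sqrt A = op_sqrt A \<odot> U"
  using someI_ex[OF op_sqrt_ex[OF assms]] by (auto simp: op_sqrt_def)

text \<open>The square root of \<open>A\<close> also commutes with \<open>B\<close>, so
  \<open>A B\<close> is a conjugate of \<open>B\<close> by it.\<close>

lemma pos_comp_commute:
  assumes "pos A" "pos B" "A \<odot> B = B \<odot> A"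
  shows "pos (A \<odot> B)"
proof -
  let ?S = "op_sqrt A"
  have "A \<odot> B = ?S\<^sup>\<star> \<odot> B \<odot> ?S"
    using op_sqrt[OF assms(1)] assms(3) by (metis op_assoc pos_sa)
  then show ?thesis using pos_conj[OF assms(2)] by simp
qed

lemma pos_conj_sa: "pos A \<Longrightarrow> D\<^sup>\<star> = D \<Longrightarrow> pos (D \<odot> (A \<odot> D))"
  by (metis pos_conj op_assoc)

text \<open>The root \<open>R\<close> commutes with \<open>S\<close>, so \<open>D = R - S\<close>
  satisfies \<open>D R D + D S D = 0\<close>. Both terms are positive, hence zero, hence
  \<open>D^3 = 0\<close> and \<open>D = 0\<close>.\<close>

lemma op_sqrt_unique:
  assumes "pos S"
  shows "op_sqrt (S \<odot> S) = S"
proof -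
  let ?A = "S \<odot> S"
  let ?R = "op_sqrt ?A"
  have A: "pos ?A" using pos_radj_comp[of S] pos_sa[OF assms] by simp
  note R = op_sqrt[OF A]
  have com: "S \<odot> ?R = ?R \<odot> S" using R(3)[of S] by (simp add: op_assoc)
  define D where "D = ?R - S"
  have D: "D\<^sup>\<star> = D" by (simp add: D_def pos_sa[OF R(1)] pos_sa[OF assms])
  have dc: "D \<odot> S = S \<odot> D" "D \<odot> ?R = ?R \<odot> D" by (simp_all add: D_def op_distrib com)
  have "D \<odot> (?R + S) = 0" by (simp add: D_def op_distrib com R(2))
  then have "D \<odot> (?R \<odot> D) + D \<odot> (S \<odot> D) = 0"
    by (metis op_assoc op_distrib(1,2) dc blinfun_compose_zero(1))
  moreover have p: "pos (D \<odot> (?R \<odot> D))" "pos (D \<odot> (S \<odot> D))" using R(1) assms D by (auto intro: pos_conj_sa)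
  ultimately have e: "D \<odot> (?R \<odot> D) = - (D \<odot> (S \<odot> D))" by (simp add: add_eq_0_iff2)
  have z1: "D \<odot> (S \<odot> D) = 0" using pos_antisym[OF p(2)] p(1) e by simp
  have z2: "D \<odot> (?R \<odot> D) = 0" using e z1 by simp
  have "D \<odot> (D \<odot> D) = D \<odot> (?R \<odot> D) - D \<odot> (S \<odot> D)" by (simp add: D_def op_distrib)
  then have z3: "D \<odot> (D \<odot> D) = 0" using z1 z2 by simp
  have sqz: "T = 0" if "T\<^sup>\<star> = T" "T \<odot> T = 0" for T :: "'a operator"
  proof (rule blinfun_eqI)
    fix x show "ap T x = ap 0 x"
      using norm_apply_sq[of T x] that by (metis blinfun.zero_left inner_zero_left norm_eq_zero zero_eq_power2)
  qed
  have "(D \<odot> D) \<odot> (D \<odot> D) = 0" using z3 by (metis op_assoc blinfun_compose_zero(1))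
  then have "D \<odot> D = 0" by (rule sqz[rotated]) (simp add: D)
  then have "D = 0" by (rule sqz[OF D])
  then show ?thesis by (simp add: D_def)
qed

text \<open>\<open>R\<close> is the absolute value of \<open>X\<close>, and the two parts are half
  of \<open>R + X\<close> and half of \<open>R - X\<close>.\<close>

lemma pos_part_ex:
  assumes X: "X\<^sup>\<star> = (X :: 'a::hilbert_space operator)"
  shows "\<exists>P N. pos P \<and> pos N \<and> X = P - N \<and> P \<odot> N = 0 \<and> N \<odot> P = 0 \<and>
    (\<forall>U. U \<odot> X = X \<odot> U \<longrightarrow> U \<odot> P = P \<odot> U \<and> U \<odot> N = N \<odot> U)"
proof -
  have X2: "pos (X \<odot> X)" using pos_radj_comp[of X] X by simp
  define R where "R = op_sqrt (X \<odot> X)"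
  note R = op_sqrt[OF X2, folded R_def]
  have com: "X \<odot> R = R \<odot> X" using R(3)[of X] by (simp add: op_assoc)
  define P where "P = (1/2) *\<^sub>R (R + X)"
  define N where "N = (1/2) *\<^sub>R (R - X)"
  have sa: "P\<^sup>\<star> = P" "N\<^sup>\<star> = N" by (simp_all add: P_def N_def X pos_sa[OF R(1)])
  have PN: "P \<odot> N = 0" "N \<odot> P = 0" by (simp_all add: P_def N_def op_distrib op_scale com R(2) scaleR_diff_right scaleR_add_right)
  have half_double: "(1/2) *\<^sub>R Z + (1/2) *\<^sub>R Z = Z" for Z :: "'a operator" by (simp flip: scaleR_add_left)
  have RPN: "R = P + N" by (simp add: P_def N_def scaleR_diff_right scaleR_add_right half_double)
  have XPN: "X = P - N" by (simp add: P_def N_def scaleR_diff_right scaleR_add_right half_double)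
  \<comment> \<open>\<open>A R A = A^3\<close> makes the form of \<open>A\<close> nonnegative on the
    range of \<open>A\<close>, hence on its closure; the null space of \<open>A\<close> contributes
    nothing.\<close>
  have half: "pos A" if "A\<^sup>\<star> = A" "B\<^sup>\<star> = B" "A \<odot> B = 0" "R = A + B" for A B
  proof -
    have "A \<odot> (R \<odot> A) = A \<odot> (A \<odot> A)" using that(3,4) by (simp add: op_distrib flip: op_assoc)
    then have p: "pos (A \<odot> (A \<odot> A))" using pos_conj_sa[OF R(1) that(1)] by simp
    have nn: "0 \<le> qf A (ap A z)" for z
      using pos_ge[OF p, of z] that(1) by (simp add: inner_radj)
    have "0 \<le> qf A x" for x
    proof -
      let ?k = "ap (kerp A) x"
      have "ap (kerp A) (x - ?k) = 0" by (simp add: apply_simps prj_idem_apply)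
      then have "x - ?k \<in> closure (range (ap A))" using in_closure_range[of A] that(1) by simp
      then have "0 \<le> qf A (x - ?k)" using nn by (rule nonneg_on_closure_range[rotated])
      also have "\<dots> = inner (ap A x) (x - ?k)" by (simp add: apply_simps kerp_null)
      also have "\<dots> = inner x (ap A (x - ?k))" by (metis inner_radj that(1))
      also have "\<dots> = qf A x" by (simp add: apply_simps kerp_null inner_commute)
      finally show ?thesis .
    qed
    then show ?thesis using that(1) by (simp add: pos_def)
  qed
  have "pos P" by (rule half[OF sa PN(1) RPN])
  moreover have "pos N" by (rule half[OF sa(2,1) PN(2)]) (simp add: RPN)
  moreover have "U \<odot> P = P \<odot> U \<and> U \<odot> N = N \<odot> U" if "U \<odot> X = X \<odot> U" for U
  proof -
    have "U \<odot> (X \<odot> X) = X \<odot> X \<odot> U" using that by (metis op_assoc)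
    from R(3)[OF this] show ?thesis using that by (simp add: P_def N_def op_distrib op_scale)
  qed
  ultimately show ?thesis using PN XPN by blast
qed

text \<open>\<open>P + N\<close> must be the positive square root of \<open>X^2\<close>, so both the
  sum and the difference of the parts are determined.\<close>

lemma pos_part_unique:
  assumes "pos P" "pos N" "X = P - N" "P \<odot> N = 0"
    and "pos P'" "pos N'" "X = P' - N'" "P' \<odot> N' = 0"
  shows "P = P'"
proof -
  have *: "P + N = op_sqrt (X \<odot> X)" if "pos P" "pos N" "X = P - N" "P \<odot> N = 0" for P N
  proof -
    have "(P \<odot> N)\<^sup>\<star> = N \<odot> P" using that(1,2) by (simp add: pos_sa)
    then have "N \<odot> P = 0" using that(4) by simp
    then have "X \<odot> X = (P + N) \<odot> (P + N)" using that by (simp add: op_distrib)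
    then show ?thesis using op_sqrt_unique[OF pos_add[OF that(1,2)]] by simp
  qed
  have "P + N = P' + N'" using *[of P N] *[of P' N'] assms by simp
  moreover have "P - N = P' - N'" using assms by simp
  ultimately have "(P + N) + (P - N) = (P' + N') + (P' - N')" by simp
  then have "2 *\<^sub>R P = 2 *\<^sub>R P'" by (simp add: scaleR_2)
  then show ?thesis by simp
qed

text \<open>\<open>R -> 1 + T R\<close> and \<open>R -> 1 + R T\<close> are contractions; their
  fixed points are a right and a left inverse and therefore agree.\<close>

lemma neumann_inverse:
  assumes "norm (T :: 'a::hilbert_space operator) < 1"
  shows "\<exists>R. (\<one> - T) \<odot> R = \<one> \<and> R \<odot> (\<one> - T) = \<one>"
proof -
  have "\<exists>!R. \<one> + T \<odot> R = R"
  proof (rule banach_fix_type[of "norm T"])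
    show "\<forall>x y. dist (\<one> + T \<odot> x) (\<one> + T \<odot> y) \<le> norm T * dist x y"
      by (auto simp: dist_norm op_distrib(4)[symmetric] norm_blinfun_compose)
  qed (use assms in auto)
  then obtain R where R: "\<one> + T \<odot> R = R" by blast
  have "\<exists>!R. \<one> + R \<odot> T = R"
  proof (rule banach_fix_type[of "norm T"])
    show "\<forall>x y. dist (\<one> + x \<odot> T) (\<one> + y \<odot> T) \<le> norm T * dist x y"
      by (auto simp: dist_norm op_distrib(3)[symmetric] mult.commute[of "norm T"] norm_blinfun_compose)
  qed (use assms in auto)
  then obtain R' where R': "\<one> + R' \<odot> T = R'" by blast
  have 1: "(\<one> - T) \<odot> R = \<one>" using R by (simp add: op_distrib diff_eq_eq)
  have 2: "R' \<odot> (\<one> - T) = \<one>" using R' by (simp add: op_distrib diff_eq_eq)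
  have "R' = R" using 1 2 by (metis op_assoc op_one_left op_one_right)
  then show ?thesis using 1 2 by blast
qed

text \<open>The operator \<open>1 - A / c\<close> has norm at most \<open>1 - s / c\<close>; the
  choice \<open>c = norm A + s\<close> keeps \<open>c\<close> positive and this bound in the unit
  interval.\<close>

lemma inverse_of_bounded_below:
  assumes A: "pos A" and s: "s > 0" "pos (A - s *\<^sub>R \<one>)"
  shows "\<exists>R. pos R \<and> A \<odot> R = \<one> \<and> R \<odot> A = \<one> \<and> (\<forall>U. U \<odot> A = A \<odot> U \<longrightarrow> U \<odot> R = R \<odot> U)"
proof -
  define c where "c = norm A + s"
  have c: "c > 0" "s \<le> c" using s by (auto simp: c_def add_nonneg_pos)
  define T where "T = \<one> - (1/c) *\<^sub>R A"
  have q: "qf T x = (norm x)\<^sup>2 - qf A x / c" for x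
    by (simp add: T_def apply_simps inner_expand power2_norm_eq_inner)
  have lo: "s * (norm x)\<^sup>2 \<le> qf A x" for x
    using pos_ge[OF s(2), of x] by (simp add: apply_simps inner_expand power2_norm_eq_inner)
  have up: "qf A x \<le> c * (norm x)\<^sup>2" for x
    using inner_le_norm_op[of A x] s(1) by (auto simp: c_def algebra_simps intro: order_trans)
  have Tsa: "T\<^sup>\<star> = T" by (simp add: T_def pos_sa[OF A])
  have "pos T" using up c by (auto simp: pos_def Tsa q field_simps)
  moreover have "qf T x \<le> (1 - s / c) * (norm x)\<^sup>2" for x
    using lo[of x] c by (simp add: q field_simps)
  ultimately have "norm T \<le> 1 - s / c" using c s by (intro pos_norm_bound) auto
  then have "norm T < 1" using c s by (smt (verit) divide_pos_pos)
  then obtain R where R: "(\<one> - T) \<odot> R = \<one>" "R \<odot> (\<one> - T) = \<one>" using neumann_inverse by blast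
  define Q where "Q = (1/c) *\<^sub>R R"
  have AT: "A = c *\<^sub>R (\<one> - T)" using c by (simp add: T_def)
  have Q: "A \<odot> Q = \<one>" "Q \<odot> A = \<one>" using R c by (simp_all add: AT Q_def op_scale)
  have "(A \<odot> Q)\<^sup>\<star> = \<one>" using Q by simp
  then have "Q\<^sup>\<star> \<odot> A = \<one>" by (simp add: pos_sa[OF A])
  then have Qsa: "Q\<^sup>\<star> = Q" using Q by (metis op_assoc op_one_left op_one_right)
  have "pos (Q\<^sup>\<star> \<odot> A \<odot> Q)" by (rule pos_conj[OF A])
  then have "pos Q" using Q Qsa by (simp add: op_assoc)
  moreover have "U \<odot> Q = Q \<odot> U" if "U \<odot> A = A \<odot> U" for U
  proof -
    have "Q \<odot> (U \<odot> A) \<odot> Q = Q \<odot> (A \<odot> U) \<odot> Q" using that by simp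
    then show ?thesis using Q by (metis op_assoc op_one_left op_one_right)
  qed
  ultimately show ?thesis using Q by blast
qed

section \<open>Strongly convergent sums\<close>

lemma norm_sum_orthogonal:
  assumes "finite F" "\<And>i j. i \<in> F \<Longrightarrow> j \<in> F \<Longrightarrow> i \<noteq> j \<Longrightarrow> inner (y i) (y j :: 'a::real_inner) = 0"
  shows "(norm (\<Sum>i\<in>F. y i))\<^sup>2 = (\<Sum>i\<in>F. (norm (y i))\<^sup>2)"
  using assms
proof (induction F rule: finite_induct)
  case (insert i F)
  have "inner (y i) (\<Sum>j\<in>F. y j) = 0"
    unfolding inner_sum_right using insert by (intro sum.neutral) auto
  then show ?case using insert
    by (simp add: power2_norm_eq_inner inner_expand inner_commute)
qed simp

text \<open>By Pythagoras, nested partial sums differ in squared norm by the difference of their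
  sums of squares. Two arbitrary finite sets are compared through a common superset.\<close>

lemma summable_orthogonal:
  fixes y :: "'i \<Rightarrow> 'a::hilbert_space"
  assumes orth: "\<And>i j. i \<in> I \<Longrightarrow> j \<in> I \<Longrightarrow> i \<noteq> j \<Longrightarrow> inner (y i) (y j) = 0"
    and sq: "(\<lambda>i. (norm (y i))\<^sup>2) summable_on I"
  shows "y summable_on I"
proof -
  let ?s = "sum (\<lambda>i. (norm (y i))\<^sup>2)"
  from sq obtain L where lim: "(?s \<longlongrightarrow> L) (finite_subsets_at_top I)"
    unfolding has_sum_def summable_on_def by blast
  have "\<exists>P. eventually P (finite_subsets_at_top I) \<and>
              (\<forall>F F'. P F \<and> P F' \<longrightarrow> dist (sum y F) (sum y F') < e)" if "e > 0" for e
  proof -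
    \<comment> \<open>Two sums of squares within \<open>d\<close> of the limit differ by less than
      \<open>2 * d\<close>, the square of \<open>e / 2\<close>.\<close>
    define d where "d = e\<^sup>2 / 8"
    define P where "P F \<longleftrightarrow> finite F \<and> F \<subseteq> I \<and> dist (?s F) L < d" for F
    have d: "d > 0" using that by (simp add: d_def)
    have ev: "eventually P (finite_subsets_at_top I)"
      using lim d
      by (auto simp add: P_def[abs_def] eventually_conj_iff eventually_finite_subsets_at_top_weakI tendsto_iff)
    then obtain F0 where F0: "finite F0" "F0 \<subseteq> I" "\<And>F. finite F \<Longrightarrow> F0 \<subseteq> F \<Longrightarrow> F \<subseteq> I \<Longrightarrow> P F"
      by (auto simp: eventually_finite_subsets_at_top)
    have sub: "dist (sum y F) (sum y F') < e / 2" if F: "P F" "P F'" "F' \<subseteq> F" for F F'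
    proof -
      have fin: "finite F" "F \<subseteq> I" using F by (auto simp: P_def)
      have "dist (sum y F) (sum y F') = norm (sum y (F - F'))"
        unfolding dist_norm using fin F(3) by (subst sum_diff) auto
      also have "(norm (sum y (F - F')))\<^sup>2 = ?s (F - F')"
        using fin orth by (intro norm_sum_orthogonal) auto
      also have "\<dots> = ?s F - ?s F'" using fin F(3) by (subst sum_diff) auto
      also have "\<dots> < 2 * d"
        using F(1,2) unfolding P_def dist_real_def by linarith
      also have "\<dots> = (e / 2)\<^sup>2" by (simp add: d_def power2_eq_square)
      finally show ?thesis using that \<open>e > 0\<close> by (intro power2_less_imp_less[of _ "e/2"]) auto
    qed
    have "dist (sum y F1) (sum y F2) < e" if F: "P F1" "P F2" for F1 F2
    proof -
      define F where "F = F0 \<union> F1 \<union> F2"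
      have "P F" using F F0(1,2) unfolding F_def by (intro F0(3)) (auto simp: P_def)
      with sub[of F F1] sub[of F F2] F have "dist (sum y F) (sum y F1) < e/2" "dist (sum y F) (sum y F2) < e/2"
        by (auto simp: F_def)
      then show ?thesis using dist_triangle3[of "sum y F1" "sum y F2" "sum y F"] by simp
    qed
    then show ?thesis using ev by blast
  qed
  then have "cauchy_filter (filtermap (sum y) (finite_subsets_at_top I))"
    by (simp add: cauchy_filter_metric_filtermap)
  moreover have "complete (UNIV :: 'a set)"
    by (meson Cauchy_convergent UNIV_I complete_def convergent_def)
  ultimately obtain L' where "(sum y \<longlongrightarrow> L') (finite_subsets_at_top I)"
    using complete_uniform[where S=UNIV] by (force simp add: filterlim_def)
  then show ?thesis using summable_on_def has_sum_def by blast
qed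

lemma has_sum_norm_orthogonal:
  fixes y :: "'i \<Rightarrow> 'a::hilbert_space"
  assumes orth: "\<And>i j. i \<in> I \<Longrightarrow> j \<in> I \<Longrightarrow> i \<noteq> j \<Longrightarrow> inner (y i) (y j) = 0"
    and s: "(y has_sum s) I"
  shows "((\<lambda>i. (norm (y i))\<^sup>2) has_sum (norm s)\<^sup>2) I"
proof -
  have "((\<lambda>F. (norm (sum y F))\<^sup>2) \<longlongrightarrow> (norm s)\<^sup>2) (finite_subsets_at_top I)"
    using s unfolding has_sum_def by (intro tendsto_intros)
  moreover have "\<forall>\<^sub>F F in finite_subsets_at_top I. (norm (sum y F))\<^sup>2 = (\<Sum>i\<in>F. (norm (y i))\<^sup>2)"
    by (rule eventually_finite_subsets_at_top_weakI) (rule norm_sum_orthogonal, use orth in auto)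
  ultimately show ?thesis unfolding has_sum_def using filterlim_cong by fastforce
qed

definition opsum :: "('i \<Rightarrow> 'a::hilbert_space operator) \<Rightarrow> 'i set \<Rightarrow> 'a operator" where
  "opsum X I = Blinfun (\<lambda>x. infsum (\<lambda>i. ap (X i) x) I)"

text \<open>Orthogonality of the ranges gives convergence at each vector; the bound on finite square
  sums makes the limit a bounded operator.\<close>

lemma opsum:
  fixes X :: "'i \<Rightarrow> 'a::hilbert_space operator"
  assumes orth: "\<And>i j. i \<in> I \<Longrightarrow> j \<in> I \<Longrightarrow> i \<noteq> j \<Longrightarrow> (X i)\<^sup>\<star> \<odot> X j = 0"
    and bound: "\<And>x F. finite F \<Longrightarrow> F \<subseteq> I \<Longrightarrow> (\<Sum>i\<in>F. nsq (X i) x) \<le> K * (norm x)\<^sup>2"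
  shows "((\<lambda>i. ap (X i) x) has_sum ap (opsum X I) x) I"
    and "((\<lambda>i. nsq (X i) x) has_sum nsq (opsum X I) x) I"
proof -
  let ?f = "\<lambda>x. infsum (\<lambda>i. ap (X i) x) I"
  have o: "inner (ap (X i) x) (ap (X j) x) = 0" if "i \<in> I" "j \<in> I" "i \<noteq> j" for i j x
    using orth[OF that] by (metis blinfun.zero_left blinfun_apply_blinfun_compose inner_radj inner_zero_right)
  have "(\<lambda>i. nsq (X i) x) summable_on I" for x
    using bound by (intro nonneg_bdd_above_summable_on bdd_aboveI2[where M="K * (norm x)\<^sup>2"]) auto
  then have hs: "((\<lambda>i. ap (X i) x) has_sum ?f x) I" for x
    by (intro has_sum_infsum summable_orthogonal o)
  have hn: "((\<lambda>i. nsq (X i) x) has_sum (norm (?f x))\<^sup>2) I" for x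
    by (rule has_sum_norm_orthogonal[OF o hs])
  have le: "(norm (?f x))\<^sup>2 \<le> K * (norm x)\<^sup>2" for x
    by (rule has_sum_le_finite_sums[OF hn]) (use bound in auto)
  have bl: "bounded_linear ?f"
  proof (rule bounded_linear_intro[where K="sqrt \<bar>K\<bar>"])
    show "?f (x + y) = ?f x + ?f y" for x y
      by (rule has_sum_unique[OF hs]) (simp add: blinfun.add_right has_sum_add[OF hs hs])
    show "?f (r *\<^sub>R x) = r *\<^sub>R ?f x" for r x
      by (rule has_sum_unique[OF hs])
        (simp add: blinfun.scaleR_right has_sum_bounded_linear[OF bounded_linear_scaleR_right hs])
    show "norm (?f x) \<le> norm x * sqrt \<bar>K\<bar>" for x
    proof (rule power2_le_imp_le)
      have "(norm (?f x))\<^sup>2 \<le> \<bar>K\<bar> * (norm x)\<^sup>2"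
        by (rule order_trans[OF le]) (intro mult_right_mono, auto)
      then show "(norm (?f x))\<^sup>2 \<le> (norm x * sqrt \<bar>K\<bar>)\<^sup>2" by (simp add: power_mult_distrib mult.commute)
    qed simp
  qed
  then have ap: "ap (opsum X I) = ?f" unfolding opsum_def by (rule bounded_linear_Blinfun_apply)
  show "((\<lambda>i. ap (X i) x) has_sum ap (opsum X I) x) I"
    "((\<lambda>i. nsq (X i) x) has_sum nsq (opsum X I) x) I"
    unfolding ap by (rule hs, rule hn)
qed

lemma has_sum_op_left:
  assumes "\<And>x. ((\<lambda>i. ap (X i) x) has_sum ap S x) I"
  shows "((\<lambda>i. ap (T \<odot> X i) x) has_sum ap (T \<odot> S) x) I"
  using has_sum_bounded_linear[OF blinfun.bounded_linear_right assms] by simp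

lemma has_sum_op_right:
  assumes "\<And>x. ((\<lambda>i. ap (X i) x) has_sum ap S x) I"
  shows "((\<lambda>i. ap (X i \<odot> T) x) has_sum ap (S \<odot> T) x) I"
  using assms[of "ap T x"] by simp

lemma has_sum_eqI:
  fixes a b :: "'b::{topological_comm_monoid_add, t2_space}"
  assumes "(f has_sum a) I" "(g has_sum b) I" "\<And>i. i \<in> I \<Longrightarrow> f i = g i"
  shows "a = b"
  using assms has_sum_cong[of I f g a] has_sum_unique by metis

lemma op_sum_eqI:
  assumes "\<And>x. ((\<lambda>i. ap (X i) x) has_sum ap S x) I"
    "\<And>x. ((\<lambda>i. ap (Y i) x) has_sum ap T x) I"
    "\<And>i. i \<in> I \<Longrightarrow> X i = Y i"
  shows "S = T"
proof (rule blinfun_eqI)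
  fix x
  have "((\<lambda>i. ap (X i) x) has_sum ap T x) I"
    by (rule has_sum_cong[THEN iffD2, OF _ assms(2)]) (simp add: assms(3))
  then show "ap S x = ap T x" using assms(1) has_sum_unique by blast
qed

lemma op_sum_left_cong:
  assumes "\<And>x. ((\<lambda>i. ap (X i) x) has_sum ap S x) I"
    "\<And>i. i \<in> I \<Longrightarrow> T \<odot> X i = T' \<odot> X i"
  shows "T \<odot> S = T' \<odot> S"
  by (rule op_sum_eqI[OF has_sum_op_left[OF assms(1)] has_sum_op_left[OF assms(1)] assms(2)])

lemma op_sum_commute:
  assumes "\<And>x. ((\<lambda>i. ap (X i) x) has_sum ap S x) I"
    "\<And>i. i \<in> I \<Longrightarrow> T \<odot> X i = X i \<odot> T"
  shows "T \<odot> S = S \<odot> T"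
  by (rule op_sum_eqI[OF has_sum_op_left[OF assms(1)] has_sum_op_right[OF assms(1)] assms(2)])

lemma op_sum_pick:
  assumes "\<And>x. ((\<lambda>i. ap (X i) x) has_sum ap S x) I" "j \<in> I"
    "\<And>i. i \<in> I \<Longrightarrow> i \<noteq> j \<Longrightarrow> T \<odot> X i = 0"
  shows "T \<odot> S = T \<odot> X j"
proof (rule op_sum_eqI[OF has_sum_op_left[OF assms(1)]])
  fix x
  show "((\<lambda>i. ap (if i = j then T \<odot> X j else 0) x) has_sum ap (T \<odot> X j) x) I"
    by (rule has_sum_finite_neutralI[where B="{j}"]) (use assms(2) in auto)
qed (use assms(3) in auto)

lemma op_sum_eq_zero:
  assumes "\<And>x. ((\<lambda>i. ap (X i) x) has_sum ap S x) I"
    "\<And>i. i \<in> I \<Longrightarrow> T \<odot> X i = 0"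
  shows "T \<odot> S = 0"
  using op_sum_left_cong[OF assms(1), of T 0] assms(2) by simp

section \<open>Orthogonal families of projections\<close>

definition orth_prjs :: "'i set \<Rightarrow> ('i \<Rightarrow> 'a::hilbert_space operator) \<Rightarrow> bool" where
  "orth_prjs I P \<longleftrightarrow> (\<forall>i\<in>I. prj (P i)) \<and> (\<forall>i\<in>I. \<forall>j\<in>I. i \<noteq> j \<longrightarrow> P i \<odot> P j = 0)"

lemma orth_prjs_subset: "orth_prjs I P \<Longrightarrow> J \<subseteq> I \<Longrightarrow> orth_prjs J P"
  by (auto simp: orth_prjs_def subset_iff)

lemma prj_add:
  assumes "prj P" "prj Q" "P \<odot> Q = 0"
  shows "prj (P + Q)" "Q \<odot> P = 0"
proof -
  have "(P \<odot> Q)\<^sup>\<star> = Q \<odot> P" using assms(1,2) by (simp add: prj_sa)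
  then show "Q \<odot> P = 0" using assms(3) by simp
  then show "prj (P + Q)" using assms by (simp add: prj_def op_distrib)
qed

lemma op_sum_comp_left:
  "finite F \<Longrightarrow> T \<odot> (\<Sum>i\<in>F. X i) = (\<Sum>i\<in>F. T \<odot> X i)"
  by (induction F rule: finite_induct) (auto simp: op_distrib)

lemma prj_finite_sum:
  assumes "finite F" "orth_prjs F P"
  shows "prj (\<Sum>i\<in>F. P i)"
  using assms
proof (induction F rule: finite_induct)
  case (insert i F)
  have "P i \<odot> (\<Sum>j\<in>F. P j) = 0"
    using insert by (auto simp: op_sum_comp_left orth_prjs_def intro!: sum.neutral)
  then have "prj (P i + (\<Sum>j\<in>F. P j))" using insert by (intro prj_add(1)) (auto simp: orth_prjs_def)
  then show ?case using insert by simp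
qed simp

lemma prj_norm_le: "prj P \<Longrightarrow> nsq P x \<le> (norm x)\<^sup>2"
  using pos_ge[OF prj_pos[OF prj_compl], of P x]
  by (simp add: apply_simps inner_expand prj_inner power2_norm_eq_inner[of x])

lemma prj_norm_le1: "prj P \<Longrightarrow> norm P \<le> 1"
  by (rule norm_blinfun_bound) (use prj_norm_le power2_le_imp_le in \<open>auto\<close>)

lemma bessel:
  assumes "finite F" "orth_prjs F P"
  shows "(\<Sum>i\<in>F. nsq (P i) x) \<le> (norm x)\<^sup>2"
proof -
  have "(\<Sum>i\<in>F. nsq (P i) x) = (\<Sum>i\<in>F. qf (P i) x)"
    using assms by (intro sum.cong) (auto simp: prj_inner orth_prjs_def)
  also have "\<dots> = qf (\<Sum>i\<in>F. P i) x" by (simp add: blinfun.sum_left inner_sum_left)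
  also have "\<dots> \<le> (norm x)\<^sup>2" using prj_finite_sum[OF assms] prj_norm_le by (simp add: prj_inner)
  finally show ?thesis .
qed

lemma prj_opsum:
  assumes P: "orth_prjs I P"
  shows "((\<lambda>i. ap (P i) x) has_sum ap (opsum P I) x) I"
    and "prj (opsum P I)" and "i \<in> I \<Longrightarrow> opsum P I \<odot> P i = P i" and "i \<in> I \<Longrightarrow> P i \<odot> opsum P I = P i"
    and "((\<lambda>i. qf (P i) x) has_sum qf (opsum P I) x) I"
proof -
  have hs: "((\<lambda>i. ap (P i) x) has_sum ap (opsum P I) x) I" for x
  proof (rule opsum(1)[where K=1])
    show "(P i)\<^sup>\<star> \<odot> P j = 0" if "i \<in> I" "j \<in> I" "i \<noteq> j" for i j
      using that P by (auto simp: orth_prjs_def prj_sa)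
    show "(\<Sum>i\<in>F. nsq (P i) x) \<le> 1 * (norm x)\<^sup>2" if "finite F" "F \<subseteq> I" for x F
      using bessel[OF that(1) orth_prjs_subset[OF P that(2)]] by simp
  qed
  then show "((\<lambda>i. ap (P i) x) has_sum ap (opsum P I) x) I" .
  have pick: "P i \<odot> opsum P I = P i" if "i \<in> I" for i
    using op_sum_pick[OF hs, where T="P i" and j=i] that P by (simp add: orth_prjs_def prj_idem)
  then show "i \<in> I \<Longrightarrow> P i \<odot> opsum P I = P i" .
  have sa: "(opsum P I)\<^sup>\<star> = opsum P I"
  proof (rule radj_unique)
    fix x y
    have "((\<lambda>i. inner (ap (P i) x) y) has_sum inner (ap (opsum P I) x) y) I"
      by (rule has_sum_bounded_linear[OF bounded_linear_inner_left hs])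
    moreover have "((\<lambda>i. inner x (ap (P i) y)) has_sum inner x (ap (opsum P I) y)) I"
      by (rule has_sum_bounded_linear[OF bounded_linear_inner_right hs])
    moreover have "inner (ap (P i) x) y = inner x (ap (P i) y)" if "i \<in> I" for i
      using P that by (simp add: inner_radj orth_prjs_def prj_sa)
    ultimately show "inner (ap (opsum P I) x) y = inner x (ap (opsum P I) y)"
      by (rule has_sum_eqI)
  qed
  have "opsum P I \<odot> opsum P I = opsum P I"
    by (rule op_sum_eqI[OF has_sum_op_right[OF hs] hs]) (rule pick)
  then show pr: "prj (opsum P I)" using sa by (simp add: prj_def)
  show "opsum P I \<odot> P i = P i" if "i \<in> I"
  proof -
    have "(P i \<odot> opsum P I)\<^sup>\<star> = (P i)\<^sup>\<star>" using pick[OF that] by simp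
    then show ?thesis using P that sa by (simp add: orth_prjs_def prj_sa)
  qed
  show "((\<lambda>i. qf (P i) x) has_sum qf (opsum P I) x) I"
    by (rule has_sum_bounded_linear[OF bounded_linear_inner_left hs])
qed

text \<open>On the range of \<open>P\<close> the form of \<open>1 - Q\<close> is at most that of
  \<open>1 - P\<close>, which is zero there.\<close>

lemma prj_le_comp:
  assumes "prj P" "prj Q" "\<And>x. qf P x \<le> qf Q x"
  shows "Q \<odot> P = P" "P \<odot> Q = P"
proof -
  have "(\<one> - Q) \<odot> P = 0"
  proof (rule blinfun_eqI)
    fix x
    let ?y = "ap P x"
    have "norm (ap (\<one> - Q) ?y) ^ 2 = qf (\<one> - Q) ?y"
      using prj_inner[OF prj_compl[OF assms(2)]] by simp
    also have "\<dots> \<le> qf (\<one> - P) ?y"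
      using assms(3)[of ?y] by (simp add: apply_simps inner_expand)
    also have "\<dots> = 0" by (simp add: apply_simps prj_idem_apply[OF assms(1)])
    finally show "ap ((\<one> - Q) \<odot> P) x = ap 0 x" by (simp add: blinfun.zero_left)
  qed
  then show 1: "Q \<odot> P = P" by (simp add: op_distrib)
  have "(Q \<odot> P)\<^sup>\<star> = P\<^sup>\<star>" using 1 by simp
  then show "P \<odot> Q = P" using assms by (simp add: prj_sa)
qed

lemma prj_orth_of_bound:
  assumes "prj P" "prj Q" "\<And>x. qf P x + qf Q x \<le> (norm x)\<^sup>2"
  shows "P \<odot> Q = 0"
proof -
  have "(\<one> - Q) \<odot> P = P"
    by (rule prj_le_comp(1)[OF assms(1) prj_compl[OF assms(2)]])
      (use assms(3) in \<open>simp add: apply_simps inner_expand power2_norm_eq_inner[symmetric] le_diff_eq\<close>)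
  then have "Q \<odot> P = 0" by (simp add: op_distrib)
  then show ?thesis using prj_add(2) assms by blast
qed

lemma prj_diff:
  assumes "prj P" "prj Q" "Q \<odot> P = P"
  shows "prj (Q - P)" "P \<odot> Q = P"
proof -
  have "(Q \<odot> P)\<^sup>\<star> = P\<^sup>\<star>" using assms by simp
  then show *: "P \<odot> Q = P" using assms(1,2) by (simp add: prj_sa)
  show "prj (Q - P)" using assms * by (simp add: prj_def op_distrib)
qed

section \<open>The spectral measure\<close>

lemma prj_norm_le': "prj P \<Longrightarrow> norm (ap P x) \<le> norm x"
  using prj_norm_le power2_le_imp_le norm_ge_zero by blast

text \<open>Both parts are chosen at once, so that they come from the same decomposition.\<close>

definition pos_neg :: "'a::hilbert_space operator \<Rightarrow> 'a operator \<times> 'a operator" where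
  "pos_neg X = (SOME (P, N). pos P \<and> pos N \<and> X = P - N \<and> P \<odot> N = 0 \<and> N \<odot> P = 0 \<and>
    (\<forall>U. U \<odot> X = X \<odot> U \<longrightarrow> U \<odot> P = P \<odot> U \<and> U \<odot> N = N \<odot> U))"

definition posp :: "'a::hilbert_space operator \<Rightarrow> 'a operator" where "posp X = fst (pos_neg X)"
definition negp :: "'a::hilbert_space operator \<Rightarrow> 'a operator" where "negp X = snd (pos_neg X)"

lemma posp:
  assumes "X\<^sup>\<star> = X"
  shows "pos (posp X)" "pos (negp X)" "X = posp X - negp X" "posp X \<odot> negp X = 0" "negp X \<odot> posp X = 0"
    "U \<odot> X = X \<odot> U \<Longrightarrow> U \<odot> posp X = posp X \<odot> U" "U \<odot> X = X \<odot> U \<Longrightarrow> U \<odot> negp X = negp X \<odot> U"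
proof -
  let ?Q = "\<lambda>(P, N). pos P \<and> pos N \<and> X = P - N \<and> P \<odot> N = 0 \<and> N \<odot> P = 0 \<and>
    (\<forall>U. U \<odot> X = X \<odot> U \<longrightarrow> U \<odot> P = P \<odot> U \<and> U \<odot> N = N \<odot> U)"
  obtain P N where "?Q (P, N)" using pos_part_ex[OF assms] by auto
  then have "?Q (pos_neg X)" unfolding pos_neg_def by (rule someI)
  then have q: "?Q (posp X, negp X)" by (simp add: posp_def negp_def)
  show "pos (posp X)" "pos (negp X)" "X = posp X - negp X" "posp X \<odot> negp X = 0" "negp X \<odot> posp X = 0"
    using q by auto
  show "U \<odot> X = X \<odot> U \<Longrightarrow> U \<odot> posp X = posp X \<odot> U" "U \<odot> X = X \<odot> U \<Longrightarrow> U \<odot> negp X = negp X \<odot> U"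
    using q by auto
qed

text \<open>The resolution of the identity of \<open>A\<close>: this is the spectral projection of
  the closed half-line ending at \<open>t\<close>.\<close>

definition specg :: "'a::hilbert_space operator \<Rightarrow> real \<Rightarrow> 'a operator" where
  "specg A t = kerp (posp (A - t *\<^sub>R \<one>))"

lemma prj_specg [simp]: "prj (specg A t)" by (simp add: specg_def)

context
  fixes A :: "'a::hilbert_space operator"
  assumes A: "A\<^sup>\<star> = A"
begin

lemma shift_sa: "(A - t *\<^sub>R \<one>)\<^sup>\<star> = A - t *\<^sub>R \<one>" by (simp add: A)

lemma specg_commute: "U \<odot> A = A \<odot> U \<Longrightarrow> U \<odot> specg A t = specg A t \<odot> U"
  unfolding specg_def
  by (intro kerp_commute_sa posp(6)[OF shift_sa] pos_sa posp(1)[OF shift_sa])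
    (simp add: op_distrib op_scale)

lemma inner_shift: "qf A y = t * (norm y)\<^sup>2 + qf (posp (A - t *\<^sub>R \<one>)) y
   - qf (negp (A - t *\<^sub>R \<one>)) y"
proof -
  have "qf (A - t *\<^sub>R \<one>) y =
    qf (posp (A - t *\<^sub>R \<one>) - negp (A - t *\<^sub>R \<one>)) y"
    using posp(3)[OF shift_sa] by metis
  then show ?thesis by (simp add: apply_simps inner_expand power2_norm_eq_inner)
qed

lemma specg_le:
  assumes "ap (specg A t) y = y"
  shows "qf A y \<le> t * (norm y)\<^sup>2"
proof -
  have "ap (posp (A - t *\<^sub>R \<one>)) y = 0" using assms by (simp add: specg_def kerp_eq_iff)
  then show ?thesis using inner_shift[of y t] pos_ge[OF posp(2)[OF shift_sa], of t y] by simp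
qed

text \<open>The negative part lives on the kernel of the positive part, so it vanishes at
  \<open>y\<close>. The strict version is what makes the resolution right-continuous.\<close>

lemma specg_ge:
  assumes "ap (specg A t) y = 0"
  shows "t * (norm y)\<^sup>2 \<le> qf A y"
    and "t * (norm y)\<^sup>2 = qf A y \<Longrightarrow> y = 0"
proof -
  let ?P = "posp (A - t *\<^sub>R \<one>)" and ?N = "negp (A - t *\<^sub>R \<one>)"
  have "kerp ?P \<odot> ?N = ?N" by (rule kerp_comp) (rule posp(4)[OF shift_sa])
  then have "(kerp ?P \<odot> ?N)\<^sup>\<star> = ?N\<^sup>\<star>" by simp
  then have "?N \<odot> kerp ?P = ?N" by (simp add: pos_sa[OF posp(2)[OF shift_sa]])
  then have "ap ?N y = 0"
    using assms by (metis blinfun.zero_right blinfun_apply_blinfun_compose specg_def)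
  then have e: "qf A y = t * (norm y)\<^sup>2 + qf ?P y"
    using inner_shift[of y t] by simp
  then show "t * (norm y)\<^sup>2 \<le> qf A y"
    using pos_ge[OF posp(1)[OF shift_sa], of t y] by simp
  show "y = 0" if "t * (norm y)\<^sup>2 = qf A y"
  proof -
    have "ap ?P y = 0" using that e by (intro pos_inner_zero posp(1)[OF shift_sa]) simp
    then show ?thesis using assms by (metis kerp_fix specg_def)
  qed
qed

lemma specg_mono: "s \<le> t \<Longrightarrow> specg A t \<odot> specg A s = specg A s"
proof (cases "s = t")
  case False
  assume "s \<le> t"
  with False have st: "s < t" by simp
  have com: "specg A s \<odot> specg A t = specg A t \<odot> specg A s"
    by (rule specg_commute) (rule specg_commute[symmetric], simp)
  have "ap ((\<one> - specg A t) \<odot> specg A s) x = 0" for x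
  proof -
    let ?y = "ap ((\<one> - specg A t) \<odot> specg A s) x"
    have 1: "ap (specg A t) ?y = 0" by (simp add: apply_simps prj_idem_apply)
    have 2: "ap (specg A s) ?y = ?y"
      by (simp add: apply_simps prj_idem_apply) (metis com blinfun_apply_blinfun_compose prj_specg prj_idem_apply)
    have "t * (norm ?y)\<^sup>2 \<le> s * (norm ?y)\<^sup>2" using specg_le[OF 2] specg_ge(1)[OF 1] by linarith
    then have "(norm ?y)\<^sup>2 \<le> 0" using st by (simp add: mult_le_cancel_right)
    then show "?y = 0" by simp
  qed
  then have "(\<one> - specg A t) \<odot> specg A s = 0" by (intro blinfun_eqI) (simp add: blinfun.zero_left)
  then show ?thesis by (simp add: op_distrib)
qed (simp add: prj_idem)

lemma specg_mono': "s \<le> t \<Longrightarrow> specg A s \<odot> specg A t = specg A s"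
  using prj_diff(2)[OF prj_specg prj_specg specg_mono] .

lemma specg_inner_mono:
  assumes "s \<le> t"
  shows "qf (specg A s) x \<le> qf (specg A t) x"
  using pos_ge[OF prj_pos[OF prj_diff(1)[OF prj_specg prj_specg specg_mono[OF assms]]], of x]
  by (simp add: apply_simps inner_expand)

lemma abs_inner_le_norm_op: "\<bar>qf A y\<bar> \<le> norm A * (norm y)\<^sup>2"
  using inner_le_norm_op[of A y] inner_le_norm_op[of "- A" y] by (simp add: apply_simps)

lemma specg_below: "t < - norm A \<Longrightarrow> specg A t = 0"
proof (rule blinfun_eqI)
  fix x assume t: "t < - norm A"
  let ?y = "ap (specg A t) x"
  have "qf A ?y \<le> t * (norm ?y)\<^sup>2" by (rule specg_le) (simp add: prj_idem_apply)
  then have "- norm A * (norm ?y)\<^sup>2 \<le> t * (norm ?y)\<^sup>2" using abs_inner_le_norm_op[of ?y] by linarith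
  then have "(norm ?y)\<^sup>2 \<le> 0" using t by (simp only: mult_le_cancel_right) linarith
  then show "?y = ap 0 x" by (simp add: blinfun.zero_left)
qed

lemma specg_above: "norm A < t \<Longrightarrow> specg A t = \<one>"
proof (rule blinfun_eqI)
  fix x assume t: "norm A < t"
  let ?y = "x - ap (specg A t) x"
  have "t * (norm ?y)\<^sup>2 \<le> qf A ?y"
    by (rule specg_ge) (simp add: apply_simps prj_idem_apply)
  then have "t * (norm ?y)\<^sup>2 \<le> norm A * (norm ?y)\<^sup>2" using abs_inner_le_norm_op[of ?y] by linarith
  then have "(norm ?y)\<^sup>2 \<le> 0" using t by (simp only: mult_le_cancel_right) linarith
  then show "ap (specg A t) x = ap \<one> x" by simp
qed

text \<open>The vectors \<open>?y n\<close> converge to some \<open>y\<close> in all the ranges of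
  \<open>?g n\<close> and orthogonal to the range at \<open>t\<close>. The first bounds the form of
  \<open>A\<close> at \<open>y\<close> from above, the second from below with equality only for
  \<open>y = 0\<close>.\<close>

lemma specg_right_continuous_seq:
  "(\<lambda>n. qf (specg A (t + 1 / Suc n)) x) \<longlonglongrightarrow> qf (specg A t) x"
proof -
  let ?g = "\<lambda>n. specg A (t + 1 / Suc n)"
  let ?F = "\<lambda>n. qf (?g n) x"
  let ?y = "\<lambda>n. ap (?g n - specg A t) x"
  have dec: "decseq ?F"
    by (intro decseq_SucI specg_inner_mono) (simp add: frac_le)
  have "convergent ?F"
    by (rule Bseq_monoseq_convergent[OF BseqI'[where K="(norm x)\<^sup>2"]])
      (use dec in \<open>auto simp: prj_inner prj_norm_le' decseq_imp_monoseq\<close>)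
  then have cF: "Cauchy ?F" by (rule convergent_Cauchy)
  have yn: "(norm (?y m - ?y n))\<^sup>2 = ?F m - ?F n" if "m \<le> n" for m n
  proof -
    have le: "t + 1 / Suc n \<le> t + 1 / Suc m" using that by (simp add: frac_le)
    have "?y m - ?y n = ap (?g m - ?g n) x" by (simp add: apply_simps)
    then show ?thesis
      using prj_inner[OF prj_diff(1)[OF prj_specg prj_specg specg_mono[OF le]], of x]
      by (simp add: apply_simps inner_expand)
  qed
  have "Cauchy ?y"
  proof (rule CauchyI)
    fix e :: real assume e: "e > 0"
    then obtain N where N: "\<And>m n. m \<ge> N \<Longrightarrow> n \<ge> N \<Longrightarrow> norm (?F m - ?F n) < e\<^sup>2"
      using cF CauchyD[of ?F "e\<^sup>2"] by auto
    have *: "norm (?y m - ?y n) < e" if "m \<ge> N" "n \<ge> m" for m n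
    proof -
      have "(norm (?y m - ?y n))\<^sup>2 < e\<^sup>2" using N[of m n] that yn[of m n] by auto
      then show ?thesis using e by (intro power2_less_imp_less[of _ e]) auto
    qed
    have "norm (?y m - ?y n) < e" if "m \<ge> N" "n \<ge> N" for m n
      using *[of n m] *[of m n] that by (cases "n \<le> m") (auto simp: norm_minus_commute)
    then show "\<exists>M. \<forall>m\<ge>M. \<forall>n\<ge>M. norm (?y m - ?y n) < e" by blast
  qed
  then obtain y where y: "?y \<longlonglongrightarrow> y" using Cauchy_convergent convergent_def by blast
  have gy: "ap (specg A t) y = 0"
  proof (rule LIMSEQ_unique)
    show "(\<lambda>n. ap (specg A t) (?y n)) \<longlonglongrightarrow> ap (specg A t) y"
      by (rule blinfun.tendsto[OF tendsto_const y])
    have "specg A t \<odot> (?g n - specg A t) = 0" for n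
      by (simp add: op_distrib specg_mono' prj_idem)
    then have "ap (specg A t) (?y n) = 0" for n
      by (metis blinfun.zero_left blinfun_apply_blinfun_compose)
    then show "(\<lambda>n. ap (specg A t) (?y n)) \<longlonglongrightarrow> 0" by simp
  qed
  have "ap (?g n) y = y" for n
  proof (rule LIMSEQ_unique)
    show "(\<lambda>m. ap (?g n) (?y m)) \<longlonglongrightarrow> ap (?g n) y"
      by (rule blinfun.tendsto[OF tendsto_const y])
    have "?g n \<odot> (?g m - specg A t) = ?g m - specg A t" if "n \<le> m" for m
      using that by (simp add: op_distrib specg_mono frac_le)
    then have "\<forall>\<^sub>F m in sequentially. ?y m = ap (?g n) (?y m)"
      by (auto intro!: eventually_sequentiallyI[of n]) (metis blinfun_apply_blinfun_compose)
    then show "(\<lambda>m. ap (?g n) (?y m)) \<longlonglongrightarrow> y" using y by (rule Lim_transform_eventually[rotated])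
  qed
  then have "qf A y \<le> (t + 1 / Suc n) * (norm y)\<^sup>2" for n
    by (intro specg_le)
  moreover have "(\<lambda>n. (t + 1 / Suc n) * (norm y)\<^sup>2) \<longlonglongrightarrow> (t + 0) * (norm y)\<^sup>2"
    using LIMSEQ_inverse_real_of_nat by (intro tendsto_intros) (simp add: inverse_eq_divide)
  ultimately have "qf A y \<le> t * (norm y)\<^sup>2"
    using LIMSEQ_le_const by (metis (no_types, lifting) add_0_right)
  then have "y = 0" using specg_ge[OF gy] by linarith
  then have sq0: "(\<lambda>n. (norm (?y n))\<^sup>2) \<longlonglongrightarrow> (norm (0::'a))\<^sup>2" using y by (intro tendsto_intros) simp
  have yeq: "(norm (?y n))\<^sup>2 = ?F n - qf (specg A t) x" for n
    using prj_inner[OF prj_diff(1)[OF prj_specg prj_specg specg_mono[of t "t + 1 / Suc n"]], of x]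
    by (simp add: apply_simps inner_expand)
  have "(\<lambda>n. ?F n - qf (specg A t) x) \<longlonglongrightarrow> 0"
    using sq0 unfolding yeq by (simp only: norm_zero power_zero_numeral)
  then show ?thesis by (rule LIM_zero_cancel)
qed

lemma specg_right_continuous: "continuous (at_right t) (\<lambda>t. qf (specg A t) x)"
proof -
  let ?F = "\<lambda>t. qf (specg A t) x"
  have "\<forall>\<^sub>F s in at_right t. dist (?F s) (?F t) < e" if e: "e > 0" for e
  proof -
    obtain n where n: "dist (?F (t + 1 / Suc n)) (?F t) < e"
      using specg_right_continuous_seq[of t x] e unfolding LIMSEQ_def by blast
    have "dist (?F s) (?F t) < e" if "t < s" "s < t + 1 / Suc n" for s
      using specg_inner_mono[of t s x] specg_inner_mono[of s "t + 1 / Suc n" x] n that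
      by (auto simp: dist_real_def)
    then show ?thesis
      unfolding eventually_at_right_field by (intro exI[of _ "t + 1 / Suc n"]) auto
  qed
  then show ?thesis unfolding continuous_within tendsto_iff by blast
qed

section \<open>Stieltjes measures of the resolution and the projections behind them\<close>

definition mu :: "'a \<Rightarrow> real measure" where
  "mu x = interval_measure (\<lambda>t. qf (specg A t) x)"

lemma sets_mu [simp, measurable_cong]: "sets (mu x) = sets borel" and space_mu [simp]: "space (mu x) = UNIV"
  by (simp_all add: mu_def)

lemma emeasure_mu_Ioc: "a \<le> b \<Longrightarrow> emeasure (mu x) {a<..b} =
   ennreal (qf (specg A b) x - qf (specg A a) x)"
  unfolding mu_def
  by (rule emeasure_interval_measure_Ioc) (auto intro: specg_inner_mono specg_right_continuous)

lemma emeasure_mu_incseq: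
  assumes "incseq S" "\<And>n. S n \<in> sets borel" "\<forall>\<^sub>F n in sequentially. emeasure (mu x) (S n) = c"
  shows "emeasure (mu x) (\<Union>n. S n) = c"
proof -
  have "(\<lambda>n. emeasure (mu x) (S n)) \<longlonglongrightarrow> emeasure (mu x) (\<Union>n. S n)"
    by (rule Lim_emeasure_incseq) (use assms in auto)
  moreover have "(\<lambda>n. emeasure (mu x) (S n)) \<longlonglongrightarrow> c"
    by (rule tendsto_eventually) (rule assms(3))
  ultimately show ?thesis by (rule LIMSEQ_unique)
qed

lemma eventually_real_ge: "\<forall>\<^sub>F n in sequentially. (a::real) < real n"
  using filterlim_real_sequentially by (simp add: filterlim_at_top_dense)

lemma emeasure_mu_atMost: "emeasure (mu x) {..t} = ennreal (qf (specg A t) x)"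
proof -
  have "\<forall>\<^sub>F n in sequentially. emeasure (mu x) {- real n<..t} = ennreal (qf (specg A t) x)"
    using eventually_real_ge[of "norm A"] eventually_real_ge[of "- t"]
  proof eventually_elim
    case (elim n) then show ?case by (simp add: emeasure_mu_Ioc specg_below blinfun.zero_left)
  qed
  then have "emeasure (mu x) (\<Union>n. {- real n<..t}) = ennreal (qf (specg A t) x)"
    by (intro emeasure_mu_incseq) (auto simp: incseq_def)
  moreover have "(\<Union>n. {- real n<..t}) = {..t}" by (auto simp: minus_less_iff intro: reals_Archimedean2)
  ultimately show ?thesis by simp
qed

lemma emeasure_mu_UNIV: "emeasure (mu x) UNIV = ennreal ((norm x)\<^sup>2)"
proof -
  have "\<forall>\<^sub>F n in sequentially. emeasure (mu x) {..real n} = ennreal ((norm x)\<^sup>2)"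
    using eventually_real_ge[of "norm A"]
    by eventually_elim (simp add: emeasure_mu_atMost specg_above power2_norm_eq_inner)
  then have "emeasure (mu x) (\<Union>n. {..real n}) = ennreal ((norm x)\<^sup>2)"
    by (intro emeasure_mu_incseq) (auto simp: incseq_def)
  moreover have "(\<Union>n. {..real n}) = UNIV" using real_arch_simple by auto
  ultimately show ?thesis by simp
qed

lemma finite_mu: "finite_measure (mu x)"
  by (rule finite_measureI) (simp add: emeasure_mu_UNIV)

text \<open>A Dynkin class argument starting from half-lines. Disjoint sets have orthogonal
  projections because their measures add up to at most the squared norm of \<open>x\<close>, so a
  countable union yields an orthogonal sum.\<close>

lemma spec_ex:
  assumes "S \<in> sets borel"
  shows "\<exists>P. prj P \<and> (\<forall>U. U \<odot> A = A \<odot> U \<longrightarrow> U \<odot> P = P \<odot> U) \<and>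
    (\<forall>x. emeasure (mu x) S = ennreal (qf P x))"
proof -
  have b: "sets borel = sigma_sets UNIV (range (\<lambda>a::real. {..a}))"
    by (subst borel_eq_atMost) simp
  have "Int_stable (range (\<lambda>a::real. {..a}))" by (auto simp: Int_stable_def)
  moreover have "range (\<lambda>a::real. {..a}) \<subseteq> Pow UNIV" by simp
  moreover have "S \<in> sigma_sets UNIV (range (\<lambda>a::real. {..a}))" using assms b by simp
  ultimately show ?thesis
  proof (induction rule: sigma_sets_induct_disjoint)
    case (basic S)
    then obtain t where "S = {..t}" by auto
    then show ?case using specg_commute emeasure_mu_atMost by (intro exI[of _ "specg A t"]) auto
  next
    case empty
    show ?case by (intro exI[of _ 0]) (auto simp: blinfun.zero_left)
  next
    case (compl S)
    then obtain P where P: "prj P" "\<And>U. U \<odot> A = A \<odot> U \<Longrightarrow> U \<odot> P = P \<odot> U"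
      "\<And>x. emeasure (mu x) S = ennreal (qf P x)" by blast
    have S: "S \<in> sets borel" using compl b by simp
    have "emeasure (mu x) (UNIV - S) = ennreal (qf (\<one> - P) x)" for x
    proof -
      have "emeasure (mu x) (UNIV - S) = emeasure (mu x) UNIV - emeasure (mu x) S"
        using emeasure_compl[of S "mu x"] S P(3) by simp
      then show ?thesis
        using pos_ge[OF prj_pos[OF P(1)], of x]
        by (simp add: P(3) emeasure_mu_UNIV ennreal_minus apply_simps inner_expand power2_norm_eq_inner)
    qed
    then show ?case using P by (intro exI[of _ "\<one> - P"]) (simp add: prj_compl op_distrib)
  next
    case (union F)
    then obtain P where P: "\<And>i. prj (P i)" "\<And>i U. U \<odot> A = A \<odot> U \<Longrightarrow> U \<odot> P i = P i \<odot> U"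
      "\<And>i x. emeasure (mu x) (F i) = ennreal (qf (P i) x)" by metis
    have F: "F i \<in> sets borel" for i using union b by auto
    have nn: "0 \<le> qf (P i) x" for i x using pos_ge[OF prj_pos[OF P(1)]] .
    have "qf (P i) x + qf (P j) x \<le> (norm x)\<^sup>2" if "i \<noteq> j" for i j x
    proof -
      have "ennreal (qf (P i) x + qf (P j) x) =
        emeasure (mu x) (F i) + emeasure (mu x) (F j)" by (simp add: P(3) nn ennreal_plus)
      also have "\<dots> = emeasure (mu x) (F i \<union> F j)"
        using union(1) that F by (intro plus_emeasure) (auto simp: disjoint_family_on_def)
      also have "\<dots> \<le> emeasure (mu x) UNIV" using F by (intro emeasure_mono) auto
      finally show ?thesis by (simp add: emeasure_mu_UNIV)
    qed
    then have orth: "orth_prjs UNIV P" unfolding orth_prjs_def using P(1) prj_orth_of_bound by blast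
    note Q = prj_opsum[OF orth]
    have "emeasure (mu x) (\<Union>i. F i) = ennreal (qf (opsum P UNIV) x)" for x
    proof -
      have "emeasure (mu x) (\<Union>i. F i) = (\<Sum>i. emeasure (mu x) (F i))"
        using union(1) F by (intro suminf_emeasure[symmetric]) auto
      also have "\<dots> = (\<Sum>i. ennreal (qf (P i) x))" by (simp add: P(3))
      also have "\<dots> = ennreal (qf (opsum P UNIV) x)"
        by (rule suminf_ennreal_eq[OF nn has_sum_imp_sums[OF Q(5)]])
      finally show ?thesis .
    qed
    moreover have "U \<odot> opsum P UNIV = opsum P UNIV \<odot> U" if "U \<odot> A = A \<odot> U" for U
      by (rule op_sum_commute[OF Q(1)]) (rule P(2)[OF that])
    ultimately show ?case using Q(2) by blast
  qed
qed

definition spec :: "real set \<Rightarrow> 'a operator" where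
  "spec S = (SOME P. prj P \<and> (\<forall>U. U \<odot> A = A \<odot> U \<longrightarrow> U \<odot> P = P \<odot> U) \<and>
    (\<forall>x. emeasure (mu x) S = ennreal (qf P x)))"

lemma spec_proj:
  assumes "S \<in> sets borel"
  shows "prj (spec S)" "U \<odot> A = A \<odot> U \<Longrightarrow> U \<odot> spec S = spec S \<odot> U"
    "emeasure (mu x) S = ennreal (qf (spec S) x)"
proof -
  note q = someI_ex[OF spec_ex[OF assms], folded spec_def]
  show "prj (spec S)" using q by (rule conjunct1)
  show "U \<odot> A = A \<odot> U \<Longrightarrow> U \<odot> spec S = spec S \<odot> U"
    using conjunct1[OF conjunct2[OF q]] by (rule allE) (erule (1) mp)
  show "emeasure (mu x) S = ennreal (qf (spec S) x)"
    using conjunct2[OF conjunct2[OF q]] by (rule spec)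
qed

lemma spec_eqI:
  assumes "S \<in> sets borel" "prj P" "\<And>x. emeasure (mu x) S = ennreal (qf P x)"
  shows "spec S = P"
proof (rule sa_eqI)
  fix x
  have "ennreal (qf (spec S) x) = ennreal (qf P x)"
    using spec_proj(3)[OF assms(1)] assms(3) by metis
  then show "qf (spec S) x = qf P x"
    using pos_ge[OF prj_pos[OF assms(2)], of x] pos_ge[OF prj_pos[OF spec_proj(1)[OF assms(1)]], of x] by simp
qed (use assms spec_proj(1) prj_sa in auto)

lemma spec_atMost: "spec {..t} = specg A t"
  by (rule spec_eqI) (auto simp: emeasure_mu_atMost)

lemma spec_UNIV: "spec UNIV = \<one>"
  by (rule spec_eqI) (auto simp: emeasure_mu_UNIV power2_norm_eq_inner)

lemma spec_empty: "spec {} = 0"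
  by (rule spec_eqI) (auto simp: blinfun.zero_left)

lemma spec_disjoint:
  assumes "S \<in> sets borel" "T \<in> sets borel" "S \<inter> T = {}"
  shows "spec S \<odot> spec T = 0" "spec (S \<union> T) = spec S + spec T"
proof -
  have nn: "0 \<le> qf (spec S) x" if "S \<in> sets borel" for S x
    using pos_ge[OF prj_pos[OF spec_proj(1)[OF that]]] .
  have e: "ennreal (qf (spec S) x + qf (spec T) x) = emeasure (mu x) (S \<union> T)" for x
    using assms plus_emeasure[of S "mu x" T] by (simp add: spec_proj(3) nn ennreal_plus)
  show o: "spec S \<odot> spec T = 0"
  proof (rule prj_orth_of_bound[OF spec_proj(1)[OF assms(1)] spec_proj(1)[OF assms(2)]])
    fix x
    have "ennreal (qf (spec S) x + qf (spec T) x) \<le> emeasure (mu x) UNIV"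
      unfolding e using assms by (intro emeasure_mono) auto
    then show "qf (spec S) x + qf (spec T) x \<le> (norm x)\<^sup>2"
      by (simp add: emeasure_mu_UNIV)
  qed
  show "spec (S \<union> T) = spec S + spec T"
    by (rule spec_eqI) (use assms o spec_proj(1) in \<open>auto simp: e[symmetric] apply_simps inner_expand intro: prj_add(1)\<close>)
qed

lemma spec_subset:
  assumes "S \<in> sets borel" "T \<in> sets borel" "S \<subseteq> T"
  shows "spec T \<odot> spec S = spec S" "spec S \<odot> spec T = spec S"
proof -
  have "spec T = spec S + spec (T - S)"
    using spec_disjoint(2)[of S "T - S"] assms by (simp add: Un_absorb1 Diff_partition)
  moreover have "spec S \<odot> spec (T - S) = 0" "spec (T - S) \<odot> spec S = 0"
    using assms by (auto intro!: spec_disjoint(1))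
  ultimately show "spec T \<odot> spec S = spec S" "spec S \<odot> spec T = spec S"
    using spec_proj(1)[OF assms(1)] by (simp_all add: op_distrib prj_idem)
qed

lemma spec_diff:
  assumes "S \<in> sets borel" "T \<in> sets borel" "S \<subseteq> T"
  shows "spec (T - S) = spec T - spec S"
  using spec_disjoint(2)[of S "T - S"] assms by (simp add: Un_absorb1 Diff_partition)

lemma spec_Compl: "S \<in> sets borel \<Longrightarrow> spec (- S) = \<one> - spec S"
  using spec_diff[of S UNIV] by (simp add: spec_UNIV Compl_eq_Diff_UNIV)

lemma spec_sum:
  fixes F :: "nat \<Rightarrow> real set"
  assumes F: "\<And>i. F i \<in> sets borel" "disjoint_family F"
  shows "orth_prjs UNIV (\<lambda>i. spec (F i))"
    and "((\<lambda>i. ap (spec (F i)) x) has_sum ap (spec (\<Union>i. F i)) x) UNIV"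
proof -
  show o: "orth_prjs UNIV (\<lambda>i. spec (F i))"
    unfolding orth_prjs_def using assms by (auto intro!: spec_proj spec_disjoint simp: disjoint_family_on_def)
  note Q = prj_opsum[OF o]
  have nn: "0 \<le> qf (spec (F i)) x" for i x using pos_ge[OF prj_pos[OF spec_proj(1)[OF F(1)]]] .
  have "spec (\<Union>i. F i) = opsum (\<lambda>i. spec (F i)) UNIV"
  proof (rule spec_eqI[OF _ Q(2)])
    show "(\<Union>i. F i) \<in> sets borel" using F by auto
    fix x
    have "emeasure (mu x) (\<Union>i. F i) = (\<Sum>i. emeasure (mu x) (F i))"
      using F by (intro suminf_emeasure[symmetric]) auto
    also have "\<dots> = (\<Sum>i. ennreal (qf (spec (F i)) x))" by (simp add: spec_proj(3) F)
    also have "\<dots> = ennreal (qf (opsum (\<lambda>i. spec (F i)) UNIV) x)"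
      by (rule suminf_ennreal_eq[OF nn has_sum_imp_sums[OF Q(5)]])
    finally show "emeasure (mu x) (\<Union>i. F i) = ennreal (qf (opsum (\<lambda>i. spec (F i)) UNIV) x)" .
  qed
  then show "((\<lambda>i. ap (spec (F i)) x) has_sum ap (spec (\<Union>i. F i)) x) UNIV"
    using Q(1) by simp
qed

lemma spec_commute_op: "S \<in> sets borel \<Longrightarrow> A \<odot> spec S = spec S \<odot> A"
  by (rule spec_proj(2)) auto

lemma spec_atMost_le:
  assumes "S \<in> sets borel" "S \<subseteq> {..t}" "ap (spec S) y = y"
  shows "qf A y \<le> t * (norm y)\<^sup>2"
proof (rule specg_le)
  have "specg A t \<odot> spec S = spec S" using spec_subset(1)[of S "{..t}"] assms by (simp add: spec_atMost)
  then show "ap (specg A t) y = y" using assms(3) by (metis blinfun_apply_blinfun_compose)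
qed

lemma spec_greaterThan_ge:
  assumes "S \<in> sets borel" "S \<subseteq> {t<..}" "ap (spec S) y = y"
  shows "t * (norm y)\<^sup>2 \<le> qf A y"
    "t * (norm y)\<^sup>2 = qf A y \<Longrightarrow> y = 0"
proof -
  have "specg A t \<odot> spec S = 0" using spec_disjoint(1)[of "{..t}" S] assms by (simp add: spec_atMost) force
  then have "ap (specg A t) y = 0" using assms(3)
    by (metis blinfun.zero_left blinfun_apply_blinfun_compose)
  then show "t * (norm y)\<^sup>2 \<le> qf A y"
    "t * (norm y)\<^sup>2 = qf A y \<Longrightarrow> y = 0" using specg_ge by blast+
qed

lemma spec_atLeast_ge:
  assumes "S \<in> sets borel" "S \<subseteq> {t..}" "ap (spec S) y = y"
  shows "t * (norm y)\<^sup>2 \<le> qf A y"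
proof -
  have "(t - 1 / Suc n) * (norm y)\<^sup>2 \<le> qf A y" for n
    by (rule spec_greaterThan_ge(1)[OF assms(1) _ assms(3)]) (use assms(2) in \<open>auto intro: less_le_trans[of _ t]\<close>)
  moreover have "(\<lambda>n. (t - 1 / Suc n) * (norm y)\<^sup>2) \<longlonglongrightarrow> (t - 0) * (norm y)\<^sup>2"
    using LIMSEQ_inverse_real_of_nat by (intro tendsto_intros) (simp add: inverse_eq_divide)
  ultimately show ?thesis using LIMSEQ_le_const2 by (metis (no_types, lifting) diff_0_right)
qed

text \<open>On the range of \<open>spec {b}\<close> the bounds from both sides make the form equal
  to \<open>b\<close> times the squared norm. Conversely, an eigenvector has no component in a set
  on either side of \<open>b\<close>.\<close>

lemma spec_singleton: "spec {b} = kerp (A - b *\<^sub>R \<one>)"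
proof (rule sa_eqI)
  let ?k = "kerp (A - b *\<^sub>R \<one>)"
  have com: "A \<odot> ?k = ?k \<odot> A"
    by (rule kerp_commute_sa[OF shift_sa]) (simp add: op_distrib op_scale)
  have comS: "spec S \<odot> ?k = ?k \<odot> spec S" if "S \<in> sets borel" for S by (rule spec_proj(2)[OF that com[symmetric], symmetric])
  have 1: "?k \<odot> spec {b} = spec {b}"
  proof (rule kerp_comp, rule blinfun_eqI)
    fix x
    let ?y = "ap (spec {b}) x"
    have yy: "ap (spec {b}) ?y = ?y" using spec_proj(1)[of "{b}"] by (simp add: prj_idem_apply)
    define P where "P = posp (A - b *\<^sub>R \<one>)"
    have pP: "pos P" and pN: "pos (negp (A - b *\<^sub>R \<one>))" unfolding P_def by (rule posp[OF shift_sa])+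
    have "specg A b \<odot> spec {b} = spec {b}" using spec_subset(1)[of "{b}" "{..b}"] by (simp add: spec_atMost)
    then have "ap (specg A b) ?y = ?y" by (metis blinfun_apply_blinfun_compose)
    then have Py: "ap P ?y = 0" by (simp add: specg_def kerp_eq_iff P_def)
    have "b * (norm ?y)\<^sup>2 \<le> qf A ?y" by (rule spec_atLeast_ge[OF _ _ yy]) auto
    then have "qf (negp (A - b *\<^sub>R \<one>)) ?y = 0"
      using inner_shift[of ?y b] Py pos_ge[OF pN, of ?y] by (simp add: P_def)
    then have "ap (negp (A - b *\<^sub>R \<one>)) ?y = 0" by (rule pos_inner_zero[OF pN])
    then have "ap (A - b *\<^sub>R \<one>) ?y = 0"
      using Py posp(3)[OF shift_sa, of b] by (metis P_def blinfun.diff_left diff_zero)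
    then show "ap ((A - b *\<^sub>R \<one>) \<odot> spec {b}) x = ap 0 x" by (simp add: blinfun.zero_left)
  qed
  have ky: "qf A y = b * (norm y)\<^sup>2" if "ap ?k y = y" for y
    using that by (simp add: kerp_eq_iff apply_simps power2_norm_eq_inner)
  have z: "spec S \<odot> ?k = 0" if S: "S \<in> sets borel" "S \<subseteq> {b<..} \<or> S \<subseteq> {..<b}" for S
  proof (rule blinfun_eqI)
    fix x
    let ?y = "ap (spec S \<odot> ?k) x"
    have y1: "ap (spec S) ?y = ?y" using spec_proj(1)[OF S(1)] by (simp add: prj_idem_apply)
    have "?k \<odot> (spec S \<odot> ?k) = spec S \<odot> ?k" using comS[OF S(1)] prj_idem[OF prj_kerp] by (metis op_assoc)
    then have y2: "ap ?k ?y = ?y" by (metis blinfun_apply_blinfun_compose)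
    show "?y = ap 0 x"
    proof (cases "S \<subseteq> {b<..}")
      case True
      then show ?thesis using spec_greaterThan_ge(2)[OF S(1) True y1] ky[OF y2] by (simp add: blinfun.zero_left)
    next
      case False
      then have Sb: "S \<subseteq> {..<b}" using S(2) by blast
      \<comment> \<open>The strict inequality is available only above \<open>b\<close>; below it,
        the set is exhausted by pieces at distance \<open>1 / Suc n\<close> from
        \<open>b\<close>.\<close>
      have yn: "ap (spec (S \<inter> {..b - 1 / Suc n})) ?y = 0" for n
      proof -
        let ?T = "S \<inter> {..b - 1 / Suc n}"
        have T: "?T \<in> sets borel" using S(1) by auto
        let ?z = "ap (spec ?T) ?y"
        have zz: "ap (spec ?T) ?z = ?z" using spec_proj(1)[OF T] by (simp add: prj_idem_apply)
        have "?k \<odot> spec ?T = spec ?T \<odot> ?k" using comS[OF T] by simp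
        then have "ap ?k ?z = ?z" using y2 by (metis blinfun_apply_blinfun_compose)
        then have "b * (norm ?z)\<^sup>2 \<le> (b - 1 / Suc n) * (norm ?z)\<^sup>2"
          using spec_atMost_le[OF T _ zz, of "b - 1 / Suc n"] ky[of ?z] by simp
        then have "(1 / Suc n) * (norm ?z)\<^sup>2 \<le> 0" by (simp add: algebra_simps)
        then have "(norm ?z)\<^sup>2 \<le> 0" by (simp add: divide_le_0_iff)
        then show ?thesis by simp
      qed
      let ?S = "\<lambda>n. S \<inter> {..b - 1 / Suc n}"
      have "(\<lambda>n. emeasure (mu ?y) (?S n)) \<longlonglongrightarrow> emeasure (mu ?y) (\<Union>n. ?S n)"
        by (rule Lim_emeasure_incseq) (use S(1) in \<open>auto simp: incseq_def frac_le intro: order_trans\<close>)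
      moreover have "(\<Union>n. ?S n) = S"
      proof -
        have "\<exists>n. t \<le> b - 1 / Suc n" if t: "t \<in> S" for t
        proof -
          obtain n where "inverse (real (Suc n)) < b - t" using reals_Archimedean[of "b - t"] Sb t by auto
          then have "t \<le> b - 1 / Suc n" unfolding inverse_eq_divide by linarith
          then show ?thesis ..
        qed
        then show ?thesis by auto
      qed
      moreover have z0: "emeasure (mu ?y) (?S n) = 0" for n using spec_proj(3)[of "?S n" ?y] S(1) yn[of n] by simp
      moreover have "(\<lambda>n. emeasure (mu ?y) (?S n)) \<longlonglongrightarrow> 0" unfolding z0 by simp
      ultimately have "emeasure (mu ?y) S = 0" using LIMSEQ_unique by metis
      then have "inner ?y ?y \<le> 0" using spec_proj(3)[OF S(1), of ?y] y1 by (simp add: ennreal_eq_0_iff)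
      then show ?thesis by (simp add: blinfun.zero_left) (metis inner_gt_zero_iff not_le)
    qed
  qed
  have "\<one> = spec {b} + (spec {b<..} + spec {..<b})"
  proof -
    have "spec ({b<..} \<union> {..<b}) = spec {b<..} + spec {..<b}" by (rule spec_disjoint(2)) auto
    moreover have "spec ({b} \<union> ({b<..} \<union> {..<b})) = spec {b} + spec ({b<..} \<union> {..<b})"
      by (rule spec_disjoint(2)) auto
    moreover have "{b} \<union> ({b<..} \<union> {..<b}) = UNIV" by auto
    ultimately show ?thesis by (simp add: spec_UNIV)
  qed
  then have "\<one> \<odot> ?k = (spec {b} + (spec {b<..} + spec {..<b})) \<odot> ?k" by simp
  also have "\<dots> = spec {b} \<odot> ?k" using z[of "{b<..}"] z[of "{..<b}"] by (simp add: op_distrib)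
  finally have 2: "spec {b} \<odot> ?k = ?k" by simp
  have eq: "spec {b} = ?k" using 1 2 comS[of "{b}"] by simp
  show "qf (spec {b}) x = qf ?k x" for x by (simp add: eq)
  show "(spec {b})\<^sup>\<star> = spec {b}" by (simp add: eq)
qed simp

end

section \<open>Integration against the spectral measure\<close>

text \<open>On a uniform partition of mesh \<open>h\<close> the increments add up to at most
  \<open>h * (F b - F a)\<close>, which tends to zero.\<close>

lemma constant_of_small_increments:
  fixes D F :: "real \<Rightarrow> real"
  assumes "\<And>s t. s \<le> t \<Longrightarrow> \<bar>D t - D s\<bar> \<le> (t - s) * (F t - F s)" and ab: "a \<le> b"
  shows "D a = D b"
proof -
  have "\<bar>D b - D a\<bar> \<le> (b - a) * (F b - F a) / Suc N" for N
  proof -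
    define h where "h = (b - a) / Suc N"
    define p where "p i = a + real i * h" for i
    have h: "h \<ge> 0" using ab by (simp add: h_def)
    have pN: "p (Suc N) = b" by (simp add: p_def h_def del: of_nat_Suc)
    have "D b - D a = (\<Sum>i<Suc N. D (p (Suc i)) - D (p i))"
      by (subst sum_lessThan_telescope) (simp add: pN, simp add: p_def)
    also have "\<bar>\<dots>\<bar> \<le> (\<Sum>i<Suc N. \<bar>D (p (Suc i)) - D (p i)\<bar>)" by (rule sum_abs)
    also have "\<dots> \<le> (\<Sum>i<Suc N. h * (F (p (Suc i)) - F (p i)))"
    proof (rule sum_mono)
      fix i
      have "p (Suc i) - p i = h" by (simp add: p_def algebra_simps)
      then show "\<bar>D (p (Suc i)) - D (p i)\<bar> \<le> h * (F (p (Suc i)) - F (p i))"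
        using assms(1)[of "p i" "p (Suc i)"] h by simp
    qed
    also have "\<dots> = h * (\<Sum>i<Suc N. F (p (Suc i)) - F (p i))" by (rule sum_distrib_left[symmetric])
    also have "(\<Sum>i<Suc N. F (p (Suc i)) - F (p i)) = F b - F a"
      by (subst sum_lessThan_telescope) (simp add: pN, simp add: p_def)
    finally show ?thesis by (simp add: h_def)
  qed
  moreover have "(\<lambda>N. (b - a) * (F b - F a) / Suc N) \<longlonglongrightarrow> 0"
    by (rule LIMSEQ_Suc[OF lim_const_over_n])
  ultimately have "\<bar>D b - D a\<bar> \<le> 0" using LIMSEQ_le_const by blast
  then show ?thesis by simp
qed

context
  fixes A :: "'a::hilbert_space operator"
  assumes A: "A\<^sup>\<star> = A"
begin

lemma AE_mu: "AE t in mu A x. t \<in> {- (norm A + 1)<..norm A + 1}"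
proof -
  have "emeasure (mu A x) {- (norm A + 1)<..norm A + 1} = emeasure (mu A x) UNIV"
    by (simp add: emeasure_mu_Ioc[OF A] specg_below[OF A] specg_above[OF A] blinfun.zero_left
        emeasure_mu_UNIV[OF A] power2_norm_eq_inner)
  then have "emeasure (mu A x) (space (mu A x) - {- (norm A + 1)<..norm A + 1}) = 0"
    using emeasure_compl[of "{- (norm A + 1)<..norm A + 1}" "mu A x"]
    by (simp add: sets_mu[OF A] space_mu[OF A] emeasure_mu_UNIV[OF A])
  then show ?thesis
    by (intro AE_I[where N="space (mu A x) - {- (norm A + 1)<..norm A + 1}"]) (auto simp: sets_mu[OF A] space_mu[OF A])
qed

lemma integrable_mu:
  assumes "S \<in> sets borel"
  shows "integrable (mu A x) (\<lambda>t. indicator S t * t)"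
proof (rule finite_measure.integrable_const_bound[OF finite_mu[OF A], where B="norm A + 1"])
  show "AE t in mu A x. norm (indicator S t * t) \<le> norm A + 1"
    using AE_mu[of x] by eventually_elim (auto simp: indicator_def)
  have "(\<lambda>t. indicator S t * t) \<in> borel_measurable borel" using assms by measurable
  then show "(\<lambda>t. indicator S t * t) \<in> borel_measurable (mu A x)"
    by (simp add: measurable_cong_sets[OF sets_mu[OF A] refl])
qed

text \<open>On each interval the increments of the form of \<open>A\<close> and of the truncated
  integral both lie between \<open>a * (F b - F a)\<close> and \<open>b * (F b - F a)\<close>. Their
  difference \<open>D\<close> is therefore constant, and it vanishes left of the spectrum.\<close>

lemma integral_mu: "integral\<^sup>L (mu A x) (\<lambda>t. t) = qf A x"
proof -
  define K where "K = norm A + 1"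
  define F where "F t = qf (specg A t) x" for t
  define G where "G t = integral\<^sup>L (mu A x) (\<lambda>s. indicator {..t} s * s)" for t
  define D where "D t = inner (ap A (ap (specg A t) x)) x - G t" for t
  have "D (-K) = D K"
  proof (rule constant_of_small_increments[where F=F and D=D and a="-K" and b=K])
    show "- K \<le> K" using norm_ge_zero[of A] unfolding K_def by linarith
    fix a b :: real assume ab: "a \<le> b"
    let ?y = "ap (spec A {a<..b}) x"
    have sp: "prj (spec A {a<..b})" by (rule spec_proj(1)[OF A]) simp
    have yy: "ap (spec A {a<..b}) ?y = ?y" using sp by (rule prj_idem_apply)
    have "{a<..b} = {..b} - {..a}" by auto
    then have dif: "spec A {a<..b} = specg A b - specg A a"
      using spec_diff[OF A, of "{..a}" "{..b}"] ab by (simp add: spec_atMost[OF A])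
    have m: "(norm ?y)\<^sup>2 = F b - F a"
      using prj_inner[OF sp, of x] unfolding dif F_def by (simp add: apply_simps inner_expand)
    have F: "F b - F a \<ge> 0" unfolding m[symmetric] by simp
    have "A \<odot> spec A {a<..b} = spec A {a<..b} \<odot> A" by (rule spec_commute_op[OF A]) simp
    then have "qf A ?y = inner (ap A ?y) x"
      by (metis inner_radj prj_sa[OF sp] yy blinfun_apply_blinfun_compose)
    also have "\<dots> = inner (ap A (ap (specg A b) x)) x - inner (ap A (ap (specg A a) x)) x"
      unfolding dif by (simp add: apply_simps inner_expand)
    finally have Ay: "qf A ?y =
      inner (ap A (ap (specg A b) x)) x - inner (ap A (ap (specg A a) x)) x" .
    have sub: "{a<..b} \<subseteq> {..b}" "{a<..b} \<subseteq> {a<..}" by auto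
    have up: "qf A ?y \<le> b * (F b - F a)"
      using spec_atMost_le[OF A _ sub(1) yy] m by simp
    have lo: "a * (F b - F a) \<le> qf A ?y"
      using spec_greaterThan_ge(1)[OF A _ sub(2) yy] m by simp
    have me: "measure (mu A x) {a<..b} = F b - F a"
      using emeasure_mu_Ioc[OF A ab, of x] F unfolding measure_def F_def by simp
    have intc: "integrable (mu A x) (\<lambda>s. c * indicator {a<..b} s)" for c :: real
      using finite_measure.emeasure_finite[OF finite_mu[OF A], of x "{a<..b}"]
      by (intro integrable_mult_right integrable_real_indicator) (auto simp: sets_mu[OF A] less_top)
    have cint: "integral\<^sup>L (mu A x) (\<lambda>s. c * indicator {a<..b} s) = c * (F b - F a)" for c :: real
      by (simp add: me space_mu[OF A])
    have G: "G b - G a = integral\<^sup>L (mu A x) (\<lambda>s. indicator {a<..b} s * s)"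
      unfolding G_def
    proof (subst Bochner_Integration.integral_diff[symmetric])
      show "integral\<^sup>L (mu A x) (\<lambda>s. indicator {..b} s * s - indicator {..a} s * s) =
        integral\<^sup>L (mu A x) (\<lambda>s. indicator {a<..b} s * s)"
        using ab by (intro Bochner_Integration.integral_cong) (auto simp: indicator_def)
    qed (rule integrable_mu, simp)+
    have "integral\<^sup>L (mu A x) (\<lambda>s. a * indicator {a<..b} s) \<le> G b - G a"
      unfolding G by (rule integral_mono[OF intc integrable_mu]) (auto simp: indicator_def)
    moreover have "G b - G a \<le> integral\<^sup>L (mu A x) (\<lambda>s. b * indicator {a<..b} s)"
      unfolding G by (rule integral_mono[OF integrable_mu intc]) (auto simp: indicator_def)
    ultimately have "a * (F b - F a) \<le> G b - G a" "G b - G a \<le> b * (F b - F a)" unfolding cint by auto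
    then show "\<bar>D b - D a\<bar> \<le> (b - a) * (F b - F a)"
      using up lo Ay unfolding D_def by (simp add: algebra_simps abs_le_iff)
  qed
  moreover have "D (-K) = 0"
  proof -
    have "AE s in mu A x. indicator {..-K} s * s = 0"
      using AE_mu[of x] by eventually_elim (auto simp: indicator_def K_def)
    then have "G (-K) = 0" unfolding G_def by (rule integral_eq_zero_AE)
    then show ?thesis by (simp add: D_def K_def specg_below[OF A] blinfun.zero_left blinfun.zero_right)
  qed
  moreover have "G K = integral\<^sup>L (mu A x) (\<lambda>t. t)"
    unfolding G_def
  proof (rule integral_cong_AE)
    show "AE s in mu A x. indicator {..K} s * s = s"
      using AE_mu[of x] by eventually_elim (auto simp: indicator_def K_def)
  qed (auto simp: measurable_cong_sets[OF sets_mu[OF A] refl])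
  ultimately show ?thesis by (simp add: D_def K_def specg_above[OF A])
qed

text \<open>The scalar is the infimum of the levels whose spectral projection contains
  \<open>Y\<close>; at all lower levels the projection is orthogonal to \<open>Y\<close>, so upper
  and lower bounds of the form meet.\<close>

lemma scalar_on_projection:
  assumes Y: "prj Y" "Y \<noteq> 0" "A \<odot> Y = Y \<odot> A"
    and triv: "\<And>t. specg A t \<odot> Y = 0 \<or> specg A t \<odot> Y = Y"
  shows "\<exists>c. A \<odot> Y = c *\<^sub>R Y"
proof -
  define S where "S = {t. specg A t \<odot> Y = Y}"
  have S: "norm A + 1 \<in> S" "bdd_below S"
  proof -
    show "norm A + 1 \<in> S" by (simp add: S_def specg_above[OF A])
    have "- norm A \<le> t" if "t \<in> S" for t
      using that Y(2) specg_below[OF A, of t] by (cases "t < - norm A") (auto simp: S_def)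
    then show "bdd_below S" by (rule bdd_belowI)
  qed
  let ?c = "Inf S"
  have yx: "nsq Y x = qf Y x" for x using Y(1) by (simp add: prj_inner)
  have e: "qf A y = ?c * (norm y)\<^sup>2" if y: "ap Y y = y" for y
  proof (rule antisym)
    have up: "qf A y \<le> t * (norm y)\<^sup>2" if "t \<in> S" for t
    proof -
      have "specg A t \<odot> Y = Y" using that by (simp add: S_def)
      then have "ap (specg A t) y = y" using y by (metis blinfun_apply_blinfun_compose)
      then show ?thesis by (rule specg_le[OF A])
    qed
    show "qf A y \<le> ?c * (norm y)\<^sup>2"
    proof (cases "y = 0")
      case False
      have "qf A y / (norm y)\<^sup>2 \<le> ?c"
        using up False S(1) by (intro cInf_greatest) (auto simp: field_simps)
      then show ?thesis using False by (simp add: field_simps)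
    qed simp
    have lo: "t * (norm y)\<^sup>2 \<le> qf A y" if "t < ?c" for t
    proof -
      have "t \<notin> S" using that S(2) cInf_lower by force
      then have "specg A t \<odot> Y = 0" using triv by (auto simp: S_def)
      then have "ap (specg A t) y = 0" using y by (metis blinfun.zero_left blinfun_apply_blinfun_compose)
      then show ?thesis by (rule specg_ge[OF A])
    qed
    show "?c * (norm y)\<^sup>2 \<le> qf A y"
    proof (cases "y = 0")
      case False
      have "?c \<le> qf A y / (norm y)\<^sup>2"
        by (rule dense_le) (use lo False in \<open>auto simp: field_simps\<close>)
      then show ?thesis using False by (simp add: field_simps)
    qed simp
  qed
  have "A \<odot> Y = ?c *\<^sub>R Y"
  proof (rule sa_eqI)
    show "(A \<odot> Y)\<^sup>\<star> = A \<odot> Y" using Y A by (simp add: prj_sa)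
    show "(?c *\<^sub>R Y)\<^sup>\<star> = ?c *\<^sub>R Y" using Y by (simp add: prj_sa)
    fix x
    let ?y = "ap Y x"
    have yy: "ap Y ?y = ?y" using Y(1) by (rule prj_idem_apply)
    have "qf (A \<odot> Y) x = qf A ?y"
      by (metis Y(3) yy blinfun_apply_blinfun_compose inner_radj prj_sa[OF Y(1)])
    then show "qf (A \<odot> Y) x = qf (?c *\<^sub>R Y) x"
      using e[OF yy] yx by (simp add: apply_simps)
  qed
  then show ?thesis by blast
qed

end

section \<open>Greedy expansion of a positive operator into projections\<close>

lemma inner_conj_prj:
  assumes "prj P" "A \<odot> P = P \<odot> A"
  shows "qf A (ap P x) = inner (ap A (ap P x)) x"
  by (metis assms blinfun_apply_blinfun_compose inner_radj prj_sa prj_idem_apply)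

lemma inner_split_prj:
  assumes "prj P" "A \<odot> P = P \<odot> A"
  shows "qf A x = qf A (ap P x) +
    qf A (ap (\<one> - P) x)"
proof -
  have com: "A \<odot> (\<one> - P) = (\<one> - P) \<odot> A" using assms by (simp add: op_distrib)
  show ?thesis
    unfolding inner_conj_prj[OF assms] inner_conj_prj[OF prj_compl[OF assms(1)] com]
    by (simp add: apply_simps inner_expand)
qed

lemma norm_split_prj:
  assumes "prj P"
  shows "(norm x)\<^sup>2 = nsq P x + nsq (\<one> - P) x"
  using inner_split_prj[OF assms, of \<one> x] by (simp add: power2_norm_eq_inner)

text \<open>Subtracting \<open>a\<close> where \<open>T\<close> is at least \<open>a\<close> leaves
  at most \<open>norm T - a\<close> there, and at most \<open>a\<close> elsewhere.\<close>

lemma greedy_step: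
  assumes T: "pos T" and a: "a > 0"
  defines "P \<equiv> spec T {a..}"
  shows "prj P" "pos (T - a *\<^sub>R P)" "norm (T - a *\<^sub>R P) \<le> max a (norm T - a)"
    "U \<odot> T = T \<odot> U \<Longrightarrow> U \<odot> P = P \<odot> U" "W \<odot> T = 0 \<Longrightarrow> W\<^sup>\<star> = W \<Longrightarrow> W \<odot> P = 0"
proof -
  have sa: "T\<^sup>\<star> = T" using T by (rule pos_sa)
  show P: "prj P" unfolding P_def by (rule spec_proj(1)[OF sa]) simp
  show com: "U \<odot> T = T \<odot> U \<Longrightarrow> U \<odot> P = P \<odot> U" for U unfolding P_def by (rule spec_proj(2)[OF sa]) simp
  have TP: "T \<odot> P = P \<odot> T" by (rule com) simp
  have lo: "a * (norm y)\<^sup>2 \<le> qf T y" if "ap P y = y" for y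
    using that unfolding P_def by (rule spec_atLeast_ge[OF sa, rotated -1]) auto
  have "\<one> - P = spec T {..<a}"
    using spec_Compl[OF sa, of "{a..}"] by (simp add: P_def Compl_atLeast)
  then have up: "qf T y \<le> a * (norm y)\<^sup>2" if "ap (\<one> - P) y = y" for y
    using that by (intro spec_atMost_le[OF sa, of "{..<a}"]) auto
  let ?u = "\<lambda>x. ap P x" and ?v = "\<lambda>x. ap (\<one> - P) x"
  have u: "ap P (?u x) = ?u x" and v: "ap (\<one> - P) (?v x) = ?v x" for x
    using prj_idem_apply[OF P] prj_idem_apply[OF prj_compl[OF P]] by auto
  have q: "qf (T - a *\<^sub>R P) x =
    (qf T (?u x) - a * (norm (?u x))\<^sup>2) + qf T (?v x)" for x
    using inner_split_prj[OF P TP, of x] by (simp add: apply_simps inner_expand prj_inner[OF P])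
  show p: "pos (T - a *\<^sub>R P)"
    unfolding pos_def
  proof (intro conjI allI)
    show "(T - a *\<^sub>R P)\<^sup>\<star> = T - a *\<^sub>R P" using sa P by (simp add: prj_sa)
    fix x show "0 \<le> qf (T - a *\<^sub>R P) x"
      unfolding q using lo[OF u, of x] pos_ge[OF T, of "?v x"] by linarith
  qed
  show "norm (T - a *\<^sub>R P) \<le> max a (norm T - a)"
  proof (rule pos_norm_bound[OF p])
    show "0 \<le> max a (norm T - a)" using a by simp
    fix x
    let ?m = "max a (norm T - a)"
    have "qf T (?u x) - a * (norm (?u x))\<^sup>2 \<le> (norm T - a) * (norm (?u x))\<^sup>2"
      using inner_le_norm_op[of T "?u x"] by (simp add: algebra_simps)
    also have "\<dots> \<le> ?m * (norm (?u x))\<^sup>2" by (rule mult_right_mono) auto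
    finally have 1: "qf T (?u x) - a * (norm (?u x))\<^sup>2 \<le> ?m * (norm (?u x))\<^sup>2" .
    have "qf T (?v x) \<le> a * (norm (?v x))\<^sup>2" by (rule up[OF v])
    also have "\<dots> \<le> ?m * (norm (?v x))\<^sup>2" by (rule mult_right_mono) auto
    finally show "qf (T - a *\<^sub>R P) x \<le> ?m * (norm x)\<^sup>2"
      unfolding q norm_split_prj[OF P, of x] distrib_left using 1 by linarith
  qed
  assume W: "W \<odot> T = 0" "W\<^sup>\<star> = W"
  have "(W \<odot> T)\<^sup>\<star> = T \<odot> W" using W(2) sa by simp
  then have TW: "T \<odot> W = 0" using W(1) by simp
  then have WP: "W \<odot> P = P \<odot> W" using W(1) by (intro com) simp
  show "W \<odot> P = 0"
  proof (rule blinfun_eqI)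
    fix x
    let ?y = "ap (P \<odot> W) x"
    have "ap T ?y = 0"
      by (metis TW TP blinfun.zero_left blinfun.zero_right blinfun_apply_blinfun_compose)
    then have "a * (norm ?y)\<^sup>2 \<le> 0" using lo[of ?y] P by (simp add: prj_idem_apply)
    then have "?y = 0" using a by (simp add: mult_le_0_iff)
    then show "ap (W \<odot> P) x = ap 0 x" using WP by (simp add: blinfun.zero_left)
  qed
qed

text \<open>The sequence \<open>r\<close> bounds the norms of the successive remainders. The
  projections inherit commutation and annihilation from \<open>T\<close>, but they need not be
  orthogonal to each other.\<close>

lemma greedy_decomposition:
  assumes T: "pos (T :: 'a::hilbert_space operator)" and a: "\<And>k. a k > 0"
    and r: "norm T \<le> r 0" "\<And>k. max (a k) (r k - a k) \<le> r (Suc k)" "r \<longlonglongrightarrow> 0"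
  obtains P :: "nat \<Rightarrow> 'a::hilbert_space operator" where "\<And>k. prj (P k)"
    "\<And>k U. U \<odot> T = T \<odot> U \<Longrightarrow> U \<odot> P k = P k \<odot> U"
    "\<And>k W. W \<odot> T = 0 \<Longrightarrow> W\<^sup>\<star> = W \<Longrightarrow> W \<odot> P k = 0"
    "(\<lambda>n. \<Sum>k<n. a k *\<^sub>R P k) \<longlonglongrightarrow> T"
    "\<And>x. ((\<lambda>k. a k * qf (P k) x) has_sum qf T x) UNIV"
proof -
  define R where "R = rec_nat T (\<lambda>k S. S - a k *\<^sub>R spec S {a k..})"
  define P where "P k = spec (R k) {a k..}" for k
  have R0: "R 0 = T" and RS: "R (Suc k) = R k - a k *\<^sub>R P k" for k by (simp_all add: R_def P_def)
  have pR: "pos (R k) \<and> norm (R k) \<le> r k" for k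
  proof (induction k)
    case 0 show ?case using T r by (simp add: R0)
  next
    case (Suc k)
    have "max (a k) (norm (R k) - a k) \<le> max (a k) (r k - a k)" using Suc by auto
    from order_trans[OF greedy_step(3)[OF conjunct1[OF Suc] a] order_trans[OF this r(2)]]
    show ?case unfolding RS P_def using greedy_step(2)[OF conjunct1[OF Suc] a] by blast
  qed
  {
    fix k
    note greedy_step[OF conjunct1[OF pR[of k]] a[of k], folded P_def]
  }
  note st = this
  have com: "U \<odot> R k = R k \<odot> U" if "U \<odot> T = T \<odot> U" for U k
  proof (induction k)
    case (Suc k) then show ?case using st(4)[OF Suc] by (simp add: RS op_distrib op_scale)
  qed (simp add: R0 that)
  have ann: "W \<odot> R k = 0" if "W \<odot> T = 0" "W\<^sup>\<star> = W" for W k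
  proof (induction k)
    case (Suc k) then show ?case using st(5)[OF Suc that(2)] by (simp add: RS op_distrib op_scale)
  qed (simp add: R0 that)
  have tel: "T - (\<Sum>k<n. a k *\<^sub>R P k) = R n" for n
    by (induction n) (simp_all add: R0 RS flip: diff_diff_eq)
  have "R \<longlonglongrightarrow> 0"
    by (rule Lim_null_comparison[OF _ r(3)]) (use pR in auto)
  then have "(\<lambda>n. T - R n) \<longlonglongrightarrow> T - 0" by (intro tendsto_intros)
  moreover have "T - R n = (\<Sum>k<n. a k *\<^sub>R P k)" for n using tel[of n] by (simp add: algebra_simps)
  ultimately have lim: "(\<lambda>n. \<Sum>k<n. a k *\<^sub>R P k) \<longlonglongrightarrow> T" by simp
  have hs: "((\<lambda>k. a k * qf (P k) x) has_sum qf T x) UNIV" for x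
  proof (rule sums_nonneg_imp_has_sum)
    have "(\<lambda>n. qf (\<Sum>k<n. a k *\<^sub>R P k) x) \<longlonglongrightarrow> qf T x"
      by (intro tendsto_inner blinfun.tendsto lim tendsto_const)
    then show "(\<lambda>k. a k * qf (P k) x) sums qf T x"
      by (simp add: sums_def blinfun.sum_left inner_sum_left blinfun.scaleR_left)
    show "0 \<le> a k * qf (P k) x" for k
      using a[of k] pos_ge[OF prj_pos[OF st(1)], of k x] by simp
  qed
  show ?thesis by (rule that[OF st(1) st(4)[OF com] st(5)[OF ann] lim hs]) auto
qed

section \<open>Partial isometries\<close>

lemma comp_eq_zero_iff: "v \<odot> T = 0 \<longleftrightarrow> v\<^sup>\<star> \<odot> (v \<odot> T) = (0 :: 'a::hilbert_space operator)"
proof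
  assume z: "v\<^sup>\<star> \<odot> (v \<odot> T) = 0"
  show "v \<odot> T = 0"
  proof (rule blinfun_eqI)
    fix x
    have "nsq v (ap T x) = inner (ap (v\<^sup>\<star> \<odot> (v \<odot> T)) x) (ap T x)"
      by (simp add: norm_apply_sq)
    then show "ap (v \<odot> T) x = ap 0 x" using z by (simp add: blinfun.zero_left)
  qed
qed simp

lemma piso:
  assumes "prj (v\<^sup>\<star> \<odot> v)"
  shows "v \<odot> (v\<^sup>\<star> \<odot> v) = v" "prj (v \<odot> v\<^sup>\<star>)" "v\<^sup>\<star> \<odot> (v \<odot> v\<^sup>\<star>) = v\<^sup>\<star>"
proof -
  have "v\<^sup>\<star> \<odot> (v \<odot> (\<one> - v\<^sup>\<star> \<odot> v)) = 0"
    using prj_idem[OF assms] by (simp add: op_distrib op_assoc)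
  then have "v \<odot> (\<one> - v\<^sup>\<star> \<odot> v) = 0" by (rule comp_eq_zero_iff[THEN iffD2])
  then show 1: "v \<odot> (v\<^sup>\<star> \<odot> v) = v" by (simp add: op_distrib)
  then have "v \<odot> v\<^sup>\<star> \<odot> (v \<odot> v\<^sup>\<star>) = v \<odot> v\<^sup>\<star>" by (metis op_assoc)
  then show "prj (v \<odot> v\<^sup>\<star>)" by (simp add: prj_def)
  have "(v \<odot> (v\<^sup>\<star> \<odot> v))\<^sup>\<star> = v\<^sup>\<star>" using 1 by simp
  then show "v\<^sup>\<star> \<odot> (v \<odot> v\<^sup>\<star>) = v\<^sup>\<star>" by (simp add: op_assoc)
qed

lemma comp_zero_left: "A \<odot> B = 0 \<Longrightarrow> A \<odot> (B \<odot> C) = (0 :: 'a::hilbert_space operator)"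
  by (simp flip: op_assoc)

lemma comp_absorb: "T \<odot> P = P \<Longrightarrow> P \<odot> X = X \<Longrightarrow> T \<odot> X = (X :: 'a::hilbert_space operator)"
  using op_assoc[of T P X] by simp

lemma comp_subst: "A \<odot> B = C \<Longrightarrow> A \<odot> (B \<odot> D) = C \<odot> (D :: 'a::hilbert_space operator)"
  by (simp flip: op_assoc)

lemma comp_radj_zero: "v\<^sup>\<star> \<odot> w = 0 \<Longrightarrow> w\<^sup>\<star> \<odot> v = (0 :: 'a::hilbert_space operator)"
  using radj_comp[of "v\<^sup>\<star>" w] by simp

lemma comp_radj_zero': "v \<odot> w\<^sup>\<star> = 0 \<Longrightarrow> w \<odot> v\<^sup>\<star> = (0 :: 'a::hilbert_space operator)"
  using radj_comp[of v "w\<^sup>\<star>"] by simp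

text \<open>The projection \<open>F\<close> onto the sum of the ranges satisfies
  \<open>F V = V\<close> and \<open>V V* F = F\<close>, so it is the final projection of
  \<open>V\<close>.\<close>

lemma piso_sum:
  fixes X :: "'i \<Rightarrow> 'a::hilbert_space operator"
  assumes p: "\<And>i. i \<in> I \<Longrightarrow> prj ((X i)\<^sup>\<star> \<odot> X i)"
    and o: "\<And>i j. i \<in> I \<Longrightarrow> j \<in> I \<Longrightarrow> i \<noteq> j \<Longrightarrow> (X i)\<^sup>\<star> \<odot> X j = 0"
    and o': "\<And>i j. i \<in> I \<Longrightarrow> j \<in> I \<Longrightarrow> i \<noteq> j \<Longrightarrow> X i \<odot> (X j)\<^sup>\<star> = 0"
  shows "((\<lambda>i. ap (X i) x) has_sum ap (opsum X I) x) I"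
    and "orth_prjs I (\<lambda>i. (X i)\<^sup>\<star> \<odot> X i)" and "orth_prjs I (\<lambda>i. X i \<odot> (X i)\<^sup>\<star>)"
    and "(opsum X I)\<^sup>\<star> \<odot> opsum X I = opsum (\<lambda>i. (X i)\<^sup>\<star> \<odot> X i) I"
    and "opsum X I \<odot> (opsum X I)\<^sup>\<star> = opsum (\<lambda>i. X i \<odot> (X i)\<^sup>\<star>) I"
proof -
  let ?E = "\<lambda>i. (X i)\<^sup>\<star> \<odot> X i" and ?F = "\<lambda>i. X i \<odot> (X i)\<^sup>\<star>" and ?V = "opsum X I"
  show E: "orth_prjs I ?E"
    unfolding orth_prjs_def using p o' by (auto simp: op_assoc comp_zero_left comp_zero_left[OF comp_zero_left])
  show F: "orth_prjs I ?F"
    unfolding orth_prjs_def using piso(2)[OF p] o by (auto simp: op_assoc comp_zero_left)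
  have n: "nsq (X i) x = nsq (?E i) x" if "i \<in> I" for i x
    using prj_inner[OF p[OF that], of x] by (simp only: norm_apply_sq[of "X i" x])
  have b: "(\<Sum>i\<in>G. nsq (X i) x) \<le> 1 * (norm x)\<^sup>2" if "finite G" "G \<subseteq> I" for x G
  proof -
    have "(\<Sum>i\<in>G. nsq (X i) x) = (\<Sum>i\<in>G. nsq (?E i) x)"
      using n that by (intro sum.cong) auto
    then show ?thesis using bessel[OF that(1) orth_prjs_subset[OF E that(2)], of x] by simp
  qed
  have hs: "((\<lambda>i. ap (X i) x) has_sum ap ?V x) I" for x by (rule opsum(1)[OF o b])
  then show "((\<lambda>i. ap (X i) x) has_sum ap ?V x) I" .
  show "?V\<^sup>\<star> \<odot> ?V = opsum ?E I"
  proof (rule sa_eqI)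
    fix x
    have "((\<lambda>i. nsq (X i) x) has_sum nsq ?V x) I" by (rule opsum(2)[OF o b])
    then have "nsq ?V x = qf (opsum ?E I) x"
      by (rule has_sum_eqI[OF _ prj_opsum(5)[OF E, of x]]) (rule norm_apply_sq)
    then show "qf (?V\<^sup>\<star> \<odot> ?V) x = qf (opsum ?E I) x"
      by (simp only: norm_apply_sq)
  qed (use prj_sa[OF prj_opsum(2)[OF E]] in auto)
  then have pV: "prj (?V\<^sup>\<star> \<odot> ?V)" using prj_opsum(2)[OF E] by simp
  have FV: "opsum ?F I \<odot> ?V = ?V"
  proof -
    have "opsum ?F I \<odot> X i = \<one> \<odot> X i" if "i \<in> I" for i
      using comp_absorb[OF prj_opsum(3)[OF F that], of "X i"] piso(1)[OF p[OF that]] by (simp add: op_assoc)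
    then show ?thesis using op_sum_left_cong[OF hs, of "opsum ?F I" \<one>] by simp
  qed
  have VX: "?V \<odot> (?V\<^sup>\<star> \<odot> X i) = X i" if "i \<in> I" for i
  proof -
    have "(X i)\<^sup>\<star> \<odot> ?V = (X i)\<^sup>\<star> \<odot> X i" by (rule op_sum_pick[OF hs that]) (use o that in auto)
    then have "((X i)\<^sup>\<star> \<odot> ?V)\<^sup>\<star> = ?E i" by simp
    then have 1: "?V\<^sup>\<star> \<odot> X i = ?E i" by simp
    have "?V \<odot> (X i)\<^sup>\<star> = X i \<odot> (X i)\<^sup>\<star>"
    proof (rule op_sum_eqI[OF has_sum_op_right[OF hs]])
      fix x
      show "((\<lambda>j. ap (if j = i then X i \<odot> (X i)\<^sup>\<star> else 0) x) has_sum ap (X i \<odot> (X i)\<^sup>\<star>) x) I"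
        by (rule has_sum_finite_neutralI[where B="{i}"]) (use that in auto)
    qed (use o' that in auto)
    then have "?V \<odot> ((X i)\<^sup>\<star> \<odot> X i) = X i \<odot> (X i)\<^sup>\<star> \<odot> X i" by (rule comp_subst)
    then show ?thesis using 1 piso(1)[OF p[OF that]] by (simp add: op_assoc)
  qed
  have "?V \<odot> ?V\<^sup>\<star> \<odot> opsum ?F I = \<one> \<odot> opsum ?F I"
    by (rule op_sum_left_cong[OF prj_opsum(1)[OF F]]) (simp add: op_assoc comp_subst[OF VX, unfolded op_assoc])
  then have 2: "(?V \<odot> ?V\<^sup>\<star> \<odot> opsum ?F I)\<^sup>\<star> = (opsum ?F I)\<^sup>\<star>" by simp
  then have "opsum ?F I \<odot> (?V \<odot> ?V\<^sup>\<star>) = opsum ?F I" by (simp add: prj_sa[OF prj_opsum(2)[OF F]])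
  then show "?V \<odot> ?V\<^sup>\<star> = opsum ?F I" using comp_subst[OF FV, of "?V\<^sup>\<star>"] by simp
qed

text \<open>Zorn's lemma for pairwise compatible families; applied to partial isometries, to
  packings and to projections of finite weight.\<close>

lemma maximal_pairwise_family:
  "\<exists>F. (\<forall>v\<in>F. \<phi> v) \<and> pairwise R F \<and> (\<forall>w. \<phi> w \<and> (\<forall>v\<in>F. R v w \<and> R w v) \<longrightarrow> w \<in> F)"
proof -
  let ?A = "{F. (\<forall>v\<in>F. \<phi> v) \<and> pairwise R F}"
  have "\<exists>F\<in>?A. \<forall>X\<in>?A. F \<subseteq> X \<longrightarrow> X = F"
  proof (rule subset_Zorn')
    fix C assume "subset.chain ?A C"
    then have C: "C \<subseteq> ?A" "\<And>X Y. X \<in> C \<Longrightarrow> Y \<in> C \<Longrightarrow> X \<subseteq> Y \<or> Y \<subseteq> X"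
      by (auto simp: subset_chain_def)
    have "pairwise R (\<Union>C)"
      unfolding pairwise_def
    proof (intro ballI impI)
      fix v w assume "v \<in> \<Union>C" "w \<in> \<Union>C" "v \<noteq> w"
      then obtain X where "X \<in> C" "v \<in> X" "w \<in> X" using C(2) by (metis UnionE subsetD)
      then show "R v w" using C(1) \<open>v \<noteq> w\<close> by (auto simp: pairwise_def subset_iff)
    qed
    then show "\<Union>C \<in> ?A" using C(1) by auto
  qed
  then obtain F where F: "F \<in> ?A" and max: "\<forall>X\<in>?A. F \<subseteq> X \<longrightarrow> X = F" by (rule bexE)
  have "w \<in> F" if w: "\<phi> w" "\<forall>v\<in>F. R v w \<and> R w v" for w
  proof -
    have "insert w F \<in> ?A" using F w by (simp add: pairwise_insert)
    from max[rule_format, OF this subset_insertI] show ?thesis by blast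
  qed
  then show ?thesis using F by (intro exI[of _ F]) simp
qed

section \<open>Families of copies of a projection\<close>

lemma norm_sq_radj: "nsq (v\<^sup>\<star>) x = qf (v \<odot> v\<^sup>\<star>) x"
  using norm_apply_sq[of "v\<^sup>\<star>" x] by simp

text \<open>An orthonormal family with a projection \<open>q\<close> in place of the number one:
  each \<open>v i\<close> is a partial isometry from \<open>q\<close>, and distinct ranges are
  orthogonal. Then \<open>opsum (\<lambda>i. v i \<odot> (v i)\<^sup>\<star>) I\<close> is the
  projection onto the sum of the ranges.\<close>

definition frame :: "'a::hilbert_space operator \<Rightarrow> 'i set \<Rightarrow> ('i \<Rightarrow> 'a operator) \<Rightarrow> bool" where
  "frame q I v \<longleftrightarrow> (\<forall>i\<in>I. \<forall>j\<in>I. (v i)\<^sup>\<star> \<odot> v j = (if i = j then q else 0))"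

lemma frame_subset: "frame q I v \<Longrightarrow> J \<subseteq> I \<Longrightarrow> frame q J v"
  by (auto simp: frame_def subset_iff)

lemma frame_reindex: "frame q I v \<Longrightarrow> inj_on f J \<Longrightarrow> f ` J \<subseteq> I \<Longrightarrow> frame q J (\<lambda>j. v (f j))"
  by (auto simp: frame_def inj_on_def image_subset_iff)

lemma frame_sum:
  fixes v :: "'i \<Rightarrow> 'a::hilbert_space operator"
  assumes q: "prj q" and v: "frame q I v"
  shows "orth_prjs I (\<lambda>i. v i \<odot> (v i)\<^sup>\<star>)" "i \<in> I \<Longrightarrow> v i \<odot> q = v i"
    "prj (opsum (\<lambda>i. v i \<odot> (v i)\<^sup>\<star>) I)"
    "i \<in> I \<Longrightarrow> opsum (\<lambda>i. v i \<odot> (v i)\<^sup>\<star>) I \<odot> v i = v i"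
    "((\<lambda>i. nsq ((v i)\<^sup>\<star>) x) has_sum qf (opsum (\<lambda>i. v i \<odot> (v i)\<^sup>\<star>) I) x) I"
    "(\<And>i. i \<in> I \<Longrightarrow> T \<odot> v i = 0) \<Longrightarrow> T \<odot> opsum (\<lambda>i. v i \<odot> (v i)\<^sup>\<star>) I = 0"
proof -
  have q': "prj ((v i)\<^sup>\<star> \<odot> v i)" if "i \<in> I" for i using v q that by (simp add: frame_def)
  show o: "orth_prjs I (\<lambda>i. v i \<odot> (v i)\<^sup>\<star>)"
    unfolding orth_prjs_def
  proof (intro conjI ballI impI)
    fix i j assume "i \<in> I" "j \<in> I" "i \<noteq> j"
    then have "(v i)\<^sup>\<star> \<odot> v j = 0" using v by (simp add: frame_def)
    then show "v i \<odot> (v i)\<^sup>\<star> \<odot> (v j \<odot> (v j)\<^sup>\<star>) = 0" by (simp add: op_assoc comp_zero_left)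
  qed (rule piso(2)[OF q'])
  show "v i \<odot> q = v i" if "i \<in> I"
    using piso(1)[OF q'[OF that]] v that by (simp add: frame_def)
  show "prj (opsum (\<lambda>i. v i \<odot> (v i)\<^sup>\<star>) I)" by (rule prj_opsum(2)[OF o])
  show "opsum (\<lambda>i. v i \<odot> (v i)\<^sup>\<star>) I \<odot> v i = v i" if "i \<in> I"
    using comp_absorb[OF prj_opsum(3)[OF o that], of "v i"] piso(1)[OF q'[OF that]] by (simp add: op_assoc)
  show "((\<lambda>i. nsq ((v i)\<^sup>\<star>) x) has_sum qf (opsum (\<lambda>i. v i \<odot> (v i)\<^sup>\<star>) I) x) I"
    using prj_opsum(5)[OF o, of x] by (simp only: norm_sq_radj)
  assume z: "\<And>i. i \<in> I \<Longrightarrow> T \<odot> v i = 0"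
  show "T \<odot> opsum (\<lambda>i. v i \<odot> (v i)\<^sup>\<star>) I = 0"
  proof (rule op_sum_eq_zero[OF prj_opsum(1)[OF o]])
    fix i assume "i \<in> I"
    from z[OF this] show "T \<odot> (v i \<odot> (v i)\<^sup>\<star>) = 0" by (rule comp_zero_left)
  qed
qed

text \<open>\<open>V\<close> carries the range of each \<open>w i\<close> onto that of
  \<open>v i\<close>, so frames over the same index set have equivalent sums.\<close>

lemma frame_link:
  fixes v w :: "'i \<Rightarrow> 'a::hilbert_space operator"
  assumes q: "prj q" and v: "frame q I v" and w: "frame q I w"
  defines "V \<equiv> opsum (\<lambda>i. v i \<odot> (w i)\<^sup>\<star>) I"
  shows "((\<lambda>i. ap (v i \<odot> (w i)\<^sup>\<star>) x) has_sum ap V x) I"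
    "V\<^sup>\<star> \<odot> V = opsum (\<lambda>i. w i \<odot> (w i)\<^sup>\<star>) I" "V \<odot> V\<^sup>\<star> = opsum (\<lambda>i. v i \<odot> (v i)\<^sup>\<star>) I"
proof -
  let ?X = "\<lambda>i. v i \<odot> (w i)\<^sup>\<star>"
  have e: "(?X i)\<^sup>\<star> \<odot> ?X j = (if i = j then w i \<odot> (w i)\<^sup>\<star> else 0)" if "i \<in> I" "j \<in> I" for i j
  proof -
    have "(?X i)\<^sup>\<star> \<odot> ?X j = w i \<odot> ((v i)\<^sup>\<star> \<odot> v j) \<odot> (w j)\<^sup>\<star>" by (simp add: op_assoc)
    also have "(v i)\<^sup>\<star> \<odot> v j = (if i = j then q else 0)" using v that by (simp add: frame_def)
    finally show ?thesis using frame_sum(2)[OF q w that(1)] by auto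
  qed
  have f: "?X i \<odot> (?X j)\<^sup>\<star> = (if i = j then v i \<odot> (v i)\<^sup>\<star> else 0)" if "i \<in> I" "j \<in> I" for i j
  proof -
    have "?X i \<odot> (?X j)\<^sup>\<star> = v i \<odot> ((w i)\<^sup>\<star> \<odot> w j) \<odot> (v j)\<^sup>\<star>" by (simp add: op_assoc)
    also have "(w i)\<^sup>\<star> \<odot> w j = (if i = j then q else 0)" using w that by (simp add: frame_def)
    finally show ?thesis using frame_sum(2)[OF q v that(1)] by auto
  qed
  have cong: "opsum g I = opsum h I" if "\<And>i. i \<in> I \<Longrightarrow> g i = h i" for g h :: "'i \<Rightarrow> 'a operator"
    unfolding opsum_def using infsum_cong[of I] that by (metis (no_types, lifting))
  have p: "prj ((?X i)\<^sup>\<star> \<odot> ?X i)" if "i \<in> I" for i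
    using frame_sum(1)[OF q w] e[OF that that] that by (simp add: orth_prjs_def)
  note S = piso_sum[of I ?X, OF p e[THEN trans] f[THEN trans]]
  show "((\<lambda>i. ap (v i \<odot> (w i)\<^sup>\<star>) x) has_sum ap V x) I"
    unfolding V_def by (rule S(1)) auto
  have eI: "(?X i)\<^sup>\<star> \<odot> ?X i = w i \<odot> (w i)\<^sup>\<star>" and fI: "?X i \<odot> (?X i)\<^sup>\<star> = v i \<odot> (v i)\<^sup>\<star>" if "i \<in> I" for i
    using e[OF that that] f[OF that that] by (simp_all only: refl if_True)
  have "V\<^sup>\<star> \<odot> V = opsum (\<lambda>i. (?X i)\<^sup>\<star> \<odot> ?X i) I" unfolding V_def by (rule S(4)) auto
  also have "\<dots> = opsum (\<lambda>i. w i \<odot> (w i)\<^sup>\<star>) I" by (rule cong) (rule eI)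
  finally show "V\<^sup>\<star> \<odot> V = opsum (\<lambda>i. w i \<odot> (w i)\<^sup>\<star>) I" .
  have "V \<odot> V\<^sup>\<star> = opsum (\<lambda>i. ?X i \<odot> (?X i)\<^sup>\<star>) I" unfolding V_def by (rule S(5)) auto
  also have "\<dots> = opsum (\<lambda>i. v i \<odot> (v i)\<^sup>\<star>) I" by (rule cong) (rule fI)
  finally show "V \<odot> V\<^sup>\<star> = opsum (\<lambda>i. v i \<odot> (v i)\<^sup>\<star>) I" .
qed

section \<open>Factors and their traces\<close>

text \<open>Membership in \<open>M\<close> is commutation with \<open>CC\<close>, so limits, kernels
  and spectral projections stay in \<open>M\<close> by commutation alone. Factoriality is stated for
  projections, normality for increasing sequences converging in form, and infiniteness through the
  trace of the identity.\<close>

locale semifinite_factor =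
  fixes M CC :: "'a::hilbert_space operator set" and \<tau> :: "'a operator \<Rightarrow> ennreal"
  assumes M_iff: "T \<in> M \<longleftrightarrow> (\<forall>S\<in>CC. S \<odot> T = T \<odot> S)"
    and CC_radj: "S \<in> CC \<Longrightarrow> S\<^sup>\<star> \<in> CC"
    and central: "Z \<in> M \<Longrightarrow> prj Z \<Longrightarrow> (\<And>T. T \<in> M \<Longrightarrow> T \<odot> Z = Z \<odot> T) \<Longrightarrow> Z = 0 \<or> Z = \<one>"
    and countable_orth: "F \<subseteq> {P \<in> M. prj P \<and> P \<noteq> 0} \<Longrightarrow> pairwise (\<lambda>P Q. P \<odot> Q = 0) F \<Longrightarrow> countable F"
    and tr_add: "A \<in> M \<Longrightarrow> B \<in> M \<Longrightarrow> pos A \<Longrightarrow> pos B \<Longrightarrow> \<tau> (A + B) = \<tau> A + \<tau> B"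
    and tr_scale: "A \<in> M \<Longrightarrow> pos A \<Longrightarrow> 0 \<le> r \<Longrightarrow> \<tau> (r *\<^sub>R A) = ennreal r * \<tau> A"
    and tr_swap: "X \<in> M \<Longrightarrow> \<tau> (X\<^sup>\<star> \<odot> X) = \<tau> (X \<odot> X\<^sup>\<star>)"
    and tr_faithful: "A \<in> M \<Longrightarrow> pos A \<Longrightarrow> \<tau> A = 0 \<Longrightarrow> A = 0"
    and tr_normal: "\<And>(S :: nat \<Rightarrow> 'a operator) A. (\<And>n. S n \<in> M) \<Longrightarrow> (\<And>n. pos (S n)) \<Longrightarrow> (\<And>n. pos (S (Suc n) - S n)) \<Longrightarrow> A \<in> M \<Longrightarrow> pos A \<Longrightarrow>
      (\<And>x. (\<lambda>n. qf (S n) x) \<longlonglongrightarrow> qf A x) \<Longrightarrow>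
      \<tau> A = (SUP n. \<tau> (S n))"
    and finite_prj_ex: "\<exists>q\<in>M. prj q \<and> q \<noteq> 0 \<and> \<tau> q < \<infinity>"
    and infinite_one: "\<tau> \<one> = \<infinity>"
begin

lemma M_commute: "T \<in> M \<Longrightarrow> (\<And>U. U \<odot> T = T \<odot> U \<Longrightarrow> U \<odot> S = S \<odot> U) \<Longrightarrow> S \<in> M"
  unfolding M_iff by blast

lemma M_add [intro]: "S \<in> M \<Longrightarrow> T \<in> M \<Longrightarrow> S + T \<in> M" by (simp add: M_iff op_distrib)
lemma M_diff [intro]: "S \<in> M \<Longrightarrow> T \<in> M \<Longrightarrow> S - T \<in> M" by (simp add: M_iff op_distrib)
lemma M_scaleR [intro]: "T \<in> M \<Longrightarrow> c *\<^sub>R T \<in> M" by (simp add: M_iff op_scale)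
lemma M_zero [simp, intro]: "0 \<in> M" by (simp add: M_iff)
lemma M_one [simp, intro]: "\<one> \<in> M" by (simp add: M_iff)
lemma M_comp [intro]: "S \<in> M \<Longrightarrow> T \<in> M \<Longrightarrow> S \<odot> T \<in> M"
  unfolding M_iff using op_assoc by metis
lemma M_sum [intro]: "(\<And>i. i \<in> I \<Longrightarrow> f i \<in> M) \<Longrightarrow> sum f I \<in> M"
  by (induction I rule: infinite_finite_induct) auto
lemma M_radj [intro]: "T \<in> M \<Longrightarrow> T\<^sup>\<star> \<in> M"
  unfolding M_iff
proof
  fix S assume T: "\<forall>S\<in>CC. S \<odot> T = T \<odot> S" and "S \<in> CC"
  then have "(S\<^sup>\<star> \<odot> T)\<^sup>\<star> = (T \<odot> S\<^sup>\<star>)\<^sup>\<star>" using CC_radj by simp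
  then show "S \<odot> T\<^sup>\<star> = T\<^sup>\<star> \<odot> S" by simp
qed

lemma M_has_sum:
  "(\<And>x. ((\<lambda>i. ap (X i) x) has_sum ap S x) I) \<Longrightarrow> (\<And>i. i \<in> I \<Longrightarrow> X i \<in> M) \<Longrightarrow> S \<in> M"
  unfolding M_iff using op_sum_commute by blast

lemma M_tendsto: "f \<longlonglongrightarrow> T \<Longrightarrow> (\<And>n. f n \<in> M) \<Longrightarrow> T \<in> M"
  unfolding M_iff using tendsto_commute by blast

lemma M_kerp [intro]:
  assumes "T \<in> M"
  shows "kerp T \<in> M"
  unfolding M_iff
proof
  fix S assume "S \<in> CC"
  then have "S \<odot> T = T \<odot> S" "S \<odot> T\<^sup>\<star> = T\<^sup>\<star> \<odot> S" using M_radj[OF assms] assms unfolding M_iff by auto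
  then show "S \<odot> kerp T = kerp T \<odot> S" by (rule kerp_commute)
qed

lemma M_spec [intro]: "A\<^sup>\<star> = A \<Longrightarrow> A \<in> M \<Longrightarrow> S \<in> sets borel \<Longrightarrow> spec A S \<in> M"
  using M_commute spec_proj(2) by metis

lemma M_opsum_prj: "orth_prjs I P \<Longrightarrow> (\<And>i. i \<in> I \<Longrightarrow> P i \<in> M) \<Longrightarrow> opsum P I \<in> M"
  by (rule M_has_sum[OF prj_opsum(1)])

text \<open>If this failed, the vectors \<open>y\<close> with \<open>P X y = 0\<close> for all
  \<open>X\<close> in \<open>M\<close> would form a closed subspace invariant under \<open>M\<close>
  and \<open>CC\<close> and containing the range of \<open>Q\<close>. Its projection is central and
  nonzero, hence the identity, and \<open>P = 0\<close>.\<close>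

lemma factor_link:
  assumes P: "P \<in> M" "prj P" "P \<noteq> 0" and Q: "Q \<in> M" "prj Q" "Q \<noteq> 0"
  shows "\<exists>X\<in>M. P \<odot> X \<odot> Q \<noteq> 0"
proof (rule ccontr)
  assume "\<not> ?thesis"
  then have z: "P \<odot> X \<odot> Q = 0" if "X \<in> M" for X using that by blast
  define K where "K = {y. \<forall>X\<in>M. ap P (ap X y) = 0}"
  have "K = (\<Inter>X\<in>M. {y. ap P (ap X y) = 0})" by (auto simp: K_def)
  moreover have "closed {y. ap P (ap X y) = 0}" for X
    by (intro closed_Collect_eq continuous_intros)
  ultimately have "closed K" by auto
  moreover have "subspace K" by (auto simp: K_def subspace_def apply_simps)
  ultimately have K: "closed K" "subspace K" by auto
  define R where "R = proj_on K"
  have inv: "ap T y \<in> K" if "y \<in> K" "T \<in> M" for T y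
  proof -
    have "X \<odot> T \<in> M" if "X \<in> M" for X using that \<open>T \<in> M\<close> by (rule M_comp)
    then show ?thesis using \<open>y \<in> K\<close> by (force simp: K_def)
  qed
  have invS: "ap S y \<in> K" if "y \<in> K" "S \<in> CC" for S y
    unfolding K_def
  proof (intro CollectI ballI)
    fix X assume X: "X \<in> M"
    have "S \<odot> P = P \<odot> S" "S \<odot> X = X \<odot> S" using P(1) X that(2) unfolding M_iff by auto
    then have "ap P (ap X (ap S y)) = ap S (ap P (ap X y))"
      by (metis blinfun_apply_blinfun_compose)
    then show "ap P (ap X (ap S y)) = 0" using that(1) X by (simp add: K_def)
  qed
  have RM: "R \<in> M"
    unfolding M_iff R_def using proj_on_commute[OF K] invS CC_radj by blast
  have "T \<odot> R = R \<odot> T" if "T \<in> M" for T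
    unfolding R_def using that by (intro proj_on_commute[OF K] inv) auto
  then have "R = 0 \<or> R = \<one>" using RM proj_on(1)[OF K] by (intro central) (auto simp: R_def)
  moreover have "ap Q x \<in> K" for x
    unfolding K_def
  proof (intro CollectI ballI)
    fix X assume "X \<in> M"
    then have "ap (P \<odot> X \<odot> Q) x = 0" by (simp only: z blinfun.zero_left)
    then show "ap P (ap X (ap Q x)) = 0" by simp
  qed
  then have "R \<odot> Q = Q" by (intro blinfun_eqI) (simp add: R_def proj_on[OF K])
  ultimately have "R = \<one>" using Q(3) by auto
  then have "y \<in> K" for y using proj_on(2)[OF K, of y] by (simp add: R_def)
  then have "ap P (ap \<one> y) = 0" for y unfolding K_def by blast
  then have "P = 0" by (intro blinfun_eqI) (simp add: blinfun.zero_left)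
  then show False using P(3) by simp
qed

text \<open>A truncated polar decomposition of \<open>T = P X Q\<close>: on the spectral part
  \<open>e\<close> where \<open>H = T* T\<close> is at least \<open>s\<close>, the operator
  \<open>H\<close> has an inverse square root, and composing \<open>T\<close> with it gives a
  partial isometry.\<close>

lemma exists_piso:
  assumes P: "P \<in> M" "prj P" "P \<noteq> 0" and Q: "Q \<in> M" "prj Q" "Q \<noteq> 0"
  shows "\<exists>u\<in>M. u \<noteq> 0 \<and> prj (u\<^sup>\<star> \<odot> u) \<and> P \<odot> u = u \<and> u \<odot> Q = u"
proof -
  obtain X where X: "X \<in> M" "P \<odot> X \<odot> Q \<noteq> 0" using factor_link[OF assms] by blast
  define T where "T = P \<odot> X \<odot> Q"
  have T: "T \<in> M" "T \<noteq> 0" using X P Q by (auto simp: T_def)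
  define H where "H = T\<^sup>\<star> \<odot> T"
  have H: "H \<in> M" "pos H" "H\<^sup>\<star> = H" using T by (auto simp: H_def)
  have "H \<noteq> 0"
  proof
    assume "H = 0"
    then have "T \<odot> \<one> = 0" by - (rule comp_eq_zero_iff[THEN iffD2], simp add: H_def)
    then show False using T by simp
  qed
  \<comment> \<open>Half the norm, so that the spectral part \<open>e\<close> cannot be
    zero.\<close>
  define s where "s = norm H / 2"
  have s: "s > 0" using \<open>H \<noteq> 0\<close> by (simp add: s_def)
  define e where "e = spec H {s..}"
  have e: "prj e" "e \<in> M" "H \<odot> e = e \<odot> H"
    using H by (auto simp: e_def intro: spec_proj(1) spec_commute_op)
  have "e \<noteq> 0"
  proof
    assume "e = 0"
    then have "spec H {..<s} = \<one>" using spec_Compl[OF H(3), of "{s..}"] by (simp add: e_def Compl_atLeast)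
    then have "qf H x \<le> s * (norm x)\<^sup>2" for x
      by (intro spec_atMost_le[OF H(3), of "{..<s}"]) auto
    then have "norm H \<le> s" using s by (intro pos_norm_bound H) auto
    then show False using s by (simp add: s_def)
  qed
  \<comment> \<open>Off \<open>e\<close> the operator is replaced by the scalar \<open>s\<close>,
    which makes it bounded below and leaves it unchanged on \<open>e\<close>.\<close>
  define H' where "H' = H \<odot> e + s *\<^sub>R (\<one> - e)"
  have He: "pos (H \<odot> e)" by (rule pos_comp_commute[OF H(2) prj_pos[OF e(1)] e(3)])
  have "pos (H' - s *\<^sub>R \<one>)"
    unfolding pos_def
  proof (intro conjI allI)
    show "(H' - s *\<^sub>R \<one>)\<^sup>\<star> = H' - s *\<^sub>R \<one>" using pos_sa[OF He] prj_sa[OF e(1)] by (simp add: H'_def)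
    fix x
    have "s * nsq e x \<le> qf H (ap e x)"
      by (rule spec_atLeast_ge[OF H(3), of "{s..}"]) (use prj_idem_apply[OF e(1)] in \<open>auto simp: e_def\<close>)
    then show "0 \<le> qf (H' - s *\<^sub>R \<one>) x"
      unfolding inner_conj_prj[OF e(1,3)]
      by (simp add: H'_def apply_simps inner_expand prj_inner[OF e(1)] right_diff_distrib)
  qed
  moreover have "pos H'" unfolding H'_def using s by (intro pos_add He pos_scaleR prj_pos prj_compl e) auto
  ultimately obtain R where R: "pos R" "H' \<odot> R = \<one>" "R \<odot> H' = \<one>"
    "\<And>U. U \<odot> H' = H' \<odot> U \<Longrightarrow> U \<odot> R = R \<odot> U"
    using inverse_of_bounded_below[OF _ s] by blast
  define G where "G = op_sqrt R"
  note G = op_sqrt[OF R(1), folded G_def]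
  have ee: "e \<odot> (H \<odot> e) = H \<odot> e" using comp_subst[OF e(3)[symmetric], of e] prj_idem[OF e(1)] by (simp add: op_assoc)
  have H'e: "H' \<odot> e = H \<odot> e" "e \<odot> H' = H \<odot> e"
    using prj_idem[OF e(1)] ee by (simp_all add: H'_def op_distrib op_scale op_assoc)

  have HH': "H \<odot> H' = H' \<odot> H"
    by (simp add: H'_def op_distrib op_scale op_assoc e(3)[symmetric])
  have c: "e \<odot> G = G \<odot> e" "H \<odot> G = G \<odot> H"
    using G(3)[OF R(4)[of e]] G(3)[OF R(4)[of H]] H'e HH' by auto
  have H'M: "H' \<in> M" using H e by (auto simp: H'_def)
  have GM: "G \<in> M" by (rule M_commute[OF H'M]) (intro G(3) R(4))
  define u where "u = T \<odot> (G \<odot> e)"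
  have "u\<^sup>\<star> \<odot> u = e \<odot> (G \<odot> (H \<odot> (G \<odot> e)))"
    using pos_sa[OF G(1)] prj_sa[OF e(1)] by (simp add: u_def H_def op_assoc)
  also have "\<dots> = e \<odot> (G \<odot> (G \<odot> (H \<odot> e)))" using comp_subst[OF c(2), of e] by (simp add: op_assoc)
  also have "\<dots> = e \<odot> (R \<odot> (H' \<odot> e))" using comp_subst[OF G(2), of "H \<odot> e"] H'e by simp
  also have "\<dots> = e" using comp_subst[OF R(3), of e] prj_idem[OF e(1)] by simp
  finally have uu: "u\<^sup>\<star> \<odot> u = e" .
  have "P \<odot> u = u" using prj_idem[OF P(2)] by (simp add: u_def T_def flip: op_assoc)
  moreover have "u \<odot> Q = u"
  proof -
    have "T \<odot> (\<one> - Q) = 0" using prj_idem[OF Q(2)] by (simp add: T_def op_assoc op_distrib)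
    then have 1: "H \<odot> (\<one> - Q) = 0" by (simp add: H_def op_assoc)
    have "(H \<odot> (\<one> - Q))\<^sup>\<star> = (\<one> - Q) \<odot> H" using H prj_sa[OF Q(2)] by simp
    then have 2: "(\<one> - Q) \<odot> H = 0" using 1 by simp
    have "e \<odot> (\<one> - Q) = 0"
    proof -
      have "(\<one> - Q) \<odot> e = 0"
        unfolding e_def by (rule greedy_step(5)[OF H(2) s 2]) (simp add: prj_sa[OF Q(2)])
      then have "((\<one> - Q) \<odot> e)\<^sup>\<star> = 0" by simp
      moreover have "((\<one> - Q) \<odot> e)\<^sup>\<star> = e \<odot> (\<one> - Q)" using prj_sa[OF Q(2)] prj_sa[OF e(1)] by simp
      ultimately show ?thesis by simp
    qed
    then have "e \<odot> Q = e" by (simp add: op_distrib)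
    then show ?thesis by (simp add: u_def op_assoc)
  qed
  moreover have "u \<noteq> 0" using uu \<open>e \<noteq> 0\<close> by auto
  moreover have "u \<in> M" using T GM e by (auto simp: u_def)
  ultimately show ?thesis using uu e by (intro bexI[of _ u]) auto
qed

text \<open>Take a maximal family of partial isometries between the two projections with orthogonal
  initial and final ranges. If both remainders were nonzero, \<open>exists_piso\<close> would supply
  one more member.\<close>

lemma comparison:
  assumes P: "P \<in> M" "prj P" and Q: "Q \<in> M" "prj Q"
  shows "\<exists>v\<in>M. prj (v\<^sup>\<star> \<odot> v) \<and> P \<odot> v = v \<and> v \<odot> Q = v \<and> (v\<^sup>\<star> \<odot> v = Q \<or> v \<odot> v\<^sup>\<star> = P)"
proof -
  let ?\<phi> = "\<lambda>v. v \<in> M \<and> v \<noteq> 0 \<and> prj (v\<^sup>\<star> \<odot> v) \<and> P \<odot> v = v \<and> v \<odot> Q = v"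
  let ?R = "\<lambda>v w. v\<^sup>\<star> \<odot> w = 0 \<and> v \<odot> w\<^sup>\<star> = 0"
  obtain F where F: "\<forall>v\<in>F. ?\<phi> v" "pairwise ?R F" "\<forall>w. ?\<phi> w \<and> (\<forall>v\<in>F. ?R v w \<and> ?R w v) \<longrightarrow> w \<in> F"
    using maximal_pairwise_family[of ?\<phi> ?R] by (elim exE conjE)
  define V where "V = opsum (\<lambda>v. v) F"
  have p: "prj (v\<^sup>\<star> \<odot> v)" if "v \<in> F" for v using F(1) that by blast
  have o: "v\<^sup>\<star> \<odot> w = 0" "v \<odot> w\<^sup>\<star> = 0" if "v \<in> F" "w \<in> F" "v \<noteq> w" for v w
    using F(2) that by (auto simp: pairwise_def)
  note S = piso_sum[of F "\<lambda>v. v", OF p o, folded V_def]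
  have VM: "V \<in> M" by (rule M_has_sum[OF S(1)]) (use F(1) in auto)
  have PV: "P \<odot> V = V"
    using op_sum_left_cong[OF S(1), of P \<one>] F(1) by auto
  have VQ: "V \<odot> Q = V"
    by (rule op_sum_eqI[OF has_sum_op_right[OF S(1)] S(1)]) (use F(1) in auto)
  let ?e = "V\<^sup>\<star> \<odot> V" and ?f = "V \<odot> V\<^sup>\<star>"
  have pe: "prj ?e" and pf: "prj ?f"
    using prj_opsum(2)[OF S(2)] prj_opsum(2)[OF S(3)] by (simp_all add: S(4,5))
  have e: "prj (Q - ?e)" "Q \<odot> ?e = ?e" and f: "prj (P - ?f)"
  proof -
    have "(V \<odot> Q)\<^sup>\<star> = V\<^sup>\<star>" using VQ by simp
    then have "Q \<odot> V\<^sup>\<star> = V\<^sup>\<star>" using prj_sa[OF Q(2)] by simp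
    then show "Q \<odot> ?e = ?e" by (rule comp_subst)
    then show "prj (Q - ?e)" by (rule prj_diff(1)[OF pe Q(2)])
    show "prj (P - ?f)" by (rule prj_diff(1)[OF pf P(2)]) (rule comp_subst[OF PV])
  qed
  have "?e = Q \<or> ?f = P"
  proof (rule ccontr)
    assume "\<not> ?thesis"
    then have ne: "P - ?f \<noteq> 0" "Q - ?e \<noteq> 0" by auto
    have mem: "P - ?f \<in> M" "Q - ?e \<in> M" using P Q VM by auto
    obtain u where u: "u \<in> M" "u \<noteq> 0" "prj (u\<^sup>\<star> \<odot> u)" "(P - ?f) \<odot> u = u" "u \<odot> (Q - ?e) = u"
      using exists_piso[OF mem(1) f ne(1) mem(2) e(1) ne(2)] by blast
    have Pu: "P \<odot> u = u"
      by (rule comp_absorb[OF _ u(4)]) (simp add: op_distrib prj_idem[OF P(2)] comp_subst[OF PV])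
    have uQ: "u \<odot> Q = u"
    proof -
      have "(Q - ?e) \<odot> Q = Q - ?e" using prj_diff(2)[OF pe Q(2) e(2)] prj_idem[OF Q(2)] by (simp add: op_distrib)
      then show ?thesis using u(5) by (metis op_assoc)
    qed
    have oF: "v\<^sup>\<star> \<odot> u = 0" "v \<odot> u\<^sup>\<star> = 0" if v: "v \<in> F" for v
    proof -
      have fv: "?f \<odot> v = v"
        using comp_absorb[OF prj_opsum(3)[OF S(3) v], of v] piso(1)[OF p[OF v]] by (simp add: S(5) op_assoc)
      have "(P - ?f) \<odot> v = 0" using fv F(1) v by (simp add: op_distrib)
      then have "((P - ?f) \<odot> v)\<^sup>\<star> = 0" by simp
      moreover have "((P - ?f) \<odot> v)\<^sup>\<star> = v\<^sup>\<star> \<odot> (P - ?f)" using prj_sa[OF f] radj_comp by metis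
      ultimately have "v\<^sup>\<star> \<odot> (P - ?f) = 0" by simp
      then show "v\<^sup>\<star> \<odot> u = 0" using u(4) comp_zero_left by metis
      have ev: "v \<odot> ?e = v"
      proof -
        have "v\<^sup>\<star> \<odot> v \<odot> ?e = v\<^sup>\<star> \<odot> v" using prj_opsum(4)[OF S(2) v] by (simp add: S(4))
        then have "v \<odot> (v\<^sup>\<star> \<odot> v \<odot> ?e) = v" using piso(1)[OF p[OF v]] by simp
        then show ?thesis using comp_subst[OF piso(1)[OF p[OF v]], of ?e] by simp
      qed
      have "v \<odot> (Q - ?e) = 0" using ev F(1) v by (simp add: op_distrib)
      moreover have "(u \<odot> (Q - ?e))\<^sup>\<star> = (Q - ?e) \<odot> u\<^sup>\<star>" using prj_sa[OF e(1)] radj_comp by metis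
      ultimately show "v \<odot> u\<^sup>\<star> = 0" using u(5) comp_zero_left by metis
    qed
    have "u \<in> F" using F(3) u Pu uQ oF comp_radj_zero comp_radj_zero' by blast
    then have "u\<^sup>\<star> \<odot> u = 0" using oF by blast
    then have "u \<odot> \<one> = 0" by - (rule comp_eq_zero_iff[THEN iffD2], simp)
    then show False using u(2) by simp
  qed
  then show ?thesis using VM pe PV VQ by (intro bexI[of _ V]) auto
qed

end

lemma opsum_finite:
  assumes "finite I" "orth_prjs I P"
  shows "opsum P I = sum P I"
proof (rule blinfun_eqI)
  fix x
  have "((\<lambda>i. ap (P i) x) has_sum (\<Sum>i\<in>I. ap (P i) x)) I"
    by (rule has_sum_finite[OF assms(1)])
  then show "ap (opsum P I) x = ap (sum P I) x"
    using prj_opsum(1)[OF assms(2), of x] has_sum_unique by (simp add: blinfun.sum_left) blast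
qed

lemma pos_sum: "(\<And>i. i \<in> I \<Longrightarrow> pos (P i)) \<Longrightarrow> pos (sum P I)"
  by (induction I rule: infinite_finite_induct) (auto intro: pos_add)

lemma frame_full:
  fixes v :: "'i \<Rightarrow> 'a::hilbert_space operator"
  assumes q: "prj q" and v: "frame q I v" and F: "prj F" "\<And>i. i \<in> I \<Longrightarrow> F \<odot> v i = v i"
    and G: "opsum (\<lambda>i. v i \<odot> (v i)\<^sup>\<star>) I \<odot> F = F"
  shows "opsum (\<lambda>i. v i \<odot> (v i)\<^sup>\<star>) I = F"
proof -
  let ?G = "opsum (\<lambda>i. v i \<odot> (v i)\<^sup>\<star>) I"
  have "(F - \<one>) \<odot> v i = 0" if "i \<in> I" for i using F(2)[OF that] by (simp add: op_distrib)
  then have "(F - \<one>) \<odot> ?G = 0" by (rule frame_sum(6)[OF q v])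
  then have FG: "F \<odot> ?G = ?G" by (simp add: op_distrib)
  have "(?G \<odot> F)\<^sup>\<star> = F \<odot> ?G" using prj_sa[OF frame_sum(3)[OF q v]] prj_sa[OF F(1)] by simp
  then show ?thesis using FG G prj_sa[OF F(1)] by simp
qed

lemma frame_sum_fix:
  fixes v :: "'i \<Rightarrow> 'a::hilbert_space operator"
  assumes q: "prj q" and v: "frame q I v" and T: "\<And>i. i \<in> I \<Longrightarrow> T \<odot> v i = v i"
  shows "T \<odot> opsum (\<lambda>i. v i \<odot> (v i)\<^sup>\<star>) I = opsum (\<lambda>i. v i \<odot> (v i)\<^sup>\<star>) I"
  using frame_sum(6)[OF q v, of "T - \<one>"] T by (simp add: op_distrib)

context semifinite_factor
begin

section \<open>The trace and packings by copies of a projection\<close>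

lemma tr_zero [simp]: "\<tau> 0 = 0"
  using tr_scale[of 0 0] by simp

lemma tr_mono:
  assumes "A \<in> M" "B \<in> M" "pos A" "pos (B - A)"
  shows "\<tau> A \<le> \<tau> B"
  using tr_add[of A "B - A"] assms by (auto simp: M_diff)

lemma tr_sum:
  assumes "finite I" "\<And>i. i \<in> I \<Longrightarrow> P i \<in> M" "\<And>i. i \<in> I \<Longrightarrow> pos (P i)"
  shows "\<tau> (sum P I) = (\<Sum>i\<in>I. \<tau> (P i))"
  using assms by (induction I rule: finite_induct) (auto simp: tr_add M_sum pos_sum)

lemma M_frame: "prj q \<Longrightarrow> frame q I v \<Longrightarrow> (\<And>i. i \<in> I \<Longrightarrow> v i \<in> M) \<Longrightarrow> opsum (\<lambda>i. v i \<odot> (v i)\<^sup>\<star>) I \<in> M"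
  by (rule M_opsum_prj[OF frame_sum(1)]) auto

lemma prj_pos_diff: "prj P \<Longrightarrow> prj Q \<Longrightarrow> Q \<odot> P = P \<Longrightarrow> pos (Q - P)"
  by (rule prj_pos[OF prj_diff(1)])

lemma tr_prj_mono: "P \<in> M \<Longrightarrow> Q \<in> M \<Longrightarrow> prj P \<Longrightarrow> prj Q \<Longrightarrow> Q \<odot> P = P \<Longrightarrow> \<tau> P \<le> \<tau> Q"
  by (intro tr_mono prj_pos_diff prj_pos)

lemma tr_frame_finite:
  assumes "finite I" "prj q" "frame q I v" "\<And>i. i \<in> I \<Longrightarrow> v i \<in> M"
  shows "\<tau> (opsum (\<lambda>i. v i \<odot> (v i)\<^sup>\<star>) I) = of_nat (card I) * \<tau> q"
proof -
  have "\<tau> (v i \<odot> (v i)\<^sup>\<star>) = \<tau> q" if "i \<in> I" for i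
    using tr_swap[OF assms(4)[OF that]] assms(3) that by (simp add: frame_def)
  then show ?thesis
    using assms by (subst opsum_finite[OF assms(1) frame_sum(1)[OF assms(2,3)]], subst tr_sum) auto
qed

lemma frame_sum_subset:
  assumes "prj q" "frame q I v" "J \<subseteq> I"
  shows "opsum (\<lambda>i. v i \<odot> (v i)\<^sup>\<star>) I \<odot> opsum (\<lambda>i. v i \<odot> (v i)\<^sup>\<star>) J = opsum (\<lambda>i. v i \<odot> (v i)\<^sup>\<star>) J"
  by (rule frame_sum_fix[OF assms(1) frame_subset[OF assms(2,3)]]) (use frame_sum(4)[OF assms(1,2)] assms(3) in auto)

lemma tr_frame_infinite:
  assumes I: "infinite I" and q: "prj q" "q \<in> M" "q \<noteq> 0" and v: "frame q I v" "\<And>i. i \<in> I \<Longrightarrow> v i \<in> M"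
  shows "\<tau> (opsum (\<lambda>i. v i \<odot> (v i)\<^sup>\<star>) I) = \<infinity>"
proof -
  let ?G = "\<lambda>I. opsum (\<lambda>i. v i \<odot> (v i)\<^sup>\<star>) I"
  have le: "of_nat n * \<tau> q \<le> \<tau> (?G I)" for n
  proof -
    obtain J where J: "J \<subseteq> I" "finite J" "card J = n" using I infinite_arbitrarily_large by blast
    note v' = frame_subset[OF v(1) J(1)]
    have "\<tau> (?G J) \<le> \<tau> (?G I)"
      by (intro tr_prj_mono M_frame[OF q(1) v'] M_frame[OF q(1) v(1)] frame_sum(3)[OF q(1) v'] frame_sum(3)[OF q(1) v(1)]
        frame_sum_subset[OF q(1) v(1) J(1)]) (use J v(2) in auto)
    then show ?thesis using tr_frame_finite[OF J(2) q(1) v'] J v(2) by (auto simp: subset_iff)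
  qed
  have "\<tau> q \<noteq> 0" using tr_faithful[OF q(2) prj_pos[OF q(1)]] q(3) by blast
  moreover have "(SUP n. of_nat n * \<tau> q) = (SUP n. of_nat n) * \<tau> q" by (simp add: SUP_mult_right_ennreal)
  ultimately have "(SUP n. of_nat n * \<tau> q) = \<infinity>" by (simp add: ennreal_SUP_of_nat_eq_top ennreal_top_mult)
  then have "\<infinity> \<le> \<tau> (?G I)" using SUP_least[of UNIV "\<lambda>n. of_nat n * \<tau> q"] le by metis
  then show ?thesis by (simp add: top_unique)
qed

text \<open>By comparison, what a maximal family of copies of \<open>q\<close> leaves of
  \<open>F\<close> either contains another copy, which maximality excludes, or is equivalent through
  \<open>z\<close> to a part of \<open>q\<close>.\<close>

lemma packing:
  assumes q: "q \<in> M" "prj q" "q \<noteq> 0" and F: "F \<in> M" "prj F"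
  obtains W z where "\<And>v. v \<in> W \<Longrightarrow> v \<in> M" "\<And>v. v \<in> W \<Longrightarrow> F \<odot> v = v" "frame q W (\<lambda>v. v)" "countable W"
    "z \<in> M" "prj (z\<^sup>\<star> \<odot> z)" "z \<odot> q = z" "z \<odot> z\<^sup>\<star> = F - opsum (\<lambda>v. v \<odot> v\<^sup>\<star>) W"
proof -
  let ?\<phi> = "\<lambda>v. v \<in> M \<and> v\<^sup>\<star> \<odot> v = q \<and> F \<odot> v = v"
  let ?R = "\<lambda>v w. v\<^sup>\<star> \<odot> w = (0 :: 'a operator)"
  obtain W where W: "\<forall>v\<in>W. ?\<phi> v" "pairwise ?R W" "\<forall>w. ?\<phi> w \<and> (\<forall>v\<in>W. ?R v w \<and> ?R w v) \<longrightarrow> w \<in> W"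
    using maximal_pairwise_family[of ?\<phi> ?R] by (elim exE conjE)
  have fr: "frame q W (\<lambda>v. v)" using W(1,2) by (auto simp: frame_def pairwise_def)
  let ?E = "opsum (\<lambda>v. v \<odot> v\<^sup>\<star>) W"
  have EM: "?E \<in> M" by (rule M_frame[OF q(2) fr]) (use W(1) in auto)
  note E = frame_sum[OF q(2) fr]
  have FE: "F \<odot> ?E = ?E" by (rule frame_sum_fix[OF q(2) fr]) (use W(1) in auto)
  have pE: "prj (F - ?E)" by (rule prj_diff(1)[OF E(3) F(2) FE])
  obtain z where z: "z \<in> M" "prj (z\<^sup>\<star> \<odot> z)" "(F - ?E) \<odot> z = z" "z \<odot> q = z" "z\<^sup>\<star> \<odot> z = q \<or> z \<odot> z\<^sup>\<star> = F - ?E"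
    using comparison[of "F - ?E" q] pE q F EM by auto
  have "z\<^sup>\<star> \<odot> z \<noteq> q"
  proof
    assume zq: "z\<^sup>\<star> \<odot> z = q"
    have Fz: "F \<odot> z = z"
      by (rule comp_absorb[OF _ z(3)]) (simp add: op_distrib prj_idem[OF F(2)] FE)
    have vz: "v\<^sup>\<star> \<odot> z = 0" if "v \<in> W" for v
    proof -
      have "(F - ?E) \<odot> v = 0" using W(1) E(4)[OF that] that by (simp add: op_distrib)
      then have "((F - ?E) \<odot> v)\<^sup>\<star> = 0" by simp
      then have "v\<^sup>\<star> \<odot> (F - ?E) = 0" using radj_comp[of "F - ?E" v] prj_sa[OF pE] by simp
      then show ?thesis using comp_zero_left[of "v\<^sup>\<star>" "F - ?E" z] z(3) by simp
    qed
    then have "z \<in> W" using W(3) z(1) zq Fz comp_radj_zero by blast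
    then have "q = 0" using vz zq by metis
    then show False using q(3) by simp
  qed
  then have zz: "z \<odot> z\<^sup>\<star> = F - ?E" using z(5) by blast
  have "countable ((\<lambda>v. v \<odot> v\<^sup>\<star>) ` W)"
  proof (rule countable_orth)
    show "(\<lambda>v. v \<odot> v\<^sup>\<star>) ` W \<subseteq> {P \<in> M. prj P \<and> P \<noteq> 0}"
    proof (clarsimp, intro conjI)
      fix v assume v: "v \<in> W"
      show "v \<odot> v\<^sup>\<star> \<in> M" using W(1) v by auto
      show "prj (v \<odot> v\<^sup>\<star>)" using E(1) v by (auto simp: orth_prjs_def)
      have "v \<odot> v\<^sup>\<star> \<odot> v = v" using E(2)[OF v] W(1) v by (simp add: op_assoc)
      moreover have "v \<noteq> 0" using W(1) v q(3) by auto
      ultimately show "v \<odot> v\<^sup>\<star> \<noteq> 0" by auto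
    qed
    show "pairwise (\<lambda>P Q. P \<odot> Q = 0) ((\<lambda>v. v \<odot> v\<^sup>\<star>) ` W)"
      using E(1) by (auto simp: pairwise_def orth_prjs_def)
  qed
  moreover have "inj_on (\<lambda>v. v \<odot> v\<^sup>\<star>) W"
  proof (rule inj_onI, rule ccontr)
    fix v w assume vw: "v \<in> W" "w \<in> W" "v \<odot> v\<^sup>\<star> = w \<odot> w\<^sup>\<star>" "v \<noteq> w"
    have "v = v \<odot> (v\<^sup>\<star> \<odot> v)" using E(2)[OF vw(1)] W(1) vw(1) by simp
    also have "\<dots> = w \<odot> w\<^sup>\<star> \<odot> v" by (simp only: vw(3)[symmetric] op_assoc)
    also have "\<dots> = w \<odot> (w\<^sup>\<star> \<odot> v)" by (rule op_assoc)
    also have "\<dots> = 0" using W(2) vw by (auto simp: pairwise_def)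
    finally have "v = 0" .
    then show False using W(1) vw(1) q(3) by auto
  qed
  ultimately have "countable W" by (rule countable_image_inj_on)
  then show ?thesis using that[of W z] W(1) fr z zz by blast
qed

text \<open>Finitely many copies and a remainder have finite trace, so the packing is infinite. The
  remainder is then absorbed by moving a part of every copy one place along.\<close>

lemma packing_infinite:
  assumes q: "q \<in> M" "prj q" "q \<noteq> 0" "\<tau> q < \<infinity>" and F: "F \<in> M" "prj F" "\<tau> F = \<infinity>"
  shows "\<exists>v :: nat \<Rightarrow> 'a operator. (\<forall>i. v i \<in> M) \<and> frame q UNIV v \<and> opsum (\<lambda>i. v i \<odot> (v i)\<^sup>\<star>) UNIV = F"
proof -
  obtain W z where W: "\<And>v. v \<in> W \<Longrightarrow> v \<in> M" "\<And>v. v \<in> W \<Longrightarrow> F \<odot> v = v" "frame q W (\<lambda>v. v)" "countable W"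
    and z: "z \<in> M" "prj (z\<^sup>\<star> \<odot> z)" "z \<odot> q = z" "z \<odot> z\<^sup>\<star> = F - opsum (\<lambda>v. v \<odot> v\<^sup>\<star>) W"
    by (rule packing[OF q(1-3) F(1,2)]) (rule that)
  let ?E = "opsum (\<lambda>v. v \<odot> v\<^sup>\<star>) W"
  define q' where "q' = z\<^sup>\<star> \<odot> z"
  have q': "prj q'" "q' \<odot> q = q'" "q \<odot> q' = q'" "z \<odot> q' = z" "q' \<in> M"
  proof -
    show "prj q'" "q' \<odot> q = q'" "z \<odot> q' = z" "q' \<in> M"
      using z piso(1)[OF z(2)] by (auto simp: q'_def op_assoc)
    have "(q' \<odot> q)\<^sup>\<star> = q'\<^sup>\<star>" using \<open>q' \<odot> q = q'\<close> by simp
    then show "q \<odot> q' = q'" using prj_sa[OF q(2)] prj_sa[OF \<open>prj q'\<close>] by simp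
  qed
  have EM: "?E \<in> M" by (rule M_frame[OF q(2) W(3)]) (rule W(1))
  have pE: "prj (z \<odot> z\<^sup>\<star>)" by (rule piso(2)[OF z(2)])
  have "infinite W"
  proof
    assume fin: "finite W"
    have "\<tau> F = \<tau> (?E + z \<odot> z\<^sup>\<star>)" using z(4) by simp
    also have "\<dots> = \<tau> ?E + \<tau> (z \<odot> z\<^sup>\<star>)"
      using EM z(1) by (intro tr_add prj_pos[OF frame_sum(3)[OF q(2) W(3)]]) auto
    also have "\<tau> (z \<odot> z\<^sup>\<star>) = \<tau> q'" using tr_swap[OF z(1)] by (simp add: q'_def)
    also have "\<tau> q' \<le> \<tau> q" using q q' by (intro tr_prj_mono) auto
    also have "\<tau> ?E = of_nat (card W) * \<tau> q" by (rule tr_frame_finite[OF fin q(2) W(3) W(1)])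
    finally have "\<tau> F \<le> of_nat (card W) * \<tau> q + \<tau> q" by simp
    also have "\<dots> < \<infinity>" using q(4) by (simp add: ennreal_mult_less_top less_top of_nat_less_top)
    finally show False using F(3) by simp
  qed
  define w where "w = from_nat_into W"
  have bij: "bij_betw w UNIV W" unfolding w_def using W(4) \<open>infinite W\<close> by (rule bij_betw_from_nat_into)
  have wW: "w i \<in> W" for i using bij by (auto simp: bij_betw_def)
  have wq: "(w i)\<^sup>\<star> \<odot> w j = (if i = j then q else 0)" for i j
    using frame_reindex[OF W(3), of w UNIV] bij by (auto simp: bij_betw_def frame_def)
  have wF: "F \<odot> w i = w i" "w i \<in> M" for i using W wW by auto
  have wz: "(w i)\<^sup>\<star> \<odot> z = 0" for i
  proof -
    have "(F - ?E) \<odot> w i = 0" using wF frame_sum(4)[OF q(2) W(3) wW] by (simp add: op_distrib)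
    then have "((F - ?E) \<odot> w i)\<^sup>\<star> = 0" by simp
    then have "(w i)\<^sup>\<star> \<odot> (z \<odot> z\<^sup>\<star>) = 0" using radj_comp[of "F - ?E" "w i"] prj_sa[OF pE] z(4) by simp
    then have "(w i)\<^sup>\<star> \<odot> (z \<odot> z\<^sup>\<star> \<odot> z) = 0" using comp_zero_left[of "(w i)\<^sup>\<star>" "z \<odot> z\<^sup>\<star>" z] by simp
    then show ?thesis using piso(1)[OF z(2)] by (simp add: op_assoc)
  qed
  \<comment> \<open>The part \<open>q'\<close> of \<open>q\<close> equivalent to the remainder is
    shifted: index \<open>0\<close> receives the remainder through \<open>z\<close>, index
    \<open>Suc i\<close> receives what was at \<open>i\<close>. The part \<open>q - q'\<close> stays
    in place.\<close>
  define y where "y i = (case i of 0 \<Rightarrow> z | Suc i \<Rightarrow> w i \<odot> q')" for i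
  have y0: "y 0 = z" and yS: "y (Suc i) = w i \<odot> q'" for i by (simp_all add: y_def)
  have wzs: "z\<^sup>\<star> \<odot> w i = 0" for i using wz by (rule comp_radj_zero)
  define v where "v i = y i + w i \<odot> (q - q')" for i
  have yy: "(y i)\<^sup>\<star> \<odot> y j = (if i = j then q' else 0)" for i j
    using q' prj_sa[OF q'(1)] prj_idem[OF q'(1)]
    by (cases i; cases j) (auto simp: y0 yS op_assoc q'_def[symmetric] comp_subst[OF wq] comp_zero_left[OF wzs] wz)
  have yw: "(y i)\<^sup>\<star> \<odot> (w j \<odot> (q - q')) = 0" for i j
    using q' prj_sa[OF q'(1)] prj_idem[OF q'(1)]
    by (cases i) (auto simp: y0 yS op_assoc comp_subst[OF wq] comp_zero_left[OF wzs] op_distrib prj_idem[OF q(2)])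
  have wy: "(w j \<odot> (q - q'))\<^sup>\<star> \<odot> y i = 0" for i j using yw by (rule comp_radj_zero)
  have ww: "(w i \<odot> (q - q'))\<^sup>\<star> \<odot> (w j \<odot> (q - q')) = (if i = j then q - q' else 0)" for i j
    using q' prj_sa[OF q'(1)] prj_idem[OF q'(1)] prj_sa[OF q(2)] prj_idem[OF q(2)]
    by (auto simp: op_assoc comp_subst[OF wq] op_distrib)
  have fr: "frame q UNIV v"
    unfolding frame_def v_def radj_add op_distrib(1,2) yy yw wy ww by auto
  let ?G = "opsum (\<lambda>i. v i \<odot> (v i)\<^sup>\<star>) UNIV"
  have Fz: "F \<odot> z = z"
  proof -
    have "F \<odot> (z \<odot> z\<^sup>\<star>) = z \<odot> z\<^sup>\<star>" 
      unfolding z(4) using frame_sum_fix[OF q(2) W(3), of F] W(2) prj_idem[OF F(2)] by (simp add: op_distrib)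
    then show ?thesis by (rule comp_absorb) (simp add: op_assoc piso(1)[OF z(2)])
  qed
  have Fy: "F \<odot> y i = y i" for i by (cases i) (simp_all add: y0 yS Fz comp_subst[OF wF(1)])
  have Fv: "F \<odot> v i = v i" for i by (simp add: v_def op_distrib(2) Fy comp_subst[OF wF(1)])
  have Gv: "?G \<odot> v i = v i" for i by (rule frame_sum(4)[OF q(2) fr]) simp
  have vy: "v i \<odot> q' = y i" for i
    using q' prj_idem[OF q'(1)] by (cases i) (simp_all add: v_def y0 yS op_distrib op_assoc)
  have vw: "v i \<odot> (q - q') = w i \<odot> (q - q')" for i
    using q' prj_idem[OF q'(1)] z(3) prj_idem[OF q(2)] by (cases i) (simp_all add: v_def y0 yS op_distrib op_assoc)
  have Gy: "?G \<odot> y i = y i" for i using comp_subst[OF Gv[of i], of q'] vy by simp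
  have Gw: "?G \<odot> (w i \<odot> (q - q')) = w i \<odot> (q - q')" for i using comp_subst[OF Gv[of i], of "q - q'"] vw by simp
  have "?G \<odot> w i = w i" for i
  proof -
    have "w i = y (Suc i) + w i \<odot> (q - q')"
      using frame_sum(2)[OF q(2) W(3) wW, of i] by (simp add: yS op_distrib)
    then show ?thesis using Gy[of "Suc i"] Gw[of i] op_distrib(2)[of ?G "y (Suc i)" "w i \<odot> (q - q')"] by simp
  qed
  moreover have "\<exists>i. v = w i" if "v \<in> W" for v using bij that by (auto simp: bij_betw_def)
  ultimately have "?G \<odot> v = v" if "v \<in> W" for v using that by metis
  then have "?G \<odot> ?E = ?E" by (rule frame_sum_fix[OF q(2) W(3)])
  moreover have "?G \<odot> (z \<odot> z\<^sup>\<star>) = z \<odot> z\<^sup>\<star>" using Gy[of 0] by (simp add: y0 comp_subst)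
  moreover have "F = ?E + z \<odot> z\<^sup>\<star>" using z(4) by simp
  ultimately have "?G \<odot> F = F" by (simp add: op_distrib)
  then have "?G = F" by (intro frame_full[OF q(2) fr F(2)] Fv)
  moreover have "y i \<in> M" for i using z(1) wF q' by (cases i) (auto simp: y0 yS)
  then have "v i \<in> M" for i unfolding v_def by (intro M_add M_comp M_diff wF q q')
  ultimately show ?thesis using fr by blast
qed

end

section \<open>Haar functions\<close>

context semifinite_factor
begin

lemma M_frame_link:
  assumes "prj q" "frame q I v" "frame q I w" "\<And>i. i \<in> I \<Longrightarrow> v i \<in> M" "\<And>i. i \<in> I \<Longrightarrow> w i \<in> M"
  shows "opsum (\<lambda>i. v i \<odot> (w i)\<^sup>\<star>) I \<in> M"
  by (rule M_has_sum[OF frame_link(1)[OF assms(1-3)]]) (use assms(4,5) in auto)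

text \<open>When \<open>q\<close> itself is infinite, \<open>q\<close> and \<open>F\<close> are both
  filled with copies of a finite \<open>p\<close>. Splitting the index set of \<open>F\<close> into
  infinitely many infinite rows yields copies of \<open>q\<close>, linked to it term by
  term.\<close>

lemma packing_any:
  assumes q: "q \<in> M" "prj q" "q \<noteq> 0" and F: "F \<in> M" "prj F" "\<tau> F = \<infinity>"
  shows "\<exists>v :: nat \<Rightarrow> 'a operator. (\<forall>i. v i \<in> M) \<and> frame q UNIV v \<and> opsum (\<lambda>i. v i \<odot> (v i)\<^sup>\<star>) UNIV = F"
proof (cases "\<tau> q = \<infinity>")
  case False
  then show ?thesis using packing_infinite[OF q _ F] by (simp add: less_top)
next
  case True
  obtain p where p: "p \<in> M" "prj p" "p \<noteq> 0" "\<tau> p < \<infinity>" using finite_prj_ex by blast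
  obtain z where z: "\<And>i::nat. z i \<in> M" "frame p UNIV z" "opsum (\<lambda>i. z i \<odot> (z i)\<^sup>\<star>) UNIV = q"
    using packing_infinite[OF p q(1,2) True] by blast
  obtain w where w: "\<And>i::nat. w i \<in> M" "frame p UNIV w" "opsum (\<lambda>i. w i \<odot> (w i)\<^sup>\<star>) UNIV = F"
    using packing_infinite[OF p F] by blast
  define y where "y j i = w (prod_encode (j, i))" for j i
  have y: "frame p UNIV (y j)" for j
    unfolding y_def by (rule frame_reindex[OF w(2)]) (auto simp: inj_on_def)
  have yM: "y j i \<in> M" for j i using w(1) by (simp add: y_def)
  define v where "v j = opsum (\<lambda>i. y j i \<odot> (z i)\<^sup>\<star>) UNIV" for j
  note L = frame_link[OF p(2) y z(2), folded v_def]
  have vM: "v j \<in> M" for j unfolding v_def by (rule M_frame_link[OF p(2) y z(2) yM z(1)])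
  have orth: "(v i)\<^sup>\<star> \<odot> v j = 0" if "i \<noteq> j" for i j
  proof (rule op_sum_eq_zero[OF L(1)])
    fix k
    have "(y j k)\<^sup>\<star> \<odot> v i = 0"
    proof (rule op_sum_eq_zero[OF L(1)])
      fix l
      have "(y j k)\<^sup>\<star> \<odot> y i l = 0" using w(2) that by (simp add: frame_def y_def)
      then show "(y j k)\<^sup>\<star> \<odot> (y i l \<odot> (z l)\<^sup>\<star>) = 0" by (rule comp_zero_left)
    qed
    then have "(v i)\<^sup>\<star> \<odot> y j k = 0" by (rule comp_radj_zero[of "y j k" "v i"])
    then show "(v i)\<^sup>\<star> \<odot> (y j k \<odot> (z k)\<^sup>\<star>) = 0" by (rule comp_zero_left)
  qed
  have fr: "frame q UNIV v" unfolding frame_def using orth L(2) z(3) by auto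
  let ?G = "opsum (\<lambda>i. v i \<odot> (v i)\<^sup>\<star>) UNIV"
  have Fy: "F \<odot> y j i = y j i" for i j
    using frame_sum(4)[OF p(2) w(2), of "prod_encode (j, i)"] w(3) by (simp add: y_def)
  have "F \<odot> v j = \<one> \<odot> v j" for j
    by (rule op_sum_left_cong[OF L(1)]) (simp add: comp_subst[OF Fy])
  then have Fv: "F \<odot> v j = v j" for j by simp
  have Gv: "?G \<odot> v j = v j" for j using frame_sum(4)[OF q(2) fr, of j] by simp
  have "?G \<odot> y j i = y j i" for i j
  proof -
    have "v j \<odot> ((v j)\<^sup>\<star> \<odot> y j i) = y j i"
      using L(3)[of j] frame_sum(4)[OF p(2) y, of i j] by (simp flip: op_assoc)
    then show ?thesis using comp_subst[OF Gv[of j], of "(v j)\<^sup>\<star> \<odot> y j i"] by simp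
  qed
  then have "?G \<odot> y (fst (prod_decode i)) (snd (prod_decode i)) = y (fst (prod_decode i)) (snd (prod_decode i))" for i .
  then have "?G \<odot> w i = w i" for i by (simp add: y_def)
  then have "?G \<odot> F = F" using frame_sum_fix[OF p(2) w(2), of ?G] w(3) by simp
  then have "?G = F" by (intro frame_full[OF q(2) fr F(2)] Fv)
  then show ?thesis using fr vM by blast
qed

text \<open>Shifting a frame of \<open>F\<close> by one index omits only the range of
  \<open>w 0\<close>. This turns infinite trace into infinite in the Murray-von Neumann
  sense.\<close>

lemma infinite_shift:
  assumes F: "F \<in> M" "prj F" "\<tau> F = \<infinity>"
  shows "\<exists>X\<in>M. X \<odot> X\<^sup>\<star> = F \<and> prj (X\<^sup>\<star> \<odot> X) \<and> F \<odot> (X\<^sup>\<star> \<odot> X) = X\<^sup>\<star> \<odot> X \<and> X\<^sup>\<star> \<odot> X \<noteq> F"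
proof -
  obtain p where p: "p \<in> M" "prj p" "p \<noteq> 0" using finite_prj_ex by blast
  obtain w where w: "\<And>i::nat. w i \<in> M" "frame p UNIV w" "opsum (\<lambda>i. w i \<odot> (w i)\<^sup>\<star>) UNIV = F"
    using packing_any[OF p F] by blast
  have w': "frame p UNIV (\<lambda>i. w (Suc i))" by (rule frame_reindex[OF w(2)]) auto
  define X where "X = opsum (\<lambda>i. w i \<odot> (w (Suc i))\<^sup>\<star>) UNIV"
  note L = frame_link[OF p(2) w(2) w', folded X_def]
  have "X \<in> M" unfolding X_def by (rule M_frame_link[OF p(2) w(2) w' w(1) w(1)])
  moreover have "prj (X\<^sup>\<star> \<odot> X)" unfolding L(2) by (rule frame_sum(3)[OF p(2) w'])
  moreover have Fw: "F \<odot> w i = w i" for i using frame_sum(4)[OF p(2) w(2), of i] w(3) by simp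
  moreover have "F \<odot> (X\<^sup>\<star> \<odot> X) = X\<^sup>\<star> \<odot> X"
    unfolding L(2) by (rule frame_sum_fix[OF p(2) w']) (rule Fw)
  moreover have "X\<^sup>\<star> \<odot> X \<noteq> F"
  proof
    assume e: "X\<^sup>\<star> \<odot> X = F"
    have "(w 0)\<^sup>\<star> \<odot> w (Suc i) = 0" for i using w(2) by (simp add: frame_def)
    then have "(w 0)\<^sup>\<star> \<odot> F = 0" unfolding e[symmetric] L(2) by (rule frame_sum(6)[OF p(2) w'])
    then have "(w 0)\<^sup>\<star> \<odot> (F \<odot> w 0) = 0" by (rule comp_zero_left)
    then have "p = 0" using Fw w(2) by (simp add: frame_def)
    then show False using p(3) by simp
  qed
  ultimately show ?thesis using L(3) w(3) by auto
qed

end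

section \<open>Nonnegative double series and the Haar system\<close>

lemma has_sum_Sigma_nonneg:
  fixes f :: "'i \<times> 'j \<Rightarrow> real"
  assumes "\<And>p. p \<in> Sigma A B \<Longrightarrow> f p \<ge> 0" "\<And>x. x \<in> A \<Longrightarrow> ((\<lambda>y. f (x, y)) has_sum g x) (B x)" "(g has_sum S) A"
  shows "(f has_sum S) (Sigma A B)"
proof (rule has_sum_SigmaI[OF assms(2,3)])
  have g0: "0 \<le> g x" if "x \<in> A" for x by (rule has_sum_nonneg[OF assms(2)[OF that]]) (use assms(1) that in auto)
  show "f summable_on Sigma A B"
  proof (rule nonneg_bdd_above_summable_on[OF assms(1)])
    show "bdd_above (sum f ` {F. F \<subseteq> Sigma A B \<and> finite F})"
    proof (rule bdd_aboveI2[where M=S], clarify)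
      fix F assume F: "F \<subseteq> Sigma A B" "finite F"
      have "sum f F \<le> sum f (Sigma (fst ` F) (\<lambda>x. snd ` {p\<in>F. fst p = x}))"
        using F assms(1) by (intro sum_mono2) (auto intro: rev_image_eqI)
      also have "\<dots> = (\<Sum>x\<in>fst ` F. \<Sum>y\<in>snd ` {p\<in>F. fst p = x}. f (x, y))"
        using F by (subst sum.Sigma) auto
      also have "\<dots> \<le> (\<Sum>x\<in>fst ` F. g x)"
        using F assms(1) by (intro sum_mono finite_sum_le_has_sum[OF assms(2)]) auto
      also have "\<dots> \<le> S" using F g0 by (intro finite_sum_le_has_sum[OF assms(3)]) auto
      finally show "sum f F \<le> S" .
    qed
  qed
qed

text \<open>The value at \<open>j\<close> of the normalized Haar function of generation
  \<open>n\<close> on the dyadic block of length \<open>2 ^ Suc n\<close> containing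
  \<open>j\<close>; the sign changes at the middle of the block.\<close>

definition haar_coeff :: "nat \<Rightarrow> nat \<Rightarrow> real" where
  "haar_coeff n j = (if odd (j div 2 ^ n) then - 1 else 1) * (1 / sqrt 2) ^ Suc n"

lemma haar_coeff_Suc: "haar_coeff (Suc n) j = (1 / sqrt 2) * haar_coeff n (j div 2)"
  by (simp add: haar_coeff_def div_mult2_eq)

lemma abs_haar_coeff: "\<bar>haar_coeff n j\<bar> = (1 / sqrt 2) ^ Suc n"
  by (simp add: haar_coeff_def abs_mult)

lemma haar_coeff_sq: "(haar_coeff n j)\<^sup>2 = (1/2) ^ Suc n"
proof -
  have "(haar_coeff n j)\<^sup>2 = ((1 / sqrt 2) ^ Suc n)\<^sup>2" by (simp add: haar_coeff_def power_mult_distrib)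
  also have "\<dots> = ((1 / sqrt 2)\<^sup>2) ^ Suc n" by (simp only: power_mult[symmetric] mult.commute)
  finally show ?thesis by (simp add: power_divide)
qed

lemma summable_haar_bound: "summable (\<lambda>n. (1 / sqrt 2) ^ Suc n :: real)"
  unfolding summable_Suc_iff by (rule summable_geometric) simp

text \<open>The \<open>j\<close>-th coordinate of the vector with Haar coefficients
  \<open>u n g\<close>, where \<open>g\<close> numbers the blocks of generation \<open>n\<close>.
  Only one block of each generation contains \<open>j\<close>, hence a single sum.\<close>

definition haar :: "(nat \<Rightarrow> nat \<Rightarrow> 'a::banach) \<Rightarrow> nat \<Rightarrow> 'a" where
  "haar u j = (\<Sum>n. haar_coeff n j *\<^sub>R u n (j div 2 ^ Suc n))"

lemma haar_summable:
  assumes "\<And>n g. norm (u n g :: 'a::banach) \<le> C"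
  shows "summable (\<lambda>n. norm (haar_coeff n j *\<^sub>R u n (j div 2 ^ Suc n)))"
    "summable (\<lambda>n. haar_coeff n j *\<^sub>R u n (j div 2 ^ Suc n))"
proof -
  show 1: "summable (\<lambda>n. norm (haar_coeff n j *\<^sub>R u n (j div 2 ^ Suc n)))"
  proof (rule summable_comparison_test'[where N=0])
    show "summable (\<lambda>n. (1 / sqrt 2) ^ Suc n * C)" by (intro summable_mult2 summable_haar_bound)
    show "norm (norm (haar_coeff n j *\<^sub>R u n (j div 2 ^ Suc n))) \<le> (1 / sqrt 2) ^ Suc n * C" for n
      using mult_left_mono[OF assms, of "\<bar>haar_coeff n j\<bar>" n "j div 2 ^ Suc n"] by (simp add: abs_haar_coeff)
  qed
  then show "summable (\<lambda>n. haar_coeff n j *\<^sub>R u n (j div 2 ^ Suc n))" by (rule summable_norm_cancel)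
qed

text \<open>Generations from \<open>1\<close> on do not separate \<open>2 * i\<close> from
  \<open>2 * i + 1\<close>; up to the factor they form the Haar expansion at half the index.\<close>

lemma haar_rec:
  assumes "\<And>n g. norm (u n g :: 'a::banach) \<le> C"
  shows "haar u j = haar_coeff 0 j *\<^sub>R u 0 (j div 2) + (1 / sqrt 2) *\<^sub>R haar (\<lambda>n. u (Suc n)) (j div 2)"
proof -
  have "haar u j = (\<Sum>n. haar_coeff (Suc n) j *\<^sub>R u (Suc n) (j div 2 ^ Suc (Suc n))) + haar_coeff 0 j *\<^sub>R u 0 (j div 2)"
    unfolding haar_def using suminf_split_head[OF haar_summable(2)[where u=u, OF assms], of j] by simp
  also have "(\<Sum>n. haar_coeff (Suc n) j *\<^sub>R u (Suc n) (j div 2 ^ Suc (Suc n))) =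
    (\<Sum>n. (1 / sqrt 2) *\<^sub>R (haar_coeff n (j div 2) *\<^sub>R u (Suc n) (j div 2 div 2 ^ Suc n)))"
    by (simp add: haar_coeff_Suc div_mult2_eq[symmetric])
  also have "\<dots> = (1 / sqrt 2) *\<^sub>R haar (\<lambda>n. u (Suc n)) (j div 2)"
    unfolding haar_def by (rule suminf_scaleR_right[symmetric, OF haar_summable(2)[where u="\<lambda>n. u (Suc n)" and C=C]]) (rule assms)
  finally show ?thesis by (simp add: add.commute)
qed

lemma parallelogram: "(norm (x + y))\<^sup>2 + (norm (y - x))\<^sup>2 = 2 * (norm x)\<^sup>2 + 2 * (norm (y::'a::real_inner))\<^sup>2"
  by (simp add: power2_norm_eq_inner inner_expand inner_commute)

lemma haar_pair:
  assumes "\<And>n g. norm (u n g :: 'a::hilbert_space) \<le> C"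
  shows "(norm (haar u (2 * i)))\<^sup>2 + (norm (haar u (Suc (2 * i))))\<^sup>2 =
    (norm (u 0 i))\<^sup>2 + (norm (haar (\<lambda>n. u (Suc n)) i))\<^sup>2"
proof -
  let ?a = "(1 / sqrt 2) *\<^sub>R u 0 i" and ?b = "(1 / sqrt 2) *\<^sub>R haar (\<lambda>n. u (Suc n)) i"
  have "haar u (2 * i) = ?a + ?b" "haar u (Suc (2 * i)) = ?b - ?a"
    by (simp_all add: haar_rec[where u=u, OF assms, of "2 * i"] haar_rec[where u=u, OF assms, of "Suc (2 * i)"] haar_coeff_def)
  then show ?thesis using parallelogram[of ?a ?b] by (simp add: power_mult_distrib power_divide)
qed

lemma sum_double: "(\<Sum>j<2 * m. f j) = (\<Sum>i<m. f (2 * i) + f (Suc (2 * i)) :: real)"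
  by (induction m) auto

text \<open>Two neighbouring coordinates are a rotation of the finest coefficient and the coarser
  part; iterating leaves only the coarse term at index \<open>0\<close>.\<close>

lemma haar_partial:
  assumes "\<And>n g. norm (u n g :: 'a::hilbert_space) \<le> C"
  shows "(\<Sum>j<2 ^ N. (norm (haar u j))\<^sup>2) =
    (\<Sum>n<N. \<Sum>g<2 ^ (N - Suc n). (norm (u n g))\<^sup>2) + (norm (haar (\<lambda>n. u (n + N)) 0))\<^sup>2"
  using assms
proof (induction N arbitrary: u)
  case (Suc N)
  have "(\<Sum>j<2 ^ Suc N. (norm (haar u j))\<^sup>2) =
    (\<Sum>i<2 ^ N. (norm (u 0 i))\<^sup>2) + (\<Sum>i<2 ^ N. (norm (haar (\<lambda>n. u (Suc n)) i))\<^sup>2)"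
    by (simp add: sum_double haar_pair[where u=u, OF Suc.prems] sum.distrib)
  also have "(\<Sum>i<2 ^ N. (norm (haar (\<lambda>n. u (Suc n)) i))\<^sup>2) =
    (\<Sum>n<N. \<Sum>g<2 ^ (N - Suc n). (norm (u (Suc n) g))\<^sup>2) + (norm (haar (\<lambda>n. u (Suc (n + N))) 0))\<^sup>2"
    by (rule Suc.IH) (rule Suc.prems)
  finally show ?case by (simp add: sum.lessThan_Suc_shift del: sum.lessThan_Suc)
qed simp

text \<open>The Haar functions form an orthonormal basis of \<open>\<ell>\<^sup>2(\<nat>)\<close>.\<close>

lemma haar_parseval:
  fixes u :: "nat \<Rightarrow> nat \<Rightarrow> 'a::hilbert_space"
  assumes u: "((\<lambda>(n, g). (norm (u n g))\<^sup>2) has_sum L) UNIV"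
  shows "((\<lambda>j. (norm (haar u j))\<^sup>2) has_sum L) UNIV"
proof -
  have L0: "L \<ge> 0" by (rule has_sum_nonneg[OF u]) auto
  have b: "norm (u n g) \<le> sqrt L" for n g
    using finite_sum_le_has_sum[OF u, of "{(n, g)}"] by (auto intro: real_le_rsqrt)
  \<comment> \<open>The pairs whose block lies within the first \<open>2 ^ N\<close>
    indices.\<close>
  define A where "A N = (SIGMA n:{..<N}. {..<(2::nat) ^ (N - Suc n)})" for N
  define s where "s N = (\<Sum>n<N. \<Sum>g<2 ^ (N - Suc n). (norm (u n g))\<^sup>2)" for N
  have sA: "s N = sum (\<lambda>(n, g). (norm (u n g))\<^sup>2) (A N)" for N unfolding s_def A_def by (subst sum.Sigma) auto
  have "filterlim A (finite_subsets_at_top UNIV) sequentially"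
    unfolding filterlim_finite_subsets_at_top
  proof (intro allI impI)
    fix X :: "(nat \<times> nat) set" assume X: "finite X \<and> X \<subseteq> UNIV"
    obtain m where m: "\<And>n g. (n, g) \<in> X \<Longrightarrow> n < m \<and> g < m"
    proof (rule that[of "Suc (Max (insert 0 (fst ` X \<union> snd ` X)))"])
      fix n g assume "(n, g) \<in> X"
      then have "n \<in> insert 0 (fst ` X \<union> snd ` X)" "g \<in> insert 0 (fst ` X \<union> snd ` X)" by force+
      then show "n < Suc (Max (insert 0 (fst ` X \<union> snd ` X))) \<and> g < Suc (Max (insert 0 (fst ` X \<union> snd ` X)))"
        using X by (auto simp: less_Suc_eq_le intro!: Max_ge simp del: Max_insert insert_iff)
    qed
    have "X \<subseteq> A N" if "N \<ge> 2 * m" for N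
    proof
      fix p assume p: "p \<in> X"
      obtain n g where [simp]: "p = (n, g)" by (cases p)
      have ng: "n < m" "g < m" using m p by auto
      have "g < 2 ^ m" using ng(2) less_exp[of m] by linarith
      also have "(2::nat) ^ m \<le> 2 ^ (N - Suc n)" using ng that by (intro power_increasing) auto
      finally show "p \<in> A N" using ng that by (simp add: A_def)
    qed
    moreover have "finite (A N)" for N by (simp add: A_def)
    ultimately show "\<forall>\<^sub>F N in sequentially. finite (A N) \<and> X \<subseteq> A N \<and> A N \<subseteq> UNIV"
      by (auto intro: eventually_sequentiallyI[of "2 * m"])
  qed
  then have s: "s \<longlonglongrightarrow> L" unfolding sA using u unfolding has_sum_def by (rule filterlim_compose[rotated])
  have u0: "(\<lambda>n. norm (u n 0)) \<longlonglongrightarrow> 0"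
  proof -
    have "((\<lambda>(n, g). (norm (u n g))\<^sup>2) \<circ> (\<lambda>n. (n, 0))) summable_on UNIV"
    proof (subst summable_on_reindex[symmetric])
      show "(\<lambda>(n, g). (norm (u n g))\<^sup>2) summable_on range (\<lambda>n. (n, 0))"
        by (rule summable_on_subset_banach[OF has_sum_imp_summable[OF u]]) simp
    qed (auto simp: inj_on_def)
    then have "summable (\<lambda>n. (norm (u n 0))\<^sup>2)" by (simp add: o_def summable_on_imp_summable)
    then have "(\<lambda>n. sqrt ((norm (u n 0))\<^sup>2)) \<longlonglongrightarrow> sqrt 0" by (intro tendsto_real_sqrt summable_LIMSEQ_zero)
    then show ?thesis by simp
  qed
  define K where "K = (\<Sum>n. (1 / sqrt 2) ^ Suc n :: real)"
  have K: "K \<ge> 0" unfolding K_def by (intro suminf_nonneg summable_haar_bound) simp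
  \<comment> \<open>Completeness enters here: no nonzero constant function on the natural numbers is
    square summable, so nothing survives at infinity. The coarse term is at most a bound for the
    later \<open>u n 0\<close> times the sum of the coefficients.\<close>
  have "(\<lambda>N. haar (\<lambda>n. u (n + N)) 0) \<longlonglongrightarrow> 0"
  proof (rule LIMSEQ_I)
    fix e :: real assume e: "e > 0"
    define d where "d = e / (K + 1)"
    have d: "d > 0" using e K by (simp add: d_def)
    obtain N0 where N0: "\<And>n. n \<ge> N0 \<Longrightarrow> norm (u n 0) < d"
      using LIMSEQ_D[OF u0 d] by auto
    have "norm (haar (\<lambda>n. u (n + N)) 0 - 0) < e" if "N \<ge> N0" for N
    proof -
      note hs = haar_summable[where u="\<lambda>n. u (n + N)" and C="sqrt L" and j=0, OF b]
      have "norm (haar (\<lambda>n. u (n + N)) 0) \<le> (\<Sum>n. norm (haar_coeff n 0 *\<^sub>R u (n + N) (0 div 2 ^ Suc n)))"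
        unfolding haar_def by (rule summable_norm[OF hs(1)])
      also have "\<dots> \<le> (\<Sum>n. (1 / sqrt 2) ^ Suc n * d)"
      proof (rule suminf_le[OF _ hs(1)])
        show "summable (\<lambda>n. (1 / sqrt 2) ^ Suc n * d)" by (intro summable_mult2 summable_haar_bound)
        fix n
        have "norm (u (n + N) 0) \<le> d" using N0[of "n + N"] that by simp
        then show "norm (haar_coeff n 0 *\<^sub>R u (n + N) (0 div 2 ^ Suc n)) \<le> (1 / sqrt 2) ^ Suc n * d"
          unfolding norm_scaleR abs_haar_coeff by (intro mult_left_mono) auto
      qed
      also have "\<dots> = K * d" unfolding K_def by (rule suminf_mult2[OF summable_haar_bound, symmetric])
      also have "\<dots> < e" using e K by (simp add: d_def field_simps)
      finally show ?thesis by simp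
    qed
    then show "\<exists>no. \<forall>N\<ge>no. norm (haar (\<lambda>n. u (n + N)) 0 - 0) < e" by blast
  qed
  then have "(\<lambda>N. s N + (norm (haar (\<lambda>n. u (n + N)) 0))\<^sup>2) \<longlonglongrightarrow> L + (norm (0::'a))\<^sup>2" by (intro tendsto_intros s)
  then have lim: "(\<lambda>N. \<Sum>j<2 ^ N. (norm (haar u j))\<^sup>2) \<longlonglongrightarrow> L" by (simp add: haar_partial[where u=u, OF b] s_def)
  let ?S = "\<lambda>m. \<Sum>j<m. (norm (haar u j))\<^sup>2"
  have mono: "incseq ?S" by (auto simp: incseq_def intro!: sum_mono2)
  have bd: "?S m \<le> L" for m
  proof -
    have "?S m \<le> ?S (2 ^ m)" using mono less_exp[of m] by (auto simp: incseq_def)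
    also have "\<dots> \<le> L" 
      by (rule incseq_le[OF _ lim]) (use mono in \<open>auto simp: incseq_def\<close>)
    finally show ?thesis .
  qed
  then obtain L' where L': "?S \<longlonglongrightarrow> L'" using incseq_convergent[OF mono] by blast
  have "filterlim (\<lambda>N. (2::nat) ^ N) at_top sequentially"
    by (rule filterlim_subseq) (simp add: strict_mono_def)
  then have "(\<lambda>N. ?S (2 ^ N)) \<longlonglongrightarrow> L'" by (rule filterlim_compose[OF L'])
  then have "L' = L" using lim LIMSEQ_unique by blast
  then show ?thesis using L' by (intro sums_nonneg_imp_has_sum) (auto simp: sums_def)
qed

section \<open>Sums of equivalent operators\<close>

lemma has_sum_partition:
  fixes f :: "'i \<Rightarrow> real"
  assumes f: "(f has_sum S) UNIV" and g: "\<And>n. (f has_sum g n) {k. c k = n}"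
  shows "(g has_sum S) UNIV"
proof -
  have "bij_betw (\<lambda>k. (c k, k)) UNIV (SIGMA n:UNIV. {k. c k = n})"
    by (auto simp: bij_betw_def inj_on_def)
  then have "((\<lambda>p. f (snd p)) has_sum S) (SIGMA n:UNIV. {k. c k = n})"
    using has_sum_reindex_bij_betw[of "\<lambda>k. (c k, k)" UNIV _ "\<lambda>p. f (snd p)" S] f by simp
  then show ?thesis by (rule has_sum_SigmaD) (simp add: g)
qed

lemma norm_le_of_radj_comp:
  assumes "v\<^sup>\<star> \<odot> v = E" "prj E"
  shows "norm v \<le> 1"
proof (rule norm_blinfun_bound)
  fix x
  have "nsq v x = nsq E x"
    using norm_apply_sq[of v x] assms by (simp add: prj_inner)
  then show "norm (ap v x) \<le> 1 * norm x"
    using prj_norm_le'[OF assms(2), of x] by simp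
qed simp

lemma frame_sums_orth:
  fixes v :: "'i \<Rightarrow> 'a::hilbert_space operator"
  assumes q: "prj q" and v: "frame q (I \<union> J) v" and IJ: "I \<inter> J = {}"
  shows "opsum (\<lambda>i. v i \<odot> (v i)\<^sup>\<star>) I \<odot> opsum (\<lambda>i. v i \<odot> (v i)\<^sup>\<star>) J = 0"
proof (rule frame_sum(6)[OF q frame_subset[OF v]])
  fix j assume j: "j \<in> J"
  have "(v j)\<^sup>\<star> \<odot> opsum (\<lambda>i. v i \<odot> (v i)\<^sup>\<star>) I = 0"
    by (rule frame_sum(6)[OF q frame_subset[OF v]]) (use j IJ v in \<open>auto simp: frame_def\<close>)
  then show "opsum (\<lambda>i. v i \<odot> (v i)\<^sup>\<star>) I \<odot> v j = 0"
    using comp_radj_zero prj_sa[OF frame_sum(3)[OF q frame_subset[OF v]], of I] by fastforce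
qed simp

lemma opsum_zero [simp]: "opsum (\<lambda>i. 0 :: 'a::hilbert_space operator) I = 0"
  unfolding opsum_def by (simp add: blinfun.zero_left) (metis blinfun_apply_inverse zero_blinfun.abs_eq)

lemma opsum_empty [simp]: "opsum P {} = (0 :: 'a::hilbert_space operator)"
  unfolding opsum_def by simp (metis blinfun_apply_inverse zero_blinfun.abs_eq)

lemma haar_apply:
  fixes Y :: "nat \<Rightarrow> nat \<Rightarrow> 'a::hilbert_space operator"
  assumes "bounded_linear h" "\<And>n g. norm (Y n g) \<le> C"
  shows "h (haar Y j) = haar (\<lambda>n g. h (Y n g) :: 'b::banach) j"
  unfolding haar_def
  using bounded_linear.suminf[OF assms(1) haar_summable(2)[where u=Y, OF assms(2)], of j]
  by (simp add: linear_scale[OF bounded_linear.linear[OF assms(1)]])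

context semifinite_factor
begin

text \<open>The sum is recorded by its quadratic form \<open>Q\<close>: the form of
  \<open>X X*\<close> at \<open>x\<close> is the squared norm of the adjoint at \<open>x\<close>,
  and such nonnegative families can be merged before any operator with form \<open>Q\<close> is
  known.\<close>

definition bsum :: "'a operator \<Rightarrow> ('a \<Rightarrow> real) \<Rightarrow> bool" where
  "bsum B Q \<longleftrightarrow> (\<exists>X :: nat \<Rightarrow> 'a operator. (\<forall>j. X j \<in> M \<and> (X j)\<^sup>\<star> \<odot> X j = B) \<and>
     (\<forall>x. ((\<lambda>j. nsq ((X j)\<^sup>\<star>) x) has_sum Q x) UNIV))"

lemma bsum_reindex:
  fixes X :: "'i \<Rightarrow> 'a operator"
  assumes h: "bij_betw h (UNIV :: nat set) (UNIV :: 'i set)" and X: "\<And>i. X i \<in> M" "\<And>i. (X i)\<^sup>\<star> \<odot> X i = B"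
    and s: "\<And>x. ((\<lambda>i. nsq ((X i)\<^sup>\<star>) x) has_sum Q x) UNIV"
  shows "bsum B Q"
  unfolding bsum_def
proof (intro exI[of _ "\<lambda>k. X (h k)"] conjI allI X)
  show "((\<lambda>k. nsq ((X (h k))\<^sup>\<star>) x) has_sum Q x) UNIV" for x
    using has_sum_reindex_bij_betw[OF h, of "\<lambda>i. nsq ((X i)\<^sup>\<star>) x" "Q x"] s by simp
qed

lemma bsum_family:
  assumes "\<And>i::nat. bsum B (Q i)"
    and "\<And>x. ((\<lambda>i. Q i x) has_sum S x) UNIV"
  shows "bsum B S"
proof -
  obtain X where X: "\<And>i j. X i j \<in> M \<and> (X i j)\<^sup>\<star> \<odot> X i j = B"
    "\<And>i x. ((\<lambda>j::nat. nsq ((X i j)\<^sup>\<star>) x) has_sum Q i x) UNIV"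
    using assms(1) unfolding bsum_def by metis
  have "((\<lambda>p. nsq ((X (fst p) (snd p))\<^sup>\<star>) x) has_sum S x) (UNIV \<times> UNIV)" for x
    by (rule has_sum_Sigma_nonneg[OF _ _ assms(2)]) (use X(2) in auto)
  then show ?thesis
    by (intro bsum_reindex[OF bij_prod_decode, of "\<lambda>p. X (fst p) (snd p)"]) (use X(1) in auto)
qed

lemma bsum_add:
  assumes "bsum B Q" "bsum B Q'"
  shows "bsum B (\<lambda>x. Q x + Q' x)"
proof -
  obtain X where X: "\<And>j. X j \<in> M" "\<And>j. (X j)\<^sup>\<star> \<odot> X j = B"
    "\<And>x. ((\<lambda>j::nat. nsq ((X j)\<^sup>\<star>) x) has_sum Q x) UNIV"
    using assms(1) unfolding bsum_def by blast
  obtain Y where Y: "\<And>j. Y j \<in> M" "\<And>j. (Y j)\<^sup>\<star> \<odot> Y j = B"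
    "\<And>x. ((\<lambda>j::nat. nsq ((Y j)\<^sup>\<star>) x) has_sum Q' x) UNIV"
    using assms(2) unfolding bsum_def by blast
  have "((\<lambda>s. nsq ((case_sum X Y s)\<^sup>\<star>) x) has_sum (Q x + Q' x)) (range Inl \<union> range Inr)" for x
    using X(3)[of x] Y(3)[of x] by (intro has_sum_Un_disjoint) (auto simp: has_sum_reindex o_def)
  then show ?thesis
    by (intro bsum_reindex[OF bij_sum_decode, of "case_sum X Y"]) (use X(1,2) Y(1,2) in \<open>auto simp: UNIV_sum split: sum.split\<close>)
qed

lemma bsum_scaleR:
  assumes "bsum B Q" "c \<ge> 0"
  shows "bsum (c *\<^sub>R B) (\<lambda>x. c * Q x)"
proof -
  obtain X where X: "\<And>j. X j \<in> M" "\<And>j. (X j)\<^sup>\<star> \<odot> X j = B"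
    "\<And>x. ((\<lambda>j::nat. nsq ((X j)\<^sup>\<star>) x) has_sum Q x) UNIV"
    using assms(1) unfolding bsum_def by blast
  have "((\<lambda>j. nsq ((sqrt c *\<^sub>R X j)\<^sup>\<star>) x) has_sum c * Q x) UNIV" for x
    using has_sum_cmult_right[OF X(3)[of x], of c] assms(2)
    by (simp add: blinfun.scaleR_left power_mult_distrib)
  then show ?thesis
    unfolding bsum_def using X(1,2) assms(2)
    by (intro exI[of _ "\<lambda>j. sqrt c *\<^sub>R X j"]) (auto simp: op_scale)
qed

text \<open>Write \<open>D = \<Sum>\<^sub>n 2\<^sup>-\<^sup>n\<^sup>-\<^sup>1 E\<^sub>n\<close> with projections \<open>E\<^sub>n\<close>, and split \<open>F\<close> into mutually orthogonal infinite
  projections \<open>F\<^sub>n\<close>, each of them a sum of copies of \<open>E\<^sub>n\<close>. Mixing the corresponding partial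
  isometries with the Haar basis produces operators \<open>X\<^sub>j\<close> with \<open>X\<^sub>j\<^sup>* X\<^sub>j = D\<close>.\<close>

lemma projection_bsum:
  assumes D: "D \<in> M" "pos D" "D \<noteq> 0" "norm D \<le> 1" and F: "F \<in> M" "prj F" "\<tau> F = \<infinity>"
  shows "bsum D (\<lambda>x. qf F x)"
proof -
  have half: "((1::real)/2) ^ k - (1/2) ^ Suc k = (1/2) ^ Suc k" for k by simp
  have r: "\<And>k. 0 < (1/2::real) ^ Suc k" "norm D \<le> (1/2) ^ 0"
    "\<And>k. max ((1/2) ^ Suc k) ((1/2) ^ k - (1/2) ^ Suc k) \<le> (1/2::real) ^ Suc k" "(\<lambda>k. (1/2::real) ^ k) \<longlonglongrightarrow> 0"
    using D(4) by (simp, simp, simp only: half max.idem order_refl) (rule LIMSEQ_power_zero, simp)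
  obtain E where E: "\<And>k. prj (E k)" "\<And>k U. U \<odot> D = D \<odot> U \<Longrightarrow> U \<odot> E k = E k \<odot> U"
    "(\<lambda>n. \<Sum>k<n. (1/2) ^ Suc k *\<^sub>R E k) \<longlonglongrightarrow> D"
    "\<And>x. ((\<lambda>k. (1/2) ^ Suc k * qf (E k) x) has_sum qf D x) UNIV"
    by (rule greedy_decomposition[OF D(2) r]) (rule that)
  have EM: "E k \<in> M" for k by (rule M_commute[OF D(1)]) (rule E(2))
  obtain n0 where n0: "E n0 \<noteq> 0"
  proof (rule ccontr)
    assume "\<not> thesis"
    then have "E n = 0" for n using that by blast
    then have "D = 0" using E(3) LIMSEQ_unique[of "\<lambda>n. 0" 0 D] by simp
    then show False using D(3) by simp
  qed
  \<comment> \<open>A zero projection cannot absorb infinitely many copies, so its share goes to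
    \<open>n0\<close>.\<close>
  define \<nu> where "\<nu> m = (if E m \<noteq> 0 then m else n0)" for m
  obtain p where p: "p \<in> M" "prj p" "p \<noteq> 0" using finite_prj_ex by blast
  obtain w where w: "\<And>i::nat. w i \<in> M" "frame p UNIV w" "opsum (\<lambda>i. w i \<odot> (w i)\<^sup>\<star>) UNIV = F"
    using packing_any[OF p F] by blast
  \<comment> \<open>Distributes the frame of \<open>F\<close> so that every nonzero
    \<open>E n\<close> gets infinitely many members.\<close>
  define c where "c k = \<nu> (fst (prod_decode k))" for k
  define I where "I n = {k. c k = n}" for n
  have wI: "frame p (I n) w" for n by (rule frame_subset[OF w(2)]) simp
  define G where "G n = opsum (\<lambda>i. w i \<odot> (w i)\<^sup>\<star>) (I n)" for n
  have G: "G n \<in> M" "prj (G n)" for n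
    unfolding G_def by (rule M_frame[OF p(2) wI w(1)], rule frame_sum(3)[OF p(2) wI])
  have Ginf: "\<tau> (G n) = \<infinity>" if "E n \<noteq> 0" for n
  proof -
    have "range (\<lambda>i. prod_encode (n, i)) \<subseteq> I n" using that by (auto simp: I_def c_def \<nu>_def)
    moreover have "infinite (range (\<lambda>i. prod_encode (n, i)))" by (rule range_inj_infinite) (simp add: inj_on_def)
    ultimately have "infinite (I n)" using finite_subset by blast
    then show ?thesis unfolding G_def by (rule tr_frame_infinite[OF _ p(2,1,3) wI w(1)])
  qed
  have Gorth: "G n \<odot> G m = 0" if "n \<noteq> m" for n m
    unfolding G_def by (rule frame_sums_orth[OF p(2) frame_subset[OF w(2)]]) (use that in \<open>auto simp: I_def\<close>)
  have "\<exists>y. (\<forall>g::nat. y g \<in> M) \<and> frame (E n) UNIV y \<and> opsum (\<lambda>g. y g \<odot> (y g)\<^sup>\<star>) UNIV = G n" for n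
  proof (cases "E n = 0")
    case True
    then have "I n = {}" using n0 by (auto simp: I_def c_def \<nu>_def)
    then show ?thesis using True by (intro exI[of _ "\<lambda>_. 0"]) (auto simp: frame_def G_def)
  next
    case False
    then show ?thesis using packing_any[OF EM E(1) False G Ginf] by blast
  qed
  then obtain Y where Y: "\<And>n g::nat. Y n g \<in> M" "\<And>n. frame (E n) UNIV (Y n)"
    "\<And>n. opsum (\<lambda>g. Y n g \<odot> (Y n g)\<^sup>\<star>) UNIV = G n" by metis
  have YY: "(Y n g)\<^sup>\<star> \<odot> Y n g = E n" for n g using Y(2) by (simp add: frame_def)
  have Yn: "norm (Y n g) \<le> 1" for n g by (rule norm_le_of_radj_comp[OF YY E(1)])
  have GY: "G n \<odot> Y n g = Y n g" for n g using frame_sum(4)[OF E(1) Y(2)] Y(3) by simp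
  have Yo: "(Y n g)\<^sup>\<star> \<odot> Y m h = 0" if "n \<noteq> m" for n m g h
  proof -
    have "(G n \<odot> Y n g)\<^sup>\<star> \<odot> (G m \<odot> Y m h) = (Y n g)\<^sup>\<star> \<odot> (G n \<odot> (G m \<odot> Y m h))"
      using prj_sa[OF G(2)] by (simp add: op_assoc)
    then have "(G n \<odot> Y n g)\<^sup>\<star> \<odot> (G m \<odot> Y m h) = 0" by (simp only: comp_zero_left[OF Gorth[OF that]] blinfun_compose_zero)
    then show ?thesis by (simp only: GY)
  qed
  have sumY: "((\<lambda>(n, g). nsq ((Y n g)\<^sup>\<star>) x) has_sum qf F x) UNIV" for x
  proof -
    have "((\<lambda>n. qf (G n) x) has_sum qf F x) UNIV"
    proof (rule has_sum_partition[where c=c])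
      show "((\<lambda>i. nsq ((w i)\<^sup>\<star>) x) has_sum qf F x) UNIV"
        using frame_sum(5)[OF p(2) w(2)] w(3) by simp
      show "((\<lambda>i. nsq ((w i)\<^sup>\<star>) x) has_sum qf (G n) x) {k. c k = n}" for n
        using frame_sum(5)[OF p(2) wI] by (simp add: G_def I_def)
    qed
    then have "((\<lambda>(n, g). nsq ((Y n g)\<^sup>\<star>) x) has_sum qf F x) (UNIV \<times> UNIV)"
    proof (rule has_sum_Sigma_nonneg[rotated 2])
      show "((\<lambda>g. case (n, g) of (n, g) \<Rightarrow> nsq ((Y n g)\<^sup>\<star>) x) has_sum qf (G n) x) UNIV" for n
        using frame_sum(5)[OF E(1) Y(2), of n x] Y(3) by simp
    qed auto
    then show ?thesis by simp
  qed
  define X where "X = haar Y"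
  have Xx: "ap (X j) x = haar (\<lambda>n g. ap (Y n g) x) j" for j x
    unfolding X_def by (rule haar_apply[OF blinfun.bounded_linear_left Yn])
  have Xs: "ap ((X j)\<^sup>\<star>) x = haar (\<lambda>n g. ap ((Y n g)\<^sup>\<star>) x) j" for j x
    unfolding X_def
    by (rule haar_apply[OF bounded_linear_compose[OF blinfun.bounded_linear_left bounded_linear_radj] Yn])
  have "X j \<in> M" for j
  proof (rule M_tendsto)
    show "(\<lambda>N. \<Sum>n<N. haar_coeff n j *\<^sub>R Y n (j div 2 ^ Suc n)) \<longlonglongrightarrow> X j"
      unfolding X_def haar_def by (rule summable_LIMSEQ[OF haar_summable(2)[where u=Y, OF Yn]])
  qed (use Y(1) in auto)
  \<comment> \<open>For fixed \<open>j\<close> exactly one block of each generation contributes,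
    with squared coefficient \<open>(1/2) ^ Suc n\<close>, and different generations have orthogonal
    ranges.\<close>
  moreover have "(X j)\<^sup>\<star> \<odot> X j = D" for j
  proof (rule sa_eqI)
    fix x
    let ?y = "\<lambda>n. haar_coeff n j *\<^sub>R ap (Y n (j div 2 ^ Suc n)) x"
    have b: "norm (ap (Y n g) x) \<le> norm x" for n g
      using norm_blinfun[of "Y n g" x] mult_right_mono[OF Yn, of "norm x" n g] by simp
    have "(?y has_sum ap (X j) x) UNIV"
      unfolding Xx haar_def
      by (rule norm_summable_imp_has_sum[OF haar_summable(1)[where u="\<lambda>n g. ap (Y n g) x", OF b]])
        (rule summable_sums[OF haar_summable(2)[where u="\<lambda>n g. ap (Y n g) x", OF b]])
    then have "((\<lambda>n. (norm (?y n))\<^sup>2) has_sum nsq (X j) x) UNIV"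
    proof (rule has_sum_norm_orthogonal[rotated])
      fix n m :: nat assume "n \<noteq> m"
      have "inner (ap (Y n g) x) (ap (Y m h) x) = 0" for g h
        using Yo[OF \<open>n \<noteq> m\<close>, of g h] by (metis blinfun.zero_left blinfun_apply_blinfun_compose inner_radj inner_zero_right)
      then show "inner (?y n) (?y m) = 0" by simp
    qed
    moreover have "(norm (?y n))\<^sup>2 = (1/2) ^ Suc n * qf (E n) x" for n
    proof -
      have "(norm (?y n))\<^sup>2 = (haar_coeff n j)\<^sup>2 * nsq (Y n (j div 2 ^ Suc n)) x"
        by (simp add: power_mult_distrib)
      also have "nsq (Y n (j div 2 ^ Suc n)) x = qf (E n) x"
        unfolding norm_apply_sq YY ..
      finally show ?thesis by (simp only: haar_coeff_sq)
    qed
    ultimately have "nsq (X j) x = qf D x"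
      by (rule has_sum_eqI[OF _ E(4)[of x]])
    then show "qf ((X j)\<^sup>\<star> \<odot> X j) x = qf D x" by (simp only: norm_apply_sq)
  qed (use pos_sa[OF D(2)] in auto)
  moreover have "((\<lambda>j. nsq ((X j)\<^sup>\<star>) x) has_sum qf F x) UNIV" for x
    unfolding Xs by (rule haar_parseval[OF sumY])
  ultimately show ?thesis unfolding bsum_def by blast
qed

end

section \<open>Commuting halves\<close>

lemma ex_blocks:
  assumes "\<And>n::nat. \<exists>m>n. R n m"
  shows "\<exists>b :: nat \<Rightarrow> nat. b 0 = 0 \<and> strict_mono b \<and> (\<forall>c. R (b c) (b (Suc c)))"
proof -
  obtain f where f: "\<And>n. f n > n \<and> R n (f n)" using assms by metis
  define b where "b = rec_nat 0 (\<lambda>_. f)"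
  have "b 0 = 0" "b (Suc c) = f (b c)" for c by (simp_all add: b_def)
  then show ?thesis using f by (intro exI[of _ b]) (auto simp: strict_mono_Suc_iff)
qed

lemma blocks_disjoint:
  assumes "strict_mono b" "c \<noteq> (c' :: nat)"
  shows "{b c..<b (Suc c)} \<inter> {b c'..<b (Suc c') :: nat} = {}"
proof -
  have "b (Suc c) \<le> b c' \<or> b (Suc c') \<le> b c"
    using assms by (metis Suc_leI linorder_neqE_nat strict_mono_less_eq)
  then show ?thesis by auto
qed

lemma ennreal_sum_blocks:
  fixes f :: "nat \<Rightarrow> ennreal"
  assumes "(\<Sum>k. f k) = \<infinity>" "\<And>k. f k < \<infinity>"
  shows "\<exists>m>n. 1 \<le> (\<Sum>k=n..<m. f k)"
proof (rule ccontr)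
  assume "\<not> ?thesis"
  then have *: "(\<Sum>k=n..<m. f k) < 1" if "m > n" for m using that by (meson not_le)
  have "(\<Sum>k<m. f k) \<le> (\<Sum>k<n. f k) + 1" for m
  proof (cases "m > n")
    case True
    have "(\<Sum>k<m. f k) = (\<Sum>k<n. f k) + (\<Sum>k=n..<m. f k)"
      using sum.atLeastLessThan_concat[of 0 n m f] True by (simp add: atLeast0LessThan)
    then show ?thesis using *[OF True] by (simp add: add_left_mono less_imp_le)
  next
    case False
    then have "(\<Sum>k<m. f k) \<le> (\<Sum>k<n. f k)" by (intro sum_mono2) auto
    then show ?thesis by (simp add: add_increasing2)
  qed
  then have "(\<Sum>k. f k) \<le> (\<Sum>k<n. f k) + 1" by (intro suminf_le_const[OF summableI])
  also have "\<dots> < \<infinity>" using assms(2) by (simp add: less_top)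
  finally show False using assms(1) by simp
qed

lemma prj_comp_commute:
  assumes "prj P" "prj Q" "P \<odot> Q = Q \<odot> P"
  shows "prj (P \<odot> Q)"
proof -
  have "P \<odot> Q \<odot> (P \<odot> Q) = P \<odot> (Q \<odot> P) \<odot> Q" by (simp only: op_assoc)
  also have "\<dots> = (P \<odot> P) \<odot> (Q \<odot> Q)" by (simp only: op_assoc assms(3)[symmetric])
  finally show ?thesis using assms by (simp add: prj_def)
qed

lemma sum_commute_op:
  "(\<And>i. i \<in> I \<Longrightarrow> T \<odot> P i = P i \<odot> T) \<Longrightarrow> T \<odot> sum P I = sum P I \<odot> (T :: 'a::hilbert_space operator)"
  by (induction I rule: infinite_finite_induct) (auto simp: op_distrib)

lemma orth_prjs_blocks:
  fixes I :: "'k \<Rightarrow> 'i set"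
  assumes P: "orth_prjs UNIV P" and D: "\<And>c c'. c \<noteq> c' \<Longrightarrow> I c \<inter> I c' = {}" and fin: "\<And>c. finite (I c)"
  shows "orth_prjs UNIV (\<lambda>c. sum P (I c))"
  unfolding orth_prjs_def
proof (intro conjI ballI impI)
  show "prj (sum P (I c))" for c by (rule prj_finite_sum[OF fin orth_prjs_subset[OF P]]) simp
  fix c c' :: 'k assume "c \<noteq> c'"
  show "sum P (I c) \<odot> sum P (I c') = 0"
  proof (subst op_sum_comp_left[OF fin], rule sum.neutral, rule ballI)
    fix j assume j: "j \<in> I c'"
    have "P j \<odot> sum P (I c) = 0"
    proof (subst op_sum_comp_left[OF fin], rule sum.neutral, rule ballI)
      fix i assume "i \<in> I c"
      then have "i \<noteq> j" using D[OF \<open>c \<noteq> c'\<close>] j by blast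
      then show "P j \<odot> P i = 0" using P by (simp add: orth_prjs_def)
    qed
    then show "sum P (I c) \<odot> P j = 0"
      by (intro prj_add(2)[where P="P j"] prj_finite_sum[OF fin orth_prjs_subset[OF P]]) (use P in \<open>auto simp: orth_prjs_def\<close>)
  qed
qed

context semifinite_factor
begin

lemma pos_comp_prj: "pos E \<Longrightarrow> prj Z \<Longrightarrow> Z \<odot> E = E \<odot> Z \<Longrightarrow> pos (E \<odot> Z)"
  by (rule pos_comp_commute) (auto simp: prj_pos)

lemma tr_comp_mono:
  assumes E: "E \<in> M" "pos E" and Z: "Z \<in> M" "prj Z" "Z \<odot> E = E \<odot> Z" and R: "R \<in> M" "prj R" "R \<odot> E = E \<odot> R"
    and "R \<odot> Z = Z"
  shows "\<tau> (E \<odot> Z) \<le> \<tau> (E \<odot> R)"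
proof (rule tr_mono)
  have "pos (E \<odot> (R - Z))"
    by (rule pos_comp_prj[OF E(2) prj_diff(1)[OF Z(2) R(2) assms(9)]]) (simp add: op_distrib Z R)
  then show "pos (E \<odot> R - E \<odot> Z)" by (simp add: op_distrib)
qed (use E Z R pos_comp_prj in auto)

lemma tr_comp_le_norm:
  assumes E: "E \<in> M" "pos E" and Z: "Z \<in> M" "prj Z" "Z \<odot> E = E \<odot> Z"
  shows "\<tau> (E \<odot> Z) \<le> ennreal (norm E) * \<tau> Z"
proof -
  have "pos ((norm E *\<^sub>R \<one> - E) \<odot> Z)"
    by (rule pos_comp_prj[OF pos_le_norm[OF E(2)] Z(2)]) (simp add: op_distrib op_scale Z)
  then have "\<tau> (E \<odot> Z) \<le> \<tau> (norm E *\<^sub>R Z)"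
    using E Z by (intro tr_mono pos_comp_prj) (auto simp: op_distrib op_scale)
  then show ?thesis using tr_scale[OF Z(1) prj_pos[OF Z(2)], of "norm E"] by simp
qed

text \<open>By normality the weight \<open>\<tau> (E \<odot> P)\<close> is countably additive in the
  projection \<open>P\<close>, like a measure with density \<open>E\<close>.\<close>

lemma tr_weighted_sum:
  assumes E: "E \<in> M" "pos E" and P: "orth_prjs (UNIV :: nat set) P" "\<And>k. P k \<in> M" "\<And>k. P k \<odot> E = E \<odot> P k"
  shows "\<tau> (E \<odot> opsum P UNIV) = (\<Sum>k. \<tau> (E \<odot> P k))"
proof -
  have prjP: "prj (P k)" for k using P(1) by (simp add: orth_prjs_def)
  have pP: "pos (E \<odot> P k)" for k by (rule pos_comp_prj[OF E(2) prjP P(3)])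
  let ?S = "\<lambda>n. \<Sum>k<n. E \<odot> P k"
  have SE: "?S n = E \<odot> (\<Sum>k<n. P k)" for n by (simp add: op_sum_comp_left)
  have EP: "E \<odot> opsum P UNIV = opsum P UNIV \<odot> E" by (rule op_sum_commute[OF prj_opsum(1)[OF P(1)]]) (simp add: P(3))
  have "\<tau> (E \<odot> opsum P UNIV) = (SUP n. \<tau> (?S n))"
  proof (rule tr_normal)
    show "?S n \<in> M" "pos (?S n)" "pos (?S (Suc n) - ?S n)" for n using E P(2) pP by (auto intro: pos_sum)
    show "E \<odot> opsum P UNIV \<in> M" using E(1) P(2) by (intro M_comp M_opsum_prj[OF P(1)]) auto
    show "pos (E \<odot> opsum P UNIV)" by (rule pos_comp_prj[OF E(2) prj_opsum(2)[OF P(1)] EP[symmetric]])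
    fix x
    have "(\<lambda>n. \<Sum>k<n. ap (P k) x) \<longlonglongrightarrow> ap (opsum P UNIV) x"
      using has_sum_imp_sums[OF prj_opsum(1)[OF P(1), of x]] by (simp add: sums_def)
    then have "(\<lambda>n. inner (ap E (\<Sum>k<n. ap (P k) x)) x) \<longlonglongrightarrow>
      inner (ap E (ap (opsum P UNIV) x)) x"
      by (intro tendsto_inner blinfun.tendsto tendsto_const)
    then show "(\<lambda>n. qf (?S n) x) \<longlonglongrightarrow> qf (E \<odot> opsum P UNIV) x"
      unfolding SE by (simp add: blinfun.sum_left)
  qed
  also have "(\<lambda>n. \<tau> (?S n)) = (\<lambda>n. \<Sum>k<n. \<tau> (E \<odot> P k))"
    using E P(2) pP by (intro ext tr_sum) auto
  also have "(SUP n. \<Sum>k<n. \<tau> (E \<odot> P k)) = (\<Sum>k. \<tau> (E \<odot> P k))" by (rule suminf_eq_SUP[symmetric])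
  finally show ?thesis .
qed

lemma tr_infinite_of_pieces:
  assumes E: "E \<in> M" "pos E" and Z: "Z \<in> M" "prj Z" "Z \<odot> E = E \<odot> Z"
    and R: "orth_prjs (UNIV :: nat set) R" "\<And>c. R c \<in> M" "\<And>c. R c \<odot> E = E \<odot> R c" "\<And>c. 1 \<le> \<tau> (E \<odot> R c)" "\<And>c. Z \<odot> R c = R c"
  shows "\<tau> (E \<odot> Z) = \<infinity>"
proof -
  note Q = prj_opsum[OF R(1)]
  have QM: "opsum R UNIV \<in> M" by (rule M_opsum_prj[OF R(1)]) (rule R(2))
  have "(\<Sum>c::nat. (1::ennreal)) \<le> (\<Sum>c. \<tau> (E \<odot> R c))" by (intro suminf_le summableI R(4))
  moreover have "(\<Sum>c::nat. (1::ennreal)) = \<infinity>"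
    using ennreal_SUP_of_nat_eq_top by (simp add: suminf_eq_SUP)
  ultimately have "\<tau> (E \<odot> opsum R UNIV) = \<infinity>"
    using tr_weighted_sum[OF E R(1-3)] by (simp add: top_unique)
  moreover have "Z \<odot> opsum R UNIV = \<one> \<odot> opsum R UNIV"
    by (rule op_sum_left_cong[OF Q(1)]) (simp add: R(5))
  moreover have "E \<odot> opsum R UNIV = opsum R UNIV \<odot> E" by (rule op_sum_commute[OF Q(1)]) (simp add: R(3))
  ultimately show ?thesis
    using tr_comp_mono[OF E QM Q(2) _ Z] by (simp add: top_unique)
qed

lemma exists_finite_subprj:
  assumes Y: "Y \<in> M" "prj Y" "\<tau> Y = \<infinity>"
  shows "\<exists>r\<in>M. prj r \<and> Y \<odot> r = r \<and> r \<noteq> 0 \<and> \<tau> r < \<infinity>"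
proof -
  obtain p where p: "p \<in> M" "prj p" "p \<noteq> 0" "\<tau> p < \<infinity>" using finite_prj_ex by blast
  obtain w where w: "\<And>i::nat. w i \<in> M" "frame p UNIV w" "opsum (\<lambda>i. w i \<odot> (w i)\<^sup>\<star>) UNIV = Y"
    using packing_any[OF p(1-3) Y] by blast
  have ww: "(w 0)\<^sup>\<star> \<odot> w 0 = p" using w(2) by (simp add: frame_def)
  have "prj (w 0 \<odot> (w 0)\<^sup>\<star>)" by (rule piso(2)) (simp add: ww p)
  moreover have "Y \<odot> (w 0 \<odot> (w 0)\<^sup>\<star>) = w 0 \<odot> (w 0)\<^sup>\<star>"
    using comp_subst[OF frame_sum(4)[OF p(2) w(2), of 0]] w(3) by simp
  moreover have "\<tau> (w 0 \<odot> (w 0)\<^sup>\<star>) = \<tau> p" using tr_swap[OF w(1), of 0] ww by simp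
  moreover have "w 0 \<odot> (w 0)\<^sup>\<star> \<noteq> 0" using calculation(3) p tr_faithful prj_pos by fastforce
  ultimately show ?thesis using w(1) p(4) by (intro bexI[of _ "w 0 \<odot> (w 0)\<^sup>\<star>"]) auto
qed

text \<open>If no projection of \<open>{A, E}' \<inter> M\<close> halves \<open>E\<close>, then a minimal projection of this algebra
  carries infinite trace; \<open>A\<close> and \<open>E\<close> are scalar on it, so it is minimal in the factor as well,
  which is absurd.\<close>

lemma halving:
  assumes A: "A \<in> M" "A\<^sup>\<star> = A" and E: "E \<in> M" "pos E" "A \<odot> E = E \<odot> A" "\<tau> E = \<infinity>"
  shows "\<exists>Z\<in>M. prj Z \<and> Z \<odot> A = A \<odot> Z \<and> Z \<odot> E = E \<odot> Z \<and> \<tau> (E \<odot> Z) = \<infinity> \<and> \<tau> (E \<odot> (\<one> - Z)) = \<infinity>"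
proof -
  let ?N = "\<lambda>Z. Z \<in> M \<and> prj Z \<and> Z \<odot> A = A \<odot> Z \<and> Z \<odot> E = E \<odot> Z"
  \<comment> \<open>Projections of positive finite weight; the total weight of a maximal orthogonal
    family of them decides between the two cases below.\<close>
  let ?\<phi> = "\<lambda>Z. ?N Z \<and> 0 < \<tau> (E \<odot> Z) \<and> \<tau> (E \<odot> Z) < \<infinity>"
  let ?R = "\<lambda>P Q. P \<odot> Q = (0 :: 'a operator)"
  obtain F where F: "\<forall>v\<in>F. ?\<phi> v" "pairwise ?R F" "\<forall>w. ?\<phi> w \<and> (\<forall>v\<in>F. ?R v w \<and> ?R w v) \<longrightarrow> w \<in> F"
    using maximal_pairwise_family[of ?\<phi> ?R] by (elim exE conjE)
  have Esa: "E\<^sup>\<star> = E" using E(2) by (rule pos_sa)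
  have oF: "orth_prjs F (\<lambda>v. v)" unfolding orth_prjs_def using F(1,2) by (auto simp: pairwise_def)
  let ?S = "opsum (\<lambda>v. v) F"
  note S = prj_opsum[OF oF]
  have NS: "?N ?S"
    using M_opsum_prj[OF oF] F(1) S(2) op_sum_commute[OF S(1), of A] op_sum_commute[OF S(1), of E] by auto
  show ?thesis
  proof (cases "\<tau> (E \<odot> ?S) = \<infinity>")
    \<comment> \<open>Countably many pieces of finite weight have infinite total. They are grouped
      into blocks of weight at least one; the even blocks form one half and the odd blocks lie in
      the other.\<close>
    case True
    have "countable F"
      by (rule countable_orth[OF _ F(2)]) (use F(1) in auto)
    have "infinite F"
    proof
      assume fin: "finite F"
      have "\<tau> (E \<odot> ?S) = \<tau> (\<Sum>v\<in>F. E \<odot> v)" by (simp add: opsum_finite[OF fin oF] op_sum_comp_left[OF fin])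
      also have "\<dots> = (\<Sum>v\<in>F. \<tau> (E \<odot> v))"
        using F(1) E by (intro tr_sum[OF fin] pos_comp_prj) auto
      also have "\<dots> < \<infinity>" using F(1) by (simp add: fin)
      finally show False using True by simp
    qed
    define P where "P = from_nat_into F"
    have bij: "bij_betw P UNIV F" unfolding P_def using \<open>countable F\<close> \<open>infinite F\<close> by (rule bij_betw_from_nat_into)
    have PF: "P k \<in> F" for k using bij by (auto simp: bij_betw_def)
    have N: "?N (P k)" and fin: "\<tau> (E \<odot> P k) < \<infinity>" for k using F(1) PF by auto
    have oP: "orth_prjs UNIV P"
      unfolding orth_prjs_def
    proof (intro conjI ballI impI)
      fix i j :: nat assume "i \<noteq> j"
      then have "P i \<noteq> P j" using bij by (auto simp: bij_betw_def inj_on_def)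
      then show "P i \<odot> P j = 0" using F(2) PF by (simp add: pairwise_def)
    qed (use N in blast)
    have "?S = opsum P UNIV"
    proof (rule blinfun_eqI)
      fix x
      have "((\<lambda>k. ap (P k) x) has_sum ap ?S x) UNIV"
        using S(1)[of x] has_sum_reindex_bij_betw[OF bij, of "\<lambda>v. ap v x"] by simp
      then show "ap ?S x = ap (opsum P UNIV) x"
        using prj_opsum(1)[OF oP, of x] by (rule has_sum_unique)
    qed
    then have "(\<Sum>k. \<tau> (E \<odot> P k)) = \<infinity>"
      using True tr_weighted_sum[OF E(1,2) oP] N by auto
    then obtain b where b: "strict_mono b" "\<And>c. 1 \<le> (\<Sum>k=b c..<b (Suc c). \<tau> (E \<odot> P k))"
      using ex_blocks[of "\<lambda>n m. 1 \<le> (\<Sum>k=n..<m. \<tau> (E \<odot> P k))"] ennreal_sum_blocks fin by blast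
    define R where "R c = sum P {b c..<b (Suc c)}" for c
    have oR: "orth_prjs UNIV R"
      unfolding R_def by (rule orth_prjs_blocks[OF oP]) (use blocks_disjoint[OF b(1)] in auto)
    have NR: "?N (R c)" for c
      using oR N sum_commute_op[of "{b c..<b (Suc c)}" A P] sum_commute_op[of "{b c..<b (Suc c)}" E P]
      by (auto simp: R_def orth_prjs_def)
    have R1: "1 \<le> \<tau> (E \<odot> R c)" for c
    proof -
      have "\<tau> (E \<odot> R c) = \<tau> (\<Sum>k=b c..<b (Suc c). E \<odot> P k)" by (simp add: R_def op_sum_comp_left)
      also have "\<dots> = (\<Sum>k=b c..<b (Suc c). \<tau> (E \<odot> P k))" using N E by (intro tr_sum pos_comp_prj) auto
      finally show ?thesis using b(2) by simp
    qed
    define U where "U c = R (2 * c)" for c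
    define V where "V c = R (Suc (2 * c))" for c
    have oU: "orth_prjs UNIV U" and oV: "orth_prjs UNIV V"
      using oR by (auto simp: orth_prjs_def U_def V_def)
    let ?Z = "opsum U UNIV"
    note Z = prj_opsum[OF oU]
    have NZ: "?N ?Z"
      using M_opsum_prj[OF oU] NR Z(2) op_sum_commute[OF Z(1), of A] op_sum_commute[OF Z(1), of E] by (auto simp: U_def)
    have VU: "V c \<odot> ?Z = 0" for c
    proof (rule op_sum_eq_zero[OF Z(1)])
      fix i :: nat
      have "Suc (2 * c) \<noteq> 2 * i" by presburger
      then show "V c \<odot> U i = 0" using oR unfolding V_def U_def orth_prjs_def by blast
    qed
    then have ZV: "?Z \<odot> V c = 0" for c using prj_add(2)[of "V c" ?Z] oV Z(2) by (auto simp: orth_prjs_def)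
    have "\<tau> (E \<odot> ?Z) = \<infinity>"
      using NZ NR R1 Z(3) by (intro tr_infinite_of_pieces[OF E(1,2) _ _ _ oU]) (auto simp: U_def)
    moreover have "\<tau> (E \<odot> (\<one> - ?Z)) = \<infinity>"
      using NZ NR R1 ZV by (intro tr_infinite_of_pieces[OF E(1,2) _ _ _ oV]) (auto simp: V_def op_distrib prj_compl)
    ultimately show ?thesis using NZ by blast
  next
    case False
    \<comment> \<open>The support of \<open>E\<close>; below it no nonzero projection has weight
      zero.\<close>
    define k where "k = \<one> - kerp E"
    have k: "prj k" "k \<in> M" "k \<odot> A = A \<odot> k" "E \<odot> k = E" "k \<odot> E = E"
    proof -
      have "A \<odot> kerp E = kerp E \<odot> A" by (rule kerp_commute_sa[OF Esa E(3)])
      then show "k \<odot> A = A \<odot> k" by (simp add: k_def op_distrib)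
      have "E \<odot> kerp E = kerp E \<odot> E" by (rule kerp_commute_sa[OF Esa]) simp
      then show "E \<odot> k = E" "k \<odot> E = E" by (simp_all add: k_def op_distrib)
      show "prj k" by (simp add: k_def prj_compl)
      show "k \<in> M" unfolding k_def by (intro M_diff M_one M_kerp E)
    qed
    define Y where "Y = k \<odot> (\<one> - ?S)"
    have kS: "k \<odot> ?S = ?S \<odot> k"
    proof -
      have "?S \<odot> kerp E = kerp E \<odot> ?S" by (rule kerp_commute_sa[OF Esa]) (use NS in simp)
      then show ?thesis by (simp add: k_def op_distrib)
    qed
    have ak: "A \<odot> (k \<odot> Z) = k \<odot> (A \<odot> Z)" "E \<odot> (k \<odot> Z) = k \<odot> (E \<odot> Z)" "?S \<odot> (k \<odot> Z) = k \<odot> (?S \<odot> Z)" for Z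
      by (simp_all only: op_assoc[symmetric] k(3-5) kS)
    have NY: "?N Y"
    proof (intro conjI)
      show "Y \<in> M" using k NS by (auto simp: Y_def)
      show "prj Y"
        unfolding Y_def by (rule prj_comp_commute[OF k(1) prj_compl[OF S(2)]]) (simp add: op_distrib kS)
      show "Y \<odot> A = A \<odot> Y" using NS k by (simp add: Y_def op_distrib op_assoc ak)
      show "Y \<odot> E = E \<odot> Y" using NS k by (simp add: Y_def op_distrib op_assoc ak)
    qed
    have EY: "E \<odot> Y = E \<odot> (\<one> - ?S)" using comp_subst[OF k(4), of "\<one> - ?S"] by (simp add: Y_def)
    have "\<tau> E = \<tau> (E \<odot> ?S) + \<tau> (E \<odot> (\<one> - ?S))"
    proof -
      have "\<tau> (E \<odot> ?S + E \<odot> (\<one> - ?S)) = \<tau> (E \<odot> ?S) + \<tau> (E \<odot> (\<one> - ?S))"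
        using NS E by (intro tr_add pos_comp_prj) (auto simp: prj_compl op_distrib)
      then show ?thesis by (simp add: op_distrib)
    qed
    then have EYinf: "\<tau> (E \<odot> Y) = \<infinity>" using False E(4) EY ennreal_add_eq_top by (metis infinity_ennreal_def)
    \<comment> \<open>A nonzero part of \<open>Y\<close> of finite weight could be added to the
      maximal family.\<close>
    have big: "\<tau> (E \<odot> Z) = \<infinity>" if Z: "?N Z" "Y \<odot> Z = Z" "Z \<noteq> 0" for Z
    proof (rule ccontr)
      assume "\<tau> (E \<odot> Z) \<noteq> \<infinity>"
      have kZ: "k \<odot> Z = Z" using comp_absorb[OF _ Z(2), of k] comp_subst[OF prj_idem[OF k(1)]] by (simp add: Y_def)
      have SZ: "?S \<odot> Z = 0"
      proof -
        have "?S \<odot> Y = 0" by (simp add: Y_def ak op_distrib kS comp_subst[OF prj_idem[OF S(2)]])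
        then show ?thesis using comp_zero_left[of ?S Y Z] Z(2) by simp
      qed
      have "E \<odot> Z \<noteq> 0"
      proof
        assume "E \<odot> Z = 0"
        then have "kerp E \<odot> Z = Z" by (rule kerp_comp)
        then have "k \<odot> Z = 0" by (simp add: k_def op_distrib)
        then show False using kZ Z(3) by simp
      qed
      then have "\<tau> (E \<odot> Z) \<noteq> 0" using tr_faithful[of "E \<odot> Z"] Z(1) E pos_comp_prj by auto
      then have "?\<phi> Z" using Z(1) \<open>\<tau> (E \<odot> Z) \<noteq> \<infinity>\<close> by (auto simp: less_top zero_less_iff_neq_zero)
      moreover have vZ: "v \<odot> Z = 0" if "v \<in> F" for v
        using S(4)[OF that] comp_zero_left[of v ?S Z] comp_subst[of v ?S v Z] SZ by simp
      moreover have "Z \<odot> v = 0" if "v \<in> F" for v using prj_add(2)[OF _ _ vZ[OF that]] F(1) Z(1) that by blast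
      ultimately have "Z \<in> F" using F(3) by blast
      then have "Z \<odot> Z = 0" using vZ by blast
      then show False using prj_idem[of Z] Z by simp
    qed
    \<comment> \<open>Any proper nonzero part \<open>Z\<close> halves the weight, since
      \<open>Z\<close> and \<open>Y - Z\<close> are both of infinite weight by \<open>big\<close>;
      only its existence is at stake.\<close>
    have "\<exists>Z. ?N Z \<and> Y \<odot> Z = Z \<and> Z \<noteq> 0 \<and> Z \<noteq> Y"
    proof (rule ccontr)
      assume "\<not> ?thesis"
      then have min: "Z = 0 \<or> Z = Y" if "?N Z" "Y \<odot> Z = Z" for Z using that by blast
      have Y0: "Y \<noteq> 0" using EYinf by auto
      have scal: "\<exists>c. B \<odot> Y = c *\<^sub>R Y" if B: "B = A \<or> B = E" for B
      proof (rule scalar_on_projection)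
        show Bsa: "B\<^sup>\<star> = B" using B A Esa by auto
        have BM: "B \<in> M" using B A E by auto
        show "prj Y" "Y \<noteq> 0" "B \<odot> Y = Y \<odot> B" using NY Y0 B by auto
        fix t
        let ?g = "specg B t"
        have g: "?g \<in> M" "U \<odot> B = B \<odot> U \<Longrightarrow> U \<odot> ?g = ?g \<odot> U" for U
          using M_spec[OF Bsa BM, of "{..t}"] specg_commute[OF Bsa] by (auto simp: spec_atMost[OF Bsa])
        have gY: "Y \<odot> ?g = ?g \<odot> Y" "A \<odot> ?g = ?g \<odot> A" "E \<odot> ?g = ?g \<odot> E"
          using B NY E(3) by (auto intro!: g(2))
        have "?N (?g \<odot> Y)"
        proof (intro conjI)
          show "?g \<odot> Y \<in> M" using g NY by auto
          show "prj (?g \<odot> Y)" using NY gY(1) by (intro prj_comp_commute) auto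
          show "?g \<odot> Y \<odot> A = A \<odot> (?g \<odot> Y)" using NY comp_subst[OF gY(2), of Y] by (simp add: op_assoc)
          show "?g \<odot> Y \<odot> E = E \<odot> (?g \<odot> Y)" using NY comp_subst[OF gY(3), of Y] by (simp add: op_assoc)
        qed
        moreover have "Y \<odot> (?g \<odot> Y) = ?g \<odot> Y"
          using comp_subst[OF gY(1), of Y] NY prj_idem[of Y] by (simp add: op_assoc)
        ultimately show "?g \<odot> Y = 0 \<or> ?g \<odot> Y = Y" by (rule min)
      qed
      have "\<tau> Y = \<infinity>"
      proof (rule ccontr)
        assume "\<tau> Y \<noteq> \<infinity>"
        then have "ennreal (norm E) * \<tau> Y < \<infinity>" by (simp add: ennreal_mult_less_top less_top)
        then show False using tr_comp_le_norm[OF E(1,2), of Y] NY EYinf by (simp add: top_unique)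
      qed
      then obtain r where r: "r \<in> M" "prj r" "Y \<odot> r = r" "r \<noteq> 0" "\<tau> r < \<infinity>"
        using exists_finite_subprj[of Y] NY by blast
      have com: "r \<odot> B = B \<odot> r" if B: "B = A \<or> B = E" for B
      proof -
        have Bsa: "B\<^sup>\<star> = B" using B A Esa by auto
        obtain c where c: "B \<odot> Y = c *\<^sub>R Y" using scal[OF B] by blast
        have Br: "B \<odot> r = c *\<^sub>R r" using comp_subst[OF c, of r] r(3) by (simp add: op_scale)
        then have "(B \<odot> r)\<^sup>\<star> = c *\<^sub>R r" using prj_sa[OF r(2)] by simp
        then have "r \<odot> B = c *\<^sub>R r" using Bsa prj_sa[OF r(2)] by simp
        then show ?thesis using Br by simp
      qed
      have Nr: "?N r" using r com by blast
      then have "r = Y" using min r by blast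
      then show False using r(5) \<open>\<tau> Y = \<infinity>\<close> by simp
    qed
    then obtain Z where Z: "?N Z" "Y \<odot> Z = Z" "Z \<noteq> 0" "Z \<noteq> Y" by blast
    have YZ: "prj (Y - Z)" "Z \<odot> Y = Z" using prj_diff[of Z Y] Z NY by auto
    have "?N (Y - Z)" "Y \<odot> (Y - Z) = Y - Z" "Y - Z \<noteq> 0"
      using Z NY YZ prj_idem[of Y] by (auto simp: op_distrib)
    then have "\<tau> (E \<odot> (Y - Z)) = \<infinity>" by (rule big)
    moreover have "\<tau> (E \<odot> (Y - Z)) \<le> \<tau> (E \<odot> (\<one> - Z))"
      using Z YZ NY prj_idem[of Z] by (intro tr_comp_mono[OF E(1,2)]) (auto simp: prj_compl op_distrib)
    ultimately have "\<tau> (E \<odot> (\<one> - Z)) = \<infinity>" by (simp add: top_unique)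
    then show ?thesis using Z(1) big[OF Z(1-3)] by blast
  qed
qed

end

section \<open>Copies of a finite projection below an operator\<close>

text \<open>\<open>W\<close> commutes with \<open>H\<close> and so with its spectral projections,
  but \<open>H\<close> has no null vectors in the spectral part of a set of positive
  numbers.\<close>

lemma spec_annihilate:
  assumes H: "H\<^sup>\<star> = (H :: 'a::hilbert_space operator)" and S: "S \<in> sets borel" "S \<subseteq> {0<..}"
    and W: "W\<^sup>\<star> = W" "W \<odot> H = 0"
  shows "W \<odot> spec H S = 0"
proof (rule blinfun_eqI)
  fix x
  have "(W \<odot> H)\<^sup>\<star> = H \<odot> W" using H W(1) by simp
  then have HW: "H \<odot> W = 0" using W(2) by simp
  have com: "W \<odot> spec H S = spec H S \<odot> W" by (rule spec_proj(2)[OF H S(1)]) (simp add: HW W(2))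
  let ?y = "ap (W \<odot> spec H S) x"
  have "ap (spec H S) ?y = ?y"
    unfolding com using spec_proj(1)[OF H S(1)] by (simp add: prj_idem_apply)
  moreover have "ap H ?y = ap (H \<odot> W) (ap (spec H S) x)" by simp
  then have "ap H ?y = 0" by (simp only: HW blinfun.zero_left)
  ultimately have "?y = 0" using spec_greaterThan_ge(2)[OF H S] by simp
  then show "?y = ap 0 x" by (simp add: blinfun.zero_left)
qed

context semifinite_factor
begin

lemma packing_count:
  assumes q: "q \<in> M" "prj q" "q \<noteq> 0" and F: "F \<in> M" "prj F"
  shows "\<exists>W. (\<forall>v\<in>W. v \<in> M \<and> F \<odot> v = v) \<and> frame q W (\<lambda>v. v) \<and> countable W \<and>
    (finite W \<longrightarrow> \<tau> F \<le> of_nat (card W + 1) * \<tau> q)"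
proof -
  obtain W z where W: "\<And>v. v \<in> W \<Longrightarrow> v \<in> M" "\<And>v. v \<in> W \<Longrightarrow> F \<odot> v = v" "frame q W (\<lambda>v. v)" "countable W"
    and z: "z \<in> M" "prj (z\<^sup>\<star> \<odot> z)" "z \<odot> q = z" "z \<odot> z\<^sup>\<star> = F - opsum (\<lambda>v. v \<odot> v\<^sup>\<star>) W"
    by (rule packing[OF q F]) (rule that)
  let ?E = "opsum (\<lambda>v. v \<odot> v\<^sup>\<star>) W"
  have EM: "?E \<in> M" by (rule M_frame[OF q(2) W(3) W(1)])
  have "\<tau> F \<le> of_nat (card W + 1) * \<tau> q" if fin: "finite W"
  proof -
    have "(z \<odot> q)\<^sup>\<star> = z\<^sup>\<star>" using z(3) by simp
    then have "q \<odot> z\<^sup>\<star> = z\<^sup>\<star>" using prj_sa[OF q(2)] by simp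
    then have qz: "q \<odot> (z\<^sup>\<star> \<odot> z) = z\<^sup>\<star> \<odot> z" by (rule comp_subst)
    have "\<tau> F = \<tau> (?E + z \<odot> z\<^sup>\<star>)" using z(4) by simp
    also have "\<dots> = \<tau> ?E + \<tau> (z \<odot> z\<^sup>\<star>)"
      using EM z(1) by (intro tr_add prj_pos[OF frame_sum(3)[OF q(2) W(3)]]) auto
    also have "\<tau> (z \<odot> z\<^sup>\<star>) = \<tau> (z\<^sup>\<star> \<odot> z)" using tr_swap[OF z(1)] by simp
    also have "\<dots> \<le> \<tau> q" using q z(1,2) qz by (intro tr_prj_mono) auto
    also have "\<tau> ?E = of_nat (card W) * \<tau> q" by (rule tr_frame_finite[OF fin q(2) W(3) W(1)])
    finally show ?thesis by (simp add: distrib_right add.commute)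
  qed
  then show ?thesis using W by blast
qed

text \<open>The excess \<open>H\<close> is cut into dyadic spectral slices \<open>Y m\<close>, each
  packed with copies of \<open>q\<close> of weight \<open>1 + t m\<close>, which \<open>A\<close>
  guarantees there. In each slice the packing misses at most the trace of one copy; this costs a
  multiple of \<open>t m\<close>, which is summable. So summable weights \<open>lam\<close> would
  give \<open>H\<close> finite trace.\<close>

lemma diagonal_minorant:
  assumes A: "A \<in> M" "pos A" and P: "P \<in> M" "pos P" and N: "pos N" and AP: "A - \<one> = P - N" "P \<odot> N = 0"
    and Z: "Z \<in> M" "prj Z" "Z \<odot> A = A \<odot> Z" "Z \<odot> P = P \<odot> Z" "\<tau> (P \<odot> Z) = \<infinity>"
    and q: "q \<in> M" "prj q" "q \<noteq> 0" "\<tau> q < \<infinity>"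
  obtains v :: "nat \<Rightarrow> 'a operator" and lam :: "nat \<Rightarrow> real" and C
  where "\<And>i. v i \<in> M" "\<And>i. Z \<odot> v i = v i" "frame q UNIV v" "\<And>i. 0 < lam i" "\<And>i. lam i \<le> C" "\<not> summable lam"
    "\<And>J x. finite J \<Longrightarrow> (\<Sum>i\<in>J. (1 + lam i) * nsq ((v i)\<^sup>\<star>) x) \<le> qf (A \<odot> Z) x"
proof -
  define H where "H = P \<odot> Z"
  have H: "pos H" "H \<in> M" "H\<^sup>\<star> = H"
    unfolding H_def using pos_comp_prj[OF P(2) Z(2,4)] pos_sa[OF pos_comp_prj[OF P(2) Z(2,4)]] P(1) Z(1) by auto
  have "H \<noteq> 0" using Z(5) by (auto simp: H_def)
  define c where "c = norm H"
  have c: "c > 0" using \<open>H \<noteq> 0\<close> by (simp add: c_def)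
  define t where "t m = c / 2 ^ Suc m" for m :: nat
  have t0: "t m > 0" and tc: "t m \<le> c" for m
    using c one_le_power[of "2::real" "Suc m"] by (simp_all add: t_def field_simps)
  define I where "I m = {t m<..2 * t m}" for m
  define Y where "Y m = spec H (I m)" for m
  have Ib: "I m \<in> sets borel" "I m \<subseteq> {0<..}" "I m \<subseteq> {t m<..}" "I m \<subseteq> {..2 * t m}" for m
    using t0[of m] by (auto simp: I_def)
  have t2: "2 * t (Suc m) = t m" for m by (simp add: t_def)
  have tmono: "t n \<le> t m" if "m \<le> n" for m n
    using that c by (auto simp: t_def intro!: divide_left_mono power_increasing)
  have "I m \<inter> I n = {}" if "m < n" for m n
  proof -
    have "2 * t n \<le> t m" using tmono[of m "n - 1"] t2[of "n - 1"] that by simp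
    then show ?thesis by (auto simp: I_def)
  qed
  then have dis: "disjoint_family I" unfolding disjoint_family_on_def by (metis linorder_neqE_nat Int_commute)
  have UI: "(\<Union>m. I m) = {0<..c}"
  proof (intro equalityI subsetI)
    fix s assume "s \<in> (\<Union>m. I m)"
    then obtain m where m: "t m < s" "s \<le> 2 * t m" by (auto simp: I_def)
    have "2 * t m \<le> c" using c by (simp add: t_def field_simps)
    then show "s \<in> {0<..c}" using m t0[of m] by simp
  next
    fix s assume s: "s \<in> {0<..c}"
    obtain n where n: "t n < s"
    proof -
      obtain n where "(1/2) ^ n < s / c" using real_arch_pow_inv[of "s / c" "1/2"] s c by auto
      then have "c / 2 ^ n < s" using c by (simp add: field_simps power_one_over)
      moreover have "t n \<le> c / 2 ^ n" using c by (simp add: t_def field_simps)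
      ultimately show thesis using that[of n] by linarith
    qed
    define m where "m = (LEAST n. t n < s)"
    have m: "t m < s" unfolding m_def by (rule LeastI[of "\<lambda>n. t n < s", OF n])
    have "s \<le> 2 * t m"
    proof (cases m)
      case 0 then show ?thesis using s by (simp add: t_def)
    next
      case (Suc k)
      then have "\<not> t k < s" using not_less_Least[of k "\<lambda>n. t n < s"] by (simp add: m_def)
      then show ?thesis using t2[of k] Suc by simp
    qed
    then show "s \<in> (\<Union>m. I m)" using m by (auto simp: I_def)
  qed
  note SS = spec_sum[OF H(3) Ib(1) dis, folded Y_def]
  have Y: "prj (Y m)" "Y m \<in> M" "U \<odot> H = H \<odot> U \<Longrightarrow> U \<odot> Y m = Y m \<odot> U" for m U
    unfolding Y_def using spec_proj(1,2)[OF H(3) Ib(1)] M_spec[OF H(3,2) Ib(1)] by auto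
  have YY: "ap (Y m) (ap (Y m) x) = ap (Y m) x" for m x
    using Y(1) by (rule prj_idem_apply)
  have YH: "Y m \<odot> H = H \<odot> Y m" for m using Y(3)[of H m] by simp
  have ZY: "Z \<odot> Y m = Y m" for m
  proof -
    have "(\<one> - Z) \<odot> H = 0"
      unfolding H_def using Z(4) prj_idem[OF Z(2)] comp_subst[OF Z(4), of Z] by (simp add: op_distrib op_assoc)
    then have "(\<one> - Z) \<odot> Y m = 0"
      unfolding Y_def by (rule spec_annihilate[OF H(3) Ib(1,2), rotated]) (simp add: prj_sa[OF Z(2)])
    then show ?thesis by (simp add: op_distrib)
  qed
  have NY: "N \<odot> Y m = 0" for m
  proof -
    have "(P \<odot> N)\<^sup>\<star> = N \<odot> P" using P N by (simp add: pos_sa)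
    then have "N \<odot> P = 0" using AP(2) by simp
    then have "N \<odot> H = 0" unfolding H_def by (rule comp_zero_left)
    then show ?thesis unfolding Y_def by (rule spec_annihilate[OF H(3) Ib(1,2), rotated]) (rule pos_sa[OF N])
  qed
  have AH: "A \<odot> H = H \<odot> A"
  proof -
    have "A = \<one> + P - N" using AP(1) by (simp add: algebra_simps)
    moreover have "(P \<odot> N)\<^sup>\<star> = N \<odot> P" using P N by (simp add: pos_sa)
    then have "N \<odot> P = 0" using AP(2) by simp
    ultimately have "A \<odot> P = P \<odot> A" using AP(2) by (simp add: op_distrib)
    then have "A \<odot> (P \<odot> Z) = P \<odot> (A \<odot> Z)" using comp_subst[of A P "P \<odot> A" Z] by (simp add: op_assoc)
    then show ?thesis by (simp add: H_def op_assoc Z(3))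
  qed
  have YA: "A \<odot> Y m = Y m \<odot> A" for m by (rule Y(3)[OF AH])
  have lower: "(1 + t m) * nsq (Y m) x \<le> qf A (ap (Y m) x)" for m x
  proof -
    let ?y = "ap (Y m) x"
    have 1: "t m * (norm ?y)\<^sup>2 \<le> qf H ?y"
      by (rule spec_greaterThan_ge(1)[OF H(3) Ib(1,3)]) (use YY in \<open>simp add: Y_def\<close>)
    have "ap Z ?y = ?y" using ZY[of m] by (metis blinfun_apply_blinfun_compose)
    then have "ap H ?y = ap P ?y" by (simp add: H_def)
    moreover have "ap N ?y = 0" using NY[of m] by (metis blinfun.zero_left blinfun_apply_blinfun_compose)
    moreover have "ap A ?y = ?y + ap P ?y - ap N ?y"
    proof -
      have "A = \<one> + P - N" using AP(1) by (simp add: algebra_simps)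
      then show ?thesis by (simp add: apply_simps)
    qed
    ultimately have "qf A ?y = (norm ?y)\<^sup>2 + qf H ?y"
      by (simp add: inner_expand power2_norm_eq_inner)
    then show ?thesis using 1 by (simp add: algebra_simps)
  qed
  obtain W where W: "\<And>m v. v \<in> W m \<Longrightarrow> v \<in> M" "\<And>m v. v \<in> W m \<Longrightarrow> Y m \<odot> v = v" "\<And>m. frame q (W m) (\<lambda>v. v)"
    "\<And>m. countable (W m)" "\<And>m. finite (W m) \<Longrightarrow> \<tau> (Y m) \<le> of_nat (card (W m) + 1) * \<tau> q"
    using packing_count[OF q(1-3) Y(2,1)] by metis
  define K where "K = Sigma UNIV W"
  have fK: "frame q K snd"
    unfolding frame_def
  proof (intro ballI)
    fix p p' assume pp: "p \<in> K" "p' \<in> K"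
    show "(snd p)\<^sup>\<star> \<odot> snd p' = (if p = p' then q else 0)"
    proof (cases "fst p = fst p'")
      case True
      then show ?thesis using W(3)[of "fst p"] pp by (auto simp: K_def frame_def prod_eq_iff)
    next
      case False
      have "Y (fst p) \<odot> Y (fst p') = 0" using SS(1) False by (simp add: orth_prjs_def)
      moreover have "Y (fst p) \<odot> snd p = snd p" "Y (fst p') \<odot> snd p' = snd p'" using W(2) pp by (auto simp: K_def)
      then have "(snd p)\<^sup>\<star> \<odot> snd p' = (Y (fst p) \<odot> snd p)\<^sup>\<star> \<odot> (Y (fst p') \<odot> snd p')" by simp
      ultimately have "(snd p)\<^sup>\<star> \<odot> snd p' = 0"
        using prj_sa[OF Y(1)] comp_zero_left[of "Y (fst p)" "Y (fst p')" "snd p'"] by (simp add: op_assoc)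
      then show ?thesis using False by auto
    qed
  qed
  have notsum: "\<not> (\<lambda>p. t (fst p)) summable_on K"
  proof
    assume s: "(\<lambda>p. t (fst p)) summable_on K"
    define B where "B = infsum (\<lambda>p. t (fst p)) K"
    have fb: "(\<Sum>p\<in>F. t (fst p)) \<le> B" if "finite F" "F \<subseteq> K" for F
      unfolding B_def by (rule finite_sum_le_infsum[OF s that]) (use t0 less_imp_le in blast)
    have fin: "finite (W m)" for m
    proof (rule ccontr)
      assume inf: "infinite (W m)"
      obtain n where n: "real n * t m > B" using ex_less_of_nat_mult[OF t0] by blast
      obtain F where F: "F \<subseteq> W m" "finite F" "card F = n" using inf infinite_arbitrarily_large by blast
      have "real n * t m = (\<Sum>p\<in>Pair m ` F. t (fst p))" using F by (simp add: sum.reindex inj_on_def)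
      also have "\<dots> \<le> B" using F by (intro fb) (auto simp: K_def)
      finally show False using n by simp
    qed
    define \<theta> where "\<theta> = enn2real (\<tau> q)"
    have \<theta>: "\<tau> q = ennreal \<theta>" "\<theta> \<ge> 0" using q(4) by (simp_all add: \<theta>_def)
    \<comment> \<open>\<open>H\<close> is at most \<open>2 * t m\<close> on the slice; the extra
      summand \<open>t m\<close> pays for what the packing misses.\<close>
    have Hm: "\<tau> (H \<odot> Y m) \<le> ennreal (2 * \<theta> * (t m * real (card (W m)) + t m))" for m
    proof -
      have "pos ((2 * t m) *\<^sub>R Y m - H \<odot> Y m)"
        unfolding pos_def
      proof (intro conjI allI)
        show "((2 * t m) *\<^sub>R Y m - H \<odot> Y m)\<^sup>\<star> = (2 * t m) *\<^sub>R Y m - H \<odot> Y m" using H(3) prj_sa[OF Y(1)] YH by simp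
        fix x
        have "qf H (ap (Y m) x) \<le> 2 * t m * nsq (Y m) x"
          by (rule spec_atMost_le[OF H(3) Ib(1,4)]) (use YY in \<open>simp add: Y_def\<close>)
        then show "0 \<le> qf ((2 * t m) *\<^sub>R Y m - H \<odot> Y m) x"
          unfolding inner_conj_prj[OF Y(1) YH[symmetric]]
          by (simp add: apply_simps inner_expand prj_inner[OF Y(1)])
      qed
      then have "\<tau> (H \<odot> Y m) \<le> \<tau> ((2 * t m) *\<^sub>R Y m)"
        by (intro tr_mono pos_comp_prj[OF H(1) Y(1) YH] M_comp M_scaleR H(2) Y(2))
      also have "\<dots> = ennreal (2 * t m) * \<tau> (Y m)" using t0[of m] by (intro tr_scale prj_pos Y(1,2)) auto
      also have "\<dots> \<le> ennreal (2 * t m) * (of_nat (card (W m) + 1) * \<tau> q)" by (intro mult_left_mono W(5) fin) simp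
      also have "\<dots> = ennreal (2 * \<theta> * (t m * real (card (W m)) + t m))"
        unfolding \<theta>(1) ennreal_of_nat_eq_real_of_nat using t0[of m] \<theta>(2)
        by (simp add: ennreal_mult[symmetric] algebra_simps del: of_nat_add)
      finally show ?thesis .
    qed
    have "(\<Sum>m<n. \<tau> (H \<odot> Y m)) \<le> ennreal (2 * \<theta> * (B + c))" for n
    proof -
      have "(\<Sum>m<n. \<tau> (H \<odot> Y m)) \<le> (\<Sum>m<n. ennreal (2 * \<theta> * (t m * real (card (W m)) + t m)))"
        by (intro sum_mono Hm)
      also have "\<dots> = ennreal (2 * \<theta> * ((\<Sum>m<n. t m * real (card (W m))) + (\<Sum>m<n. t m)))"
        using t0 \<theta>(2) by (subst sum_ennreal) (auto simp: less_imp_le sum_distrib_left sum.distrib distrib_left)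
      also have "\<dots> \<le> ennreal (2 * \<theta> * (B + c))"
      proof (intro ennreal_leI mult_left_mono add_mono)
        have "(\<Sum>m<n. t m * real (card (W m))) = (\<Sum>p\<in>Sigma {..<n} W. t (fst p))"
          using sum.Sigma[of "{..<n}" W "\<lambda>m v. t m"] fin by (simp add: split_beta mult.commute)
        also have "\<dots> \<le> B" using fin by (intro fb) (auto simp: K_def)
        finally show "(\<Sum>m<n. t m * real (card (W m))) \<le> B" .
        have "(\<Sum>m<n. t m) = c - c / 2 ^ n" by (induction n) (auto simp: t_def field_simps)
        then show "(\<Sum>m<n. t m) \<le> c" using c by simp
      qed (use \<theta> in auto)
      finally show ?thesis .
    qed
    then have le: "(\<Sum>m. \<tau> (H \<odot> Y m)) \<le> ennreal (2 * \<theta> * (B + c))" by (intro suminf_le_const summableI)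
    \<comment> \<open>The slices exhaust the support of \<open>H\<close>: on the nonpositive part of
      the spectrum \<open>H\<close> vanishes, and there is no spectrum above its norm.\<close>
    have HU: "H \<odot> opsum Y UNIV = H"
    proof -
      have "opsum Y UNIV = spec H {0<..c}"
        using SS(2) prj_opsum(1)[OF SS(1)] unfolding UI by (intro blinfun_eqI) (rule has_sum_unique)
      moreover have "H \<odot> spec H {0<..c} = H"
      proof -
        let ?S = "- {0<..c}"
        have S: "?S \<in> sets borel" by simp
        have "H \<odot> spec H ?S = 0"
        proof (rule blinfun_eqI)
          fix x
          let ?u = "ap (spec H ({..0} \<union> {c<..})) x"
          have sp: "spec H ({..0} \<union> {c<..}) = spec H {..0} + spec H {c<..}"
            by (rule spec_disjoint(2)[OF H(3)]) (use c in auto)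
          have 1: "ap H (ap (spec H {..0}) x) = 0"
          proof (rule pos_inner_zero[OF H(1)])
            have "qf H (ap (spec H {..0}) x)
              \<le> 0 * nsq (spec H {..0}) x"
              by (rule spec_atMost_le[OF H(3), of "{..0}"]) (auto simp: prj_idem_apply spec_proj(1)[OF H(3)])
            then show "qf H (ap (spec H {..0}) x) = 0"
              using pos_ge[OF H(1), of "ap (spec H {..0}) x"] by simp
          qed
          have 2: "ap (spec H {c<..}) x = 0"
          proof (rule spec_greaterThan_ge(2)[OF H(3), of "{c<..}" c])
            let ?z = "ap (spec H {c<..}) x"
            have "c * (norm ?z)\<^sup>2 \<le> qf H ?z"
              by (rule spec_greaterThan_ge(1)[OF H(3), of "{c<..}"]) (auto simp: prj_idem_apply spec_proj(1)[OF H(3)])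
            then show "c * (norm ?z)\<^sup>2 = qf H ?z" using inner_le_norm_op[of H ?z] by (simp add: c_def)
          qed (auto simp: prj_idem_apply spec_proj(1)[OF H(3)])
          have "?S = {..0} \<union> {c<..}" using c by auto
          then show "ap (H \<odot> spec H ?S) x = ap 0 x"
            using 1 2 by (simp add: sp apply_simps blinfun.zero_left blinfun.zero_right)
        qed
        then show ?thesis using spec_Compl[OF H(3), of "{0<..c}"] by (simp add: op_distrib)
      qed
      ultimately show ?thesis by simp
    qed
    have "\<tau> H = (\<Sum>m. \<tau> (H \<odot> Y m))"
      using tr_weighted_sum[OF H(2,1) SS(1) Y(2) YH] HU by simp
    then show False using Z(5) le by (simp add: H_def top_unique)
  qed
  have "infinite K" using notsum summable_on_finite by blast
  moreover have "countable K" unfolding K_def by (intro countable_SIGMA W) auto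
  ultimately have bij: "bij_betw (from_nat_into K) UNIV K" by (intro bij_betw_from_nat_into)
  define e where "e = from_nat_into K"
  have eK: "e i \<in> K" and einj: "inj e" for i using bij by (auto simp: e_def bij_betw_def)
  define v where "v i = snd (e i)" for i
  define lam where "lam i = t (fst (e i))" for i
  have fv: "frame q UNIV v" unfolding v_def by (rule frame_reindex[OF fK einj]) (use eK in auto)
  have vW: "v i \<in> W (fst (e i))" for i using eK[of i] by (auto simp: v_def K_def)
  show thesis
  proof (rule that[of v lam c])
    show "v i \<in> M" for i using W(1) vW by blast
    show "Z \<odot> v i = v i" for i by (rule comp_absorb[OF ZY W(2)[OF vW]])
    show "frame q UNIV v" by (rule fv)
    show "0 < lam i" "lam i \<le> c" for i using t0 tc by (auto simp: lam_def)
    show "\<not> summable lam"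
    proof
      assume "summable lam"
      then have "lam summable_on UNIV" by (rule summable_nonneg_imp_summable_on) (use t0 in \<open>auto simp: lam_def less_imp_le\<close>)
      then have "(\<lambda>p. t (fst p)) summable_on K"
        using summable_on_reindex_bij_betw[OF bij, of "\<lambda>p. t (fst p)"] by (simp add: lam_def[abs_def] e_def)
      then show False using notsum by blast
    qed
    fix J :: "nat set" and x
    assume J: "finite J"
    define G where "G = e ` J"
    define D where "D = fst ` G"
    define V where "V m = {w. (m, w) \<in> G}" for m
    have GDV: "G = Sigma D V" unfolding D_def V_def by force
    have G: "finite G" "G \<subseteq> K" using J eK by (auto simp: G_def)
    have V: "finite (V m)" "V m \<subseteq> W m" for m
    proof -
      have "V m \<subseteq> snd ` G" by (force simp: V_def)
      then show "finite (V m)" using G(1) finite_subset by blast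
      show "V m \<subseteq> W m" using G(2) by (auto simp: V_def K_def)
    qed
    have D: "finite D" using G(1) by (simp add: D_def)
    have "(\<Sum>i\<in>J. (1 + lam i) * nsq ((v i)\<^sup>\<star>) x) =
      (\<Sum>p\<in>G. (1 + t (fst p)) * nsq ((snd p)\<^sup>\<star>) x)"
      unfolding G_def lam_def v_def using einj by (subst sum.reindex) (auto intro: inj_on_subset)
    also have "\<dots> = (\<Sum>m\<in>D. \<Sum>w\<in>V m. (1 + t m) * nsq (w\<^sup>\<star>) x)"
      unfolding GDV using D V(1) by (subst sum.Sigma) (auto simp: split_beta)
    also have "\<dots> \<le> (\<Sum>m\<in>D. (1 + t m) * nsq (Y m) x)"
    proof (rule sum_mono)
      fix m
      let ?y = "ap (Y m) x"
      have fV: "frame q (V m) (\<lambda>w. w)" by (rule frame_subset[OF W(3) V(2)])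
      note oV = frame_sum(1)[OF q(2) fV]
      have "nsq (w\<^sup>\<star>) x = nsq (w \<odot> w\<^sup>\<star>) ?y" if w: "w \<in> V m" for w
      proof -
        have "Y m \<odot> w = w" using W(2) V(2) w by blast
        then have "(Y m \<odot> w)\<^sup>\<star> = w\<^sup>\<star>" by simp
        then have "w\<^sup>\<star> \<odot> Y m = w\<^sup>\<star>" using prj_sa[OF Y(1)] by simp
        then have "ap (w\<^sup>\<star>) x = ap (w\<^sup>\<star>) ?y" by (metis blinfun_apply_blinfun_compose)
        moreover have "prj (w \<odot> w\<^sup>\<star>)" using oV w by (simp add: orth_prjs_def)
        ultimately show ?thesis using norm_sq_radj[of w ?y] by (simp only: prj_inner)
      qed
      then have "(\<Sum>w\<in>V m. nsq (w\<^sup>\<star>) x) = (\<Sum>w\<in>V m. nsq (w \<odot> w\<^sup>\<star>) ?y)"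
        by (intro sum.cong) auto
      also have "\<dots> \<le> (norm ?y)\<^sup>2" by (rule bessel[OF V(1) oV])
      finally show "(\<Sum>w\<in>V m. (1 + t m) * nsq (w\<^sup>\<star>) x) \<le> (1 + t m) * (norm ?y)\<^sup>2"
        using t0[of m] by (simp add: sum_distrib_left[symmetric] mult_left_mono)
    qed
    also have "\<dots> \<le> (\<Sum>m\<in>D. inner (ap A (ap (Y m) x)) x)"
      using lower[of _ x] unfolding inner_conj_prj[OF Y(1) YA] by (intro sum_mono) auto
    also have "\<dots> = qf (A \<odot> sum Y D) x"
      by (simp add: blinfun.sum_left blinfun.sum_right inner_sum_left)
    also have "\<dots> \<le> qf (A \<odot> Z) x"
    proof -
      have pD: "prj (sum Y D)" by (rule prj_finite_sum[OF D orth_prjs_subset[OF SS(1)]]) simp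
      have "Z \<odot> sum Y D = sum Y D" by (simp add: op_sum_comp_left[OF D] ZY)
      moreover have "A \<odot> sum Y D = sum Y D \<odot> A" by (rule sum_commute_op) (rule YA)
      ultimately have "pos (A \<odot> (Z - sum Y D))"
        by (intro pos_comp_prj[OF A(2) prj_diff(1)[OF pD Z(2)]]) (simp_all add: op_distrib Z(3))
      from pos_ge[OF this, of x] show ?thesis by (simp add: op_distrib apply_simps inner_expand)
    qed
    finally show "(\<Sum>i\<in>J. (1 + lam i) * nsq ((v i)\<^sup>\<star>) x) \<le> qf (A \<odot> Z) x" .
  qed
qed

end

section \<open>Splitting a half into weighted copies and deficient projections\<close>

lemma has_sum_partition_on:
  fixes f :: "'i \<Rightarrow> real"
  assumes f: "(f has_sum S) K" and g: "\<And>n. (f has_sum g n) {k \<in> K. c k = n}"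
  shows "(g has_sum S) UNIV"
proof (rule has_sum_partition[where f="\<lambda>k. if k \<in> K then f k else 0" and c=c])
  show "((\<lambda>k. if k \<in> K then f k else 0) has_sum S) UNIV"
    by (rule iffD2[OF has_sum_cong_neutral f]) auto
  show "((\<lambda>k. if k \<in> K then f k else 0) has_sum g n) {k. c k = n}" for n
    by (rule iffD2[OF has_sum_cong_neutral g[of n]]) auto
qed

lemma radj_has_sum:
  assumes X: "\<And>x. ((\<lambda>i. ap (X i) x) has_sum ap S x) I"
    and Y: "\<And>x. ((\<lambda>i. ap ((X i)\<^sup>\<star>) x) has_sum ap T x) I"
  shows "S\<^sup>\<star> = T"
proof (rule radj_unique)
  fix x y
  have "((\<lambda>i. inner (ap (X i) x) y) has_sum inner (ap S x) y) I"
    by (rule has_sum_bounded_linear[OF bounded_linear_inner_left X])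
  moreover have "((\<lambda>i. inner x (ap ((X i)\<^sup>\<star>) y)) has_sum inner x (ap T y)) I"
    by (rule has_sum_bounded_linear[OF bounded_linear_inner_right Y])
  ultimately show "inner (ap S x) y = inner x (ap T y)"
    by (rule has_sum_eqI) (rule inner_radj)
qed

text \<open>Steps of size \<open>1/2\<close> bring the bound from above \<open>C\<close> down to
  \<open>1/2\<close>, then geometric steps bring it to zero. All steps stay below one because every
  coefficient has to be deficient.\<close>

lemma ex_step_sizes:
  "\<exists>a r :: nat \<Rightarrow> real. (\<forall>k. 0 < a k \<and> a k < 1) \<and> C \<le> r 0 \<and> (\<forall>k. max (a k) (r k - a k) \<le> r (Suc k)) \<and> r \<longlonglongrightarrow> 0"
proof -
  obtain K :: nat where K: "2 * C \<le> real K" using real_arch_simple by blast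
  define a :: "nat \<Rightarrow> real" where "a k = (if k < K then 1/2 else (1/2) ^ (k - K + 2))" for k
  define r :: "nat \<Rightarrow> real" where "r k = (if k < K then (real K - real k + 1) / 2 else (1/2) ^ (k - K + 1))" for k
  have "0 < a k \<and> a k < 1" for k
    using power_Suc_less_one[of "1/2::real" "Suc (k - K)"] by (auto simp: a_def)
  moreover have "C \<le> r 0" using K by (auto simp: r_def)
  moreover have "max (a k) (r k - a k) \<le> r (Suc k)" for k
  proof -
    consider "Suc k < K" | "Suc k = K" | "k \<ge> K" by linarith
    then show ?thesis
    proof cases
      case 3
      then show ?thesis by (simp add: a_def r_def Suc_diff_le)
    qed (auto simp: a_def r_def field_simps)
  qed
  moreover have "r \<longlonglongrightarrow> 0"
  proof (rule LIMSEQ_offset[of _ K])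
    have "(\<lambda>k. (1/2::real) ^ (k + 1)) \<longlonglongrightarrow> 0" by (rule LIMSEQ_ignore_initial_segment[OF LIMSEQ_power_zero]) simp
    then show "(\<lambda>k. r (k + K)) \<longlonglongrightarrow> 0" by (simp add: r_def)
  qed
  ultimately show ?thesis by blast
qed

lemma ex_block_index:
  assumes b: "strict_mono (b :: nat \<Rightarrow> nat)" "b 0 = 0"
  shows "\<exists>c. \<forall>l n. c l = n \<longleftrightarrow> b n \<le> l \<and> l < b (Suc n)"
proof -
  have "\<exists>n. b n \<le> l \<and> l < b (Suc n)" for l
  proof -
    have ex: "l < b (Suc l)" using strict_mono_imp_increasing[OF b(1), of "Suc l"] by simp
    define n where "n = (LEAST n. l < b (Suc n))"
    have n: "l < b (Suc n)" unfolding n_def by (rule LeastI[of "\<lambda>n. l < b (Suc n)", OF ex])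
    have "b n \<le> l"
    proof (cases n)
      case 0 then show ?thesis using b(2) by simp
    next
      case (Suc m)
      then have "\<not> l < b (Suc m)" using not_less_Least[of m "\<lambda>n. l < b (Suc n)"] by (simp add: n_def)
      then show ?thesis using Suc by simp
    qed
    then show ?thesis using n by blast
  qed
  then obtain c where c: "\<And>l. b (c l) \<le> l \<and> l < b (Suc (c l))" by metis
  have "c l = n" if "b n \<le> l" "l < b (Suc n)" for l n
    using blocks_disjoint[OF b(1), of "c l" n] c[of l] that by force
  then show ?thesis using c by blast
qed

context semifinite_factor
begin

text \<open>The copies \<open>v\<close> are grouped into blocks of total excess at least one. From
  each even block one copy \<open>v (g k i)\<close> is taken with weight \<open>a k\<close>, to make
  the \<open>k\<close>-th projection infinite later. Each odd block \<open>L k i\<close> keeps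
  excesses scaled down to total \<open>1 - a k\<close>. What remains of \<open>A \<odot> Z\<close>
  is expanded into \<open>a k\<close> times \<open>E k\<close>. These three parts have the forms
  \<beta>, \<gamma> and \<alpha>.\<close>

lemma half_decomposition:
  assumes A: "A \<in> M" "pos A" and P: "P \<in> M" "pos P" and N: "pos N" and AP: "A - \<one> = P - N" "P \<odot> N = 0"
    and Z: "Z \<in> M" "prj Z" "Z \<odot> A = A \<odot> Z" "Z \<odot> P = P \<odot> Z" "\<tau> (P \<odot> Z) = \<infinity>"
    and q: "q \<in> M" "prj q" "q \<noteq> 0" "\<tau> q < \<infinity>"
    and a: "\<And>k. 0 < a k" "\<And>k. a k < 1"
    and r: "norm A \<le> r 0" "\<And>k. max (a k) (r k - a k) \<le> r (Suc k)" "r \<longlonglongrightarrow> 0"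
  obtains v :: "nat \<Rightarrow> 'a operator" and L :: "nat \<Rightarrow> nat \<Rightarrow> nat set" and g :: "nat \<Rightarrow> nat \<Rightarrow> nat"
    and \<mu> E \<alpha> \<beta> \<gamma>
  where "\<And>i. v i \<in> M" "\<And>i. Z \<odot> v i = v i" "frame q UNIV v"
    "\<And>k i. finite (L k i)" "\<And>k i k' i'. (k, i) \<noteq> (k', i') \<Longrightarrow> L k i \<inter> L k' i' = {}"
    "\<And>k i k' i'. g k i = g k' i' \<Longrightarrow> (k, i) = (k', i')" "\<And>k i k' i'. g k i \<notin> L k' i'"
    "\<And>l. 0 \<le> \<mu> l" "\<And>k i. (\<Sum>l\<in>L k i. \<mu> l) = 1 - a k"
    "\<And>k::nat. E k \<in> M" "\<And>k. prj (E k)" "\<And>k. Z \<odot> E k = E k"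
    "\<And>x. ((\<lambda>k. a k * qf (E k) x) has_sum \<alpha> x) UNIV"
    "\<And>x. ((\<lambda>(k, i::nat). a k * nsq ((v (g k i))\<^sup>\<star>) x) has_sum \<beta> x) UNIV"
    "\<And>x. ((\<lambda>(k, i). \<Sum>l\<in>L k i. (1 + \<mu> l) * nsq ((v l)\<^sup>\<star>) x) has_sum \<gamma> x) UNIV"
    "\<And>x. \<alpha> x + \<beta> x + \<gamma> x = qf (A \<odot> Z) x"
proof -
  obtain v lam C where v: "\<And>i::nat. v i \<in> M" "\<And>i. Z \<odot> v i = v i" "frame q UNIV v" and
    lam: "\<And>i. 0 < lam i" "\<And>i. lam i \<le> C" "\<not> summable lam" and
    bnd: "\<And>J x. finite J \<Longrightarrow> (\<Sum>i\<in>J. (1 + lam i) * nsq ((v i)\<^sup>\<star>) x) \<le> qf (A \<odot> Z) x"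
    by (rule diagonal_minorant[OF A P N AP Z q]) (rule that)
  have "\<exists>m>n. 1 \<le> (\<Sum>k=n..<m. lam k)" for n
  proof (rule ccontr)
    assume "\<not> ?thesis"
    then have *: "(\<Sum>k=n..<m. lam k) < 1" if "m > n" for m using that by (meson not_le)
    have "(\<Sum>k<m. lam k) \<le> (\<Sum>k<n. lam k) + 1" for m
    proof (cases "m > n")
      case True
      then have "(\<Sum>k<m. lam k) = (\<Sum>k<n. lam k) + (\<Sum>k=n..<m. lam k)"
        using sum.atLeastLessThan_concat[of 0 n m lam] by (simp add: atLeast0LessThan)
      then show ?thesis using *[OF True] by simp
    next
      case False
      then have "(\<Sum>k<m. lam k) \<le> (\<Sum>k<n. lam k)" using lam(1) by (intro sum_mono2) (auto simp: less_imp_le)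
      then show ?thesis by simp
    qed
    then have "summable lam" using lam(1) by (intro summableI_nonneg_bounded) (auto simp: less_imp_le)
    then show False using lam(3) by blast
  qed
  then obtain b where b: "b 0 = 0" "strict_mono b" "\<And>c. 1 \<le> (\<Sum>k=b c..<b (Suc c). lam k)"
    using ex_blocks[of "\<lambda>n m. 1 \<le> (\<Sum>k=n..<m. lam k)"] by blast
  obtain blk where blk: "\<And>l n. blk l = n \<longleftrightarrow> b n \<le> l \<and> l < b (Suc n)" using ex_block_index[OF b(2,1)] by blast
  define Lam where "Lam c = (\<Sum>k=b c..<b (Suc c). lam k)" for c
  have Lam: "Lam c \<ge> 1" for c using b(3) by (simp add: Lam_def)
  \<comment> \<open>Blocks \<open>2 * m\<close> and \<open>2 * m + 1\<close> serve the same pair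
    \<open>(k, i)\<close>, so every \<open>k\<close> is served infinitely often by both
    kinds.\<close>
  define \<kappa> where "\<kappa> c = fst (prod_decode (c div 2))" for c
  define \<mu> where "\<mu> l = lam l * ((1 - a (\<kappa> (blk l))) / Lam (blk l))" for l
  have mu0: "0 \<le> \<mu> l" for l
    unfolding \<mu>_def using lam(1)[of l] a(2)[of "\<kappa> (blk l)"] Lam[of "blk l"] by simp
  have mul: "\<mu> l \<le> lam l" for l
  proof -
    have "(1 - a (\<kappa> (blk l))) / Lam (blk l) \<le> 1"
      using a(1)[of "\<kappa> (blk l)"] Lam[of "blk l"] by (simp add: divide_le_eq)
    then show ?thesis unfolding \<mu>_def by (rule mult_left_le) (use lam(1)[of l] in simp)
  qed
  \<comment> \<open>The weights removed from \<open>A \<odot> Z\<close>; they never exceed the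
    guaranteed \<open>1 + lam l\<close>, which keeps the remainder positive.\<close>
  define \<omega> where "\<omega> l = (if odd (blk l) then 1 + \<mu> l else if l = b (blk l) then a (\<kappa> (blk l)) else 0)" for l
  have om: "0 \<le> \<omega> l" "\<omega> l \<le> 1 + lam l" for l
    using mu0[of l] mul[of l] a[of "\<kappa> (blk l)"] lam(1)[of l] by (auto simp: \<omega>_def)
  have omC: "(\<omega> l)\<^sup>2 \<le> (1 + C)\<^sup>2" for l using om[of l] lam(2)[of l] by (intro power_mono) auto
  define X where "X l = \<omega> l *\<^sub>R (v l \<odot> (v l)\<^sup>\<star>)" for l
  note fv = frame_sum[OF q(2) v(3)]
  have pv: "prj (v l \<odot> (v l)\<^sup>\<star>)" for l using fv(1) by (simp add: orth_prjs_def)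
  have Xsa: "(X l)\<^sup>\<star> = X l" for l by (simp add: X_def)
  have Xo: "(X i)\<^sup>\<star> \<odot> X j = 0" if "i \<noteq> j" for i j
    unfolding Xsa using fv(1) that by (simp add: X_def op_scale orth_prjs_def)
  have Xb: "(\<Sum>i\<in>F. nsq (X i) x) \<le> (1 + C)\<^sup>2 * (norm x)\<^sup>2" if "finite F" for F x
  proof -
    have "(\<Sum>i\<in>F. nsq (X i) x) =
      (\<Sum>i\<in>F. (\<omega> i)\<^sup>2 * nsq (v i \<odot> (v i)\<^sup>\<star>) x)"
      by (simp add: X_def blinfun.scaleR_left power_mult_distrib del: blinfun_apply_blinfun_compose)
    also have "\<dots> \<le> (\<Sum>i\<in>F. (1 + C)\<^sup>2 * nsq (v i \<odot> (v i)\<^sup>\<star>) x)"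
      by (intro sum_mono mult_right_mono omC) simp
    also have "\<dots> = (1 + C)\<^sup>2 * (\<Sum>i\<in>F. nsq (v i \<odot> (v i)\<^sup>\<star>) x)" by (rule sum_distrib_left[symmetric])
    also have "\<dots> \<le> (1 + C)\<^sup>2 * (norm x)\<^sup>2" by (intro mult_left_mono bessel[OF that orth_prjs_subset[OF fv(1)]]) auto
    finally show ?thesis .
  qed
  define S where "S = opsum X UNIV"
  have hsS: "((\<lambda>l. ap (X l) x) has_sum ap S x) UNIV" for x
    unfolding S_def by (rule opsum(1)[OF Xo Xb])
  have SM: "S \<in> M" by (rule M_has_sum[OF hsS]) (use v(1) in \<open>auto simp: X_def\<close>)
  have Ssa: "S\<^sup>\<star> = S" by (rule radj_has_sum[OF hsS]) (simp add: Xsa hsS)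
  have qS: "((\<lambda>l. \<omega> l * nsq ((v l)\<^sup>\<star>) x) has_sum qf S x) UNIV" for x
  proof -
    have "((\<lambda>l. qf (X l) x) has_sum qf S x) UNIV"
      by (rule has_sum_bounded_linear[OF bounded_linear_inner_left hsS])
    moreover have "qf (X l) x = \<omega> l * nsq ((v l)\<^sup>\<star>) x" for l
      unfolding norm_sq_radj by (simp add: X_def blinfun.scaleR_left)
    ultimately show ?thesis by simp
  qed
  define T where "T = A \<odot> Z - S"
  have TM: "T \<in> M" using A Z SM by (auto simp: T_def)
  have pAZ: "pos (A \<odot> Z)" by (rule pos_comp_prj[OF A(2) Z(2,3)])
  have Tq: "qf T x = qf (A \<odot> Z) x - qf S x" for x
    by (simp add: T_def blinfun.diff_left inner_expand)
  have pT: "pos T"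
    unfolding pos_def
  proof (intro conjI allI)
    show "T\<^sup>\<star> = T" using pos_sa[OF pAZ] Ssa unfolding T_def radj_diff by simp
    fix x
    have "qf S x \<le> qf (A \<odot> Z) x"
    proof (rule has_sum_le_finite_sums[OF qS])
      fix F :: "nat set" assume F: "finite F"
      have "(\<Sum>l\<in>F. \<omega> l * nsq ((v l)\<^sup>\<star>) x) \<le> (\<Sum>l\<in>F. (1 + lam l) * nsq ((v l)\<^sup>\<star>) x)"
        by (intro sum_mono mult_right_mono om) simp
      also have "\<dots> \<le> qf (A \<odot> Z) x" by (rule bnd[OF F])
      finally show "(\<Sum>l\<in>F. \<omega> l * nsq ((v l)\<^sup>\<star>) x) \<le> qf (A \<odot> Z) x" .
    qed
    then show "0 \<le> qf T x" by (simp add: Tq)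
  qed
  have "norm T \<le> norm A"
  proof (rule pos_norm_bound[OF pT])
    fix x
    have "0 \<le> qf S x" by (rule has_sum_nonneg[OF qS]) (use om in simp)
    then have "qf T x \<le> qf A (ap Z x)"
      unfolding Tq inner_conj_prj[OF Z(2) Z(3)[symmetric]] by simp
    also have "\<dots> \<le> norm A * nsq Z x" by (rule inner_le_norm_op)
    also have "\<dots> \<le> norm A * (norm x)\<^sup>2" by (intro mult_left_mono prj_norm_le[OF Z(2)]) simp
    finally show "qf T x \<le> norm A * (norm x)\<^sup>2" .
  qed simp
  then have r0: "norm T \<le> r 0" using r(1) by simp
  obtain E where E: "\<And>k. prj (E k)" "\<And>k U. U \<odot> T = T \<odot> U \<Longrightarrow> U \<odot> E k = E k \<odot> U"
    "\<And>k W. W \<odot> T = 0 \<Longrightarrow> W\<^sup>\<star> = W \<Longrightarrow> W \<odot> E k = 0"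
    "\<And>x. ((\<lambda>k. a k * qf (E k) x) has_sum qf T x) UNIV"
    by (rule greedy_decomposition[OF pT a(1) r0 r(2,3)]) (rule that)
  have "(\<one> - Z) \<odot> T = 0"
  proof -
    have "(\<one> - Z) \<odot> S = 0"
    proof (rule op_sum_eq_zero[OF hsS])
      show "(\<one> - Z) \<odot> X l = 0" for l
        unfolding X_def op_scale by (simp add: op_distrib comp_subst[OF v(2)])
    qed
    moreover have "(\<one> - Z) \<odot> (A \<odot> Z) = 0"
      using comp_subst[OF Z(3), of Z] prj_idem[OF Z(2)] by (simp add: op_distrib op_assoc)
    ultimately show ?thesis by (simp add: T_def op_distrib(4))
  qed
  then have "(\<one> - Z) \<odot> E k = 0" for k by (rule E(3)) (simp add: prj_sa[OF Z(2)])
  then have ZE: "Z \<odot> E k = E k" for k by (simp add: op_distrib)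
  define s where "s c x = (\<Sum>l=b c..<b (Suc c). \<omega> l * nsq ((v l)\<^sup>\<star>) x)" for c x
  have hs: "((\<lambda>c. s c x) has_sum qf S x) UNIV" for x
  proof (rule has_sum_partition[OF qS, where c=blk])
    fix c
    have "{l. blk l = c} = {b c..<b (Suc c)}" using blk by auto
    then show "((\<lambda>l. \<omega> l * nsq ((v l)\<^sup>\<star>) x) has_sum s c x) {l. blk l = c}"
      by (simp add: s_def)
  qed
  define \<beta> where "\<beta> x = infsum (\<lambda>c. s c x) {c. even c}" for x
  define \<gamma> where "\<gamma> x = infsum (\<lambda>c. s c x) {c. odd c}" for x
  have be: "((\<lambda>c. s c x) has_sum \<beta> x) {c. even c}" and ga: "((\<lambda>c. s c x) has_sum \<gamma> x) {c. odd c}" for x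
    unfolding \<beta>_def \<gamma>_def by (intro has_sum_infsum summable_on_subset_banach[OF has_sum_imp_summable[OF hs]]; simp)+
  have bg: "\<beta> x + \<gamma> x = qf S x" for x
  proof -
    have "((\<lambda>c. s c x) has_sum (\<beta> x + \<gamma> x)) ({c. even c} \<union> {c. odd c})"
      by (rule has_sum_Un_disjoint[OF be ga]) auto
    moreover have "{c. even c} \<union> {c. odd c} = (UNIV :: nat set)" by auto
    ultimately show ?thesis using hs[of x] has_sum_unique by metis
  qed
  define g where "g k i = b (2 * prod_encode (k, i))" for k i
  define L where "L k i = {b (Suc (2 * prod_encode (k, i)))..<b (Suc (Suc (2 * prod_encode (k, i))))}" for k i
  have blkg: "blk (g k i) = 2 * prod_encode (k, i)" for k i
    using b(2) by (simp add: blk g_def strict_mono_less)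
  have blkL: "blk l = Suc (2 * prod_encode (k, i))" if "l \<in> L k i" for k i l using that by (simp add: blk L_def)
  show thesis
  proof (rule that[of v L g \<mu> E "\<lambda>x. qf T x" \<beta> \<gamma>])
    show "v i \<in> M" "Z \<odot> v i = v i" "frame q UNIV v" for i by (rule v)+
    show "finite (L k i)" for k i by (simp add: L_def)
    show "L k i \<inter> L k' i' = {}" if "(k, i) \<noteq> (k', i')" for k i k' i'
    proof -
      have "prod_encode (k, i) \<noteq> prod_encode (k', i')" using that by (simp add: prod_encode_eq)
      then show ?thesis using blkL[of _ k i] blkL[of _ k' i'] by fastforce
    qed
    show "(k, i) = (k', i')" if "g k i = g k' i'" for k i k' i'
    proof -
      have "2 * prod_encode (k, i) = blk (g k' i')" unfolding that[symmetric] by (rule blkg[symmetric])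
      then have "prod_encode (k, i) = prod_encode (k', i')" unfolding blkg by linarith
      then show ?thesis by (rule prod_encode_eq[THEN iffD1])
    qed
    show "g k i \<notin> L k' i'" for k i k' i'
    proof
      assume "g k i \<in> L k' i'"
      then have "Suc (2 * prod_encode (k', i')) = 2 * prod_encode (k, i)" using blkL blkg by metis
      then show False by presburger
    qed
    show "0 \<le> \<mu> l" for l by (rule mu0)
    show "(\<Sum>l\<in>L k i. \<mu> l) = 1 - a k" for k i
    proof -
      let ?c = "Suc (2 * prod_encode (k, i))"
      have "(\<Sum>l\<in>L k i. \<mu> l) = (\<Sum>l\<in>L k i. lam l * ((1 - a k) / Lam ?c))"
        using blkL[of _ k i] by (intro sum.cong) (auto simp: \<mu>_def \<kappa>_def)
      also have "\<dots> = Lam ?c * ((1 - a k) / Lam ?c)" unfolding L_def Lam_def by (rule sum_distrib_right[symmetric])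
      finally show ?thesis using Lam[of ?c] by simp
    qed
    show "E k \<in> M" for k by (rule M_commute[OF TM]) (rule E(2))
    show "prj (E k)" "Z \<odot> E k = E k" for k by (rule E(1), rule ZE)
    show "((\<lambda>k. a k * qf (E k) x) has_sum qf T x) UNIV" for x by (rule E(4))
    fix x
    have "bij_betw (\<lambda>p. 2 * prod_encode p) (UNIV :: (nat \<times> nat) set) {c. even c}"
    proof (rule bij_betwI')
      fix c :: nat assume "c \<in> {c. even c}"
      then show "\<exists>p\<in>UNIV. c = 2 * prod_encode p" by (intro bexI[of _ "prod_decode (c div 2)"]) auto
    qed (auto simp: prod_encode_eq)
    from has_sum_reindex_bij_betw[OF this, of "\<lambda>c. s c x" "\<beta> x"]
    have "((\<lambda>p. s (2 * prod_encode p) x) has_sum \<beta> x) UNIV" using be by simp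
    moreover have "s (2 * prod_encode (k, i)) x = a k * nsq ((v (g k i))\<^sup>\<star>) x" for k i
    proof -
      let ?c = "2 * prod_encode (k, i)"
      have "s ?c x = (\<Sum>l=b ?c..<b (Suc ?c). if l = g k i then a k * nsq ((v l)\<^sup>\<star>) x else 0)"
        unfolding s_def
      proof (rule sum.cong)
        fix l assume "l \<in> {b ?c..<b (Suc ?c)}"
        then have bl: "blk l = ?c" by (simp add: blk)
        show "\<omega> l * nsq ((v l)\<^sup>\<star>) x = (if l = g k i then a k * nsq ((v l)\<^sup>\<star>) x else 0)"
          unfolding \<omega>_def g_def \<kappa>_def bl by simp
      qed simp
      also have "\<dots> = a k * nsq ((v (g k i))\<^sup>\<star>) x"
        using b(2) by (simp add: g_def strict_mono_less)
      finally show ?thesis .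
    qed
    ultimately show "((\<lambda>(k, i). a k * nsq ((v (g k i))\<^sup>\<star>) x) has_sum \<beta> x) UNIV"
      by (auto elim!: has_sum_cong[THEN iffD1, rotated])
    have "bij_betw (\<lambda>p. Suc (2 * prod_encode p)) (UNIV :: (nat \<times> nat) set) {c. odd c}"
    proof (rule bij_betwI')
      fix c :: nat assume "c \<in> {c. odd c}"
      then show "\<exists>p\<in>UNIV. c = Suc (2 * prod_encode p)" by (intro bexI[of _ "prod_decode (c div 2)"]) auto
    qed (auto simp: prod_encode_eq)
    from has_sum_reindex_bij_betw[OF this, of "\<lambda>c. s c x" "\<gamma> x"]
    have "((\<lambda>p. s (Suc (2 * prod_encode p)) x) has_sum \<gamma> x) UNIV" using ga by simp
    moreover have "s (Suc (2 * prod_encode (k, i))) x = (\<Sum>l\<in>L k i. (1 + \<mu> l) * nsq ((v l)\<^sup>\<star>) x)" for k i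
      unfolding s_def L_def[symmetric] using blkL by (intro sum.cong) (auto simp: \<omega>_def)
    ultimately show "((\<lambda>(k, i). \<Sum>l\<in>L k i. (1 + \<mu> l) * nsq ((v l)\<^sup>\<star>) x) has_sum \<gamma> x) UNIV"
      by (auto elim!: has_sum_cong[THEN iffD1, rotated])
    show "qf T x + \<beta> x + \<gamma> x = qf (A \<odot> Z) x"
      using bg[of x] by (simp add: Tq)
  qed
qed

end

section \<open>Redistribution by rotations\<close>

lemma rotation_norm:
  fixes p y :: "'a::real_inner"
  assumes "c\<^sup>2 + s\<^sup>2 = (1::real)"
  shows "(norm (c *\<^sub>R p + s *\<^sub>R y))\<^sup>2 + (norm (c *\<^sub>R y - s *\<^sub>R p))\<^sup>2 = (norm p)\<^sup>2 + (norm y)\<^sup>2"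
proof -
  have "(norm (c *\<^sub>R p + s *\<^sub>R y))\<^sup>2 + (norm (c *\<^sub>R y - s *\<^sub>R p))\<^sup>2 =
    (c\<^sup>2 + s\<^sup>2) * inner p p + (c\<^sup>2 + s\<^sup>2) * inner y y"
    unfolding power2_norm_eq_inner inner_expand inner_scaleR_left inner_scaleR_right inner_commute[of y p]
    by (simp only: power2_eq_square) algebra
  then show ?thesis using assms by (simp add: power2_norm_eq_inner)
qed

context semifinite_factor
begin

text \<open>One step rotates \<open>r q \<oplus> (1 + \<mu>) q\<close> into a matrix with diagonal \<open>(q, (r + \<mu>) q)\<close>; the excesses
  \<open>\<mu>\<close> add up to exactly the deficiency \<open>1 - r\<close>, so that the last remainder is \<open>q\<close> again.
  (For \<open>r = 1 + \<mu>\<close> the division by zero yields the trivial rotation.)\<close>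

lemma rotation_chain:
  fixes v :: "'i \<Rightarrow> 'a operator"
  assumes "finite L" and q: "prj q"
    and "u \<in> M" "u\<^sup>\<star> \<odot> u = r *\<^sub>R q" "0 \<le> r" "r \<le> 1" "frame q L v" "\<And>l. l \<in> L \<Longrightarrow> v l \<in> M"
    "\<And>l. l \<in> L \<Longrightarrow> u\<^sup>\<star> \<odot> v l = 0" "\<And>l. l \<in> L \<Longrightarrow> 0 \<le> \<mu> l" "r + (\<Sum>l\<in>L. \<mu> l) = 1"
  shows "\<exists>es. es \<noteq> [] \<and> (\<forall>e\<in>set es. e \<in> M \<and> e\<^sup>\<star> \<odot> e = q \<and>
      (\<forall>T. T \<odot> u = 0 \<longrightarrow> (\<forall>l\<in>L. T \<odot> v l = 0) \<longrightarrow> T \<odot> e = 0)) \<and>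
    (\<forall>x. (\<Sum>e\<leftarrow>es. nsq (e\<^sup>\<star>) x) =
      nsq (u\<^sup>\<star>) x + (\<Sum>l\<in>L. (1 + \<mu> l) * nsq ((v l)\<^sup>\<star>) x))"
  using assms(1,3-)
proof (induction L arbitrary: u r rule: finite_induct)
  case empty
  then show ?case by (intro exI[of _ "[u]"]) auto
next
  case (insert l L)
  define m where "m = 1 + \<mu> l"
  have m: "m \<ge> 1" using insert.prems by (simp add: m_def)
  \<comment> \<open>The squared sine of the angle that makes the first diagonal entry
    \<open>r + S * (m - r)\<close> equal to one; invariance of the matrix trace leaves
    \<open>r + \<mu> l\<close> for the second.\<close>
  define S where "S = (1 - r) / (m - r)"
  have S: "0 \<le> S" "S \<le> 1" "r + S * (m - r) = 1"
  proof -
    have r: "r \<le> 1" by (rule insert.prems(4))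
    show "0 \<le> S" "S \<le> 1" using r m by (auto simp: S_def divide_le_eq)
    show "r + S * (m - r) = 1" using r m by (cases "m = r") (auto simp: S_def)
  qed
  define s where "s = sqrt S"
  define c where "c = sqrt (1 - S)"
  have sc: "s * s = S" "c * c = 1 - S" "c\<^sup>2 + s\<^sup>2 = 1" using S by (auto simp: s_def c_def)
  define w where "w = sqrt m *\<^sub>R v l"
  have vl: "(v l)\<^sup>\<star> \<odot> v l = q" using insert.prems(5) by (simp add: frame_def)
  have ww: "w\<^sup>\<star> \<odot> w = m *\<^sub>R q" using m by (simp add: w_def op_scale vl)
  have uw: "u\<^sup>\<star> \<odot> w = 0" using insert.prems(7) by (simp add: w_def op_scale)
  then have wu: "w\<^sup>\<star> \<odot> u = 0" by (rule comp_radj_zero)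
  define X where "X = c *\<^sub>R u + s *\<^sub>R w"
  define Y where "Y = c *\<^sub>R w - s *\<^sub>R u"
  have XM: "X \<in> M" "Y \<in> M" using insert.prems(1,6) by (auto simp: X_def Y_def w_def)
  have XX: "X\<^sup>\<star> \<odot> X = q"
  proof -
    have "X\<^sup>\<star> \<odot> X = ((c * c) * r + (s * s) * m) *\<^sub>R q"
      by (simp add: X_def op_distrib op_scale insert.prems(2) ww uw wu scaleR_add_left mult.assoc)
    also have "(c * c) * r + (s * s) * m = 1" using S(3) unfolding sc by (simp add: algebra_simps)
    finally show ?thesis by simp
  qed
  have YY: "Y\<^sup>\<star> \<odot> Y = (r + \<mu> l) *\<^sub>R q"
  proof -
    have "Y\<^sup>\<star> \<odot> Y = ((c * c) * m + (s * s) * r) *\<^sub>R q"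
      by (simp add: Y_def op_distrib op_scale insert.prems(2) ww uw wu scaleR_add_left mult.assoc)
    also have "(c * c) * m + (s * s) * r = r + \<mu> l" using S(3) unfolding sc by (simp add: algebra_simps m_def)
    finally show ?thesis .
  qed
  have sum: "r + \<mu> l + (\<Sum>l\<in>L. \<mu> l) = 1" using insert.prems(9) insert.hyps by simp
  have nn: "0 \<le> (\<Sum>l\<in>L. \<mu> l)" using insert.prems(8) by (intro sum_nonneg) auto
  have Yv: "Y\<^sup>\<star> \<odot> v k = 0" if "k \<in> L" for k
  proof -
    have "(v l)\<^sup>\<star> \<odot> v k = 0" using insert.prems(5) insert.hyps that by (auto simp: frame_def)
    then show ?thesis using insert.prems(7)[of k] that by (simp add: Y_def w_def op_distrib op_scale)
  qed
  obtain es where es: "es \<noteq> []" "\<forall>e\<in>set es. e \<in> M \<and> e\<^sup>\<star> \<odot> e = q \<and>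
      (\<forall>T. T \<odot> Y = 0 \<longrightarrow> (\<forall>l\<in>L. T \<odot> v l = 0) \<longrightarrow> T \<odot> e = 0)"
    "\<forall>x. (\<Sum>e\<leftarrow>es. nsq (e\<^sup>\<star>) x) =
      nsq (Y\<^sup>\<star>) x + (\<Sum>l\<in>L. (1 + \<mu> l) * nsq ((v l)\<^sup>\<star>) x)"
    using insert.IH[of Y "r + \<mu> l", OF XM(2) YY _ _ frame_subset[OF insert.prems(5)] insert.prems(6) Yv insert.prems(8) sum]
      insert.prems(3) insert.prems(8)[of l] nn sum by auto
  have T: "T \<odot> X = 0 \<and> T \<odot> Y = 0" if "T \<odot> u = 0" "T \<odot> v l = 0" for T
    using that by (simp add: X_def Y_def w_def op_distrib op_scale)
  have quad: "nsq (X\<^sup>\<star>) x + nsq (Y\<^sup>\<star>) x =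
    nsq (u\<^sup>\<star>) x + (1 + \<mu> l) * nsq ((v l)\<^sup>\<star>) x" for x
    using rotation_norm[OF sc(3), of "ap (u\<^sup>\<star>) x" "ap (w\<^sup>\<star>) x"] m
    by (simp add: X_def Y_def w_def apply_simps power_mult_distrib m_def)
  show ?case
  proof (intro exI[of _ "X # es"] conjI ballI allI impI)
    show "e \<in> M" "e\<^sup>\<star> \<odot> e = q" if "e \<in> set (X # es)" for e using that es(2) XM XX by auto
    show "T \<odot> e = 0" if "e \<in> set (X # es)" "T \<odot> u = 0" "\<forall>k\<in>insert l L. T \<odot> v k = 0" for e T
      using that es(2) T[of T] by auto
    show "(\<Sum>e\<leftarrow>X # es. nsq (e\<^sup>\<star>) x) = nsq (u\<^sup>\<star>) x +
      (\<Sum>k\<in>insert l L. (1 + \<mu> k) * nsq ((v k)\<^sup>\<star>) x)" for x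
      using es(3) quad[of x] insert.hyps by simp
  qed simp
qed

text \<open>The copies of \<open>q\<close> obtained from different \<open>i\<close> are orthogonal. They are coloured in such a
  way that each colour occurs at most once for every \<open>i\<close>, but infinitely often altogether; then
  every colour class adds up to an infinite projection.\<close>

lemma group_bsum:
  fixes u v :: "nat \<Rightarrow> 'a operator"
  assumes B: "B \<in> M" "pos B" "B \<noteq> 0" "norm B \<le> 1" and q: "q \<in> M" "prj q" "q \<noteq> 0"
    and u: "frame q UNIV u" "\<And>i. u i \<in> M" and L: "\<And>i. finite (L i)" "\<And>i j. i \<noteq> j \<Longrightarrow> L i \<inter> L j = {}"
    and v: "frame q UNIV v" "\<And>l. v l \<in> M" and uv: "\<And>i j l. l \<in> L j \<Longrightarrow> (u i)\<^sup>\<star> \<odot> v l = 0"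
    and a: "0 \<le> a" "a \<le> 1" and mu: "\<And>l. 0 \<le> \<mu> l" "\<And>i. (\<Sum>l\<in>L i. \<mu> l) = 1 - a"
    and Q: "\<And>x. ((\<lambda>i. a * nsq ((u i)\<^sup>\<star>) x +
      (\<Sum>l\<in>L i. (1 + \<mu> l) * nsq ((v l)\<^sup>\<star>) x)) has_sum Q x) UNIV"
  shows "bsum B Q"
proof -
  have "\<exists>es. es \<noteq> [] \<and> (\<forall>e\<in>set es. e \<in> M \<and> e\<^sup>\<star> \<odot> e = q \<and>
      (\<forall>T. T \<odot> u i = 0 \<longrightarrow> (\<forall>l\<in>L i. T \<odot> v l = 0) \<longrightarrow> T \<odot> e = 0)) \<and>
    (\<forall>x. (\<Sum>e\<leftarrow>es. nsq (e\<^sup>\<star>) x) =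
      a * nsq ((u i)\<^sup>\<star>) x + (\<Sum>l\<in>L i. (1 + \<mu> l) * nsq ((v l)\<^sup>\<star>) x))" for i
  proof -
    have 1: "(sqrt a *\<^sub>R u i)\<^sup>\<star> \<odot> (sqrt a *\<^sub>R u i) = a *\<^sub>R q"
      using u(1) a by (simp add: op_scale frame_def)
    have 2: "(sqrt a *\<^sub>R u i)\<^sup>\<star> \<odot> v l = 0" if "l \<in> L i" for l using uv[OF that] by (simp add: op_scale)
    have 3: "a + (\<Sum>l\<in>L i. \<mu> l) = 1" using mu(2)[of i] by simp
    obtain es where es: "es \<noteq> []" "\<forall>e\<in>set es. e \<in> M \<and> e\<^sup>\<star> \<odot> e = q \<and>
        (\<forall>T. T \<odot> (sqrt a *\<^sub>R u i) = 0 \<longrightarrow> (\<forall>l\<in>L i. T \<odot> v l = 0) \<longrightarrow> T \<odot> e = 0)"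
      "\<forall>x. (\<Sum>e\<leftarrow>es. nsq (e\<^sup>\<star>) x) = nsq ((sqrt a *\<^sub>R u i)\<^sup>\<star>) x +
        (\<Sum>l\<in>L i. (1 + \<mu> l) * nsq ((v l)\<^sup>\<star>) x)"
      using rotation_chain[OF L(1) q(2) M_scaleR[OF u(2)] 1 a frame_subset[OF v(1)] v(2) 2 mu(1) 3] by auto
    have "T \<odot> (sqrt a *\<^sub>R u i) = 0" if "T \<odot> u i = 0" for T using that by (simp add: op_scale)
    moreover have "nsq ((sqrt a *\<^sub>R u i)\<^sup>\<star>) x = a * nsq ((u i)\<^sup>\<star>) x" for x
      using a(1) by (simp add: blinfun.scaleR_left power_mult_distrib)
    ultimately show ?thesis using es by (intro exI[of _ es]) auto
  qed
  then have "\<forall>i. \<exists>es. es \<noteq> [] \<and> (\<forall>e\<in>set es. e \<in> M \<and> e\<^sup>\<star> \<odot> e = q \<and>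
      (\<forall>T. T \<odot> u i = 0 \<longrightarrow> (\<forall>l\<in>L i. T \<odot> v l = 0) \<longrightarrow> T \<odot> e = 0)) \<and>
    (\<forall>x. (\<Sum>e\<leftarrow>es. nsq (e\<^sup>\<star>) x) =
      a * nsq ((u i)\<^sup>\<star>) x + (\<Sum>l\<in>L i. (1 + \<mu> l) * nsq ((v l)\<^sup>\<star>) x))"
    by (rule allI)
  from choice[OF this] obtain es where es: "\<And>i. es i \<noteq> []" "\<And>i e. e \<in> set (es i) \<Longrightarrow> e \<in> M" "\<And>i e. e \<in> set (es i) \<Longrightarrow> e\<^sup>\<star> \<odot> e = q"
    "\<And>i e T. e \<in> set (es i) \<Longrightarrow> T \<odot> u i = 0 \<Longrightarrow> (\<And>l. l \<in> L i \<Longrightarrow> T \<odot> v l = 0) \<Longrightarrow> T \<odot> e = 0"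
    "\<And>i x. (\<Sum>e\<leftarrow>es i. nsq (e\<^sup>\<star>) x) =
      a * nsq ((u i)\<^sup>\<star>) x + (\<Sum>l\<in>L i. (1 + \<mu> l) * nsq ((v l)\<^sup>\<star>) x)"
    by (elim exE) blast
  define e where "e p = es (fst p) ! snd p" for p :: "nat \<times> nat"
  define K where "K = Sigma UNIV (\<lambda>i. {..<length (es i)})"
  have eK: "e p \<in> set (es (fst p))" if "p \<in> K" for p using that by (auto simp: K_def e_def)
  have orth: "(e p)\<^sup>\<star> \<odot> e p' = 0" if p: "p \<in> K" "p' \<in> K" "fst p \<noteq> fst p'" for p p'
  proof (rule es(4)[OF eK[OF p(2)]])
    have "(u (fst p'))\<^sup>\<star> \<odot> e p = 0"
    proof (rule es(4)[OF eK[OF p(1)]])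
      show "(u (fst p'))\<^sup>\<star> \<odot> u (fst p) = 0" using u(1) p(3) by (simp add: frame_def)
    qed (rule uv)
    then show "(e p)\<^sup>\<star> \<odot> u (fst p') = 0" by (rule comp_radj_zero)
    fix l assume l: "l \<in> L (fst p')"
    have "(v l)\<^sup>\<star> \<odot> e p = 0"
    proof (rule es(4)[OF eK[OF p(1)]])
      show "(v l)\<^sup>\<star> \<odot> u (fst p) = 0" by (rule comp_radj_zero[OF uv[OF l]])
      fix k assume "k \<in> L (fst p)"
      then have "l \<noteq> k" using L(2)[OF p(3)] l by blast
      then show "(v l)\<^sup>\<star> \<odot> v k = 0" using v(1) by (simp add: frame_def)
    qed
    then show "(e p)\<^sup>\<star> \<odot> v l = 0" by (rule comp_radj_zero)
  qed
  \<comment> \<open>Members of one list differ in \<open>snd p\<close>, hence in colour; the first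
    members alone already realize every colour infinitely often.\<close>
  define c where "c p = fst (prod_decode (fst p)) + snd p" for p :: "nat \<times> nat"
  define J where "J n = {p \<in> K. c p = n}" for n
  have fJ: "frame q (J n) e" for n
    unfolding frame_def
  proof (intro ballI)
    fix p p' assume pp: "p \<in> J n" "p' \<in> J n"
    then have K: "p \<in> K" "p' \<in> K" and c: "c p = c p'" by (auto simp: J_def)
    show "(e p)\<^sup>\<star> \<odot> e p' = (if p = p' then q else 0)"
    proof (cases "fst p = fst p'")
      case True
      then have "p = p'" using c by (simp add: c_def prod_eq_iff)
      then show ?thesis using es(3)[OF eK[OF K(1)]] by simp
    qed (use orth[OF K] in auto)
  qed
  have infJ: "infinite (J n)" for n
  proof -
    have "(\<lambda>i. (prod_encode (n, i), 0)) ` UNIV \<subseteq> J n" using es(1) by (auto simp: J_def K_def c_def)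
    moreover have "infinite ((\<lambda>i::nat. (prod_encode (n, i), 0::nat)) ` UNIV)"
      by (rule range_inj_infinite) (simp add: inj_on_def)
    ultimately show ?thesis using finite_subset by blast
  qed
  have eM: "e p \<in> M" if "p \<in> J n" for p n using es(2)[OF eK] that by (auto simp: J_def)
  define F where "F n = opsum (\<lambda>p. e p \<odot> (e p)\<^sup>\<star>) (J n)" for n
  have F: "F n \<in> M" "prj (F n)" "\<tau> (F n) = \<infinity>" for n
    unfolding F_def
    by (rule M_frame[OF q(2) fJ eM], assumption, rule frame_sum(3)[OF q(2) fJ],
      rule tr_frame_infinite[OF infJ q(2,1,3) fJ eM], assumption)
  show ?thesis
  proof (rule bsum_family)
    show "bsum B (\<lambda>x. qf (F n) x)" for n by (rule projection_bsum[OF B F])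
    fix x
    have "((\<lambda>p. nsq ((e p)\<^sup>\<star>) x) has_sum Q x) K"
      unfolding K_def
    proof (rule has_sum_Sigma_nonneg[OF _ _ Q])
      fix i :: nat
      have "(\<Sum>j<length (es i). nsq ((e (i, j))\<^sup>\<star>) x) = (\<Sum>e\<leftarrow>es i. nsq (e\<^sup>\<star>) x)"
        by (simp add: e_def sum_list_sum_nth atLeast0LessThan)
      then show "((\<lambda>j. nsq ((e (i, j))\<^sup>\<star>) x) has_sum
        a * nsq ((u i)\<^sup>\<star>) x + (\<Sum>l\<in>L i. (1 + \<mu> l) * nsq ((v l)\<^sup>\<star>) x)) {..<length (es i)}"
        using es(5)[of x i] by (intro has_sum_finiteI) auto
    qed simp
    then show "((\<lambda>n. qf (F n) x) has_sum Q x) UNIV"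
    proof (rule has_sum_partition_on[where c=c])
      show "((\<lambda>p. nsq ((e p)\<^sup>\<star>) x) has_sum qf (F n) x) {p \<in> K. c p = n}" for n
        using frame_sum(5)[OF q(2) fJ[of n], of x] by (simp add: F_def J_def)
    qed
  qed
qed


text \<open>The deficient projections \<open>E k\<close> lie under \<open>Y\<close> and the copies
  \<open>v\<close> under \<open>Y'\<close>, which makes them orthogonal for free. The infinite sum
  \<open>R k = E k + G k\<close> is repacked into copies of \<open>q\<close> of weight
  \<open>a k\<close>, and the \<open>i\<close>-th of them receives the excess of
  \<open>L k i\<close>.\<close>

lemma cross_bsum:
  fixes Y Y' :: "'a operator" and v :: "nat \<Rightarrow> 'a operator" and E :: "nat \<Rightarrow> 'a operator"
    and L :: "nat \<Rightarrow> nat \<Rightarrow> nat set" and g :: "nat \<Rightarrow> nat \<Rightarrow> nat" and \<mu> :: "nat \<Rightarrow> real"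
    and \<alpha> \<beta> \<gamma> :: "'a \<Rightarrow> real" and a :: "nat \<Rightarrow> real"
  assumes B: "B \<in> M" "pos B" "B \<noteq> 0" "norm B \<le> 1"
    and q: "q \<in> M" "prj q" "q \<noteq> 0" "\<tau> q < \<infinity>" and a: "\<And>k. 0 < a k" "\<And>k. a k < 1"
    and Y: "Y \<odot> Y' = 0" "prj Y"
    and E: "\<And>k. E k \<in> M" "\<And>k. prj (E k)" "\<And>k. Y \<odot> E k = E k"
    and al: "\<And>x. ((\<lambda>k. a k * qf (E k) x) has_sum \<alpha> x) UNIV"
    and v: "\<And>i. v i \<in> M" "\<And>i. Y' \<odot> v i = v i" "frame q UNIV v"
    and L: "\<And>k i. finite (L k i)" "\<And>k i k' i'. (k, i) \<noteq> (k', i') \<Longrightarrow> L k i \<inter> L k' i' = {}"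
    and g: "\<And>k i k' i'. g k i = g k' i' \<Longrightarrow> (k, i) = (k', i')" "\<And>k i k' i'. g k i \<notin> L k' i'"
    and mu: "\<And>l. 0 \<le> \<mu> l" "\<And>k i. (\<Sum>l\<in>L k i. \<mu> l) = 1 - a k"
    and be: "\<And>x. ((\<lambda>(k, i). a k * nsq ((v (g k i))\<^sup>\<star>) x) has_sum \<beta> x) UNIV"
    and ga: "\<And>x. ((\<lambda>(k, i). \<Sum>l\<in>L k i. (1 + \<mu> l) * nsq ((v l)\<^sup>\<star>) x) has_sum \<gamma> x) UNIV"
  shows "bsum B (\<lambda>x. \<alpha> x + \<beta> x + \<gamma> x)"
proof -
  have fg: "frame q UNIV (\<lambda>i. v (g k i))" for k by (rule frame_reindex[OF v(3)]) (auto simp: inj_on_def dest: g(1))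
  define G where "G k = opsum (\<lambda>i. v (g k i) \<odot> (v (g k i))\<^sup>\<star>) UNIV" for k
  have G: "G k \<in> M" "prj (G k)" for k
    unfolding G_def by (rule M_frame[OF q(2) fg v(1)], rule frame_sum(3)[OF q(2) fg])
  have Ginf: "\<tau> (G k) = \<infinity>" for k unfolding G_def by (rule tr_frame_infinite[OF _ q(2,1,3) fg v(1)]) simp
  have YG: "Y' \<odot> G k = G k" for k unfolding G_def by (rule frame_sum_fix[OF q(2) fg]) (rule v(2))
  have EG: "E k \<odot> G k = 0" for k
  proof -
    have "E k \<odot> Y = E k" by (rule prj_diff(2)[OF E(2) Y(2) E(3)])
    then have "E k \<odot> (Y' \<odot> G k) = 0"
      using comp_subst[of "E k" Y "E k" "Y' \<odot> G k"] comp_zero_left[OF Y(1), of "G k"] by simp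
    then show ?thesis by (simp add: YG)
  qed
  define R where "R k = E k + G k" for k
  have R: "R k \<in> M" "prj (R k)" for k unfolding R_def using E G EG by (auto intro: prj_add(1))
  have RG: "R k \<odot> G k = G k" for k using EG prj_idem[OF G(2)] by (simp add: R_def op_distrib)
  have "\<tau> (R k) = \<infinity>" for k using tr_prj_mono[OF G(1) R(1) G(2) R(2) RG, of k] Ginf by (simp add: top_unique)
  then have "\<exists>u :: nat \<Rightarrow> 'a operator. (\<forall>i. u i \<in> M) \<and> frame q UNIV u \<and> opsum (\<lambda>i. u i \<odot> (u i)\<^sup>\<star>) UNIV = R k" for k
    by (rule packing_any[OF q(1-3) R])
  then obtain u where u: "\<And>k i::nat. u k i \<in> M" "\<And>k. frame q UNIV (u k)" "\<And>k. opsum (\<lambda>i. u k i \<odot> (u k i)\<^sup>\<star>) UNIV = R k"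
    by metis
  have uv: "(u k i)\<^sup>\<star> \<odot> v l = 0" if l: "l \<in> L k j" for k i j l
  proof -
    have "E k \<odot> Y = E k" by (rule prj_diff(2)[OF E(2) Y(2) E(3)])
    then have "E k \<odot> (Y' \<odot> v l) = 0"
      using comp_subst[of "E k" Y "E k" "Y' \<odot> v l"] comp_zero_left[OF Y(1), of "v l"] by simp
    then have 1: "E k \<odot> v l = 0" by (simp add: v(2))
    have "(v l)\<^sup>\<star> \<odot> v (g k i) = 0" for i
    proof -
      have "l \<noteq> g k i" using l g(2) by blast
      then show ?thesis using v(3) by (simp add: frame_def)
    qed
    then have "(v l)\<^sup>\<star> \<odot> G k = 0" unfolding G_def by (rule frame_sum(6)[OF q(2) fg])
    then have 2: "G k \<odot> v l = 0" using comp_radj_zero[of "v l" "G k"] prj_sa[OF G(2)] by simp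
    have Rv: "R k \<odot> v l = 0" using 1 2 by (simp add: R_def op_distrib)
    have "R k \<odot> u k i = u k i" using frame_sum(4)[OF q(2) u(2)[of k], of i] u(3) by simp
    then have "(R k \<odot> u k i)\<^sup>\<star> = (u k i)\<^sup>\<star>" by simp
    then have "(u k i)\<^sup>\<star> \<odot> R k = (u k i)\<^sup>\<star>" using prj_sa[OF R(2)] by simp
    then show ?thesis using comp_subst[of "(u k i)\<^sup>\<star>" "R k" "(u k i)\<^sup>\<star>" "v l"] Rv by simp
  qed
  define \<delta> where "\<delta> k x = infsum (\<lambda>i. \<Sum>l\<in>L k i. (1 + \<mu> l) * nsq ((v l)\<^sup>\<star>) x) UNIV" for k x
  have hd: "((\<lambda>i. \<Sum>l\<in>L k i. (1 + \<mu> l) * nsq ((v l)\<^sup>\<star>) x) has_sum \<delta> k x) UNIV" for k x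
  proof -
    let ?f = "\<lambda>(k, i::nat). \<Sum>l\<in>L k i. (1 + \<mu> l) * nsq ((v l)\<^sup>\<star>) x"
    have "?f summable_on range (Pair k)"
      by (rule summable_on_subset_banach[OF has_sum_imp_summable[OF ga]]) simp
    then have "(?f \<circ> Pair k) summable_on UNIV" by (subst summable_on_reindex[symmetric]) (auto simp: inj_on_def)
    then show ?thesis unfolding \<delta>_def by (intro has_sum_infsum) (simp add: o_def)
  qed
  have sd: "((\<lambda>k. \<delta> k x) has_sum \<gamma> x) UNIV" for x
    by (rule has_sum_SigmaD[where B="\<lambda>_. UNIV" and f="\<lambda>(k, i). \<Sum>l\<in>L k i. (1 + \<mu> l) * nsq ((v l)\<^sup>\<star>) x"])
      (use ga hd in auto)
  have sg: "((\<lambda>k. a k * qf (G k) x) has_sum \<beta> x) UNIV" for x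
  proof (rule has_sum_SigmaD[where B="\<lambda>_. UNIV" and f="\<lambda>(k, i). a k * nsq ((v (g k i))\<^sup>\<star>) x"])
    fix k
    show "((\<lambda>y. case (k, y) of (k, i) \<Rightarrow> a k * nsq ((v (g k i))\<^sup>\<star>) x) has_sum a k * qf (G k) x) UNIV"
      using has_sum_cmult_right[OF frame_sum(5)[OF q(2) fg[of k], of x], of "a k"] by (simp add: G_def)
  qed (use be in auto)
  show ?thesis
  proof (rule bsum_family)
    fix k
    show "bsum B (\<lambda>x. a k * qf (R k) x + \<delta> k x)"
    proof (rule group_bsum[OF B q(1-3) u(2,1), where L="L k" and v=v and a="a k" and \<mu>=\<mu>])
      show "L k i \<inter> L k j = {}" if "i \<noteq> j" for i j using L(2)[of k i k j] that by simp
      show "((\<lambda>i. a k * nsq ((u k i)\<^sup>\<star>) x + (\<Sum>l\<in>L k i. (1 + \<mu> l) * nsq ((v l)\<^sup>\<star>) x)) has_sum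
        a k * qf (R k) x + \<delta> k x) UNIV" for x
        using frame_sum(5)[OF q(2) u(2)[of k], of x] u(3)[of k] by (intro has_sum_add has_sum_cmult_right hd) simp
    qed (use L v uv less_imp_le[OF a(1)] less_imp_le[OF a(2)] mu in auto)
  next
    fix x
    have "((\<lambda>k. a k * qf (E k) x + a k * qf (G k) x + \<delta> k x) has_sum \<alpha> x + \<beta> x + \<gamma> x) UNIV"
      by (intro has_sum_add al sg sd)
    moreover have "a k * qf (E k) x + a k * qf (G k) x + \<delta> k x =
      a k * qf (R k) x + \<delta> k x" for k
      by (simp add: R_def blinfun.add_left inner_expand distrib_left)
    ultimately show "((\<lambda>k. a k * qf (R k) x + \<delta> k x) has_sum \<alpha> x + \<beta> x + \<gamma> x) UNIV" by simp
  qed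
qed

text \<open>The deficient part of each half is combined with the copies and excesses of the other.
  Neither crossed sum need be the form of a half, but together they give the form of
  \<open>A\<close>.\<close>

lemma core_bsum:
  assumes A: "A \<in> M" "pos A" and P: "P \<in> M" "pos P" and N: "pos N" and AP: "A - \<one> = P - N" "P \<odot> N = 0"
    and inf: "\<tau> P = \<infinity>" and B: "B \<in> M" "pos B" "B \<noteq> 0" "norm B \<le> 1"
  shows "bsum B (\<lambda>x. qf A x)"
proof -
  have Asa: "A\<^sup>\<star> = A" by (rule pos_sa[OF A(2)])
  have "(P \<odot> N)\<^sup>\<star> = N \<odot> P" using P N by (simp add: pos_sa)
  then have NP: "N \<odot> P = 0" using AP(2) by simp
  have "A = \<one> + P - N" using AP(1) by (simp add: algebra_simps)
  then have APc: "A \<odot> P = P \<odot> A" using AP(2) NP by (simp add: op_distrib)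
  obtain Z where Z: "Z \<in> M" "prj Z" "Z \<odot> A = A \<odot> Z" "Z \<odot> P = P \<odot> Z" "\<tau> (P \<odot> Z) = \<infinity>" "\<tau> (P \<odot> (\<one> - Z)) = \<infinity>"
    using halving[OF A(1) Asa P APc inf] by blast
  define Z' where "Z' = \<one> - Z"
  have Z': "Z' \<in> M" "prj Z'" "Z' \<odot> A = A \<odot> Z'" "Z' \<odot> P = P \<odot> Z'" "\<tau> (P \<odot> Z') = \<infinity>"
    using Z by (auto simp: Z'_def prj_compl op_distrib)
  have ZZ': "Z \<odot> Z' = 0" "Z' \<odot> Z = 0" using prj_idem[OF Z(2)] by (simp_all add: Z'_def op_distrib)
  obtain q where q: "q \<in> M" "prj q" "q \<noteq> 0" "\<tau> q < \<infinity>" using finite_prj_ex by blast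
  obtain a r :: "nat \<Rightarrow> real" where ar: "\<forall>k. 0 < a k \<and> a k < 1" "norm A \<le> r 0"
    "\<forall>k. max (a k) (r k - a k) \<le> r (Suc k)" "r \<longlonglongrightarrow> 0"
    using ex_step_sizes[of "norm A"] by (elim exE conjE)
  have a: "0 < a k" "a k < 1" for k using ar(1) by auto
  have r: "max (a k) (r k - a k) \<le> r (Suc k)" for k by (rule spec[OF ar(3)])
  obtain v L g \<mu> E \<alpha> \<beta> \<gamma> where 1:
    "\<And>i::nat. v i \<in> M" "\<And>i. Z \<odot> v i = v i" "frame q UNIV v"
    "\<And>k i. finite (L k i)" "\<And>k i k' i'. (k, i) \<noteq> (k', i') \<Longrightarrow> L k i \<inter> L k' i' = {}"
    "\<And>k i k' i'. g k i = g k' i' \<Longrightarrow> (k, i) = (k', i')" "\<And>k i k' i'. g k i \<notin> L k' i'"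
    "\<And>l. 0 \<le> \<mu> l" "\<And>k i. (\<Sum>l\<in>L k i. \<mu> l) = 1 - a k"
    "\<And>k::nat. E k \<in> M" "\<And>k. prj (E k)" "\<And>k. Z \<odot> E k = E k"
    "\<And>x. ((\<lambda>k. a k * qf (E k) x) has_sum \<alpha> x) UNIV"
    "\<And>x. ((\<lambda>(k, i::nat). a k * nsq ((v (g k i))\<^sup>\<star>) x) has_sum \<beta> x) UNIV"
    "\<And>x. ((\<lambda>(k, i::nat). \<Sum>l\<in>L k i. (1 + \<mu> l) * nsq ((v l)\<^sup>\<star>) x) has_sum \<gamma> x) UNIV"
    "\<And>x. \<alpha> x + \<beta> x + \<gamma> x = qf (A \<odot> Z) x"
    by (rule half_decomposition[OF A P N AP Z(1-5) q a ar(2) r ar(4)]) (rule that)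
  obtain v' L' g' \<mu>' E' \<alpha>' \<beta>' \<gamma>' where 2:
    "\<And>i::nat. v' i \<in> M" "\<And>i. Z' \<odot> v' i = v' i" "frame q UNIV v'"
    "\<And>k i. finite (L' k i)" "\<And>k i k' i'. (k, i) \<noteq> (k', i') \<Longrightarrow> L' k i \<inter> L' k' i' = {}"
    "\<And>k i k' i'. g' k i = g' k' i' \<Longrightarrow> (k, i) = (k', i')" "\<And>k i k' i'. g' k i \<notin> L' k' i'"
    "\<And>l. 0 \<le> \<mu>' l" "\<And>k i. (\<Sum>l\<in>L' k i. \<mu>' l) = 1 - a k"
    "\<And>k::nat. E' k \<in> M" "\<And>k. prj (E' k)" "\<And>k. Z' \<odot> E' k = E' k"
    "\<And>x. ((\<lambda>k. a k * qf (E' k) x) has_sum \<alpha>' x) UNIV"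
    "\<And>x. ((\<lambda>(k, i::nat). a k * nsq ((v' (g' k i))\<^sup>\<star>) x) has_sum \<beta>' x) UNIV"
    "\<And>x. ((\<lambda>(k, i::nat). \<Sum>l\<in>L' k i. (1 + \<mu>' l) * nsq ((v' l)\<^sup>\<star>) x) has_sum \<gamma>' x) UNIV"
    "\<And>x. \<alpha>' x + \<beta>' x + \<gamma>' x = qf (A \<odot> Z') x"
    by (rule half_decomposition[OF A P N AP Z' q a ar(2) r ar(4)]) (rule that)
  have "bsum B (\<lambda>x. (\<alpha> x + \<beta>' x + \<gamma>' x) + (\<alpha>' x + \<beta> x + \<gamma> x))"
    by (rule bsum_add[OF
      cross_bsum[OF B q a ZZ'(1) Z(2) 1(10-13) 2(1-9,14,15)]
      cross_bsum[OF B q a ZZ'(2) Z'(2) 2(10-13) 1(1-9,14,15)]])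
  moreover have "(\<alpha> x + \<beta>' x + \<gamma>' x) + (\<alpha>' x + \<beta> x + \<gamma> x) = qf A x" for x
  proof -
    have "A \<odot> Z + A \<odot> Z' = A" by (simp add: Z'_def op_distrib)
    then have "qf A x = qf (A \<odot> Z) x + qf (A \<odot> Z') x"
      by (metis blinfun.add_left inner_add_left)
    then show ?thesis using 1(16)[of x] 2(16)[of x] by linarith
  qed
  ultimately show ?thesis by simp
qed

end

section \<open>Direct sums and spectral slices\<close>

context semifinite_factor
begin

text \<open>For fixed \<open>j\<close> the operators of all pieces are added over \<open>n\<close>.
  Their supports lie under the orthogonal \<open>e n\<close>, and their ranges under the orthogonal
  \<open>E n\<close> because each is dominated in form by \<open>A \<odot> E n\<close>.\<close>

lemma bsum_direct:
  assumes B: "B \<in> M" and e: "orth_prjs J e" and E: "orth_prjs J E"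
    and Be: "\<And>x. ((\<lambda>n. ap (B \<odot> e n) x) has_sum ap B x) J"
    and AE: "\<And>x. ((\<lambda>n. qf (A \<odot> E n) x) has_sum qf A x) J"
    and b: "\<And>n. n \<in> J \<Longrightarrow> bsum (B \<odot> e n) (\<lambda>x. qf (A \<odot> E n) x)"
  shows "bsum B (\<lambda>x. qf A x)"
proof -
  have pe: "prj (e n)" "prj (E n)" if "n \<in> J" for n using e E that by (auto simp: orth_prjs_def)
  have "\<forall>n\<in>J. \<exists>X :: nat \<Rightarrow> 'a operator. (\<forall>j. X j \<in> M \<and> (X j)\<^sup>\<star> \<odot> X j = B \<odot> e n) \<and>
     (\<forall>x. ((\<lambda>j. nsq ((X j)\<^sup>\<star>) x) has_sum qf (A \<odot> E n) x) UNIV)"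
    using b by (simp add: bsum_def)
  from bchoice[OF this] obtain X where
    X: "\<forall>n\<in>J. (\<forall>j::nat. X n j \<in> M \<and> (X n j)\<^sup>\<star> \<odot> X n j = B \<odot> e n) \<and>
     (\<forall>x. ((\<lambda>j. nsq ((X n j)\<^sup>\<star>) x) has_sum qf (A \<odot> E n) x) UNIV)" ..
  have XM: "X n j \<in> M" and XX: "(X n j)\<^sup>\<star> \<odot> X n j = B \<odot> e n" and
    Xs: "((\<lambda>j. nsq ((X n j)\<^sup>\<star>) x) has_sum qf (A \<odot> E n) x) UNIV"
    if "n \<in> J" for n j x using X that by auto
  have Xe: "X n j \<odot> e n = X n j" if n: "n \<in> J" for n j
  proof -
    have "(X n j)\<^sup>\<star> \<odot> (X n j \<odot> (\<one> - e n)) = B \<odot> e n \<odot> (\<one> - e n)" by (simp add: XX[OF n] flip: op_assoc)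
    also have "\<dots> = 0" using prj_idem[OF pe(1)[OF n]] by (simp add: op_distrib op_assoc)
    finally have "X n j \<odot> (\<one> - e n) = 0" using comp_eq_zero_iff by blast
    then show ?thesis by (simp add: op_distrib)
  qed
  have Xle: "nsq ((X n j)\<^sup>\<star>) x \<le> qf (A \<odot> E n) x" if n: "n \<in> J" for n j x
    using has_sum_mono2[OF has_sum_finite[of "{j}" "\<lambda>j. nsq ((X n j)\<^sup>\<star>) x"] Xs[OF n, of x]] by simp
  have XE: "(X n j)\<^sup>\<star> \<odot> E n = (X n j)\<^sup>\<star>" if n: "n \<in> J" for n j
  proof -
    have "ap ((X n j)\<^sup>\<star>) (ap (\<one> - E n) x) = 0" for x
    proof -
      have "ap (E n) (ap (\<one> - E n) x) = 0"
        using prj_idem_apply[OF pe(2)[OF n]] by (simp add: apply_simps blinfun.diff_right)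
      then show ?thesis using Xle[OF n, of j "ap (\<one> - E n) x"] by simp
    qed
    then have "(X n j)\<^sup>\<star> \<odot> (\<one> - E n) = 0" by (intro blinfun_eqI) (simp add: blinfun.zero_left)
    then show ?thesis by (simp add: op_distrib)
  qed
  have o: "(X n j)\<^sup>\<star> \<odot> X m j = 0" if "n \<in> J" "m \<in> J" "n \<noteq> m" for n m j
  proof -
    have "((X m j)\<^sup>\<star> \<odot> E m)\<^sup>\<star> = ((X m j)\<^sup>\<star>)\<^sup>\<star>" by (simp only: XE[OF that(2)])
    then have "E m \<odot> X m j = X m j" using prj_sa[OF pe(2)[OF that(2)]] by simp
    moreover have "E n \<odot> (E m \<odot> X m j) = 0" by (rule comp_zero_left) (use E that in \<open>auto simp: orth_prjs_def\<close>)
    ultimately show ?thesis using comp_subst[OF XE[OF that(1)], of j "X m j"] by simp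
  qed
  have o': "((X n j)\<^sup>\<star>)\<^sup>\<star> \<odot> (X m j)\<^sup>\<star> = 0" if "n \<in> J" "m \<in> J" "n \<noteq> m" for n m j
  proof -
    have "(X m j \<odot> e m)\<^sup>\<star> = (X m j)\<^sup>\<star>" by (simp only: Xe[OF that(2)])
    then have "e m \<odot> (X m j)\<^sup>\<star> = (X m j)\<^sup>\<star>" using prj_sa[OF pe(1)[OF that(2)]] by simp
    moreover have "e n \<odot> (e m \<odot> (X m j)\<^sup>\<star>) = 0" by (rule comp_zero_left) (use e that in \<open>auto simp: orth_prjs_def\<close>)
    ultimately show ?thesis using comp_subst[OF Xe[OF that(1)], of j "(X m j)\<^sup>\<star>"] by simp
  qed
  have bnd: "(\<Sum>n\<in>F. nsq (X n j) x) \<le> norm B * (norm x)\<^sup>2" if F: "finite F" "F \<subseteq> J" for F j x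
  proof -
    have "nsq (X n j) x \<le> norm B * nsq (e n) x" if "n \<in> F" for n
    proof -
      have n: "n \<in> J" using F that by blast
      let ?y = "ap (e n) x"
      have "ap (X n j) x = ap (X n j \<odot> e n) x" by (simp only: Xe[OF n])
      also have "\<dots> = ap (X n j) ?y" by simp
      also have "nsq (X n j) ?y = qf B ?y"
        unfolding norm_apply_sq XX[OF n] by (simp add: prj_idem_apply[OF pe(1)[OF n]])
      also have "\<dots> \<le> norm B * (norm ?y)\<^sup>2" by (rule inner_le_norm_op)
      finally show ?thesis .
    qed
    then have "(\<Sum>n\<in>F. nsq (X n j) x) \<le> norm B * (\<Sum>n\<in>F. nsq (e n) x)"
      unfolding sum_distrib_left by (rule sum_mono)
    also have "\<dots> \<le> norm B * (norm x)\<^sup>2"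
      by (intro mult_left_mono bessel[OF F(1)] orth_prjs_subset[OF e F(2)]) auto
    finally show ?thesis .
  qed
  have bnd': "(\<Sum>n\<in>F. nsq ((X n j)\<^sup>\<star>) x) \<le> norm A * (norm x)\<^sup>2" if F: "finite F" "F \<subseteq> J" for F j x
  proof -
    have "nsq ((X n j)\<^sup>\<star>) x \<le> norm A * nsq (E n) x" if "n \<in> F" for n
    proof -
      have n: "n \<in> J" using F that by blast
      let ?y = "ap (E n) x"
      have "ap ((X n j)\<^sup>\<star>) x = ap ((X n j)\<^sup>\<star> \<odot> E n) x" by (simp only: XE[OF n])
      also have "\<dots> = ap ((X n j)\<^sup>\<star>) ?y" by simp
      also have "nsq ((X n j)\<^sup>\<star>) ?y \<le> qf A ?y"
        using Xle[OF n, of j ?y] by (simp add: prj_idem_apply[OF pe(2)[OF n]])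
      also have "\<dots> \<le> norm A * (norm ?y)\<^sup>2" by (rule inner_le_norm_op)
      finally show ?thesis .
    qed
    then have "(\<Sum>n\<in>F. nsq ((X n j)\<^sup>\<star>) x) \<le> norm A * (\<Sum>n\<in>F. nsq (E n) x)"
      unfolding sum_distrib_left by (rule sum_mono)
    also have "\<dots> \<le> norm A * (norm x)\<^sup>2"
      by (intro mult_left_mono bessel[OF F(1)] orth_prjs_subset[OF E F(2)]) auto
    finally show ?thesis .
  qed
  define Y where "Y j = opsum (\<lambda>n. X n j) J" for j
  have Y: "((\<lambda>n. ap (X n j) x) has_sum ap (Y j) x) J" for j x
    unfolding Y_def by (rule opsum(1)[OF o bnd])
  have T: "((\<lambda>n. ap ((X n j)\<^sup>\<star>) x) has_sum ap (opsum (\<lambda>n. (X n j)\<^sup>\<star>) J) x) J"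
    "((\<lambda>n. nsq ((X n j)\<^sup>\<star>) x) has_sum nsq (opsum (\<lambda>n. (X n j)\<^sup>\<star>) J) x) J" for j x
    by (rule opsum(1)[where X="\<lambda>n. (X n j)\<^sup>\<star>", OF o' bnd'], assumption+)
      (rule opsum(2)[where X="\<lambda>n. (X n j)\<^sup>\<star>", OF o' bnd'], assumption+)
  have Yr: "(Y j)\<^sup>\<star> = opsum (\<lambda>n. (X n j)\<^sup>\<star>) J" for j by (rule radj_has_sum[OF Y T(1)])
  show ?thesis
    unfolding bsum_def
  proof (intro exI[of _ Y] conjI allI)
    fix j
    show "Y j \<in> M" by (rule M_has_sum[OF Y XM])
    show "(Y j)\<^sup>\<star> \<odot> Y j = B"
    proof (rule op_sum_eqI[OF has_sum_op_left[OF Y] Be])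
      fix n assume n: "n \<in> J"
      have "(X n j)\<^sup>\<star> \<odot> Y j = (X n j)\<^sup>\<star> \<odot> X n j" by (rule op_sum_pick[OF Y n]) (use o n in auto)
      then have "((X n j)\<^sup>\<star> \<odot> Y j)\<^sup>\<star> = ((X n j)\<^sup>\<star> \<odot> X n j)\<^sup>\<star>" by (simp only:)
      then have "(Y j)\<^sup>\<star> \<odot> X n j = (X n j)\<^sup>\<star> \<odot> X n j" by (simp only: radj_comp radj_radj)
      then show "(Y j)\<^sup>\<star> \<odot> X n j = B \<odot> e n" by (simp only: XX[OF n])
    qed
  next
    fix x
    have "((\<lambda>p. nsq ((X (fst p) (snd p))\<^sup>\<star>) x) has_sum qf A x) (J \<times> UNIV)"
      by (rule has_sum_Sigma_nonneg[OF _ _ AE]) (use Xs in auto)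
    then have "((\<lambda>p. nsq ((X (snd p) (fst p))\<^sup>\<star>) x) has_sum qf A x) (UNIV \<times> J)"
      by (subst (asm) has_sum_swap) (simp add: case_prod_unfold)
    then show "((\<lambda>j. nsq ((Y j)\<^sup>\<star>) x) has_sum qf A x) UNIV"
      by (rule has_sum_SigmaD) (simp add: Yr T(2))
  qed
qed

text \<open>After division by \<open>c\<close> the excess of \<open>A \<odot> E\<close> over the
  identity dominates \<open>t / c - 1\<close> times the infinite projection \<open>F\<close>, so it
  has infinite trace.\<close>

lemma core_above:
  assumes A: "A \<in> M" "pos A" and E: "E \<in> M" "prj E" "A \<odot> E = E \<odot> A"
    and F: "F \<in> M" "prj F" "A \<odot> F = F \<odot> A" "E \<odot> F = F" "\<tau> F = \<infinity>" "pos (A \<odot> F - t *\<^sub>R F)"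
    and B: "B \<in> M" "pos B" "B \<noteq> 0" "norm B \<le> c" and c: "0 < c" "c < t"
  shows "bsum B (\<lambda>x. qf (A \<odot> E) x)"
proof -
  define A' where "A' = (1 / c) *\<^sub>R (A \<odot> E)"
  have pAE: "pos (A \<odot> E)" by (rule pos_comp_prj[OF A(2) E(2) E(3)[symmetric]])
  have A': "A' \<in> M" "pos A'" using A E c pAE by (auto simp: A'_def intro!: pos_scaleR)
  then have sa: "(A' - \<one>)\<^sup>\<star> = A' - \<one>" by (simp add: pos_sa)
  note P = posp[OF sa]
  let ?P = "posp (A' - \<one>)"
  have PM: "?P \<in> M" by (rule M_commute[OF M_diff[OF A'(1) M_one]]) (rule posp(6)[OF sa])
  have FE: "F \<odot> E = F"
    using F(2,4) E(2) prj_diff(2) by blast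
  have 1: "A' \<odot> F = (1 / c) *\<^sub>R (A \<odot> F)" using F(4) by (simp add: A'_def op_scale op_assoc)
  have 2: "F \<odot> A' = (1 / c) *\<^sub>R (A \<odot> F)"
  proof -
    have "F \<odot> (A \<odot> E) = (A \<odot> F) \<odot> E" by (simp add: F(3) op_assoc)
    also have "\<dots> = A \<odot> F" by (simp add: op_assoc FE)
    finally show ?thesis by (simp add: A'_def op_scale)
  qed
  have "F \<odot> (A' - \<one>) = (A' - \<one>) \<odot> F" by (simp add: op_distrib 1 2)
  then have FP: "F \<odot> ?P = ?P \<odot> F" by (rule posp(6)[OF sa])
  have FN: "F \<odot> negp (A' - \<one>) = negp (A' - \<one>) \<odot> F" 
    by (rule posp(7)[OF sa]) fact
  have "pos (negp (A' - \<one>) \<odot> F)" by (rule pos_comp_prj[OF P(2) F(2) FN])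
  moreover have "pos ((1 / c) *\<^sub>R (A \<odot> F - t *\<^sub>R F))" using F(6) c by (intro pos_scaleR) auto
  ultimately have p: "pos (negp (A' - \<one>) \<odot> F + (1 / c) *\<^sub>R (A \<odot> F - t *\<^sub>R F))" by (rule pos_add)
  have "?P \<odot> F - (t / c - 1) *\<^sub>R F = negp (A' - \<one>) \<odot> F + (1 / c) *\<^sub>R (A \<odot> F - t *\<^sub>R F)"
  proof -
    have "(A' - \<one>) \<odot> F = ?P \<odot> F - negp (A' - \<one>) \<odot> F" by (subst P(3)) (simp only: op_distrib)
    then have "?P \<odot> F = negp (A' - \<one>) \<odot> F + (A' \<odot> F - F)" by (simp add: op_distrib)
    then show ?thesis by (simp add: 1 algebra_simps)
  qed
  then have "pos (?P \<odot> F - (t / c - 1) *\<^sub>R F)" using p by simp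
  then have "\<tau> ((t / c - 1) *\<^sub>R F) \<le> \<tau> (?P \<odot> F)"
    by (rule tr_mono[rotated 3]) (use PM F(1,2) c in \<open>auto intro: pos_scaleR prj_pos\<close>)
  moreover have "\<tau> ((t / c - 1) *\<^sub>R F) = \<infinity>"
    using c by (subst tr_scale[OF F(1) prj_pos[OF F(2)]]) (auto simp: F(5) ennreal_mult_eq_top_iff ennreal_eq_0_iff)
  moreover have "\<tau> (?P \<odot> F) \<le> \<tau> (?P \<odot> \<one>)"
    by (rule tr_comp_mono[OF PM P(1) F(1,2) FP]) (auto simp: prj_def)
  ultimately have inf: "\<tau> ?P = \<infinity>" by (simp add: top_unique)
  have "norm ((1 / c) *\<^sub>R B) \<le> 1" using B(4) c by (simp add: field_simps)
  then have "bsum ((1 / c) *\<^sub>R B) (\<lambda>x. qf A' x)"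
    using B c by (intro core_bsum[OF A' PM P(1-4) inf] pos_scaleR) auto
  then have "bsum (c *\<^sub>R (1 / c) *\<^sub>R B) (\<lambda>x. c * qf A' x)"
    by (rule bsum_scaleR) (use c in simp)
  then show ?thesis using c by (simp add: A'_def blinfun.scaleR_left)
qed

end

text \<open>The sequence starts at \<open>-1\<close>, so the half-open slices between consecutive
  levels begin left of zero and cover the spectrum of a positive contraction except the point
  \<open>1\<close>.\<close>

definition level :: "nat \<Rightarrow> real" where "level n = 1 - 2 / real (Suc n)"

lemma level: "level n < 1" "0 \<le> level (Suc n)" "-1 \<le> level n" "strict_mono level"
  by (auto simp: level_def field_simps strict_mono_def)

lemma level_mono: "m \<le> n \<Longrightarrow> level m \<le> level n"
  using level(4) by (simp add: strict_mono_less_eq)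

lemma level_cofinal: "x < 1 \<Longrightarrow> \<exists>n. x < level n"
proof -
  assume "x < 1"
  then obtain n where n: "2 / (1 - x) < real n" using reals_Archimedean2 by blast
  then have "2 < (1 - x) * real (Suc n)" using \<open>x < 1\<close> by (simp add: field_simps)
  then show ?thesis by (intro exI[of _ n]) (simp add: level_def field_simps)
qed

lemma level_Union: "(\<Union>m. {level n<..level (n + m)}) = {level n<..<1}"
proof (intro equalityI subsetI)
  fix x assume x: "x \<in> {level n<..<1}"
  then obtain k where k: "x < level k" using level_cofinal by auto
  also have "level k \<le> level (n + k)" by (rule level_mono) simp
  finally show "x \<in> (\<Union>m. {level n<..level (n + m)})" using x by (intro UN_I[of k]) auto
qed (use level(1) in \<open>auto intro: le_less_trans\<close>)

lemma level_intervals: "(\<Union>n. {level n<..level (Suc n)}) = {-1<..<1}" "disjoint_family (\<lambda>n. {level n<..level (Suc n)})"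
proof -
  have "\<exists>n. x \<in> {level n<..level (Suc n)}" if x: "-1 < x" "x < 1" for x
  proof -
    obtain k where k: "x < level k" using level_cofinal[OF x(2)] by blast
    define n where "n = (LEAST k. x \<le> level k)"
    have n: "x \<le> level n" unfolding n_def by (rule LeastI[of _ k]) (use k in simp)
    have "level 0 = -1" by (simp add: level_def)
    then obtain m where m: "n = Suc m" using n x(1) by (cases n) auto
    then have "\<not> x \<le> level m" using not_less_Least[of m "\<lambda>k. x \<le> level k"] by (simp add: n_def)
    then show ?thesis using n m by (intro exI[of _ m]) auto
  qed
  moreover have "x \<in> {-1<..<1}" if "x \<in> {level n<..level (Suc n)}" for x n
    using that level(1)[of "Suc n"] level(3)[of n] by auto
  ultimately show "(\<Union>n. {level n<..level (Suc n)}) = {-1<..<1}" by auto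
  show "disjoint_family (\<lambda>n. {level n<..level (Suc n)})"
    unfolding disjoint_family_on_def
  proof (intro ballI impI)
    fix m n :: nat assume "m \<noteq> n"
    then have "Suc m \<le> n \<or> Suc n \<le> m" by auto
    then show "{level m<..level (Suc m)} \<inter> {level n<..level (Suc n)} = {}"
      using level_mono[of "Suc m" n] level_mono[of "Suc n" m] by auto
  qed
qed

lemma spec_ge_pos:
  assumes A: "A\<^sup>\<star> = A" and S: "S \<in> sets borel" "S \<subseteq> {t..}"
  shows "pos (A \<odot> spec A S - t *\<^sub>R spec A S)"
proof -
  note e = spec_proj(1)[OF A S(1)] and c = spec_commute_op[OF A S(1)]
  have "0 \<le> qf (A \<odot> spec A S - t *\<^sub>R spec A S) x" for x
  proof -
    let ?y = "ap (spec A S) x"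
    have "t * (norm ?y)\<^sup>2 \<le> qf A ?y"
      by (rule spec_atLeast_ge[OF A S]) (simp add: prj_idem_apply[OF e])
    then show ?thesis by (simp add: inner_conj_prj[OF e c] prj_inner[OF e] apply_simps inner_expand)
  qed
  moreover have "(A \<odot> spec A S - t *\<^sub>R spec A S)\<^sup>\<star> = A \<odot> spec A S - t *\<^sub>R spec A S"
    using c by (simp add: A prj_sa[OF e])
  ultimately show ?thesis by (simp add: pos_def)
qed

lemma spec_interval_norm_le:
  assumes B: "pos B" and S: "S \<in> sets borel" "S \<subseteq> {..t}" "0 \<le> t"
  shows "norm (B \<odot> spec B S) \<le> t"
proof (rule pos_norm_bound[OF _ S(3)])
  note e = spec_proj(1)[OF pos_sa[OF B] S(1)] and c = spec_commute_op[OF pos_sa[OF B] S(1)]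
  show "pos (B \<odot> spec B S)" by (rule pos_comp_commute[OF B prj_pos[OF e] c])
  fix x
  let ?y = "ap (spec B S) x"
  have "qf (B \<odot> spec B S) x = qf B ?y"
    by (simp add: inner_conj_prj[OF e c])
  also have "\<dots> \<le> t * (norm ?y)\<^sup>2"
    by (rule spec_atMost_le[OF pos_sa[OF B] S(1,2)]) (simp add: prj_idem_apply[OF e])
  also have "\<dots> \<le> t * (norm x)\<^sup>2" by (intro mult_left_mono prj_norm_le e S)
  finally show "qf (B \<odot> spec B S) x \<le> t * (norm x)\<^sup>2" .
qed

lemma spec_inside:
  assumes B: "pos B" "norm B \<le> 1"
  shows "spec B {-1<..<1} = \<one> - spec B {1}"
proof -
  note sa = pos_sa[OF B(1)]
  have 1: "spec B {..-1} = 0"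
  proof (rule blinfun_eqI)
    fix x
    let ?y = "ap (spec B {..-1}) x"
    have "qf B ?y \<le> -1 * (norm ?y)\<^sup>2"
      by (rule spec_atMost_le[OF sa, of "{..-1}"]) (simp_all add: prj_idem_apply[OF spec_proj(1)[OF sa]])
    then have "(norm ?y)\<^sup>2 \<le> 0" using pos_ge[OF B(1), of ?y] by linarith
    then show "?y = ap 0 x" by (simp add: blinfun.zero_left)
  qed
  have 2: "spec B {1<..} = 0"
  proof (rule blinfun_eqI)
    fix x
    let ?y = "ap (spec B {1<..}) x"
    have y: "ap (spec B {1<..}) ?y = ?y" by (simp add: prj_idem_apply[OF spec_proj(1)[OF sa]])
    have "1 * (norm ?y)\<^sup>2 \<le> qf B ?y"
      by (rule spec_greaterThan_ge(1)[OF sa _ _ y]) auto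
    moreover have "qf B ?y \<le> 1 * (norm ?y)\<^sup>2"
      by (rule order_trans[OF inner_le_norm_op mult_right_mono[OF B(2)]]) simp
    ultimately have "1 * (norm ?y)\<^sup>2 = qf B ?y" by simp
    then show "?y = ap 0 x" using spec_greaterThan_ge(2)[OF sa _ _ y, of 1] by (simp add: blinfun.zero_left)
  qed
  have "spec B ({..-1} \<union> {1} \<union> {1<..}) = spec B ({..-1} \<union> {1}) + spec B {1<..}"
    by (rule spec_disjoint(2)[OF sa]) auto
  moreover have "spec B ({..-1} \<union> {1}) = spec B {..-1} + spec B {1}"
    by (rule spec_disjoint(2)[OF sa]) auto
  ultimately have "spec B ({..-1} \<union> {1} \<union> {1<..}) = spec B {1}" using 1 2 by (simp only: add_0_left add_0_right)
  moreover have "{-1<..<1} = - ({..-1} \<union> {1} \<union> {1<..} :: real set)" by auto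
  ultimately show ?thesis using spec_Compl[OF sa, of "{..-1} \<union> {1} \<union> {1<..}"] by simp
qed

section \<open>Slices of \<open>B\<close> matched with infinite projections of
  \<open>A\<close>\<close>

context semifinite_factor
begin

definition slice :: "'a operator \<Rightarrow> nat \<Rightarrow> 'a operator" where
  "slice B n = spec B {level n<..level (Suc n)}"

lemma slice:
  assumes B: "pos B" "norm B \<le> 1"
  shows "B \<in> M \<Longrightarrow> slice B n \<in> M" "orth_prjs UNIV (slice B)" "slice B n \<odot> B = B \<odot> slice B n" "norm (B \<odot> slice B n) \<le> level (Suc n)"
    "((\<lambda>n. ap (B \<odot> slice B n) x) has_sum ap (B \<odot> (\<one> - spec B {1})) x) UNIV"
    "slice B n \<odot> spec B {1} = 0"
proof -
  note sa = pos_sa[OF B(1)]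
  show "B \<in> M \<Longrightarrow> slice B n \<in> M" unfolding slice_def by (rule M_spec[OF sa]) auto
  show "orth_prjs UNIV (slice B)" unfolding slice_def by (rule spec_sum(1)[OF sa _ level_intervals(2)]) simp
  show "slice B n \<odot> B = B \<odot> slice B n" unfolding slice_def using spec_commute_op[OF sa] by simp
  show "norm (B \<odot> slice B n) \<le> level (Suc n)"
    unfolding slice_def by (rule spec_interval_norm_le[OF B(1)]) (auto simp: level(2))
  show "((\<lambda>n. ap (B \<odot> slice B n) x) has_sum ap (B \<odot> (\<one> - spec B {1})) x) UNIV"
  proof (rule has_sum_op_left)
    show "((\<lambda>n. ap (slice B n) x) has_sum ap (\<one> - spec B {1}) x) UNIV" for x
      using spec_sum(2)[OF sa _ level_intervals(2), of x]
      unfolding slice_def level_intervals(1) spec_inside[OF B] by simp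
  qed
  show "slice B n \<odot> spec B {1} = 0"
    unfolding slice_def by (rule spec_disjoint(1)[OF sa]) (use level(1)[of "Suc n"] in auto)
qed

lemma tr_spec_incseq:
  assumes A: "A \<in> M" "A\<^sup>\<star> = A" and S: "incseq S" "\<And>n. S n \<in> sets borel"
  shows "\<tau> (spec A (\<Union>n. S n)) = (SUP n. \<tau> (spec A (S n)))"
proof (rule tr_normal)
  have U: "(\<Union>n. S n) \<in> sets borel" using S by auto
  show "spec A (S n) \<in> M" for n using A S by auto
  show "spec A (\<Union>n. S n) \<in> M" using A U by auto
  show "pos (spec A (S n))" for n by (rule prj_pos[OF spec_proj(1)[OF A(2) S(2)]])
  show "pos (spec A (\<Union>n. S n))" by (rule prj_pos[OF spec_proj(1)[OF A(2) U]])
  show "pos (spec A (S (Suc n)) - spec A (S n))" for n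
    using spec_diff[OF A(2) S(2) S(2), of n "Suc n"] incseq_SucD[OF S(1)] prj_pos[OF spec_proj(1)[OF A(2), of "S (Suc n) - S n"]] S(2)
    by simp
  fix x
  have nn: "0 \<le> qf (spec A T) x" if "T \<in> sets borel" for T
    by (rule pos_ge[OF prj_pos[OF spec_proj(1)[OF A(2) that]]])
  have "(\<lambda>n. emeasure (mu A x) (S n)) \<longlonglongrightarrow> emeasure (mu A x) (\<Union>n. S n)"
    by (rule Lim_emeasure_incseq) (use S sets_mu[OF A(2)] in auto)
  then have "(\<lambda>n. ennreal (qf (spec A (S n)) x)) \<longlonglongrightarrow> ennreal (qf (spec A (\<Union>n. S n)) x)"
    by (simp add: spec_proj(3)[OF A(2)] S U)
  then show "(\<lambda>n. qf (spec A (S n)) x) \<longlonglongrightarrow> qf (spec A (\<Union>n. S n)) x"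
    by (subst (asm) tendsto_ennreal_iff) (use nn S U in auto)
qed

text \<open>Slice \<open>n\<close> of \<open>B\<close> has norm at most
  \<open>level (Suc n)\<close>; requiring one level more on \<open>F n\<close> leaves the strict gap
  that \<open>core_above\<close> asks for.\<close>

definition towers :: "'a operator \<Rightarrow> (nat \<Rightarrow> 'a operator) \<Rightarrow> bool" where
  "towers A F \<longleftrightarrow> orth_prjs UNIV F \<and> (\<forall>n. F n \<in> M \<and> F n \<odot> A = A \<odot> F n \<and> \<tau> (F n) = \<infinity> \<and>
     pos (A \<odot> F n - level (Suc (Suc n)) *\<^sub>R F n))"

text \<open>With finite trace on \<open>{1..}\<close>, infinite trace sits just below one. It is cut
  into blocks of trace at least one accumulating at \<open>1\<close>, and these are dealt out to
  countably many projections.\<close>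

lemma towers_of_finite_top:
  assumes A: "A \<in> M" "A\<^sup>\<star> = A" and inf: "\<And>s. s < 1 \<Longrightarrow> \<tau> (spec A {s<..}) = \<infinity>" and fin: "\<tau> (spec A {1..}) < \<infinity>"
  shows "\<exists>F. towers A F"
proof -
  define t where "t n = level (Suc (Suc n))" for n
  have inf': "\<tau> (spec A {level n<..<1}) = \<infinity>" for n
  proof -
    have "spec A ({level n<..<1} \<union> {1..}) = spec A {level n<..<1} + spec A {1..}"
      by (rule spec_disjoint(2)[OF A(2)]) auto
    moreover have "{level n<..<1} \<union> {1..} = {level n<..}" using level(1)[of n] by auto
    moreover have "\<tau> (spec A {level n<..<1} + spec A {1..}) = \<tau> (spec A {level n<..<1}) + \<tau> (spec A {1..})"
      using A by (intro tr_add prj_pos spec_proj(1)) auto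
    ultimately have "\<tau> (spec A {level n<..<1}) + \<tau> (spec A {1..}) = \<infinity>" using inf[OF level(1), of n] by simp
    then show ?thesis using fin by auto
  qed
  have "\<exists>m>n. 1 \<le> \<tau> (spec A {t n<..t m})" for n
  proof (rule ccontr)
    let ?k = "Suc (Suc n)"
    assume *: "\<not> ?thesis"
    have "\<tau> (spec A {level ?k<..level (?k + m)}) \<le> 1" for m
    proof (cases m)
      case 0 then show ?thesis by (simp add: spec_empty[OF A(2)])
    next
      case (Suc j)
      then show ?thesis using * by (auto simp: t_def not_le dest!: spec[of _ "n + Suc j"])
    qed
    then have "(SUP m. \<tau> (spec A {level ?k<..level (?k + m)})) \<le> 1" by (rule SUP_least)
    moreover have "incseq (\<lambda>m. {level ?k<..level (?k + m)})"
      unfolding incseq_def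
    proof (intro allI impI subsetI)
      fix m m' x assume "m \<le> m'" "x \<in> {level ?k<..level (?k + m)}"
      then show "x \<in> {level ?k<..level (?k + m')}" using level_mono[of "?k + m" "?k + m'"] by auto
    qed
    ultimately have "\<tau> (spec A {level ?k<..<1}) \<le> 1"
      using tr_spec_incseq[OF A, of "\<lambda>m. {level ?k<..level (?k + m)}"] by (simp only: level_Union) simp
    then show False using inf'[of ?k] by (simp add: top_unique)
  qed
  then obtain b where b: "strict_mono b" "\<And>c. 1 \<le> \<tau> (spec A {t (b c)<..t (b (Suc c))})"
    using ex_blocks[of "\<lambda>n m. 1 \<le> \<tau> (spec A {t n<..t m})"] by blast
  define K where "K c = {t (b c)<..t (b (Suc c))}" for c
  have tm: "t m \<le> t n" if "m \<le> n" for m n using that by (simp add: t_def level_mono)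
  have disj: "K c \<inter> K c' = {}" if "c \<noteq> c'" for c c'
  proof -
    have "Suc c \<le> c' \<or> Suc c' \<le> c" using that by auto
    then have "t (b (Suc c)) \<le> t (b c') \<or> t (b (Suc c')) \<le> t (b c)"
      using b(1) by (auto intro!: tm simp: strict_mono_less_eq)
    then show ?thesis by (auto simp: K_def)
  qed
  \<comment> \<open>Row \<open>n\<close> of the pairing; since
    \<open>n \<le> prod_encode (n, i)\<close>, none of its blocks starts below
    \<open>t n\<close>.\<close>
  define S where "S n = (\<Union>i. K (prod_encode (n, i)))" for n
  have SB: "S n \<in> sets borel" for n by (auto simp: S_def K_def)
  have Sd: "S m \<inter> S n = {}" if "m \<noteq> n" for m n
    using disj[of "prod_encode (m, _)" "prod_encode (n, _)"] that by (fastforce simp: S_def)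
  have St: "S n \<subseteq> {t n..}" for n
  proof
    fix x assume "x \<in> S n"
    then obtain i where i: "t (b (prod_encode (n, i))) < x" by (auto simp: S_def K_def)
    have "n \<le> b (prod_encode (n, i))"
      using le_prod_encode_1[of n i] strict_mono_imp_increasing[OF b(1), of "prod_encode (n, i)"] by linarith
    then show "x \<in> {t n..}" using tm i by force
  qed
  have "\<tau> (spec A (S n)) = \<infinity>" for n
  proof -
    have "\<tau> (\<one> \<odot> spec A (S n)) = \<infinity>"
    proof (rule tr_infinite_of_pieces)
      let ?R = "\<lambda>i. spec A (K (prod_encode (n, i)))"
      show "orth_prjs UNIV ?R"
      proof (rule spec_sum(1)[OF A(2)])
        show "disjoint_family (\<lambda>i. K (prod_encode (n, i)))"
          unfolding disjoint_family_on_def by (intro ballI impI disj) simp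
      qed (simp add: K_def)
      show "?R c \<in> M" for c using A by (intro M_spec) (auto simp: K_def)
      show "1 \<le> \<tau> (\<one> \<odot> ?R c)" for c using b(2) by (simp add: K_def)
      show "spec A (S n) \<odot> ?R c = ?R c" for c
        by (rule spec_subset(1)[OF A(2) _ SB]) (auto simp: S_def K_def)
    qed (use A SB spec_proj(1)[OF A(2)] in \<open>auto simp: pos_def\<close>)
    then show ?thesis by simp
  qed
  moreover have "spec A (S n) \<odot> A = A \<odot> spec A (S n)" for n using spec_commute_op[OF A(2) SB] by simp
  moreover have "pos (A \<odot> spec A (S n) - level (Suc (Suc n)) *\<^sub>R spec A (S n))" for n
    by (rule spec_ge_pos[OF A(2) SB St, unfolded t_def])
  moreover have "orth_prjs UNIV (\<lambda>n. spec A (S n))"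
    by (simp add: orth_prjs_def spec_proj(1)[OF A(2) SB] spec_disjoint(1)[OF A(2) SB SB Sd])
  ultimately show ?thesis
    unfolding towers_def using M_spec[OF A(2,1) SB] by (intro exI[of _ "\<lambda>n. spec A (S n)"]) simp
qed


text \<open>The infinite projection of \<open>{1..}\<close> is halved again and again by projections
  commuting with \<open>A\<close>; what is split off at each stage is \<open>F n\<close>.\<close>

lemma towers_of_infinite_top:
  assumes A: "A \<in> M" "A\<^sup>\<star> = A" and inf: "\<tau> (spec A {1..}) = \<infinity>"
  shows "\<exists>F. towers A F"
proof -
  let ?G = "spec A {1..}"
  let ?P = "\<lambda>G. G \<in> M \<and> prj G \<and> G \<odot> A = A \<odot> G \<and> \<tau> G = \<infinity> \<and> ?G \<odot> G = G"
  have G: "prj ?G" "?G \<in> M" using A spec_proj(1)[OF A(2)] by auto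
  have "\<exists>f. \<forall>n. ?P (f n) \<and> (f n \<odot> f (Suc n) = f (Suc n) \<and> \<tau> (f n - f (Suc n)) = \<infinity>)"
  proof (rule dependent_nat_choice[where P="\<lambda>_. ?P" and Q="\<lambda>_ G G'. G \<odot> G' = G' \<and> \<tau> (G - G') = \<infinity>"])
    show "\<exists>G. ?P G" using G inf spec_commute_op[OF A(2)] by (intro exI[of _ ?G]) (auto simp: prj_idem)
    fix G assume P: "?P G"
    then have com: "A \<odot> G = G \<odot> A" by simp
    obtain Z where Z: "Z \<in> M" "prj Z" "Z \<odot> A = A \<odot> Z" "Z \<odot> G = G \<odot> Z" "\<tau> (G \<odot> Z) = \<infinity>" "\<tau> (G \<odot> (\<one> - Z)) = \<infinity>"
      using halving[OF A, of G] P prj_pos by auto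
    have "(G \<odot> Z) \<odot> A = A \<odot> (G \<odot> Z)"
    proof -
      have "(G \<odot> Z) \<odot> A = G \<odot> (A \<odot> Z)" by (simp add: op_assoc Z(3))
      then show ?thesis by (simp add: com flip: op_assoc)
    qed
    moreover have "?G \<odot> (G \<odot> Z) = G \<odot> Z" by (rule comp_subst) (use P in simp)
    moreover have "prj (G \<odot> Z)" by (rule prj_comp_commute) (use P Z in auto)
    moreover have "G \<odot> (G \<odot> Z) = G \<odot> Z" by (rule comp_subst) (use P prj_idem in auto)
    ultimately show "\<exists>G'. ?P G' \<and> (G \<odot> G' = G' \<and> \<tau> (G - G') = \<infinity>)"
      using P Z by (intro exI[of _ "G \<odot> Z"]) (auto simp: op_distrib)
  qed
  then obtain f where f: "\<And>n. f n \<in> M" "\<And>n. prj (f n)" "\<And>n. f n \<odot> A = A \<odot> f n" "\<And>n. ?G \<odot> f n = f n"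
    "\<And>n. f n \<odot> f (Suc n) = f (Suc n)" "\<And>n. \<tau> (f n - f (Suc n)) = \<infinity>" by blast
  have le: "f m \<odot> f n = f n" if "m \<le> n" for m n
    using that
  proof (induction n rule: dec_induct)
    case base then show ?case by (rule prj_idem[OF f(2)])
  next
    case (step n)
    have "f m \<odot> (f n \<odot> f (Suc n)) = f n \<odot> f (Suc n)" by (rule comp_subst[OF step.IH])
    then show ?case by (simp only: f(5))
  qed
  define F where "F n = f n - f (Suc n)" for n
  have F: "F n \<in> M" "prj (F n)" "F n \<odot> A = A \<odot> F n" "?G \<odot> F n = F n" for n
    using f by (auto simp: F_def op_distrib prj_diff(1))
  have o: "F m \<odot> F n = 0" if "m < n" for m n
    using that by (simp add: F_def op_distrib le)
  have o': "F m \<odot> F n = 0" if "m \<noteq> n" for m n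
    using o[of m n] prj_add(2)[OF F(2) F(2) o, of n m] that by (cases "m < n") auto
  have "pos (A \<odot> F n - level (Suc (Suc n)) *\<^sub>R F n)" for n
  proof -
    have FG: "F n \<odot> ?G = F n" by (rule prj_diff(2)[OF F(2) G(1) F(4)])
    have p: "pos (A \<odot> ?G - 1 *\<^sub>R ?G)" by (rule spec_ge_pos[OF A(2)]) auto
    have "(A \<odot> ?G - 1 *\<^sub>R ?G) \<odot> F n = A \<odot> F n - F n" by (simp add: op_distrib op_assoc F(4))
    moreover have "F n \<odot> (A \<odot> ?G - 1 *\<^sub>R ?G) = A \<odot> F n - F n"
    proof -
      have "F n \<odot> (A \<odot> ?G) = A \<odot> (F n \<odot> ?G)" using F(3)[of n] by (simp flip: op_assoc)
      then show ?thesis by (simp add: op_distrib FG)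
    qed
    ultimately have "pos (A \<odot> F n - F n)" using pos_comp_prj[OF p F(2)[of n]] by simp
    moreover have "pos ((1 - level (Suc (Suc n))) *\<^sub>R F n)"
      using level(1)[of "Suc (Suc n)"] by (intro pos_scaleR prj_pos F(2)) simp
    ultimately have "pos ((A \<odot> F n - F n) + (1 - level (Suc (Suc n))) *\<^sub>R F n)" by (rule pos_add)
    then show ?thesis by (simp add: algebra_simps)
  qed
  then show ?thesis
    unfolding towers_def using F(1-3) o' f(6)
    by (intro exI[of _ F]) (auto simp: orth_prjs_def F_def)
qed

lemma towers_exist:
  assumes "A \<in> M" "A\<^sup>\<star> = A" "\<And>s. s < 1 \<Longrightarrow> \<tau> (spec A {s<..}) = \<infinity>"
  shows "\<exists>F. towers A F"
  using towers_of_finite_top[OF assms] towers_of_infinite_top[OF assms(1,2)] by (cases "\<tau> (spec A {1..}) = \<infinity>") (auto simp: less_top)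

text \<open>Slice \<open>n\<close> of \<open>B\<close> is realized on a piece of \<open>A\<close>
  containing \<open>F n\<close>. The complement \<open>R\<close> of all these \<open>F n\<close>
  joins one of the pieces, so that all of \<open>A\<close> is covered.\<close>

lemma bsum_towers:
  assumes A: "A \<in> M" "pos A" and F: "towers A F" and B: "B \<in> M" "pos B" "B \<noteq> 0" "norm B \<le> 1" "spec B {1} = 0"
  shows "bsum B (\<lambda>x. qf A x)"
proof -
  note sl = slice[OF B(2,4)]
  have Fo: "orth_prjs UNIV F" and FM: "F n \<in> M" and FA: "F n \<odot> A = A \<odot> F n" and Finf: "\<tau> (F n) = \<infinity>"
    and Fp: "pos (A \<odot> F n - level (Suc (Suc n)) *\<^sub>R F n)" for n using F by (auto simp: towers_def)
  have Fprj: "prj (F n)" for n using Fo by (simp add: orth_prjs_def)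
  define J where "J = {n. B \<odot> slice B n \<noteq> 0}"
  have BJ: "((\<lambda>n. ap (B \<odot> slice B n) x) has_sum ap B x) J" for x
  proof -
    have "((\<lambda>n. ap (B \<odot> slice B n) x) has_sum ap B x) UNIV" using sl(5)[of x] B(5) by simp
    moreover have "ap (B \<odot> slice B n) x = 0" if "n \<in> UNIV - J" for n
      using that by (simp only: J_def Diff_iff mem_Collect_eq not_not blinfun.zero_left)
    ultimately show ?thesis
      using has_sum_cong_neutral[of J UNIV "\<lambda>n. ap (B \<odot> slice B n) x" "\<lambda>n. ap (B \<odot> slice B n) x"] by auto
  qed
  obtain m where m: "m \<in> J"
  proof (rule ccontr)
    assume *: "\<not> thesis"
    have "J = {}" using * that by blast
    have "ap B x = 0" for x
      by (rule has_sum_unique[OF BJ[of x, unfolded \<open>J = {}\<close>] has_sum_empty])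
    then have "B = 0" by (intro blinfun_eqI) (simp add: blinfun.zero_left)
    then show False using B(3) by simp
  qed
  have FoJ: "orth_prjs J F" by (rule orth_prjs_subset[OF Fo]) simp
  note S = prj_opsum[OF FoJ]
  define R where "R = \<one> - opsum F J"
  have R: "prj R" "R \<in> M" "R \<odot> A = A \<odot> R"
  proof -
    show "prj R" unfolding R_def by (rule prj_compl[OF S(2)])
    show "R \<in> M" unfolding R_def using M_opsum_prj[OF FoJ FM] by blast
    have "A \<odot> opsum F J = opsum F J \<odot> A" by (rule op_sum_commute[OF S(1)]) (simp add: FA)
    then show "R \<odot> A = A \<odot> R" by (simp add: R_def op_distrib)
  qed
  have RF: "R \<odot> F n = 0" "F n \<odot> R = 0" if "n \<in> J" for n using S(3,4)[OF that] by (simp_all add: R_def op_distrib)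
  define E where "E n = F n + (if n = m then R else 0)" for n
  have E: "orth_prjs J E"
    unfolding orth_prjs_def
  proof (intro conjI ballI impI)
    show "prj (E n)" if "n \<in> J" for n using Fprj prj_add(1)[OF Fprj R(1) RF(2)[OF that]] by (cases "n = m") (simp_all add: E_def)
    show "E n \<odot> E k = 0" if "n \<in> J" "k \<in> J" "n \<noteq> k" for n k
      using that RF Fo by (auto simp: E_def op_distrib orth_prjs_def)
  qed
  have EM: "E n \<in> M" "E n \<odot> A = A \<odot> E n" for n using FM R FA by (auto simp: E_def op_distrib)
  have EF: "E n \<odot> F n = F n" if "n \<in> J" for n using RF[OF that] prj_idem[OF Fprj] by (cases "n = m") (simp_all add: E_def op_distrib)
  have Esum: "((\<lambda>n. ap (E n) x) has_sum ap \<one> x) J" for x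
  proof -
    have "((\<lambda>n. ap (if n = m then R else 0) x) has_sum ap R x) J"
      by (rule has_sum_finite_neutralI[where B="{m}"]) (use m in \<open>auto simp: blinfun.zero_left\<close>)
    from has_sum_add[OF S(1)[of x] this] show ?thesis by (simp add: E_def R_def apply_simps)
  qed
  show ?thesis
  proof (rule bsum_direct[OF B(1) orth_prjs_subset[OF sl(2)] E BJ])
    show "((\<lambda>n. qf (A \<odot> E n) x) has_sum qf A x) J" for x
      using has_sum_bounded_linear[OF bounded_linear_inner_left has_sum_op_left[OF Esum, of A x]] by simp
    fix n assume n: "n \<in> J"
    have "0 < norm (B \<odot> slice B n)" using n by (simp add: J_def)
    then have l0: "0 < level (Suc n)" using sl(4)[of n] by linarith
    show "bsum (B \<odot> slice B n) (\<lambda>x. qf (A \<odot> E n) x)"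
    proof (rule core_above[OF A EM(1) _ EM(2)[symmetric] FM Fprj FA[symmetric] EF[OF n] Finf Fp _ _ _ sl(4) l0])
      show "prj (E n)" using E n by (simp add: orth_prjs_def)
      show "B \<odot> slice B n \<in> M" using B(1) sl(1) by blast
      show "pos (B \<odot> slice B n)" using sl(2,3) by (intro pos_comp_prj B(2)) (auto simp: orth_prjs_def)
      show "B \<odot> slice B n \<noteq> 0" using n by (simp add: J_def)
      show "level (Suc n) < level (Suc (Suc n))" using level(4) by (simp add: strict_mono_less)
    qed
  qed simp
qed

text \<open>One infinite part \<open>G\<close> of the eigenspace is a projection and takes care of
  \<open>B \<odot> (\<one> - e)\<close>, whose norm may be one. The other part \<open>H\<close>
  stays with the rest of \<open>A\<close>, where its eigenvalue one exceeds the norm of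
  \<open>B \<odot> e\<close>.\<close>

lemma bsum_two_parts:
  assumes A: "A \<in> M" "pos A" and F: "F \<in> M" "prj F" "A \<odot> F = F" "\<tau> F = \<infinity>"
    and B: "B \<in> M" "pos B" "norm B \<le> 1" and e: "e \<in> M" "prj e" "e \<odot> B = B \<odot> e" "B \<odot> e \<noteq> 0" "B \<odot> (\<one> - e) \<noteq> 0"
    and c: "norm (B \<odot> e) \<le> c" "c < 1"
  shows "bsum B (\<lambda>x. qf A x)"
proof -
  have FA: "F \<odot> A = F" using F(2,3) A(2) radj_comp[of A F] by (simp add: prj_sa pos_sa)
  have "A \<odot> F = F \<odot> A" using F(3) FA by simp
  then obtain Y where Y: "Y \<in> M" "prj Y" "Y \<odot> A = A \<odot> Y" "Y \<odot> F = F \<odot> Y" "\<tau> (F \<odot> Y) = \<infinity>" "\<tau> (F \<odot> (\<one> - Y)) = \<infinity>"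
    using halving[OF A(1) pos_sa[OF A(2)] F(1) prj_pos[OF F(2)]] F(4) by blast
  define G where "G = F \<odot> Y"
  define H where "H = F \<odot> (\<one> - Y)"
  have G: "G \<in> M" "prj G" "A \<odot> G = G" "\<tau> G = \<infinity>"
  proof -
    show "A \<odot> G = G" unfolding G_def by (rule comp_subst[OF F(3)])
    show "prj G" unfolding G_def by (rule prj_comp_commute[OF F(2) Y(2) Y(4)[symmetric]])
  qed (use F Y in \<open>auto simp: G_def\<close>)
  have H: "H \<in> M" "prj H" "A \<odot> H = H" "\<tau> H = \<infinity>"
  proof -
    show "A \<odot> H = H" unfolding H_def by (rule comp_subst[OF F(3)])
    show "prj H" unfolding H_def by (rule prj_comp_commute[OF F(2) prj_compl[OF Y(2)]]) (simp add: op_distrib Y(4))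
  qed (use F Y in \<open>auto simp: H_def\<close>)
  have sa: "T \<odot> A = T" if "prj T" "A \<odot> T = T" for T
    using that A(2) radj_comp[of A T] by (simp add: prj_sa pos_sa)
  have "G \<odot> H = 0"
  proof -
    have "G \<odot> H = F \<odot> (Y \<odot> F) \<odot> (\<one> - Y)" by (simp add: G_def H_def op_assoc)
    also have "\<dots> = F \<odot> (F \<odot> (Y \<odot> (\<one> - Y)))" by (simp add: Y(4) op_assoc)
    finally show ?thesis using prj_idem[OF Y(2)] by (simp add: op_distrib)
  qed
  then have GH: "(\<one> - G) \<odot> H = H" by (simp add: op_distrib)
  define e' where "e' b = (if b then \<one> - e else e)" for b
  define E where "E b = (if b then G else \<one> - G)" for b
  have e': "orth_prjs UNIV e'" and E: "orth_prjs UNIV E"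
    using prj_idem[OF e(2)] prj_idem[OF G(2)] e(2) G(2) by (auto simp: orth_prjs_def e'_def E_def prj_compl op_distrib)
  show ?thesis
  proof (rule bsum_direct[OF B(1) e' E])
    show "((\<lambda>b. ap (B \<odot> e' b) x) has_sum ap B x) UNIV" for x
      by (rule has_sum_finiteI) (auto simp: e'_def UNIV_bool apply_simps blinfun.diff_right)
    show "((\<lambda>b. qf (A \<odot> E b) x) has_sum qf A x) UNIV" for x
      by (rule has_sum_finiteI) (auto simp: E_def UNIV_bool apply_simps blinfun.diff_right inner_expand)
    fix b
    show "bsum (B \<odot> e' b) (\<lambda>x. qf (A \<odot> E b) x)"
    proof (cases b)
      case True
      have "bsum (B \<odot> (\<one> - e)) (\<lambda>x. qf G x)"
      proof (rule projection_bsum[OF _ _ e(5) _ G(1,2,4)])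
        show "B \<odot> (\<one> - e) \<in> M" using B e by blast
        show "pos (B \<odot> (\<one> - e))" by (rule pos_comp_prj[OF B(2) prj_compl[OF e(2)]]) (simp add: op_distrib e(3))
        have "norm (B \<odot> (\<one> - e)) \<le> norm B * norm (\<one> - e)" by (rule norm_blinfun_compose)
        also have "\<dots> \<le> 1 * 1" using B(3) prj_norm_le1[OF prj_compl[OF e(2)]] by (intro mult_mono) auto
        finally show "norm (B \<odot> (\<one> - e)) \<le> 1" by simp
      qed
      then show ?thesis using True by (simp only: e'_def E_def G(3) if_True)
    next
      case False
      have "0 < norm (B \<odot> e)" using e(4) by simp
      then have c0: "0 < c" using c(1) by linarith
      have "bsum (B \<odot> e) (\<lambda>x. qf (A \<odot> (\<one> - G)) x)"
      proof (rule core_above[OF A _ prj_compl[OF G(2)] _ H(1,2) _ GH H(4) _ _ _ e(4) c(1) c0 c(2)])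
        show "\<one> - G \<in> M" using G(1) by blast
        show "A \<odot> (\<one> - G) = (\<one> - G) \<odot> A" using G(3) sa[OF G(2,3)] by (simp add: op_distrib)
        show "A \<odot> H = H \<odot> A" using H(3) sa[OF H(2,3)] by simp
        show "pos (A \<odot> H - 1 *\<^sub>R H)" by (simp add: H(3) pos_def)
        show "B \<odot> e \<in> M" using B e by blast
        show "pos (B \<odot> e)" by (rule pos_comp_prj[OF B(2) e(2,3)])
      qed
      then show ?thesis using False by (simp add: e'_def E_def)
    qed
  qed
qed

end

section \<open>Infinite null projections\<close>

lemma kerp_scaleR: "c \<noteq> 0 \<Longrightarrow> kerp (c *\<^sub>R T) = kerp T"
  by (simp add: kerp_def blinfun.scaleR_left)

lemma specg_scaleR:
  assumes A: "A\<^sup>\<star> = A" and c: "0 < c"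
  shows "specg (c *\<^sub>R A) (c * t) = specg A t"
proof -
  have sa: "(A - t *\<^sub>R \<one>)\<^sup>\<star> = A - t *\<^sub>R \<one>" by (simp add: A)
  have eq: "c *\<^sub>R A - (c * t) *\<^sub>R \<one> = c *\<^sub>R (A - t *\<^sub>R \<one>)" by (simp add: algebra_simps)
  have sa': "(c *\<^sub>R (A - t *\<^sub>R \<one>))\<^sup>\<star> = c *\<^sub>R (A - t *\<^sub>R \<one>)" by (simp add: A)
  have "posp (c *\<^sub>R (A - t *\<^sub>R \<one>)) = c *\<^sub>R posp (A - t *\<^sub>R \<one>)"
  proof (rule pos_part_unique[OF posp(1-4)[OF sa']])
    show "c *\<^sub>R (A - t *\<^sub>R \<one>) = c *\<^sub>R posp (A - t *\<^sub>R \<one>) - c *\<^sub>R negp (A - t *\<^sub>R \<one>)"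
      by (subst posp(3)[OF sa]) (simp only: scaleR_right_diff_distrib)
    show "(c *\<^sub>R posp (A - t *\<^sub>R \<one>)) \<odot> (c *\<^sub>R negp (A - t *\<^sub>R \<one>)) = 0" by (simp add: op_scale posp(4)[OF sa])
  qed (use c in \<open>auto intro: pos_scaleR posp(1,2)[OF sa]\<close>)
  then show ?thesis unfolding specg_def eq using c by (simp add: kerp_scaleR)
qed

lemma spec_greaterThan_scaleR:
  assumes A: "A\<^sup>\<star> = A" and c: "0 < c"
  shows "spec (c *\<^sub>R A) {c * t<..} = spec A {t<..}"
proof -
  have "(c *\<^sub>R A)\<^sup>\<star> = c *\<^sub>R A" by (simp add: A)
  then show ?thesis
    using spec_Compl[OF A, of "{..t}"] spec_Compl[of "c *\<^sub>R A" "{..c * t}"] specg_scaleR[OF assms, of t]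
    by (simp add: spec_atMost[OF A] spec_atMost Compl_atMost)
qed

context semifinite_factor
begin

text \<open>\<open>bsum\<close> together with the requirement on null projections: the null space of
  \<open>X X*\<close> is that of the adjoint of \<open>X\<close>.\<close>

definition nsum :: "'a operator \<Rightarrow> 'a operator \<Rightarrow> bool" where
  "nsum B A \<longleftrightarrow> (\<exists>X :: nat \<Rightarrow> 'a operator.
     (\<forall>j. X j \<in> M \<and> (X j)\<^sup>\<star> \<odot> X j = B \<and> \<tau> (kerp ((X j)\<^sup>\<star>)) = \<infinity>) \<and>
     (\<forall>x. ((\<lambda>j. nsq ((X j)\<^sup>\<star>) x) has_sum qf A x) UNIV))"

lemma nsum_scaleR:
  assumes "nsum B A" "0 < c"
  shows "nsum (c *\<^sub>R B) (c *\<^sub>R A)"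
proof -
  obtain X where X: "\<And>j. X j \<in> M" "\<And>j. (X j)\<^sup>\<star> \<odot> X j = B" "\<And>j. \<tau> (kerp ((X j)\<^sup>\<star>)) = \<infinity>"
    "\<And>x. ((\<lambda>j::nat. nsq ((X j)\<^sup>\<star>) x) has_sum qf A x) UNIV"
    using assms(1) unfolding nsum_def by blast
  have "((\<lambda>j. nsq ((sqrt c *\<^sub>R X j)\<^sup>\<star>) x) has_sum qf (c *\<^sub>R A) x) UNIV" for x
    using has_sum_cmult_right[OF X(4)[of x], of c] assms(2)
    by (simp add: blinfun.scaleR_left power_mult_distrib)
  then show ?thesis
    unfolding nsum_def using X(1-3) assms(2)
    by (intro exI[of _ "\<lambda>j. sqrt c *\<^sub>R X j"]) (auto simp: op_scale kerp_scaleR)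
qed

text \<open>Every term is dominated in form by \<open>A \<odot> Z\<close>, hence vanishes on the
  infinite range of \<open>1 - Z\<close>.\<close>

lemma bsum_kerp:
  assumes b: "bsum B (\<lambda>x. qf (A \<odot> Z) x)" and Z: "Z \<in> M" "prj Z" "\<tau> (\<one> - Z) = \<infinity>"
  shows "\<exists>X :: nat \<Rightarrow> 'a operator. (\<forall>j. X j \<in> M \<and> (X j)\<^sup>\<star> \<odot> X j = B \<and> \<tau> (kerp ((X j)\<^sup>\<star>)) = \<infinity>) \<and>
     (\<forall>x. ((\<lambda>j. nsq ((X j)\<^sup>\<star>) x) has_sum qf (A \<odot> Z) x) UNIV)"
proof -
  obtain X where X: "\<And>j. X j \<in> M" "\<And>j. (X j)\<^sup>\<star> \<odot> X j = B"
    "\<And>x. ((\<lambda>j::nat. nsq ((X j)\<^sup>\<star>) x) has_sum qf (A \<odot> Z) x) UNIV"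
    using b unfolding bsum_def by blast
  have "\<tau> (kerp ((X j)\<^sup>\<star>)) = \<infinity>" for j
  proof -
    have "ap ((X j)\<^sup>\<star>) (ap (\<one> - Z) x) = 0" for x
    proof -
      let ?y = "ap (\<one> - Z) x"
      have "ap Z ?y = 0" using prj_idem_apply[OF Z(2)] by (simp add: apply_simps blinfun.diff_right)
      then have "((\<lambda>j. nsq ((X j)\<^sup>\<star>) ?y) has_sum 0) UNIV" using X(3)[of ?y] by simp
      then have "nsq ((X j)\<^sup>\<star>) ?y = 0" by (rule nonneg_has_sum_le_0D) auto
      then show ?thesis by simp
    qed
    then have "(X j)\<^sup>\<star> \<odot> (\<one> - Z) = 0" by (intro blinfun_eqI) (simp add: blinfun.zero_left)
    then have "kerp ((X j)\<^sup>\<star>) \<odot> (\<one> - Z) = \<one> - Z" by (rule kerp_comp)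
    then have "\<tau> (\<one> - Z) \<le> \<tau> (kerp ((X j)\<^sup>\<star>))"
      using X(1) Z prj_compl by (intro tr_prj_mono) auto
    then show ?thesis using Z(3) by (simp add: top_unique)
  qed
  then show ?thesis using X by blast
qed

lemma nsum_split:
  assumes Z: "Z \<in> M" "prj Z" "\<tau> Z = \<infinity>" "\<tau> (\<one> - Z) = \<infinity>"
    and b: "bsum B (\<lambda>x. qf (A \<odot> Z) x)" "bsum B (\<lambda>x. qf (A \<odot> (\<one> - Z)) x)"
  shows "nsum B A"
proof -
  obtain X where X: "\<And>j. X j \<in> M" "\<And>j. (X j)\<^sup>\<star> \<odot> X j = B" "\<And>j. \<tau> (kerp ((X j)\<^sup>\<star>)) = \<infinity>"
    "\<And>x. ((\<lambda>j::nat. nsq ((X j)\<^sup>\<star>) x) has_sum qf (A \<odot> Z) x) UNIV"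
    using bsum_kerp[OF b(1) Z(1,2,4)] by blast
  have Z': "\<one> - Z \<in> M" "prj (\<one> - Z)" "\<tau> (\<one> - (\<one> - Z)) = \<infinity>" using Z prj_compl by auto
  obtain Y where Y: "\<And>j. Y j \<in> M" "\<And>j. (Y j)\<^sup>\<star> \<odot> Y j = B" "\<And>j. \<tau> (kerp ((Y j)\<^sup>\<star>)) = \<infinity>"
    "\<And>x. ((\<lambda>j::nat. nsq ((Y j)\<^sup>\<star>) x) has_sum qf (A \<odot> (\<one> - Z)) x) UNIV"
    using bsum_kerp[OF b(2) Z'] by blast
  have sum: "qf (A \<odot> Z) x + qf (A \<odot> (\<one> - Z)) x = qf A x" for x
    by (simp add: apply_simps blinfun.diff_right inner_expand)
  have "((\<lambda>s. nsq ((case_sum X Y s)\<^sup>\<star>) x) has_sum qf A x) (range Inl \<union> range Inr)" for x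
    unfolding sum[symmetric] using X(4)[of x] Y(4)[of x] by (intro has_sum_Un_disjoint) (auto simp: has_sum_reindex o_def)
  then have "((\<lambda>s. nsq ((case_sum X Y s)\<^sup>\<star>) x) has_sum qf A x) UNIV" for x
    by (simp add: UNIV_sum)
  then have "((\<lambda>j. nsq ((case_sum X Y (sum_decode j))\<^sup>\<star>) x) has_sum qf A x) UNIV" for x
    using has_sum_reindex_bij_betw[OF bij_sum_decode, of "\<lambda>s. nsq ((case_sum X Y s)\<^sup>\<star>) x"] by simp
  then show ?thesis
    unfolding nsum_def using X(1-3) Y(1-3)
    by (intro exI[of _ "\<lambda>j. case_sum X Y (sum_decode j)"]) (auto split: sum.split)
qed

lemma tr_infinite_prj:
  assumes "E \<in> M" "pos E" "Z \<in> M" "prj Z" "Z \<odot> E = E \<odot> Z" "\<tau> (E \<odot> Z) = \<infinity>"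
  shows "\<tau> Z = \<infinity>"
  using tr_comp_le_norm[OF assms(1-5)] assms(6) by (auto simp: top_unique ennreal_mult_eq_top_iff)

text \<open>Halving the excess \<open>P\<close> leaves infinite excess on both sides, so
  \<open>core_bsum\<close> applies to each half of \<open>A\<close>.\<close>

lemma nsum_large_excess:
  assumes A: "A \<in> M" "pos A" and P: "P \<in> M" "pos P" "\<tau> P = \<infinity>" and N: "pos N" and AP: "A - \<one> = P - N" "P \<odot> N = 0"
    and B: "B \<in> M" "pos B" "B \<noteq> 0" "norm B \<le> 1"
  shows "nsum B A"
proof -
  have "(P \<odot> N)\<^sup>\<star> = N \<odot> P" using P N by (simp add: pos_sa)
  then have NP: "N \<odot> P = 0" using AP(2) by simp
  have A_eq: "A = \<one> + P - N" using AP(1) by (simp add: algebra_simps)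
  then have APc: "A \<odot> P = P \<odot> A" using AP(2) NP by (simp add: op_distrib)
  have half: "\<tau> Z = \<infinity> \<and> bsum B (\<lambda>x. qf (A \<odot> Z) x)"
    if Z: "Z \<in> M" "prj Z" "Z \<odot> A = A \<odot> Z" "Z \<odot> P = P \<odot> Z" "\<tau> (P \<odot> Z) = \<infinity>" for Z
  proof
    show "\<tau> Z = \<infinity>" by (rule tr_infinite_prj[OF P(1,2) Z(1,2,4,5)])
    have ZN: "Z \<odot> N = N \<odot> Z" using Z(3,4) A_eq by (simp add: op_distrib)
    show "bsum B (\<lambda>x. qf (A \<odot> Z) x)"
    proof (rule core_bsum[OF _ _ _ _ _ _ _ Z(5) B])
      show "A \<odot> Z \<in> M" "P \<odot> Z \<in> M" using A P Z by auto
      show "pos (A \<odot> Z)" "pos (P \<odot> Z)" using A P Z by (auto intro: pos_comp_prj)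
      \<comment> \<open>Off \<open>Z\<close> the operator \<open>A \<odot> Z - \<one>\<close> is
        minus the identity, which has to be put into the negative part.\<close>
      show "pos (N \<odot> Z + (\<one> - Z))" by (intro pos_add pos_comp_prj N Z prj_pos prj_compl ZN)
      show "A \<odot> Z - \<one> = P \<odot> Z - (N \<odot> Z + (\<one> - Z))" by (simp add: A_eq op_distrib)
      have "P \<odot> Z \<odot> (N \<odot> Z) = P \<odot> (N \<odot> (Z \<odot> Z))" by (simp add: op_assoc comp_subst[OF ZN])
      then have "P \<odot> Z \<odot> (N \<odot> Z) = 0" by (simp add: comp_zero_left[OF AP(2)])
      moreover have "P \<odot> Z \<odot> (\<one> - Z) = 0" using prj_idem[OF Z(2)] by (simp add: op_distrib op_assoc)
      ultimately show "P \<odot> Z \<odot> (N \<odot> Z + (\<one> - Z)) = 0" by (simp only: op_distrib) simp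
    qed
  qed
  obtain Z where Z: "Z \<in> M" "prj Z" "Z \<odot> A = A \<odot> Z" "Z \<odot> P = P \<odot> Z" "\<tau> (P \<odot> Z) = \<infinity>" "\<tau> (P \<odot> (\<one> - Z)) = \<infinity>"
    using halving[OF A(1) pos_sa[OF A(2)] P(1,2) APc P(3)] by blast
  have "\<tau> (\<one> - Z) = \<infinity> \<and> bsum B (\<lambda>x. qf (A \<odot> (\<one> - Z)) x)"
    by (rule half) (use Z in \<open>auto simp: prj_compl op_distrib\<close>)
  then show ?thesis using half[OF Z(1-5)] by (intro nsum_split[OF Z(1,2)]) auto
qed

lemma nsum_projection:
  assumes A: "A \<in> M" "prj A" "\<tau> A = \<infinity>" and B: "B \<in> M" "pos B" "B \<noteq> 0" "norm B \<le> 1"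
  shows "nsum B A"
proof -
  have half: "\<tau> Z = \<infinity> \<and> bsum B (\<lambda>x. qf (A \<odot> Z) x)"
    if Z: "Z \<in> M" "prj Z" "Z \<odot> A = A \<odot> Z" "\<tau> (A \<odot> Z) = \<infinity>" for Z
  proof
    show "\<tau> Z = \<infinity>" by (rule tr_infinite_prj[OF A(1) prj_pos[OF A(2)] Z])
    show "bsum B (\<lambda>x. qf (A \<odot> Z) x)"
      using A Z prj_comp_commute[OF A(2) Z(2)] by (intro projection_bsum[OF B]) auto
  qed
  obtain Z where Z: "Z \<in> M" "prj Z" "Z \<odot> A = A \<odot> Z" "\<tau> (A \<odot> Z) = \<infinity>" "\<tau> (A \<odot> (\<one> - Z)) = \<infinity>"
    using halving[OF A(1) prj_sa[OF A(2)] A(1) prj_pos[OF A(2)] refl A(3)] by blast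
  have "\<tau> (\<one> - Z) = \<infinity> \<and> bsum B (\<lambda>x. qf (A \<odot> (\<one> - Z)) x)"
    by (rule half) (use Z in \<open>auto simp: prj_compl op_distrib\<close>)
  then show ?thesis using half[OF Z(1-4)] by (intro nsum_split[OF Z(1,2)]) auto
qed

text \<open>The piece \<open>e\<close> for \<open>bsum_two_parts\<close> is a slice on which
  \<open>B\<close> is nonzero. It exists because \<open>B\<close> is more than its eigenprojection
  for the value one, and this nonzero eigenprojection lies in the complementary part.\<close>

lemma nsum_eigenvalue:
  assumes A: "A \<in> M" "pos A" and F: "F \<in> M" "prj F" "A \<odot> F = F" "\<tau> F = \<infinity>"
    and B: "B \<in> M" "pos B" "norm B \<le> 1" "spec B {1} \<noteq> 0" "B \<noteq> spec B {1}"
  shows "nsum B A"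
proof -
  have FA: "F \<odot> A = F" using F(2,3) A(2) radj_comp[of A F] by (simp add: prj_sa pos_sa)
  then have AF: "A \<odot> F = F \<odot> A" using F(3) by simp
  note sl = slice[OF B(2,3)]
  let ?E = "spec B {1}"
  have E: "prj ?E" by (rule spec_proj(1)[OF pos_sa[OF B(2)]]) simp
  have "(B - \<one>) \<odot> ?E = 0" using spec_singleton[OF pos_sa[OF B(2)], of 1] by simp
  then have BE: "B \<odot> ?E = ?E" by (simp add: op_distrib)
  obtain n where n: "B \<odot> slice B n \<noteq> 0"
  proof (rule ccontr)
    assume *: "\<not> thesis"
    have "B \<odot> slice B n = 0" for n using * that by blast
    then have "((\<lambda>n::nat. 0) has_sum ap (B \<odot> (\<one> - ?E)) x) UNIV" for x
      using sl(5)[of x] by (simp only: blinfun.zero_left)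
    then have "ap (B \<odot> (\<one> - ?E)) x = 0" for x by (rule has_sum_unique[OF _ has_sum_0]) simp
    then have "B \<odot> (\<one> - ?E) = 0" by (intro blinfun_eqI) (simp add: blinfun.zero_left)
    then show False using B(5) BE by (simp add: op_distrib)
  qed
  have "B \<odot> (\<one> - slice B n) \<noteq> 0"
  proof
    assume "B \<odot> (\<one> - slice B n) = 0"
    then have "B \<odot> (\<one> - slice B n) \<odot> ?E = 0" by simp
    then have "?E = 0" by (simp add: op_distrib op_assoc sl(6) BE)
    then show False using B(4) by simp
  qed
  then have two: "bsum B (\<lambda>x. qf A' x)"
    if "A' \<in> M" "pos A'" "F' \<in> M" "prj F'" "A' \<odot> F' = F'" "\<tau> F' = \<infinity>" for A' F'
    using bsum_two_parts[OF that B(1-3) sl(1)[OF B(1)] _ sl(3) n _ sl(4) level(1)] sl(2) by (simp add: orth_prjs_def)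
  have half: "\<tau> Z = \<infinity> \<and> bsum B (\<lambda>x. qf (A \<odot> Z) x)"
    if Z: "Z \<in> M" "prj Z" "Z \<odot> A = A \<odot> Z" "Z \<odot> F = F \<odot> Z" "\<tau> (F \<odot> Z) = \<infinity>" for Z
  proof
    show "\<tau> Z = \<infinity>" by (rule tr_infinite_prj[OF F(1) prj_pos[OF F(2)] Z(1,2,4,5)])
    show "bsum B (\<lambda>x. qf (A \<odot> Z) x)"
    proof (rule two[OF _ _ _ _ _ Z(5)])
      show "A \<odot> Z \<in> M" "F \<odot> Z \<in> M" using A F Z by auto
      show "pos (A \<odot> Z)" by (rule pos_comp_prj[OF A(2) Z(2,3)])
      show "prj (F \<odot> Z)" by (rule prj_comp_commute[OF F(2) Z(2) Z(4)[symmetric]])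
      have "Z \<odot> (F \<odot> Z) = F \<odot> Z" using comp_subst[OF Z(4), of Z] prj_idem[OF Z(2)] by (simp add: op_assoc)
      then show "A \<odot> Z \<odot> (F \<odot> Z) = F \<odot> Z" by (simp add: op_assoc comp_subst[OF F(3)])
    qed
  qed
  obtain Z where Z: "Z \<in> M" "prj Z" "Z \<odot> A = A \<odot> Z" "Z \<odot> F = F \<odot> Z" "\<tau> (F \<odot> Z) = \<infinity>" "\<tau> (F \<odot> (\<one> - Z)) = \<infinity>"
    using halving[OF A(1) pos_sa[OF A(2)] F(1) prj_pos[OF F(2)] AF F(4)] by blast
  have "\<tau> (\<one> - Z) = \<infinity> \<and> bsum B (\<lambda>x. qf (A \<odot> (\<one> - Z)) x)"
    by (rule half) (use Z in \<open>auto simp: prj_compl op_distrib\<close>)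
  then show ?thesis using half[OF Z(1-5)] by (intro nsum_split[OF Z(1,2)]) auto
qed

text \<open>The projections of even and of odd index form towers again, since passing to later
  members only raises the level. They yield the two orthogonal pieces of \<open>A\<close>.\<close>

lemma nsum_no_eigenvalue:
  assumes A: "A \<in> M" "pos A" "\<And>s. s < 1 \<Longrightarrow> \<tau> (spec A {s<..}) = \<infinity>"
    and B: "B \<in> M" "pos B" "B \<noteq> 0" "norm B \<le> 1" "spec B {1} = 0"
  shows "nsum B A"
proof -
  obtain F where F: "towers A F" using towers_exist[OF A(1) pos_sa[OF A(2)] A(3)] by blast
  have Fo: "orth_prjs UNIV F" and FM: "F n \<in> M" and FA: "F n \<odot> A = A \<odot> F n" and Finf: "\<tau> (F n) = \<infinity>"
    and Fp: "pos (A \<odot> F n - level (Suc (Suc n)) *\<^sub>R F n)" for n using F by (auto simp: towers_def)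
  have Fprj: "prj (F n)" for n using Fo by (simp add: orth_prjs_def)
  have half: "\<tau> Z = \<infinity> \<and> bsum B (\<lambda>x. qf (A \<odot> Z) x)"
    if Z: "Z \<in> M" "prj Z" "Z \<odot> A = A \<odot> Z" and g: "inj g" "\<And>n. n \<le> g n" "\<And>n. Z \<odot> F (g n) = F (g n)" for Z g
  proof
    have FZ: "F (g n) \<odot> Z = F (g n)" for n by (rule prj_diff(2)[OF Fprj Z(2) g(3)])
    show "\<tau> Z = \<infinity>" using tr_prj_mono[OF FM Z(1) Fprj Z(2) g(3), of 0] Finf by (simp add: top_unique)
    have "towers (A \<odot> Z) (\<lambda>n. F (g n))"
      unfolding towers_def
    proof (intro conjI allI)
      show "orth_prjs UNIV (\<lambda>n. F (g n))" using Fo g(1) by (auto simp: orth_prjs_def inj_eq)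
      fix n
      have 1: "A \<odot> Z \<odot> F (g n) = A \<odot> F (g n)" by (simp add: op_assoc g(3))
      have "F (g n) \<odot> (A \<odot> Z) = A \<odot> (F (g n) \<odot> Z)" using FA by (simp flip: op_assoc)
      then show "F (g n) \<odot> (A \<odot> Z) = A \<odot> Z \<odot> F (g n)" by (simp add: 1 FZ)
      have "pos ((A \<odot> F (g n) - level (Suc (Suc (g n))) *\<^sub>R F (g n)) +
        (level (Suc (Suc (g n))) - level (Suc (Suc n))) *\<^sub>R F (g n))"
        using level_mono[of "Suc (Suc n)" "Suc (Suc (g n))"] g(2)[of n] by (intro pos_add Fp pos_scaleR prj_pos Fprj) simp
      then show "pos (A \<odot> Z \<odot> F (g n) - level (Suc (Suc n)) *\<^sub>R F (g n))" by (simp add: 1 algebra_simps)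
    qed (use FM Finf in auto)
    then show "bsum B (\<lambda>x. qf (A \<odot> Z) x)"
      using A Z by (intro bsum_towers[OF _ _ _ B] pos_comp_prj) auto
  qed
  define Z where "Z = opsum F (range (\<lambda>i. 2 * i))"
  have Fo': "orth_prjs (range (\<lambda>i. 2 * i)) F" by (rule orth_prjs_subset[OF Fo]) simp
  note S = prj_opsum[OF Fo', folded Z_def]
  have Z: "Z \<in> M" "prj Z" "Z \<odot> A = A \<odot> Z"
    using M_opsum_prj[OF Fo' FM] S(2) op_sum_commute[OF S(1), of A] FA by (simp_all add: Z_def)
  have h1: "\<tau> Z = \<infinity> \<and> bsum B (\<lambda>x. qf (A \<odot> Z) x)"
    by (rule half[OF Z, of "\<lambda>i. 2 * i"]) (use S(3) in \<open>auto simp: inj_def\<close>)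
  have "F (Suc (2 * n)) \<odot> Z = 0" for n
  proof (rule op_sum_eq_zero[OF S(1)])
    fix i :: nat assume "i \<in> range (\<lambda>i. 2 * i)"
    then have "Suc (2 * n) \<noteq> i" by (auto simp: Suc_double_not_eq_double)
    then show "F (Suc (2 * n)) \<odot> F i = 0" using Fo by (simp add: orth_prjs_def)
  qed
  then have "Z \<odot> F (Suc (2 * n)) = 0" for n using prj_add(2)[OF Fprj Z(2)] by blast
  then have "\<tau> (\<one> - Z) = \<infinity> \<and> bsum B (\<lambda>x. qf (A \<odot> (\<one> - Z)) x)"
    by (intro half[of _ "\<lambda>n. Suc (2 * n)"]) (use Z in \<open>auto simp: inj_def prj_compl op_distrib\<close>)
  then show ?thesis using h1 by (intro nsum_split[OF Z(1,2)]) auto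
qed

end

section \<open>The complex structure\<close>

lemma scaleC_scaleR: "scaleC c (r *\<^sub>R x) = r *\<^sub>R scaleC c (x :: 'h::complex_hilbert_space)"
  by (simp add: scaleC_of_real[symmetric] scaleC_scaleC mult.commute)

lemma inner_scaleC: "inner (scaleC c x) y = inner x (scaleC (cnj c) (y :: 'h::complex_hilbert_space))"
proof -
  have "cinner x (scaleC (cnj c) y) = c * cinner x y"
    by (subst cinner_commute, subst cinner_scaleC_left) (simp flip: cinner_commute)
  then show ?thesis by (simp add: inner_eq_Re_cinner cinner_scaleC_left)
qed

lemma norm_scaleC: "norm (scaleC c x) = cmod c * norm (x :: 'h::complex_hilbert_space)"
proof -
  have "(norm (scaleC c x))\<^sup>2 = inner x (scaleC (cnj c * c) x)"
    by (simp add: power2_norm_eq_inner inner_scaleC scaleC_scaleC)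
  also have "cnj c * c = complex_of_real ((cmod c)\<^sup>2)" by (metis complex_norm_square mult.commute)
  also have "inner x (scaleC \<dots> x) = (cmod c * norm x)\<^sup>2"
    by (simp add: scaleC_of_real power_mult_distrib power2_norm_eq_inner)
  finally show ?thesis by (simp add: power2_eq_iff_nonneg)
qed

lemma scaleC_minus_left: "scaleC (- c) x = - scaleC c (x :: 'h::complex_hilbert_space)"
  using scaleC_add_left[of "- c" c x] scaleC_of_real[of 0 x] by (simp add: eq_neg_iff_add_eq_0)

definition multC :: "complex \<Rightarrow> 'h::complex_hilbert_space operator" where
  "multC c = Blinfun (scaleC c)"

lemma multC_apply [simp]: "ap (multC c) x = scaleC c (x :: 'h::complex_hilbert_space)"
proof -
  have "bounded_linear (scaleC c :: 'h \<Rightarrow> 'h)"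
    by (rule bounded_linear_intro[where K="cmod c"]) (auto simp: scaleC_add_right scaleC_scaleR norm_scaleC mult.commute)
  then show ?thesis by (simp add: multC_def bounded_linear_Blinfun_apply)
qed

lemma radj_multC: "(multC c)\<^sup>\<star> = multC (cnj c)"
  by (rule radj_unique) (simp add: inner_scaleC)

lemma bounded_ops_iff: "A \<in> bounded_ops \<longleftrightarrow> (\<forall>c. multC c \<odot> A = A \<odot> multC c)"
  by (force simp: bounded_ops_def fun_eq_iff simp flip: blinfun_apply_inject)

lemma cinner_Im: "Im (cinner x y) = - inner (scaleC \<i> x) (y :: 'h::complex_hilbert_space)"
  by (simp add: inner_eq_Re_cinner cinner_scaleC_left)

lemma bounded_ops_radj: "A \<in> bounded_ops \<Longrightarrow> A\<^sup>\<star> \<in> bounded_ops"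
proof -
  assume "A \<in> bounded_ops"
  then have "(multC (cnj c) \<odot> A)\<^sup>\<star> = (A \<odot> multC (cnj c))\<^sup>\<star>" for c by (simp add: bounded_ops_iff)
  then show ?thesis by (simp add: bounded_ops_iff radj_multC)
qed

text \<open>The imaginary part of \<open>cinner\<close> is up to sign a real inner product with
  \<open>\<i>\<close> times the first vector, so a complex-linear map has the same real and complex
  adjoint.\<close>

lemma adj_eq: 
  fixes A :: "'h::complex_hilbert_space operator"
  assumes "A \<in> bounded_ops"
  shows "adj A = A\<^sup>\<star>"
  unfolding adj_def
proof (rule the_equality)
  have "Im (cinner (ap A x) y) = Im (cinner x (ap (A\<^sup>\<star>) y))" for x y
    using assms by (simp add: cinner_Im inner_radj[symmetric] bounded_ops_def)
  then show "\<forall>x y. cinner (ap A x) y = cinner x (ap (A\<^sup>\<star>) y)"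
    by (simp add: complex_eq_iff inner_eq_Re_cinner[symmetric] inner_radj)
  fix B assume "\<forall>x y. cinner (ap A x) y = cinner x (ap B y)"
  then show "B = A\<^sup>\<star>" by (intro radj_unique[symmetric]) (simp add: inner_eq_Re_cinner)
qed

lemma cinner_sa:
  fixes A :: "'h::complex_hilbert_space operator"
  assumes A: "A \<in> bounded_ops" "A\<^sup>\<star> = A"
  shows "cinner (ap A x) x = complex_of_real (qf A x)"
proof -
  have "inner (scaleC \<i> (ap A x)) x = inner (ap A x) (scaleC (cnj \<i>) x)" by (rule inner_scaleC)
  also have "\<dots> = inner x (scaleC (cnj \<i>) (ap A x))"
    using A(1) inner_radj[of A x "scaleC (cnj \<i>) x"] A(2) by (simp add: bounded_ops_def)
  also have "\<dots> = - inner (scaleC \<i> (ap A x)) x"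
    by (simp add: scaleC_minus_left inner_commute)
  finally show ?thesis by (simp add: complex_eq_iff cinner_Im inner_eq_Re_cinner[symmetric])
qed

text \<open>Real values of the complex form force selfadjointness: the real form of
  \<open>\<i>\<close> times \<open>A\<close> then vanishes, so this operator is skew.\<close>

lemma positive_op_iff: "positive_op A \<longleftrightarrow> A \<in> bounded_ops \<and> pos A"
proof
  assume p: "positive_op A"
  then have A: "A \<in> bounded_ops" by (simp add: positive_op_def)
  have z: "Im (cinner (ap A x) x) = 0" "0 \<le> Re (cinner (ap A x) x)" for x
    using p by (auto simp: positive_op_def complex_nonneg_Reals_iff)
  let ?S = "multC \<i> \<odot> A"
  have "?S + ?S\<^sup>\<star> = 0"
  proof (rule sa_eqI)
    show "qf (?S + ?S\<^sup>\<star>) x = inner (ap 0 x) x" for x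
      using z(1)[of x] inner_radj[of ?S x x]
      by (simp add: cinner_Im apply_simps inner_expand blinfun.zero_left inner_commute)
  qed (simp_all add: add.commute)
  moreover have "?S\<^sup>\<star> = - (multC \<i> \<odot> A\<^sup>\<star>)"
  proof -
    have "multC (- \<i>) = - (multC \<i> :: 'a operator)" by (intro blinfun_eqI) (simp add: blinfun.minus_left scaleC_minus_left)
    moreover have "A\<^sup>\<star> \<odot> multC (- \<i>) = multC (- \<i>) \<odot> A\<^sup>\<star>"
      using bounded_ops_radj[OF A] by (simp add: bounded_ops_iff)
    ultimately show ?thesis by (simp add: radj_multC op_distrib)
  qed
  ultimately have "multC \<i> \<odot> (A - A\<^sup>\<star>) = 0" by (simp add: op_distrib)
  then have "multC (- \<i>) \<odot> (multC \<i> \<odot> (A - A\<^sup>\<star>)) = 0" by simp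
  moreover have "multC (- \<i>) \<odot> multC \<i> = (\<one> :: 'a operator)"
    using scaleC_of_real[of 1] by (intro blinfun_eqI) (simp add: scaleC_scaleC)
  ultimately have "A = A\<^sup>\<star>" by (simp flip: op_assoc)
  then show "A \<in> bounded_ops \<and> pos A" using A z(2) by (simp add: pos_def inner_eq_Re_cinner)
next
  assume "A \<in> bounded_ops \<and> pos A"
  then show "positive_op A"
    by (simp add: positive_op_def cinner_sa pos_sa pos_ge complex_nonneg_Reals_iff)
qed

lemma projection_iff: "projection P \<longleftrightarrow> P \<in> bounded_ops \<and> prj P"
  by (auto simp: projection_def prj_def adj_eq)

lemma bounded_ops_commute:
  "A \<in> bounded_ops \<Longrightarrow> (\<And>U. U \<odot> A = A \<odot> U \<Longrightarrow> U \<odot> T = T \<odot> U) \<Longrightarrow> T \<in> bounded_ops"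
  by (simp add: bounded_ops_iff)

lemma bounded_ops_closed [intro]:
  "\<one> \<in> bounded_ops" "A \<in> bounded_ops \<Longrightarrow> B \<in> bounded_ops \<Longrightarrow> A + B \<in> bounded_ops"
  "A \<in> bounded_ops \<Longrightarrow> B \<in> bounded_ops \<Longrightarrow> A - B \<in> bounded_ops"
  "A \<in> bounded_ops \<Longrightarrow> r *\<^sub>R A \<in> bounded_ops"
  "A \<in> bounded_ops \<Longrightarrow> B \<in> bounded_ops \<Longrightarrow> A \<odot> B \<in> bounded_ops"
  by (simp_all add: bounded_ops_iff op_distrib op_scale) (metis op_assoc)

lemma bounded_ops_kerp:
  assumes "C \<in> bounded_ops"
  shows "kerp C \<in> bounded_ops"
  using assms bounded_ops_radj[OF assms] kerp_commute unfolding bounded_ops_iff by metis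

lemma prj_eq_of_range:
  assumes "prj P" "prj Q" "range (ap P) = range (ap Q)"
  shows "P = Q"
proof -
  have 1: "S \<odot> T = T" if S: "prj S" "range (ap T) = range (ap S)" for S T :: "'a operator"
  proof (rule blinfun_eqI)
    fix x
    obtain y where "ap T x = ap S y" using S(2) by blast
    then show "ap (S \<odot> T) x = ap T x" by (simp add: prj_idem_apply[OF S(1)])
  qed
  have "P \<odot> Q = Q" "Q \<odot> P = P" using 1 assms by auto
  then show ?thesis using prj_diff(2)[OF assms(1,2)] by simp
qed

lemma null_proj_eq:
  assumes "C \<in> bounded_ops"
  shows "null_proj C = kerp C"
  unfolding null_proj_def
proof (rule the_equality)
  have r: "range (ap (kerp C)) = {x. ap C x = 0}"
    by (auto simp: kerp_null) (metis kerp_fix rangeI)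
  then show "projection (kerp C) \<and> range (ap (kerp C)) = {x. ap C x = 0}"
    by (simp add: projection_iff bounded_ops_kerp[OF assms])
  fix P assume "projection P \<and> range (ap P) = {x. ap C x = 0}"
  then show "P = kerp C" using r by (intro prj_eq_of_range) (auto simp: projection_iff)
qed

lemma pos_part_eq:
  assumes X: "X \<in> bounded_ops" "X\<^sup>\<star> = X"
  shows "pos_part X = posp X"
  unfolding pos_part_def
proof (rule the_equality)
  have "posp X \<in> bounded_ops" "negp X \<in> bounded_ops"
    by (rule bounded_ops_commute[OF X(1)], erule posp(6,7)[OF X(2)])+
  then show "\<exists>N. positive_op (posp X) \<and> positive_op N \<and> X = posp X - N \<and> posp X \<odot> N = 0"
    using posp(1-4)[OF X(2)] by (auto simp: positive_op_iff)
  fix P assume "\<exists>N. positive_op P \<and> positive_op N \<and> X = P - N \<and> P \<odot> N = 0"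
  then show "P = posp X" using pos_part_unique posp(1-4)[OF X(2)] unfolding positive_op_iff by metis
qed

lemma spectral_measure_of_spec:
  assumes A: "A \<in> bounded_ops" "A\<^sup>\<star> = A"
  shows "spectral_measure_of A (spec A)"
proof -
  have "projection_valued_measure (spec A)"
    unfolding projection_valued_measure_def
  proof (intro conjI ballI allI impI)
    show "projection (spec A S)" if "S \<in> sets borel" for S
      unfolding projection_iff using spec_proj(1)[OF A(2) that] spec_proj(2)[OF A(2) that]
      by (auto intro: bounded_ops_commute[OF A(1)])
    show "spec A UNIV = \<one>" by (rule spec_UNIV[OF A(2)])
    show "(\<lambda>n. ap (spec A (F n)) x) sums ap (spec A (\<Union>n. F n)) x"
      if "range F \<subseteq> sets borel" "disjoint_family F" for F :: "nat \<Rightarrow> real set" and x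
      by (rule has_sum_imp_sums[OF spec_sum(2)[OF A(2)]]) (use that in auto)
  qed
  moreover have "scalar_spectral_measure (spec A) x = mu A x" for x
  proof -
    have "scalar_spectral_measure (spec A) x = measure_of (space (mu A x)) (sets (mu A x)) (emeasure (mu A x))"
      unfolding scalar_spectral_measure_def sets_mu[OF A(2)] space_mu[OF A(2)]
      by (rule measure_of_eq)
        (use sets.sigma_sets_eq[of "borel :: real measure"] in \<open>auto simp: spec_proj(3)[OF A(2)] inner_eq_Re_cinner\<close>)
    then show ?thesis by (simp only: measure_of_of_measure)
  qed
  ultimately show ?thesis
    unfolding spectral_measure_of_def
    using integrable_mu[OF A(2), of UNIV] integral_mu[OF A(2)] cinner_sa[OF A] by simp
qed

section \<open>Uniqueness of the spectral projections of points\<close>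

text \<open>\<open>spectral_proj\<close> is a definite description over all spectral measures, so
  every such \<open>E\<close> must be shown to take the same value at a point. That value is
  identified with the kernel projection of \<open>A - b\<close>.\<close>

context
  fixes A :: "'h::complex_hilbert_space operator" and E :: "real set \<Rightarrow> 'h operator"
  assumes A: "A\<^sup>\<star> = A" and E: "spectral_measure_of A E"
begin

lemma pvm_prj: "S \<in> sets borel \<Longrightarrow> prj (E S)"
  using E by (simp add: spectral_measure_of_def projection_valued_measure_def projection_iff)

lemma pvm_UNIV: "E UNIV = \<one>"
  using E by (simp add: spectral_measure_of_def projection_valued_measure_def)

lemma pvm_sums:
  fixes F :: "nat \<Rightarrow> real set"
  assumes "\<And>n. F n \<in> sets borel" "disjoint_family F"
  shows "(\<lambda>n. ap (E (F n)) x) sums ap (E (\<Union>n. F n)) x"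
proof -
  have "range F \<subseteq> sets borel" using assms(1) by auto
  then show ?thesis using E assms(2) unfolding spectral_measure_of_def projection_valued_measure_def by blast
qed

abbreviation nu :: "'h \<Rightarrow> real measure" where "nu \<equiv> scalar_spectral_measure E"

lemma sets_nu: "sets (nu x) = sets borel" and space_nu: "space (nu x) = UNIV"
  using sets.sigma_sets_eq[of "borel :: real measure"]
  by (simp_all add: scalar_spectral_measure_def sets_measure_of space_measure_of_conv)

lemma pvm_inner_nonneg: "S \<in> sets borel \<Longrightarrow> 0 \<le> qf (E S) x"
  by (rule pos_ge[OF prj_pos[OF pvm_prj]])

lemma emeasure_nu:
  assumes "S \<in> sets borel"
  shows "emeasure (nu x) S = ennreal (qf (E S) x)"
proof -
  let ?\<mu> = "\<lambda>S. ennreal (Re (cinner (ap (E S) x) x))"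
  have "(\<lambda>n::nat. ap (E {}) x) sums ap (E (\<Union>n::nat. {})) x"
    by (rule pvm_sums) (auto simp: disjoint_family_on_def)
  then have "ap (E {}) x = 0" by (simp add: sums_iff summable_const_iff)
  then have "positive (sets (nu x)) ?\<mu>" by (simp add: positive_def inner_eq_Re_cinner[symmetric])
  moreover have "countably_additive (sets (nu x)) ?\<mu>"
  proof (rule countably_additiveI)
    fix F :: "nat \<Rightarrow> real set"
    assume F: "range F \<subseteq> sets (nu x)" "disjoint_family F"
    then have B: "F n \<in> sets borel" for n by (auto simp: sets_nu)
    have "(\<lambda>n. qf (E (F n)) x) sums qf (E (\<Union>n. F n)) x"
      by (rule bounded_linear.sums[OF bounded_linear_inner_left pvm_sums[OF B F(2)]])
    then show "(\<Sum>n. ?\<mu> (F n)) = ?\<mu> (\<Union>n. F n)"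
      using pvm_inner_nonneg[OF B] by (intro suminf_ennreal_eq) (auto simp: inner_eq_Re_cinner)
  qed
  ultimately show ?thesis
    using emeasure_measure_of[OF scalar_spectral_measure_def, of E x S] assms
    by (simp add: sets_nu inner_eq_Re_cinner sets.space_closed[of borel, simplified])
qed

lemma pvm_Un:
  assumes S: "S \<in> sets borel" "T \<in> sets borel" "S \<inter> T = {}"
  shows "E (S \<union> T) = E S + E T" "E S \<odot> E T = 0"
proof -
  have q: "qf (E (S \<union> T)) x = qf (E S) x + qf (E T) x" for x
  proof -
    have "emeasure (nu x) S + emeasure (nu x) T = emeasure (nu x) (S \<union> T)"
      by (rule plus_emeasure) (use S in \<open>auto simp: sets_nu\<close>)
    then show ?thesis using S pvm_inner_nonneg
      by (simp add: emeasure_nu ennreal_plus[symmetric] add_nonneg_nonneg del: ennreal_plus)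
  qed
  show "E (S \<union> T) = E S + E T"
    by (rule sa_eqI) (use S q in \<open>auto simp: prj_sa[OF pvm_prj] apply_simps inner_expand\<close>)
  have "qf (E S) x + qf (E T) x \<le> (norm x)\<^sup>2" for x
    using q[of x] prj_norm_le[OF pvm_prj[of "S \<union> T"], of x] prj_inner[OF pvm_prj[of "S \<union> T"], of x] S by simp
  then show "E S \<odot> E T = 0" using S by (intro prj_orth_of_bound pvm_prj)
qed

lemma pvm_Compl: "S \<in> sets borel \<Longrightarrow> E (- S) = \<one> - E S"
  using pvm_Un(1)[of S "- S"] pvm_UNIV by (simp add: Compl_partition algebra_simps)

lemma pvm_subset:
  assumes "T \<in> sets borel" "S \<in> sets borel" "T \<subseteq> S"
  shows "E S \<odot> E T = E T" "E T \<odot> E S = E T"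
proof -
  have "E S = E T + E (S - T)" using pvm_Un(1)[of T "S - T"] assms by (simp add: Un_absorb1)
  moreover have "E (S - T) \<odot> E T = 0" "E T \<odot> E (S - T) = 0" by (rule pvm_Un(2); use assms in auto)+
  ultimately show "E S \<odot> E T = E T" "E T \<odot> E S = E T"
    using prj_idem[OF pvm_prj[OF assms(1)]] by (simp_all add: op_distrib)
qed

lemma integrable_nu: "integrable (nu x) (\<lambda>t. t)" and integral_nu: "integral\<^sup>L (nu x) (\<lambda>t. t) = qf A x"
proof -
  have "integrable (nu x) (\<lambda>t. t) \<and> cinner (ap A x) x = complex_of_real (integral\<^sup>L (nu x) (\<lambda>t. t))"
    using E by (simp add: spectral_measure_of_def)
  then show "integrable (nu x) (\<lambda>t. t)" "integral\<^sup>L (nu x) (\<lambda>t. t) = qf A x"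
    by (simp_all add: inner_eq_Re_cinner)
qed

text \<open>On \<open>S\<close> the measures of \<open>z\<close> and of its projection
  \<open>?w\<close> agree, and the latter has no mass outside \<open>S\<close>.\<close>

lemma integral_nu_indicator:
  assumes S: "S \<in> sets borel"
  shows "integral\<^sup>L (nu z) (\<lambda>t. indicator S t * t) =
    qf A (ap (E S) z)"
proof -
  let ?w = "ap (E S) z"
  have eq: "emeasure (nu ?w) T = emeasure (nu z) T" if T: "T \<in> sets borel" "T \<subseteq> S" for T
  proof -
    have "qf (E T) ?w = inner (ap (E T \<odot> E S) z) ?w" by simp
    also have "\<dots> = qf (E S \<odot> E T) z"
      using inner_radj[of "E S" "ap (E T) z" z] prj_sa[OF pvm_prj[OF S]] by (simp add: pvm_subset(2)[OF T(1) S T(2)] del: blinfun_apply_blinfun_compose) simp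
    also have "\<dots> = qf (E T) z" by (simp only: pvm_subset(1)[OF T(1) S T(2)])
    finally show ?thesis by (simp add: emeasure_nu[OF T(1)])
  qed
  have "restrict_space (nu ?w) S = restrict_space (nu z) S"
  proof (rule measure_eqI)
    show "sets (restrict_space (nu ?w) S) = sets (restrict_space (nu z) S)" by (simp add: sets_restrict_space sets_nu)
    fix T assume "T \<in> sets (restrict_space (nu ?w) S)"
    then have T: "T \<in> sets borel" "T \<subseteq> S" using S by (auto simp: sets_restrict_space sets_nu)
    then show "emeasure (restrict_space (nu ?w) S) T = emeasure (restrict_space (nu z) S) T"
      using S by (simp add: emeasure_restrict_space sets_nu space_nu eq)
  qed
  then have "integral\<^sup>L (restrict_space (nu ?w) S) (\<lambda>t. t) = integral\<^sup>L (restrict_space (nu z) S) (\<lambda>t. t)" by simp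
  then have "integral\<^sup>L (nu z) (\<lambda>t. indicator S t * t) = integral\<^sup>L (nu ?w) (\<lambda>t. indicator S t * t)"
    using S by (simp add: integral_restrict_space sets_nu space_nu)
  also have "\<dots> = integral\<^sup>L (nu ?w) (\<lambda>t. t)"
  proof (rule integral_cong_AE)
    have "E (- S) \<odot> E S = 0" using S by (intro pvm_Un(2)) auto
    then have "ap (E (- S)) ?w = 0" by (metis blinfun.zero_left blinfun_apply_blinfun_compose)
    then have "emeasure (nu ?w) (- S) = 0" using S by (simp add: emeasure_nu)
    then have "AE t in nu ?w. t \<in> S"
      using S by (intro AE_I[where N="- S"]) (auto simp: sets_nu)
    then show "AE t in nu ?w. indicator S t * t = t" by eventually_elim simp
  qed (use S in \<open>simp_all add: measurable_cong_sets[OF sets_nu refl]\<close>)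
  also have "\<dots> = qf A ?w" by (rule integral_nu)
  finally show ?thesis .
qed

lemma integrable_nu_indicator: "S \<in> sets borel \<Longrightarrow> integrable (nu z) (\<lambda>t. indicator S t * t)"
  using integrable_mult_indicator[OF _ integrable_nu, of S z] by (simp add: sets_nu)

text \<open>Integrating separately over \<open>S\<close> and its complement shows that
  \<open>A\<close> has no off-diagonal part with respect to \<open>E S\<close>.\<close>

lemma pvm_commute:
  assumes S: "S \<in> sets borel"
  shows "A \<odot> E S = E S \<odot> A \<odot> E S" "A \<odot> E S = E S \<odot> A"
proof -
  let ?P = "E S" and ?R = "\<one> - E S"
  have P: "?P\<^sup>\<star> = ?P" "?P \<odot> ?P = ?P" using pvm_prj[OF S] by (auto simp: prj_def)
  have "A = ?P \<odot> A \<odot> ?P + ?R \<odot> A \<odot> ?R"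
  proof (rule sa_eqI[OF A])
    show "(?P \<odot> A \<odot> ?P + ?R \<odot> A \<odot> ?R)\<^sup>\<star> = ?P \<odot> A \<odot> ?P + ?R \<odot> A \<odot> ?R"
      by (simp add: A P op_assoc)
    fix z
    have "integral\<^sup>L (nu z) (\<lambda>t. indicator S t * t + indicator (- S) t * t) =
      integral\<^sup>L (nu z) (\<lambda>t. indicator S t * t) + integral\<^sup>L (nu z) (\<lambda>t. indicator (- S) t * t)"
      using S by (intro Bochner_Integration.integral_add integrable_nu_indicator) auto
    also have "(\<lambda>t. indicator S t * t + indicator (- S) t * t) = (\<lambda>t::real. t)" by (auto simp: indicator_def)
    finally have "qf A z =
      qf A (ap ?P z) + qf A (ap ?R z)"
      using S by (simp add: integral_nu integral_nu_indicator pvm_Compl del: minus_blinfun.rep_eq)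
    moreover have "qf (T \<odot> A \<odot> T) z = qf A (ap T z)"
      if "T\<^sup>\<star> = T" for T :: "'h operator"
      using inner_radj[of T "ap A (ap T z)" z] that by simp
    ultimately show "qf A z = qf (?P \<odot> A \<odot> ?P + ?R \<odot> A \<odot> ?R) z"
      using P(1) by (simp add: blinfun.add_left inner_add_left del: blinfun_apply_blinfun_compose minus_blinfun.rep_eq)
  qed
  then obtain T where T: "A = ?P \<odot> A \<odot> ?P + ?R \<odot> T \<odot> ?R" by blast
  have "?R \<odot> ?P = 0" "?P \<odot> ?R = 0" using P by (simp_all add: op_distrib)
  have "A \<odot> ?P = ?P \<odot> A \<odot> ?P \<odot> ?P + ?R \<odot> T \<odot> (?R \<odot> ?P)"
    by (subst T) (simp only: op_distrib op_assoc)
  then show 1: "A \<odot> ?P = ?P \<odot> A \<odot> ?P" using \<open>?R \<odot> ?P = 0\<close> P by (simp add: op_assoc)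
  have "(A \<odot> ?P)\<^sup>\<star> = (?P \<odot> A \<odot> ?P)\<^sup>\<star>" by (rule arg_cong[OF 1])
  then have "?P \<odot> A = ?P \<odot> A \<odot> ?P" by (simp only: radj_comp A P op_assoc)
  from trans[OF 1 this[symmetric]] show "A \<odot> ?P = ?P \<odot> A" .
qed

lemma measure_nu: "S \<in> sets borel \<Longrightarrow> measure (nu x) S = qf (E S) x"
  by (simp add: measure_def emeasure_nu pvm_inner_nonneg)

lemma integrable_nu_const: "S \<in> sets borel \<Longrightarrow> integrable (nu x) (\<lambda>t. indicator S t * (b::real))"
  by (intro Bochner_Integration.integrable_mult_left integrable_real_indicator) (auto simp: sets_nu emeasure_nu)

text \<open>The measure of an eigenvector integrates \<open>t - b\<close> over \<open>S\<close> to
  zero. With \<open>S\<close> on one side of \<open>b\<close> the factor \<open>c\<close> supplies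
  the sign that makes the integrand nonnegative, and no mass is left.\<close>

lemma pvm_eigenvector:
  assumes x: "ap A x = b *\<^sub>R x" and S: "S \<in> sets borel" "b \<notin> S"
    and sg: "\<And>t. t \<in> S \<Longrightarrow> 0 \<le> c * (t - b)" "c \<noteq> 0"
  shows "ap (E S) x = 0"
proof -
  let ?w = "ap (E S) x"
  have "ap A ?w = b *\<^sub>R ?w"
    using pvm_commute(2)[OF S(1)] x by (metis blinfun_apply_blinfun_compose blinfun.scaleR_right)
  then have "integral\<^sup>L (nu x) (\<lambda>t. indicator S t * t) = b * inner ?w x"
    by (simp add: integral_nu_indicator[OF S(1)] prj_inner[OF pvm_prj[OF S(1)]] power2_norm_eq_inner)
  moreover have "integral\<^sup>L (nu x) (\<lambda>t. indicator S t * b) = b * inner ?w x"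
    using S(1) by (simp add: measure_nu space_nu)
  ultimately have "integral\<^sup>L (nu x) (\<lambda>t. indicator S t * t - indicator S t * b) = 0"
    by (subst Bochner_Integration.integral_diff[OF integrable_nu_indicator[OF S(1)] integrable_nu_const[OF S(1)]]) linarith
  then have "integral\<^sup>L (nu x) (\<lambda>t. c * (indicator S t * t - indicator S t * b)) = 0" by simp
  moreover have "AE t in nu x. 0 \<le> c * (indicator S t * t - indicator S t * b)"
    using sg(1) by (auto simp: indicator_def)
  moreover have "integrable (nu x) (\<lambda>t. c * (indicator S t * t - indicator S t * b))"
    using S(1) by (intro Bochner_Integration.integrable_mult_right Bochner_Integration.integrable_diff integrable_nu_indicator integrable_nu_const)
  ultimately have "AE t in nu x. c * (indicator S t * t - indicator S t * b) = 0"
    using integral_nonneg_eq_0_iff_AE by blast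
  then have "AE t in nu x. t \<notin> S"
    by eventually_elim (use S(2) sg(2) in \<open>auto simp: indicator_def split: if_splits\<close>)
  then have "emeasure (nu x) S = 0"
    using S(1) by (subst (asm) AE_iff_measurable[of S]) (auto simp: sets_nu space_nu)
  then have "inner ?w x \<le> 0" using S(1) by (simp add: emeasure_nu ennreal_eq_0_iff)
  then show ?thesis using prj_inner[OF pvm_prj[OF S(1)], of x] by simp
qed

lemma pvm_singleton: "E {b} = kerp (A - b *\<^sub>R \<one>)"
proof (rule blinfun_eqI)
  let ?K = "kerp (A - b *\<^sub>R \<one>)"
  have P: "prj (E {b})" by (rule pvm_prj) simp
  have "E {b} \<odot> A \<odot> E {b} = b *\<^sub>R E {b}"
  proof (rule sa_eqI)
    fix z
    let ?w = "ap (E {b}) z"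
    have "qf (E {b} \<odot> A \<odot> E {b}) z = qf A ?w"
      using inner_radj[of "E {b}" "ap A ?w" z] prj_sa[OF P] by simp
    also have "\<dots> = integral\<^sup>L (nu z) (\<lambda>t. indicator {b} t * t)" by (simp add: integral_nu_indicator)
    also have "(\<lambda>t. indicator {b} t * t) = (\<lambda>t. indicator {b} t * b)" by (auto simp: indicator_def)
    also have "integral\<^sup>L (nu z) \<dots> = b * inner ?w z" by (simp add: measure_nu space_nu)
    finally show "qf (E {b} \<odot> A \<odot> E {b}) z = qf (b *\<^sub>R E {b}) z"
      by (simp add: blinfun.scaleR_left)
  qed (simp_all add: prj_sa[OF P] A op_assoc)
  then have "(A - b *\<^sub>R \<one>) \<odot> E {b} = 0" using pvm_commute(1)[of "{b}"] by (simp add: op_distrib op_scale)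
  then have 1: "?K \<odot> E {b} = E {b}" by (rule kerp_comp)
  fix x
  let ?y = "ap ?K x"
  have y: "ap A ?y = b *\<^sub>R ?y" using kerp_null[of "A - b *\<^sub>R \<one>" x] by (simp add: apply_simps)
  have "ap (E {b<..}) ?y = 0" by (rule pvm_eigenvector[OF y, where c=1]) auto
  moreover have "ap (E {..<b}) ?y = 0" by (rule pvm_eigenvector[OF y, where c="-1"]) auto
  moreover have "E ({..<b} \<union> {b<..}) = E {..<b} + E {b<..}" by (rule pvm_Un(1)) auto
  moreover have "{..<b} \<union> {b<..} = - {b}" by auto
  ultimately have "ap (E (- {b})) ?y = 0" by (simp add: blinfun.add_left)
  then have "ap (E {b}) ?y = ?y" by (simp add: pvm_Compl apply_simps)
  moreover have "E {b} \<odot> ?K = E {b}" by (rule prj_diff(2)[OF P prj_kerp 1])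
  ultimately show "ap (E {b}) x = ?y" by (metis blinfun_apply_blinfun_compose)
qed

end

lemma spectral_proj_singleton:
  assumes A: "A \<in> bounded_ops" "A\<^sup>\<star> = A"
  shows "spectral_proj {b} A = kerp (A - b *\<^sub>R \<one>)"
  unfolding spectral_proj_def
proof (rule the_equality)
  show "\<exists>E. spectral_measure_of A E \<and> kerp (A - b *\<^sub>R \<one>) = E {b}"
    using spectral_measure_of_spec[OF A] pvm_singleton[OF A(2)] by (intro exI[of _ "spec A"]) simp
qed (use pvm_singleton[OF A(2)] in auto)

section \<open>Von Neumann algebras and the essential norm\<close>

lemma positives_iff: "A \<in> positives M \<longleftrightarrow> A \<in> M \<and> A \<in> bounded_ops \<and> pos A"
  by (auto simp: positives_def positive_op_iff)

lemma projections_iff: "P \<in> projections M \<longleftrightarrow> P \<in> M \<and> P \<in> bounded_ops \<and> prj P"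
  by (auto simp: projections_def projection_iff)

lemma le_op_iff: "le_op A B \<longleftrightarrow> B - A \<in> bounded_ops \<and> pos (B - A)"
  by (simp add: le_op_def positive_op_iff)

context
  fixes M :: "'h::complex_hilbert_space operator set"
  assumes M: "von_neumann_algebra M"
begin

lemma vn_bounded: "A \<in> M \<Longrightarrow> A \<in> bounded_ops"
  using M by (auto simp: von_neumann_algebra_def)

lemma vn_radj: "A \<in> M \<Longrightarrow> A\<^sup>\<star> \<in> M"
  using M adj_eq[OF vn_bounded] by (auto simp: von_neumann_algebra_def)

text \<open>The scalars join the commutant because members of the double commutant must be
  complex-linear besides commuting with the commutant.\<close>

lemma vn_iff: "T \<in> M \<longleftrightarrow> (\<forall>S\<in>commutant M \<union> range multC. S \<odot> T = T \<odot> S)"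
proof -
  have "commutant (commutant M) = M" using M by (simp add: von_neumann_algebra_def)
  then have "T \<in> M \<longleftrightarrow> T \<in> commutant (commutant M)" by simp
  also have "\<dots> \<longleftrightarrow> (\<forall>S\<in>commutant M \<union> range multC. S \<odot> T = T \<odot> S)"
    unfolding commutant_def[of "commutant M"] mem_Collect_eq bounded_ops_iff by auto
  finally show ?thesis .
qed

lemma vn_diff: "A \<in> M \<Longrightarrow> B \<in> M \<Longrightarrow> A - B \<in> M"
  unfolding vn_iff by (simp add: op_distrib)

lemma vn_positives_iff: "A \<in> positives M \<longleftrightarrow> A \<in> M \<and> pos A"
  using vn_bounded by (auto simp: positives_iff)

lemma vn_projections_iff: "P \<in> projections M \<longleftrightarrow> P \<in> M \<and> prj P"
  using vn_bounded by (auto simp: projections_iff)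

lemma equiv_op_iff: "equiv_op M B C \<longleftrightarrow> (\<exists>X\<in>M. B = X \<odot> X\<^sup>\<star> \<and> C = X\<^sup>\<star> \<odot> X)"
  using adj_eq[OF vn_bounded] by (auto simp: equiv_op_def)

text \<open>Equivalent projections have equal trace, so finiteness of \<open>\<tau> P\<close> leaves
  trace zero for \<open>P - Q\<close>.\<close>

lemma finite_projection_of_trace:
  assumes tr: "trace_on M \<tau>" "faithful_trace M \<tau>" and P: "P \<in> M" "prj P" "\<tau> P < \<infinity>"
  shows "finite_projection M P"
  unfolding finite_projection_def
proof (intro conjI ballI impI)
  show "P \<in> projections M" using P by (simp add: vn_projections_iff)
  fix Q assume Q: "Q \<in> projections M" and e: "le_op Q P \<and> equiv_op M P Q"
  have d: "P - Q \<in> positives M" using e P Q vn_diff by (auto simp: le_op_iff vn_positives_iff vn_projections_iff)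
  have "\<tau> P = \<tau> Q"
    using e tr(1) adj_eq[OF vn_bounded] unfolding trace_on_def equiv_op_iff by metis
  moreover have "\<tau> (Q + (P - Q)) = \<tau> Q + \<tau> (P - Q)"
    using tr(1) Q d unfolding trace_on_def by (metis prj_pos vn_positives_iff vn_projections_iff)
  ultimately have "\<tau> P + 0 = \<tau> P + \<tau> (P - Q)" by simp
  then have "\<tau> (P - Q) = 0" using P(3) ennreal_add_left_cancel[of "\<tau> P" 0 "\<tau> (P - Q)"] by auto
  then show "Q = P" using tr(2) d by (auto simp: faithful_trace_def)
qed

end

lemma semifinite_factor_of:
  fixes M :: "'h::complex_hilbert_space operator set"
  assumes M: "factor M" "sigma_finite_algebra M" "infinite_algebra M" "factor_trace M \<tau>"
  shows "semifinite_factor M (commutant M \<union> range multC) \<tau>"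
proof -
  have vn: "von_neumann_algebra M" and ct: "\<And>Z. Z \<in> M \<inter> commutant M \<Longrightarrow> \<exists>c. \<forall>x. ap Z x = scaleC c x"
    using M(1) by (auto simp: factor_def)
  have tr: "trace_on M \<tau>" "faithful_trace M \<tau>" and nt: "normal_trace M \<tau>" and sf: "semifinite_trace M \<tau>"
    using M(4) by (auto simp: factor_trace_def)
  note vn = vn vn_bounded[OF vn] vn_radj[OF vn] vn_iff[OF vn] vn_positives_iff[OF vn] vn_projections_iff[OF vn]
    vn_diff[OF vn]
  have one: "\<one> \<in> M" by (simp add: vn(4))
  have inf: "\<tau> \<one> = \<infinity>"
    using M(3) finite_projection_of_trace[OF vn(1) tr one prj_one]
    by (cases "\<tau> (\<one> :: 'h operator) = \<infinity>") (auto simp: infinite_algebra_def infinite_projection_def less_top)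
  have add: "\<tau> (A + B) = \<tau> A + \<tau> B" if "A \<in> M" "B \<in> M" "pos A" "pos B" for A B
    using tr(1) that by (simp add: trace_on_def vn(5))
  have scale: "\<tau> (r *\<^sub>R A) = ennreal r * \<tau> A" if "A \<in> M" "pos A" "0 \<le> r" for A r
    using tr(1) that by (simp add: trace_on_def vn(5))
  show ?thesis
  proof
    show "T \<in> M \<longleftrightarrow> (\<forall>S\<in>commutant M \<union> range multC. S \<odot> T = T \<odot> S)" for T by (rule vn(4))
    show "S\<^sup>\<star> \<in> commutant M \<union> range multC" if S: "S \<in> commutant M \<union> range multC" for S
    proof (cases "S \<in> range multC")
      case True then show ?thesis by (auto simp: radj_multC)
    next
      case False
      then have c: "S \<in> bounded_ops" "\<And>A. A \<in> M \<Longrightarrow> S \<odot> A = A \<odot> S" using S by (auto simp: commutant_def)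
      have "S\<^sup>\<star> \<odot> A = A \<odot> S\<^sup>\<star>" if "A \<in> M" for A
      proof -
        have "(A\<^sup>\<star> \<odot> S)\<^sup>\<star> = (S \<odot> A\<^sup>\<star>)\<^sup>\<star>" using c(2)[OF vn(3)[OF that]] by simp
        then show ?thesis by simp
      qed
      then show ?thesis using bounded_ops_radj[OF c(1)] by (simp add: commutant_def)
    qed
    show "Z = 0 \<or> Z = \<one>" if Z: "Z \<in> M" "prj Z" "\<And>T. T \<in> M \<Longrightarrow> T \<odot> Z = Z \<odot> T" for Z
    proof -
      have "Z \<in> M \<inter> commutant M" using Z(1,3) vn(2) by (auto simp: commutant_def)
      then obtain c where c: "\<And>x. ap Z x = scaleC c x" using ct by blast
      \<comment> \<open>Idempotence of the scalar by which \<open>Z\<close> acts; if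
        \<open>c * c\<close> differs from \<open>c\<close>, the whole space is trivial.\<close>
      have z: "scaleC (c * c - c) x = 0" for x :: 'h
        using prj_idem_apply[OF Z(2), of x] scaleC_add_left[of "c * c - c" c x] by (simp add: c scaleC_scaleC)
      show ?thesis
      proof (cases "c * c - c = 0")
        case True
        then consider "c = 0" | "c = 1" by fastforce
        then show ?thesis
        proof cases
          case 1 then show ?thesis using scaleC_of_real[of 0] by (intro disjI1 blinfun_eqI) (simp add: c blinfun.zero_left)
        next
          case 2 then show ?thesis using scaleC_of_real[of 1] by (intro disjI2 blinfun_eqI) (simp add: c)
        qed
      next
        case False
        then have "x = 0" for x :: 'h using z[of x] norm_scaleC[of "c * c - c" x] by simp
        then show ?thesis by (intro disjI1 blinfun_eqI) metis
      qed
    qed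
    show "countable F" if "F \<subseteq> {P \<in> M. prj P \<and> P \<noteq> 0}" "pairwise (\<lambda>P Q. P \<odot> Q = 0) F" for F
    proof -
      have "F \<subseteq> projections M - {0}" using that(1) by (auto simp: vn(6))
      then show ?thesis using M(2) that(2) unfolding sigma_finite_algebra_def by blast
    qed
    show "\<tau> (A + B) = \<tau> A + \<tau> B" if "A \<in> M" "B \<in> M" "pos A" "pos B" for A B
      by (rule add[OF that])
    show "\<tau> (r *\<^sub>R A) = ennreal r * \<tau> A" if "A \<in> M" "pos A" "0 \<le> r" for A r
      by (rule scale[OF that])
    show "\<tau> (X\<^sup>\<star> \<odot> X) = \<tau> (X \<odot> X\<^sup>\<star>)" if "X \<in> M" for X
      using tr(1) that adj_eq[OF vn(2)[OF that]] by (auto simp: trace_on_def)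
    show "A = 0" if "A \<in> M" "pos A" "\<tau> A = 0" for A
      using tr(2) that by (auto simp: faithful_trace_def vn(5))
    show "\<tau> A = (SUP n. \<tau> (S n))"
      if S: "\<And>n. S n \<in> M" "\<And>n. pos (S n)" "\<And>n. pos (S (Suc n) - S n)" and A: "A \<in> M" "pos A"
        and lim: "\<And>x. (\<lambda>n. qf (S n) x) \<longlonglongrightarrow> qf A x" for S :: "nat \<Rightarrow> 'h operator" and A
    proof -
      have le: "le_op X Y \<longleftrightarrow> (\<forall>x. qf X x \<le> qf Y x)"
        if "X \<in> M" "Y \<in> M" "pos X" "pos Y" for X Y
        using that vn(2,7) by (auto simp: le_op_iff pos_def apply_simps inner_expand)
      have mono: "incseq (\<lambda>n. qf (S n) x)" for x
        using pos_ge[OF S(3), where x=x] by (intro incseq_SucI) (simp add: apply_simps inner_expand)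
      have "\<tau> A = (SUP T\<in>range S. \<tau> T)"
      proof (rule nt[unfolded normal_trace_def, rule_format])
        show "range S \<subseteq> positives M" "A \<in> positives M" using S A by (auto simp: vn(5))
        show "\<exists>C\<in>range S. le_op X C \<and> le_op Y C" if "X \<in> range S" "Y \<in> range S" for X Y
        proof -
          obtain m n where "X = S m" "Y = S n" using \<open>X \<in> range S\<close> \<open>Y \<in> range S\<close> by blast
          then have "le_op X (S (max m n)) \<and> le_op Y (S (max m n))"
            using incseqD[OF mono, of m "max m n"] incseqD[OF mono, of n "max m n"] by (simp add: le S)
          then show ?thesis by blast
        qed
        show "le_op X A" if "X \<in> range S" for X
          using that incseq_le[OF mono lim] by (auto simp: le S A)
        show "le_op A T" if T: "T \<in> positives M" "\<And>X. X \<in> range S \<Longrightarrow> le_op X T" for T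
        proof -
          have T': "T \<in> M" "pos T" using T(1) by (auto simp: vn(5))
          have "qf (S n) x \<le> qf T x" for n x
            using T(2)[of "S n"] by (simp add: le S T')
          then show ?thesis using LIMSEQ_le_const2[OF lim] by (auto simp: le A T')
        qed
      qed simp
      then show ?thesis by (simp add: image_comp o_def)
    qed
    show "\<exists>q\<in>M. prj q \<and> q \<noteq> 0 \<and> \<tau> q < \<infinity>"
    proof -
      have "(\<one> :: 'h operator) \<noteq> 0"
      proof
        assume "(\<one> :: 'h operator) = 0"
        then have "\<tau> (0 *\<^sub>R (\<one> :: 'h operator)) = \<infinity>" using inf by simp
        moreover have "\<tau> (0 *\<^sub>R \<one>) = ennreal 0 * \<tau> \<one>"
          by (rule scale[OF one pos_one]) simp
        ultimately show False by simp
      qed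
      moreover have "\<one> \<in> positives M" by (simp add: vn(5) one)
      ultimately obtain B where "B \<in> positives M" "B \<noteq> 0" "\<tau> B < \<infinity>"
        using sf unfolding semifinite_trace_def by blast
      then have B: "B \<in> M" "pos B" "B \<noteq> 0" "\<tau> B < \<infinity>" by (simp_all add: vn(5))
      \<comment> \<open>The spectral projection \<open>e\<close> of \<open>B\<close> above
        \<open>s\<close> satisfies \<open>s e \<le> B\<close>, so it inherits finite trace; at half
        the norm it is nonzero.\<close>
      define s where "s = norm B / 2"
      have s: "0 < s" using B(3) by (simp add: s_def)
      note sa = pos_sa[OF B(2)]
      define e where "e = spec B {s..}"
      have e: "prj e" "B \<odot> e = e \<odot> B"
        using spec_proj(1)[OF sa] spec_commute_op[OF sa] by (auto simp: e_def)
      have spM: "spec B T \<in> M" if "T \<in> sets borel" for T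
        using B(1) spec_proj(2)[OF sa that] unfolding vn(4) by blast
      then have eM: "e \<in> M" by (simp add: e_def)
      have "e \<noteq> 0"
      proof
        assume "e = 0"
        then have "spec B {..<s} = \<one>" using spec_Compl[OF sa, of "{s..}"] by (simp add: e_def Compl_atLeast)
        moreover have "norm (B \<odot> spec B {..<s}) \<le> s" by (rule spec_interval_norm_le[OF B(2)]) (use s in auto)
        ultimately have "norm B \<le> s" by simp
        then show False using s by (simp add: s_def)
      qed
      have "pos (B \<odot> e - s *\<^sub>R e)" unfolding e_def by (rule spec_ge_pos[OF sa]) auto
      moreover have "pos (B \<odot> (\<one> - e))"
        by (rule pos_comp_commute[OF B(2) prj_pos[OF prj_compl[OF e(1)]]]) (simp add: op_distrib e(2))
      ultimately have "pos ((B \<odot> e - s *\<^sub>R e) + B \<odot> (\<one> - e))" by (rule pos_add)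
      then have p: "pos (B - s *\<^sub>R e)" by (simp add: op_distrib)
      have seM: "s *\<^sub>R e \<in> M" using eM unfolding vn(4) by (simp add: op_scale)
      have pse: "pos (s *\<^sub>R e)" using e(1) s by (intro pos_scaleR prj_pos) auto
      have "\<tau> (s *\<^sub>R e + (B - s *\<^sub>R e)) = \<tau> (s *\<^sub>R e) + \<tau> (B - s *\<^sub>R e)"
        by (rule add[OF seM vn(7)[OF B(1) seM] pse p])
      then have "\<tau> (s *\<^sub>R e) \<le> \<tau> B" by simp
      moreover have "\<tau> (s *\<^sub>R e) = ennreal s * \<tau> e"
        by (rule scale[OF eM prj_pos[OF e(1)]]) (use s in simp)
      ultimately have "ennreal s * \<tau> e < \<infinity>" using le_less_trans[OF _ B(4)] by simp
      then have "\<tau> e < \<infinity>" using s by (auto simp: ennreal_mult_less_top)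
      then show ?thesis using eM e(1) \<open>e \<noteq> 0\<close> by blast
    qed
  qed (rule inf)
qed

text \<open>Cutting \<open>A\<close> off above \<open>s\<close> changes it by an element of the
  ideal. Hence an essential norm equal to \<open>norm B\<close> forces infinite spectral projections
  above every smaller level.\<close>

lemma ess_norm_le:
  fixes M :: "'h::complex_hilbert_space operator set"
  assumes vn: "von_neumann_algebra M" and A: "A \<in> M" "pos A"
    and fin: "finite_projection M (spec A {s<..})" and s: "0 \<le> s"
  shows "ess_norm M A \<le> s"
proof -
  let ?e = "spec A {s<..}"
  note sa = pos_sa[OF A(2)]
  have mA: "- A \<in> M" using A(1) unfolding vn_iff[OF vn] by (simp add: op_distrib)
  have "- (A \<odot> ?e) \<in> finite_ideal M"
    unfolding finite_ideal_def hull_def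
  proof (rule InterI)
    fix I assume "I \<in> {I. (two_sided_ideal M I \<and> closed I) \<and> {P. finite_projection M P} \<subseteq> I}"
    then have "(- A) \<odot> ?e \<in> I" using fin mA by (auto simp: two_sided_ideal_def)
    then show "- (A \<odot> ?e) \<in> I" by (simp add: op_distrib)
  qed
  then have "A + - (A \<odot> ?e) \<in> quotient_map M A" by (auto simp: quotient_map_def)
  then have "ess_norm M A \<le> norm (A + - (A \<odot> ?e))"
    unfolding ess_norm_def quotient_norm_def by (intro cINF_lower bdd_belowI2[where m=0]) auto
  also have "A + - (A \<odot> ?e) = A \<odot> spec A {..s}"
    using spec_Compl[OF sa, of "{s<..}"] by (simp add: op_distrib)
  also have "norm \<dots> \<le> s" by (rule spec_interval_norm_le[OF A(2)]) (use s in auto)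
  finally show ?thesis .
qed

context semifinite_factor
begin

text \<open>The remainders are positive with forms at most that of \<open>A\<close>, so
  \<open>pos_apply_norm_le\<close> controls their squared norms at \<open>x\<close> by their forms
  there, which tend to zero.\<close>

lemma sums_of_quadratic:
  assumes A: "pos A" and C: "\<And>j::nat. pos (C j)" and s: "\<And>x. ((\<lambda>j. qf (C j) x) has_sum qf A x) UNIV"
  shows "(\<lambda>j. ap (C j) x) sums ap A x"
proof -
  define R where "R n = A - (\<Sum>j<n. C j)" for n
  have q: "qf (R n) y = qf A y - (\<Sum>j<n. qf (C j) y)" for n y
    by (simp add: R_def apply_simps blinfun.sum_left inner_expand inner_sum_left)
  have sums: "(\<lambda>j. qf (C j) y) sums qf A y" for y
    by (rule has_sum_imp_sums[OF s])
  have "(\<Sum>j<n. qf (C j) y) \<le> qf A y" for n y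
    using sum_le_suminf[OF sums_summable[OF sums], of "{..<n}" y] sums_unique[OF sums, of y] pos_ge[OF C] by simp
  moreover have "(\<Sum>j<n. C j)\<^sup>\<star> = (\<Sum>j<n. C j)" for n by (rule pos_sa[OF pos_sum[OF C]])
  ultimately have R: "pos (R n)" for n using pos_sa[OF A] by (auto simp: pos_def q) (simp add: R_def)
  have "qf (R n) y \<le> norm A * (norm y)\<^sup>2" for n y
    using inner_le_norm_op[of A y] pos_ge[OF C] by (simp add: q order_trans[OF _ inner_le_norm_op] sum_nonneg)
  then have b: "nsq (R n) x \<le> norm A * qf (R n) x" for n
    by (rule pos_apply_norm_le[OF R])
  have "(\<lambda>n. norm A * qf (R n) x) \<longlonglongrightarrow> norm A * (qf A x - qf A x)"
    unfolding q by (intro tendsto_intros) (use sums[of x] in \<open>simp add: sums_def\<close>)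
  then have "(\<lambda>n. norm A * qf (R n) x) \<longlonglongrightarrow> 0" by simp
  then have "(\<lambda>n. nsq (R n) x) \<longlonglongrightarrow> 0"
    by (rule tendsto_sandwich[OF _ _ tendsto_const, rotated 2]) (simp_all add: b)
  then have "(\<lambda>n. sqrt (nsq (R n) x)) \<longlonglongrightarrow> sqrt 0" by (rule tendsto_real_sqrt)
  then have "(\<lambda>n. ap (R n) x) \<longlonglongrightarrow> 0" by (simp add: tendsto_norm_zero_iff)
  then have "(\<lambda>n. ap A x - ap (R n) x) \<longlonglongrightarrow> ap A x - 0" by (intro tendsto_intros)
  then show ?thesis by (simp add: sums_def R_def apply_simps blinfun.sum_left)
qed

lemma kerp_comp_radj: "kerp (X \<odot> X\<^sup>\<star>) = kerp (X\<^sup>\<star>)"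
proof -
  have "ap (X \<odot> X\<^sup>\<star>) x = 0 \<longleftrightarrow> ap (X\<^sup>\<star>) x = 0" for x
    using norm_sq_radj[of X x] by (auto simp del: blinfun_apply_blinfun_compose) (simp add: blinfun.zero_right)
  then show ?thesis by (simp add: kerp_def)
qed

end

theorem theorem5p2:
  fixes M :: "'h::complex_hilbert_space operator set"
    and \<tau> :: "'h operator \<Rightarrow> ennreal"
    and A B :: "'h operator"
  assumes "factor M"
    and "sigma_finite_algebra M"
    and "semifinite_algebra M"
    and "infinite_algebra M"
    and "factor_trace M \<tau>"
    and "A \<in> positives M"
    and "B \<in> positives M"
    and "B \<noteq> 0"
    and "\<tau> (pos_part (A - norm B *\<^sub>R id_blinfun)) = \<infinity>
      \<or> (ess_norm M A = norm B \<and> spectral_proj {norm B} B = 0)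
      \<or> (ess_norm M A = norm B \<and> spectral_proj {norm B} B \<noteq> 0
          \<and> B \<noteq> norm B *\<^sub>R spectral_proj {norm B} B
          \<and> infinite_projection M (spectral_proj {ess_norm M A} A))
      \<or> (ess_norm M A = norm B \<and> B = norm B *\<^sub>R spectral_proj {norm B} B
          \<and> A = ess_norm M A *\<^sub>R spectral_proj {ess_norm M A} A
          \<and> infinite_projection M (spectral_proj {ess_norm M A} A))"
  shows "\<exists>C :: nat \<Rightarrow> 'h operator.
      (\<forall>j. C j \<in> positives M \<and> equiv_op M (C j) B \<and> infinite_projection M (null_proj (C j)))
      \<and> (\<forall>x. (\<lambda>j. blinfun_apply (C j) x) sums blinfun_apply A x)"
proof -
  interpret semifinite_factor M "commutant M \<union> range multC" \<tau>
    by (rule semifinite_factor_of[OF assms(1,2,4,5)])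
  have vn: "von_neumann_algebra M" and tr: "trace_on M \<tau>" "faithful_trace M \<tau>"
    using assms(1,5) by (auto simp: factor_def factor_trace_def)
  note pj = vn_projections_iff[OF vn] and bo = vn_bounded[OF vn]
  have A: "A \<in> M" "pos A" and B: "B \<in> M" "pos B" using assms(6,7) by (auto simp: positives_iff)
  note Asa = pos_sa[OF A(2)] and Bsa = pos_sa[OF B(2)]
  define b where "b = norm B"
  have b: "0 < b" using assms(8) by (simp add: b_def)
  have fin: "finite_projection M P" if "P \<in> M" "prj P" "\<tau> P \<noteq> \<infinity>" for P
    using finite_projection_of_trace[OF vn tr that(1,2)] that(3) by (auto simp: less_top)
  define A1 where "A1 = (1 / b) *\<^sub>R A"
  define B1 where "B1 = (1 / b) *\<^sub>R B"
  have A1: "A1 \<in> M" "pos A1" and B1: "B1 \<in> M" "pos B1" "B1 \<noteq> 0" "norm B1 \<le> 1"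
    using A B b assms(8) by (auto simp: A1_def B1_def b_def intro!: pos_scaleR)
  have AA1: "A = b *\<^sub>R A1" and BB1: "B = b *\<^sub>R B1" using b by (simp_all add: A1_def B1_def)
  define F where "F = kerp (A - b *\<^sub>R \<one>)"
  define G where "G = kerp (B - b *\<^sub>R \<one>)"
  have FM: "F \<in> M" "prj F" using A(1) by (auto simp: F_def)
  have F_eq: "spectral_proj {b} A = F" and G_eq: "spectral_proj {b} B = G"
    using spectral_proj_singleton[OF bo Asa] spectral_proj_singleton[OF bo Bsa] A(1) B(1) by (simp_all add: F_def G_def)
  have AF: "A1 \<odot> F = F"
  proof -
    have "(A - b *\<^sub>R \<one>) \<odot> F = 0" by (simp add: F_def)
    then show ?thesis using b by (simp add: A1_def op_distrib op_scale)
  qed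
  have G1: "spec B1 {1} = G"
  proof -
    have "B - b *\<^sub>R \<one> = b *\<^sub>R (B1 - 1 *\<^sub>R \<one>)" by (simp add: BB1 scaleR_right_diff_distrib)
    then show ?thesis using b by (simp only: spec_singleton[OF pos_sa[OF B1(2)]] G_def) (simp add: kerp_scaleR)
  qed
  have F_inf: "\<tau> F = \<infinity>" if "infinite_projection M F"
    using that fin[OF FM] by (auto simp: infinite_projection_def)
  \<comment> \<open>With \<open>ess_norm M A = b\<close> the eigenprojections of \<open>A\<close>
    and \<open>B\<close> belong to the same number, so (iii) and (iv) become statements about
    \<open>F\<close> and \<open>G\<close>.\<close>
  have cases: "\<tau> (pos_part (A - b *\<^sub>R \<one>)) = \<infinity> \<or> (ess_norm M A = b \<and> G = 0)
      \<or> (infinite_projection M F \<and> G \<noteq> 0 \<and> B \<noteq> b *\<^sub>R G) \<or> (infinite_projection M F \<and> A = b *\<^sub>R F)"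
    using assms(9) unfolding b_def[symmetric] G_eq by (metis F_eq)
  have "nsum B1 A1"
    using cases
  proof (elim disjE conjE)
    assume inf: "\<tau> (pos_part (A - b *\<^sub>R \<one>)) = \<infinity>"
    let ?X = "A - b *\<^sub>R \<one>"
    have X: "?X \<in> M" "?X\<^sup>\<star> = ?X" using A(1) by (auto simp: Asa)
    note P = posp[OF X(2)]
    have PM: "posp ?X \<in> M" by (rule M_commute[OF X(1)]) (rule P(6))
    have inf': "\<tau> (posp ?X) = \<infinity>" using inf pos_part_eq[OF bo[OF X(1)] X(2)] by simp
    have "\<tau> ((1 / b) *\<^sub>R posp ?X) = \<infinity>"
      using b tr_scale[OF PM P(1), of "1 / b"] by (simp add: inf' ennreal_mult_eq_top_iff)
    moreover have "A1 - \<one> = (1 / b) *\<^sub>R posp ?X - (1 / b) *\<^sub>R negp ?X"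
    proof -
      have "A1 - \<one> = (1 / b) *\<^sub>R ?X" using b by (simp add: A1_def scaleR_right_diff_distrib)
      then show ?thesis by (subst (asm) P(3)) (simp only: scaleR_right_diff_distrib)
    qed
    ultimately show "nsum B1 A1"
      using b PM by (intro nsum_large_excess[OF A1 _ _ _ _ _ _ B1, where N="(1 / b) *\<^sub>R negp ?X"])
        (auto intro: pos_scaleR P(1,2) simp: op_scale P(4))
  next
    assume e: "ess_norm M A = b" "G = 0"
    have "\<tau> (spec A1 {s<..}) = \<infinity>" if s: "s < 1" for s
    proof (rule ccontr)
      assume *: "\<tau> (spec A1 {s<..}) \<noteq> \<infinity>"
      \<comment> \<open>\<open>s\<close> may be negative, while the bound on the essential norm
        takes nonnegative levels.\<close>
      let ?t = "max (b * s) 0"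
      have sp: "spec A T \<in> M" "prj (spec A T)" if "T \<in> sets borel" for T
        using that A(1) by (auto intro: M_spec[OF Asa] spec_proj(1)[OF Asa])
      have "spec A1 {s<..} = spec A {b * s<..}"
        using spec_greaterThan_scaleR[OF Asa, of "1 / b" "b * s"] b by (simp add: A1_def)
      moreover have "\<tau> (spec A {?t<..}) \<le> \<tau> (spec A {b * s<..})"
        by (intro tr_prj_mono sp spec_subset(1)[OF Asa]) auto
      ultimately have "\<tau> (spec A {?t<..}) \<noteq> \<infinity>" using * by (auto simp: top_unique)
      then have "ess_norm M A \<le> ?t" by (intro ess_norm_le[OF vn A] fin sp) auto
      moreover have "?t < b" using b s by simp
      ultimately show False using e(1) by simp
    qed
    then show "nsum B1 A1" by (intro nsum_no_eigenvalue[OF A1 _ B1]) (simp_all add: G1 e(2))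
  next
    assume f: "infinite_projection M F" "G \<noteq> 0" "B \<noteq> b *\<^sub>R G"
    then show "nsum B1 A1"
      using b by (intro nsum_eigenvalue[OF A1 FM AF F_inf B1(1,2,4)]) (auto simp: G1 BB1)
  next
    assume f: "infinite_projection M F" "A = b *\<^sub>R F"
    then have "A1 = F" using b by (simp add: A1_def)
    then show "nsum B1 A1" using nsum_projection[OF FM F_inf[OF f(1)] B1] by simp
  qed
  then have "nsum B A" unfolding AA1 BB1 by (rule nsum_scaleR[OF _ b])
  then obtain X where X: "\<And>j. X j \<in> M" "\<And>j. (X j)\<^sup>\<star> \<odot> X j = B" "\<And>j. \<tau> (kerp ((X j)\<^sup>\<star>)) = \<infinity>"
    "\<And>x. ((\<lambda>j::nat. nsq ((X j)\<^sup>\<star>) x) has_sum qf A x) UNIV"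
    unfolding nsum_def by blast
  \<comment> \<open>Infinite trace is translated back: the shift exhibits a proper subprojection
    equivalent to \<open>P\<close>.\<close>
  have infp: "infinite_projection M P" if P: "P \<in> M" "prj P" "\<tau> P = \<infinity>" for P
  proof -
    obtain Y where Y: "Y \<in> M" "Y \<odot> Y\<^sup>\<star> = P" "prj (Y\<^sup>\<star> \<odot> Y)" "P \<odot> (Y\<^sup>\<star> \<odot> Y) = Y\<^sup>\<star> \<odot> Y" "Y\<^sup>\<star> \<odot> Y \<noteq> P"
      using infinite_shift[OF P] by blast
    define Q where "Q = Y\<^sup>\<star> \<odot> Y"
    have Q: "Q \<in> projections M" using Y by (auto simp: Q_def pj)
    have "equiv_op M P Q" using Y by (auto simp: equiv_op_iff[OF vn] Q_def)
    moreover have "le_op Q P"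
      using prj_pos_diff[OF Y(3) P(2) Y(4)] P Y by (auto simp: le_op_iff Q_def intro!: bo)
    ultimately show ?thesis
      using P Q Y(5) by (auto simp: infinite_projection_def finite_projection_def pj Q_def)
  qed
  show ?thesis
  proof (intro exI[of _ "\<lambda>j. X j \<odot> (X j)\<^sup>\<star>"] conjI allI)
    fix j
    have C: "X j \<odot> (X j)\<^sup>\<star> \<in> M" using X(1) by auto
    show "X j \<odot> (X j)\<^sup>\<star> \<in> positives M" using C bo by (simp add: positives_iff)
    show "equiv_op M (X j \<odot> (X j)\<^sup>\<star>) B" unfolding equiv_op_iff[OF vn] using X(1,2) by metis
    show "infinite_projection M (null_proj (X j \<odot> (X j)\<^sup>\<star>))"
      unfolding null_proj_eq[OF bo[OF C]] kerp_comp_radj using X(1,3) by (intro infp) auto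
  next
    show "(\<lambda>j. ap (X j \<odot> (X j)\<^sup>\<star>) x) sums ap A x" for x
      by (rule sums_of_quadratic[OF A(2)]) (use X(4) in \<open>simp_all add: norm_sq_radj del: blinfun_apply_blinfun_compose\<close>)
  qed
qed

end
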